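(* Let $L>0$, $\lambda>0$, and let $f\in L^2_{per}(\mathbb T)$ be time independent, where $\mathbb T=[-\frac L2,\frac L2]$. Let $u(t)$ be a global solution, in $H^1_{per}(\mathbb T)$ for all $t\in\mathbb R$, of the damped driven nonlinear Schrödinger equation $$iu_t+u_{xx}+|u|^2u+i\lambda u=f,\quad x\in\mathbb T,$$ with $L$-periodic boundary conditions and initial data $u(0)=u_0\in H^1_{per}(\mathbb T)$, such that $u$ does not belong to the global attractor. Then there are positive constants $c_1,C_1,C_2,C_3$ such that, as $t\to-\infty$ (i.e. for all sufficiently negative $t$), $$c_1e^{-\frac12\lambda t}\le |u(t)|\le C_1e^{-\frac32\lambda t},$$ where $c_1$ and $C_1$ depend on $|u_0|$, $|f|$ and $\lambda$; $$E(t):=|u_x(t)|^2-\tfrac12|u(t)|_{L^4}^4\le C_2e^{-3\lambda t},$$ where $C_2$ depends on $\|u_0\|$, $|f|$ and $L$; and $$\|u(t)\|\le C_3e^{-\frac92\lambda t},$$ where $C_3$ depends on $|u_0|$, $|f|$ and $\lambda$.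
   Context: Functions are complex-valued and $L$-periodic. $|\cdot|$ is the norm of $L^2_{per}(\mathbb T)$ (inside $|u|^2u$ it is the pointwise modulus), $|\cdot|_{L^4}$ is the norm of $L^4(\mathbb T)$, and $\|u\|^2=|u_x|^2+|u|^2$ is the squared norm of $H^1_{per}(\mathbb T)$. The equation is globally well-posed in $H^1_{per}(\mathbb T)$ for all $t\in\mathbb R$ and, with $S(t)$ the solution operator, possesses a global attractor $\mathcal A\subset H^1_{per}(\mathbb T)$: the compact set with $S(t)\mathcal A=\mathcal A$ for all $t\ge 0$ attracting every bounded subset of $H^1_{per}(\mathbb T)$ as $t\to+\infty$. The solution "does not belong to the global attractor" if its trajectory is not contained in $\mathcal A$. *)

theory Defs
  imports "HOL-Analysis.Analysis"
begin

text \<open>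
  Functions on the torus \<open>[-L/2, L/2]\<close> are represented by \<open>L\<close>-periodic functions on the
  whole real line.
\<close>

definition periodic :: "real \<Rightarrow> (real \<Rightarrow> 'a) \<Rightarrow> bool" where
  "periodic L g \<longleftrightarrow> (\<forall>x. g (x + L) = g x)"

text \<open>
  Members of \<open>L2per L\<close> are functions, not classes modulo equality almost everywhere; everything
  below depends on them only through integrals.
\<close>

definition L2per :: "real \<Rightarrow> (real \<Rightarrow> complex) set" where
  "L2per L = {g. periodic L g \<and> g \<in> borel_measurable lebesgue \<and>
     set_integrable lebesgue {-L/2..L/2} (\<lambda>x. (cmod (g x))\<^sup>2)}"

definition L2norm :: "real \<Rightarrow> (real \<Rightarrow> complex) \<Rightarrow> real" where
  "L2norm L g = sqrt (LINT x:{-L/2..L/2}|lebesgue. (cmod (g x))\<^sup>2)"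

definition L4norm :: "real \<Rightarrow> (real \<Rightarrow> complex) \<Rightarrow> real" where
  "L4norm L g = root 4 (LINT x:{-L/2..L/2}|lebesgue. (cmod (g x)) ^ 4)"

text \<open>
  Real-valued test functions suffice, since \<open>pairing\<close> is bilinear.
\<close>

definition test_fun :: "real \<Rightarrow> (real \<Rightarrow> real) \<Rightarrow> bool" where
  "test_fun L \<phi> \<longleftrightarrow> periodic L \<phi> \<and> (\<forall>n. (deriv ^^ n) \<phi> differentiable_on UNIV)"

definition pairing :: "real \<Rightarrow> (real \<Rightarrow> complex) \<Rightarrow> (real \<Rightarrow> real) \<Rightarrow> complex" where
  "pairing L g \<phi> = (LINT x:{-L/2..L/2}|lebesgue. g x * complex_of_real (\<phi> x))"

definition weak_deriv :: "real \<Rightarrow> (real \<Rightarrow> complex) \<Rightarrow> (real \<Rightarrow> complex) \<Rightarrow> bool" where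
  "weak_deriv L v g \<longleftrightarrow> g \<in> L2per L \<and>
     (\<forall>\<phi>. test_fun L \<phi> \<longrightarrow> pairing L v (deriv \<phi>) = - pairing L g \<phi>)"

text \<open>
  An element of the Sobolev space is identified with its unique continuous representative
  (one-dimensional Sobolev embedding), so equality in \<open>H1per L\<close> is equality of functions.
  The weak derivative is unique only almost everywhere, hence the choice in \<open>wderiv\<close>.
\<close>

definition H1per :: "real \<Rightarrow> (real \<Rightarrow> complex) set" where
  "H1per L = {v. periodic L v \<and> continuous_on UNIV v \<and> (\<exists>g. weak_deriv L v g)}"

definition wderiv :: "real \<Rightarrow> (real \<Rightarrow> complex) \<Rightarrow> (real \<Rightarrow> complex)" where
  "wderiv L v = (SOME g. weak_deriv L v g)"

definition H1norm :: "real \<Rightarrow> (real \<Rightarrow> complex) \<Rightarrow> real" where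
  "H1norm L v = sqrt ((L2norm L (wderiv L v))\<^sup>2 + (L2norm L v)\<^sup>2)"

definition H1dist :: "real \<Rightarrow> (real \<Rightarrow> complex) \<Rightarrow> (real \<Rightarrow> complex) \<Rightarrow> real" where
  "H1dist L v w = H1norm L (\<lambda>x. v x - w x)"

definition H1top :: "real \<Rightarrow> (real \<Rightarrow> complex) topology" where
  "H1top L = Metric_space.mtopology (H1per L) (H1dist L)"

definition energy :: "real \<Rightarrow> (real \<Rightarrow> complex) \<Rightarrow> real" where
  "energy L v = (L2norm L (wderiv L v))\<^sup>2 - 1/2 * (L4norm L v) ^ 4"

text \<open>
  A global solution of \<open>i u\<^sub>t + u\<^sub>x\<^sub>x + |u|\<^sup>2 u + i lam u = f\<close> is a curve
  \<open>t \<mapsto> u t\<close>, continuous from the whole real line into \<open>H1per L\<close>, that satisfies the equation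
  at every time as an identity of periodic distributions in \<open>x\<close>.
\<close>

definition nls_solution ::
    "real \<Rightarrow> real \<Rightarrow> (real \<Rightarrow> complex) \<Rightarrow> (real \<Rightarrow> real \<Rightarrow> complex) \<Rightarrow> bool" where
  "nls_solution L lam f u \<longleftrightarrow>
     continuous_map euclideanreal (H1top L) u \<and>
     (\<forall>\<phi> t. test_fun L \<phi> \<longrightarrow>
        (\<exists>D. ((\<lambda>s. pairing L (u s) \<phi>) has_vector_derivative D) (at t) \<and>
             \<i> * D + pairing L (u t) (deriv (deriv \<phi>))
               + pairing L (\<lambda>x. complex_of_real ((cmod (u t x))\<^sup>2) * u t x) \<phi>
               + \<i> * complex_of_real lam * pairing L (u t) \<phi>
             = pairing L f \<phi>))"

text \<open>
  \<open>evolve L lam f t B\<close> is the image \<open>S(t)B\<close> under the solution operator, which sends \<open>v\<close> to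
  \<open>u t\<close> for the solution \<open>u\<close> with \<open>u 0 = v\<close>. Writing it as a set of values of
  solutions avoids building the global well-posedness theorem into the definition.
\<close>

definition evolve ::
    "real \<Rightarrow> real \<Rightarrow> (real \<Rightarrow> complex) \<Rightarrow> real \<Rightarrow> (real \<Rightarrow> complex) set \<Rightarrow> (real \<Rightarrow> complex) set" where
  "evolve L lam f t B = {u t | u. nls_solution L lam f u \<and> u 0 \<in> B}"

definition H1bounded :: "real \<Rightarrow> (real \<Rightarrow> complex) set \<Rightarrow> bool" where
  "H1bounded L B \<longleftrightarrow> B \<subseteq> H1per L \<and> (\<exists>M. \<forall>v\<in>B. H1norm L v \<le> M)"

definition is_global_attractor ::
    "real \<Rightarrow> real \<Rightarrow> (real \<Rightarrow> complex) \<Rightarrow> (real \<Rightarrow> complex) set \<Rightarrow> bool" where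
  "is_global_attractor L lam f A \<longleftrightarrow>
     compactin (H1top L) A \<and>
     (\<forall>t\<ge>0. evolve L lam f t A = A) \<and>
     (\<forall>B. H1bounded L B \<longrightarrow>
        (\<forall>\<epsilon>>0. \<forall>\<^sub>F t in at_top. \<forall>w \<in> evolve L lam f t B. \<exists>a\<in>A. H1dist L w a < \<epsilon>))"

end

theory Submission
  imports Defs
begin

text \<open>
  Backward in time the differential inequality for the mass \<open>|u|\<^sup>2\<close> gives
  \<open>|u(t)| = O(exp (- 5/4 lam t))\<close>, and, as soon as \<open>|u|\<^sup>2\<close> exceeds the threshold
  \<open>4 |f|\<^sup>2 / (3 lam\<^sup>2)\<close> at one time, growth at least like \<open>exp (- 3/4 lam t)\<close>.

  The solution is only in \<open>H\<^sup>1\<close> and the forcing only in \<open>L\<^sup>2\<close>, so the energy cannot be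
  differentiated directly. It is replaced by a conserved quantity of the integrable cubic equation.
  For large \<open>\<mu>\<close> let \<open>\<Gamma>\<close> be the small periodic solution of the Riccati equation
  \<open>\<Gamma>' = - \<mu> \<Gamma> - cnj u - u \<Gamma>\<^sup>2 / 2\<close>. The real part of \<open>\<integral> u \<Gamma>\<close> is
  invariant under the undamped, unforced flow, depends smoothly on \<open>u\<close> in \<open>L\<^sup>2\<close>, and
  \<open>\<mu>\<^sup>2 (|u|\<^sup>2 + \<mu> Re \<integral> u \<Gamma>)\<close> tends to the energy as \<open>\<mu> \<rightarrow> \<infinity>\<close>.
  Adding \<open>2 Re \<integral> u cnj \<psi>\<close>, where \<open>\<psi>\<close> approximates \<open>f\<close>, gives a functional
  \<open>J\<close> with \<open>J' + 2 lam J = d\<close> where no derivative of \<open>u\<close> occurs in \<open>d\<close>. In the limit this bounds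
  the energy by \<open>O(exp (- 2 lam t))\<close>, and interpolation then bounds the \<open>H\<^sup>1\<close> norm by
  \<open>O(exp (- 15/4 lam t))\<close>. All rates are strictly better than the claimed ones, so every
  constant can be taken to be 1.

  If the mass never exceeds the threshold, the same functional at a fixed \<open>\<mu>\<close> bounds the
  \<open>H\<^sup>1\<close> norm on the whole past by a bootstrap. The past of the trajectory is then a bounded
  set, every \<open>u(s)\<close> is the image of one of its points after an arbitrarily long time, and hence
  the trajectory lies in the closed set \<open>A\<close>.
\<close>

subsection \<open>Trigonometric test functions\<close>

text \<open>What is given is a single weak trajectory, so a functional of \<open>u\<close> can be
  differentiated in time only through an expansion whose error is quadratic in the L2 increment. The
  energy has none: formally its derivative pairs the second derivative of \<open>u\<close> with
  \<open>f\<close>, and neither factor is regular enough. The Riccati functional has one, because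
  resolvents in \<open>\<mu>\<close> smooth \<open>u\<close>. Its origin: for the potential
  \<open>u / sqrt 2\<close> at an imaginary spectral parameter, \<open>\<Gamma> / sqrt 2\<close> is
  the ratio of the components of a Floquet solution, and half the integral of
  \<open>u \<Gamma>\<close> is its Floquet exponent over one period, up to the constant
  \<open>\<mu> L / 2\<close>.

  The rates start from the exact damping \<open>2 lam\<close> of the squared L2 norm: the forcing
  costs \<open>lam / 2\<close> either way, leaving \<open>5/2 lam\<close> and
  \<open>3/2 lam\<close>. The functional keeps the rate \<open>2 lam\<close>, since as
  \<open>\<mu>\<close> grows the dangerous terms of \<open>d\<close> cancel or have a favourable
  sign, and the rest grows no faster than the L2 norm. Finally \<open>15/4\<close> is half of
  \<open>6 * 5/4\<close>: interpolation bounds the squared derivative by the energy and powers of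
  the L2 norm up to the sixth.\<close>

definition smooth_upto :: "nat \<Rightarrow> (real \<Rightarrow> real) \<Rightarrow> bool" where
  "smooth_upto n f \<longleftrightarrow> (\<forall>m\<le>n. (deriv ^^ m) f differentiable_on UNIV)"

lemma differentiable_on_UNIV_deriv:
  fixes f :: "real \<Rightarrow> real"
  assumes "f differentiable_on UNIV"
  shows "(f has_real_derivative deriv f x) (at x)"
  using assms by (auto simp: differentiable_on_def DERIV_deriv_iff_real_differentiable)

lemma differentiable_on_UNIV_I:
  fixes f :: "real \<Rightarrow> real"
  assumes "\<And>x. (f has_real_derivative f' x) (at x)"
  shows "f differentiable_on UNIV" "deriv f = f'"
  using assms by (auto simp: differentiable_on_def real_differentiable_def intro!: DERIV_imp_deriv)

lemma smooth_upto_0: "smooth_upto 0 f \<longleftrightarrow> f differentiable_on UNIV"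
  by (simp add: smooth_upto_def)

text \<open>Peeling off the innermost derivative gives a recursion in the order. Closure of test
  functions under sums and products then becomes an induction at finite order, which the unbounded
  quantifier in \<open>test_fun\<close> would not allow.\<close>

lemma smooth_upto_Suc: "smooth_upto (Suc n) f \<longleftrightarrow> f differentiable_on UNIV \<and> smooth_upto n (deriv f)"
proof -
  have eq: "(deriv ^^ Suc m) f = (deriv ^^ m) (deriv f)" for m
    by (simp add: funpow_swap1)
  have "(\<forall>m\<le>Suc n. Q m) \<longleftrightarrow> Q 0 \<and> (\<forall>m\<le>n. Q (Suc m))" for Q :: "nat \<Rightarrow> bool"
    by (metis Suc_le_mono le0 not0_implies_Suc)
  from this[of "\<lambda>m. (deriv ^^ m) f differentiable_on UNIV"] show ?thesis
    unfolding smooth_upto_def eq by simp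
qed

lemma smooth_upto_differentiable: "smooth_upto n f \<Longrightarrow> f differentiable_on UNIV"
  by (cases n) (auto simp: smooth_upto_0 smooth_upto_Suc)

lemma smooth_upto_mono: "smooth_upto n f \<Longrightarrow> m \<le> n \<Longrightarrow> smooth_upto m f"
  by (auto simp: smooth_upto_def)

lemma smooth_upto_const: "smooth_upto n (\<lambda>x. c)"
proof (induction n arbitrary: c)
  case (Suc n)
  show ?case by (simp add: smooth_upto_Suc Suc)
qed (simp add: smooth_upto_0)

lemma deriv_add_fun:
  fixes f g :: "real \<Rightarrow> real"
  assumes "f differentiable_on UNIV" "g differentiable_on UNIV"
  shows "deriv (\<lambda>x. f x + g x) = (\<lambda>x. deriv f x + deriv g x)"
  by (intro differentiable_on_UNIV_I DERIV_add differentiable_on_UNIV_deriv assms)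

lemma deriv_mult_fun:
  fixes f g :: "real \<Rightarrow> real"
  assumes "f differentiable_on UNIV" "g differentiable_on UNIV"
  shows "deriv (\<lambda>x. f x * g x) = (\<lambda>x. deriv f x * g x + f x * deriv g x)"
  by (intro differentiable_on_UNIV_I) (auto intro!: derivative_eq_intros differentiable_on_UNIV_deriv assms)

lemma smooth_upto_add:
  "smooth_upto n f \<Longrightarrow> smooth_upto n g \<Longrightarrow> smooth_upto n (\<lambda>x. f x + g x)"
proof (induction n arbitrary: f g)
  case 0
  then show ?case by (simp add: smooth_upto_0)
next
  case (Suc n)
  then show ?case by (simp add: smooth_upto_Suc deriv_add_fun)
qed

lemma smooth_upto_mult:
  "smooth_upto n f \<Longrightarrow> smooth_upto n g \<Longrightarrow> smooth_upto n (\<lambda>x. f x * g x)"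
proof (induction n arbitrary: f g)
  case 0
  then show ?case by (simp add: smooth_upto_0 differentiable_on_mult)
next
  case (Suc n)
  have "smooth_upto n f" "smooth_upto n g"
    using Suc.prems smooth_upto_mono by auto
  moreover have "f differentiable_on UNIV" "g differentiable_on UNIV"
    using Suc.prems by (auto simp: smooth_upto_Suc)
  ultimately show ?case using Suc
    by (simp add: smooth_upto_Suc deriv_mult_fun smooth_upto_add differentiable_on_mult)
qed

lemma smooth_upto_cos_sin: "smooth_upto n (\<lambda>x. cos (w * x)) \<and> smooth_upto n (\<lambda>x. sin (w * x))"
proof (induction n)
  case 0
  show ?case by (auto simp: smooth_upto_0 intro!: differentiable_on_UNIV_I derivative_eq_intros)
next
  case (Suc n)
  have d: "deriv (\<lambda>x. cos (w * x)) = (\<lambda>x. (- w) * sin (w * x))" "deriv (\<lambda>x. sin (w * x)) = (\<lambda>x. w * cos (w * x))"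
    by (auto intro!: differentiable_on_UNIV_I derivative_eq_intros)
  have "(\<lambda>x. cos (w * x)) differentiable_on UNIV" "(\<lambda>x. sin (w * x)) differentiable_on UNIV"
    using Suc smooth_upto_differentiable by blast+
  then show ?case
    unfolding smooth_upto_Suc d using Suc smooth_upto_mult[OF smooth_upto_const] by blast
qed

lemma test_fun_iff: "test_fun L \<phi> \<longleftrightarrow> periodic L \<phi> \<and> (\<forall>n. smooth_upto n \<phi>)"
  unfolding test_fun_def smooth_upto_def by blast

lemma test_fun_const: "test_fun L (\<lambda>x. c)"
  by (simp add: test_fun_iff smooth_upto_const periodic_def)

lemma test_fun_add: "test_fun L f \<Longrightarrow> test_fun L g \<Longrightarrow> test_fun L (\<lambda>x. f x + g x)"
  by (simp add: test_fun_iff smooth_upto_add periodic_def)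

lemma test_fun_mult: "test_fun L f \<Longrightarrow> test_fun L g \<Longrightarrow> test_fun L (\<lambda>x. f x * g x)"
  by (simp add: test_fun_iff smooth_upto_mult periodic_def)

lemma test_fun_diff: "test_fun L f \<Longrightarrow> test_fun L g \<Longrightarrow> test_fun L (\<lambda>x. f x - g x)"
  using test_fun_add[OF _ test_fun_mult[OF test_fun_const[of L "-1"]]] by simp

lemma test_fun_DERIV: "test_fun L f \<Longrightarrow> (f has_real_derivative deriv f x) (at x)"
  by (auto simp: test_fun_iff intro: differentiable_on_UNIV_deriv smooth_upto_differentiable)

lemma test_fun_cont: "test_fun L f \<Longrightarrow> continuous_on A f"
  by (meson DERIV_continuous_on continuous_on_subset subset_UNIV test_fun_DERIV)

lemma test_fun_deriv: assumes "test_fun L f" shows "test_fun L (deriv f)"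
proof -
  have "smooth_upto n (deriv f)" for n
    using assms smooth_upto_Suc by (auto simp: test_fun_iff)
  moreover have "deriv f (x + L) = deriv f x" for x
  proof -
    have "((\<lambda>x. f (x + L)) has_real_derivative deriv f (x + L)) (at x)"
      using DERIV_shift test_fun_DERIV[OF assms] by blast
    moreover have "(\<lambda>x. f (x + L)) = f"
      using assms by (auto simp: test_fun_def periodic_def)
    ultimately show ?thesis
      by (metis DERIV_imp_deriv)
  qed
  ultimately show ?thesis by (simp add: test_fun_iff periodic_def)
qed

lemma test_fun_antideriv:
  assumes "test_fun L g" "\<And>x. (f has_real_derivative g x) (at x)" "periodic L f"
  shows "test_fun L f" "deriv f = g"
proof -
  show d: "deriv f = g" and "test_fun L f"
    using assms differentiable_on_UNIV_I[of f g]
    by (auto simp: test_fun_iff) (metis not0_implies_Suc smooth_upto_0 smooth_upto_Suc)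
qed

text \<open>A real-linear functional of \<open>cis y\<close> is a combination of
  \<open>cos y\<close> and \<open>sin y\<close>, so polynomials on the circle pull back to
  trigonometric polynomials, which are smooth and \<open>L\<close>-periodic.\<close>

lemma test_fun_real_polynomial:
  assumes "real_polynomial_function p" "L \<noteq> 0"
  shows "test_fun L (\<lambda>x. p (cis (2 * pi / L * x)))"
  using assms(1)
proof induction
  case (linear h)
  have per: "cis (2 * pi / L * (x + L)) = cis (2 * pi / L * x)" for x
    using \<open>L \<noteq> 0\<close> by (simp add: distrib_left cis_mult [symmetric])
  have "h (cis y) = cos y * h 1 + sin y * h \<i>" for y
  proof -
    have "cis y = cos y *\<^sub>R 1 + sin y *\<^sub>R \<i>"
      by (simp add: complex_eq_iff)
    then show ?thesis
      by (simp only: linear_simps[OF linear] real_scaleR_def)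
  qed
  then have "(\<lambda>x. h (cis (2 * pi / L * x)))
      = (\<lambda>x. cos (2 * pi / L * x) * h 1 + sin (2 * pi / L * x) * h \<i>)"
    by simp
  then have "smooth_upto n (\<lambda>x. h (cis (2 * pi / L * x)))" for n
    using smooth_upto_cos_sin by (simp only:) (intro smooth_upto_add smooth_upto_mult smooth_upto_const; blast)
  then show ?case
    using per by (simp add: test_fun_iff periodic_def)
next
  case (const c) then show ?case by (rule test_fun_const)
next
  case (add f g) then show ?case by (simp add: test_fun_add)
next
  case (mult f g) then show ?case by (simp add: test_fun_mult)
qed

text \<open>Weierstrass' theorem for periodic functions: matching end values let \<open>F\<close>
  descend to a continuous \<open>G\<close> on the unit circle, where Stone-Weierstrass supplies a
  polynomial.\<close>

lemma trig_approximation: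
  fixes F :: "real \<Rightarrow> complex"
  assumes L: "0 < L" and cont: "continuous_on {-L/2..L/2} F" and eq: "F (-L/2) = F (L/2)" and e: "0 < e"
  obtains p q where "test_fun L p" "test_fun L q"
    "\<And>x. x \<in> {-L/2..L/2} \<Longrightarrow> cmod (F x - Complex (p x) (q x)) < e"
proof -
  define c where "c x = cis (2 * pi / L * x)" for x
  define G where "G z = F (L / (2 * pi) * Arg z)" for z
  let ?S = "sphere (0::complex) 1" and ?T = "{-L/2..L/2}"
  have c_S: "c x \<in> ?S" for x by (simp add: c_def)
  have Arg_T: "L / (2 * pi) * Arg z \<in> ?T" for z
  proof -
    have "- pi < Arg z" "Arg z \<le> pi" by (auto simp: mpi_less_Arg Arg_le_pi)
    then have "- (L * pi) \<le> L * Arg z" "L * Arg z \<le> L * pi"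
      using mult_left_mono[of "- pi" "Arg z" L] mult_left_mono[of "Arg z" pi L] L by auto
    then show ?thesis using L by (auto simp: field_simps)
  qed
  have c_Arg: "c (L / (2 * pi) * Arg z) = z" if "z \<in> ?S" for z
    using that L cis_Arg[of z] by (cases "z = 0") (auto simp: c_def sgn_eq)
  have G_c: "G (c x) = F x" if "x \<in> ?T" for x
  proof (cases "x = - L/2")
    case True
    then have "c x = -1" using L by (simp add: c_def complex_eq_iff)
    moreover have "Arg (-1) = pi"
      using Arg_cis[of pi] by simp
    ultimately show ?thesis using True L eq by (simp add: G_def)
  next
    case False
    then have "- L/2 < x" "x \<le> L/2"
      using that by auto
    then have "2 * pi / L * (- L/2) < 2 * pi / L * x" "2 * pi / L * x \<le> 2 * pi / L * (L/2)"
      using L by (intro mult_strict_left_mono mult_left_mono; simp)+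
    then have "- pi < 2 * pi / L * x" "2 * pi / L * x \<le> pi"
      using L by simp_all
    then have "Arg (c x) = 2 * pi / L * x"
      unfolding c_def by (simp add: Arg_cis)
    then show ?thesis using L by (simp add: G_def)
  qed
  have contc: "continuous_on A c" for A
    unfolding c_def by (intro continuous_intros)
  \<comment> \<open>\<open>Arg\<close> jumps at -1, so continuity of \<open>G\<close> cannot be read
    off its formula. Instead the wrapping map \<open>c\<close> is used as a quotient map: the
    preimage of a closed set under \<open>G\<close> is the image under \<open>c\<close> of a compact
    set. At \<open>- L/2\<close> this needs \<open>F (-L/2) = F (L/2)\<close>.\<close>
  have "continuous_on ?S G"
    unfolding continuous_on_closed_vimage[OF closed_sphere]
  proof (intro allI impI)
    fix C :: "complex set" assume C: "closed C"
    have "G -` C \<inter> ?S = c ` (F -` C \<inter> ?T)"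
    proof (intro equalityI subsetI)
      fix z assume z: "z \<in> G -` C \<inter> ?S"
      then have "F (L / (2 * pi) * Arg z) \<in> C" by (simp add: G_def)
      then show "z \<in> c ` (F -` C \<inter> ?T)"
        using z c_Arg[of z] Arg_T[of z] by (intro image_eqI[of _ _ "L / (2 * pi) * Arg z"]) auto
    qed (use G_c c_S in auto)
    moreover have "compact (F -` C \<inter> ?T)"
    proof -
      have "closed (F -` C \<inter> ?T)"
        using cont C continuous_on_closed_vimage[of ?T F] by blast
      then have "compact (?T \<inter> (F -` C \<inter> ?T))"
        by (intro compact_Int_closed) auto
      then show ?thesis by (simp add: Int_absorb1 inf.absorb2)
    qed
    ultimately show "closed (G -` C \<inter> ?S)"
      using compact_continuous_image[OF contc] compact_imp_closed by metis
  qed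
  then obtain g where g: "polynomial_function g" "\<And>z. z \<in> ?S \<Longrightarrow> norm (G z - g z) < e"
    using Stone_Weierstrass_polynomial_function[of ?S G e] e by auto
  show ?thesis
  proof
    show "test_fun L (\<lambda>x. Re (g (c x)))" "test_fun L (\<lambda>x. Im (g (c x)))"
      using g(1) test_fun_real_polynomial[of "Re \<circ> g" L] test_fun_real_polynomial[of "Im \<circ> g" L] L
      unfolding polynomial_function_def c_def by (auto simp: bounded_linear_Re bounded_linear_Im)
    show "cmod (F x - Complex (Re (g (c x))) (Im (g (c x)))) < e" if "x \<in> ?T" for x
      using g(2)[OF c_S[of x]] G_c[OF that] by simp
  qed
qed

subsection \<open>Square integrable periodic functions\<close>

lemma continuous_lebesgue_measurable:
  fixes f :: "real \<Rightarrow> 'a::euclidean_space"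
  assumes "continuous_on UNIV f"
  shows "f \<in> borel_measurable lebesgue"
proof -
  have "f \<in> borel_measurable lborel"
    using borel_measurable_continuous_onI[OF assms] measurable_lborel2 by auto
  then show ?thesis by (rule measurable_completion)
qed

text \<open>The optimal choice is \<open>t = b / a\<close>. If \<open>a\<close> or \<open>b\<close>
  vanishes, a value of \<open>t\<close> adapted to a supposedly positive \<open>c\<close> gives the
  contradiction. Cauchy-Schwarz follows without dividing by a norm.\<close>

lemma le_mult_of_AMGM:
  fixes a b c :: real
  assumes "0 \<le> a" "0 \<le> b" "\<And>t. 0 < t \<Longrightarrow> 2 * c \<le> t * a\<^sup>2 + b\<^sup>2 / t"
  shows "c \<le> a * b"
proof (cases "a = 0")
  case True
  show ?thesis
  proof (rule ccontr)
    assume "\<not> c \<le> a * b"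
    then have c: "0 < c" using True by simp
    have t: "0 < b\<^sup>2 / c + 1"
      using c by (simp add: add_nonneg_pos)
    have "2 * c \<le> b\<^sup>2 / (b\<^sup>2 / c + 1)"
      using assms(3)[OF t] True by simp
    also have "\<dots> \<le> c"
    proof -
      have "b\<^sup>2 \<le> c * (b\<^sup>2 / c + 1)"
        using c by (simp add: distrib_left)
      then show ?thesis
        using t by (simp only: pos_divide_le_eq)
    qed
    finally show False using c by simp
  qed
next
  case False
  then have a: "0 < a" using assms by simp
  show ?thesis
  proof (cases "b = 0")
    case True
    show ?thesis
    proof (rule ccontr)
      assume "\<not> c \<le> a * b"
      then have c: "0 < c" using True by simp
      then have "2 * c \<le> c / a\<^sup>2 * a\<^sup>2"
        using assms(3)[of "c / a\<^sup>2"] True a by simp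
      then show False using c a by simp
    qed
  next
    case False
    then have b: "0 < b" using assms by simp
    have "2 * c \<le> b / a * a\<^sup>2 + b\<^sup>2 / (b / a)"
      using assms(3)[of "b / a"] a b by simp
    then show ?thesis using a b by (simp add: power2_eq_square)
  qed
qed

locale torus =
  fixes L :: real
  assumes L_pos: "0 < L"
begin

definition T where "T = {- L / 2 .. L / 2}"
definition M where "M = lebesgue_on T"
abbreviation nrm where "nrm \<equiv> L2norm L"

lemma mem_T: "x \<in> T \<longleftrightarrow> - L / 2 \<le> x \<and> x \<le> L / 2"
  by (simp add: T_def)

sublocale M: finite_measure M
  unfolding M_def T_def by (rule finite_measure_lebesgue_on) (metis box_real(2) lmeasurable_cbox)

lemma T_lebesgue [simp, measurable]: "T \<in> sets lebesgue"
  by (simp add: T_def)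

lemma LINT_T:
  fixes h :: "real \<Rightarrow> 'a::euclidean_space"
  shows "(LINT x:{- L / 2 .. L / 2}|lebesgue. h x) = (LINT x|M. h x)"
  unfolding T_def[symmetric] M_def by (simp add: set_lebesgue_integral_def integral_restrict_space)

lemma set_integrable_T:
  fixes h :: "real \<Rightarrow> 'a::euclidean_space"
  shows "set_integrable lebesgue {- L / 2 .. L / 2} h \<longleftrightarrow> integrable M h"
  unfolding T_def[symmetric] M_def by (simp add: set_integrable_def integrable_restrict_space)

lemma space_M [simp]: "space M = T"
  by (simp add: M_def space_restrict_space)

lemma measure_M [simp]: "measure M T = L"
  unfolding M_def using L_pos by (subst measure_restrict_space) (auto simp: T_def)

lemma meas_M: "f \<in> borel_measurable lebesgue \<Longrightarrow> f \<in> borel_measurable M"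
  unfolding M_def by (rule measurable_restrict_space1)

lemma id_meas_M [measurable]: "(\<lambda>x. x) \<in> borel_measurable M"
  by (intro meas_M continuous_lebesgue_measurable continuous_intros)

lemma periodic_shift:
  assumes "periodic L g"
  shows "g (x + of_int n * L) = g x"
proof (induction n rule: int_induct[where k = 0])
  case (step1 i)
  have eq: "x + of_int (i + 1) * L = (x + of_int i * L) + L" by (simp add: algebra_simps)
  show ?case
    unfolding eq using step1 assms[unfolded periodic_def, rule_format, of "x + of_int i * L"] by simp
next
  case (step2 i)
  have eq: "(x + of_int (i - 1) * L) + L = x + of_int i * L" by (simp add: algebra_simps)
  show ?case
    using step2 assms[unfolded periodic_def, rule_format, of "x + of_int (i - 1) * L"] unfolding eq by simp
qed simp

lemma periodic_rep:
  obtains n :: int where "x + of_int n * L \<in> T"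
proof
  define m where "m = \<lfloor>x / L + 1/2\<rfloor>"
  have "of_int m \<le> x / L + 1/2" "x / L + 1/2 \<le> of_int m + 1"
    unfolding m_def by linarith+
  then have "of_int m * L \<le> (x / L + 1/2) * L" "(x / L + 1/2) * L \<le> (of_int m + 1) * L"
    using L_pos by (auto intro: mult_right_mono)
  moreover have "(x / L + 1/2) * L = x + L / 2"
    using L_pos by (simp add: distrib_right)
  ultimately have "of_int m * L \<le> x + L / 2" "x + L / 2 \<le> of_int m * L + L"
    by (simp_all add: distrib_right)
  then show "x + of_int (- m) * L \<in> T"
    by (simp add: mem_T)
qed

lemma periodic_all_T:
  assumes "periodic L g" "\<And>x. x \<in> T \<Longrightarrow> P (g x)"
  shows "P (g x)"
proof -
  obtain n where "x + of_int n * L \<in> T" by (rule periodic_rep)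
  from assms(2)[OF this] show ?thesis by (simp only: periodic_shift[OF assms(1)])
qed

lemma periodic_ends:
  assumes "periodic L g"
  shows "g (L/2) = g (- L/2)"
proof -
  have eq: "- L/2 + L = L/2" by simp
  from assms have "g (- L/2 + L) = g (- L/2)" unfolding periodic_def by (rule spec)
  then show ?thesis unfolding eq .
qed

lemma L2per_iff:
  "g \<in> L2per L \<longleftrightarrow> periodic L g \<and> g \<in> borel_measurable lebesgue \<and> integrable M (\<lambda>x. (cmod (g x))\<^sup>2)"
  unfolding L2per_def set_integrable_T by simp

lemma L2D:
  assumes "g \<in> L2per L"
  shows "periodic L g" "g \<in> borel_measurable lebesgue" "g \<in> borel_measurable M"
    "integrable M (\<lambda>x. (cmod (g x))\<^sup>2)"
  using assms by (auto simp: L2per_iff intro: meas_M)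

lemma nrm_def: "nrm g = sqrt (LINT x|M. (cmod (g x))\<^sup>2)"
  unfolding L2norm_def LINT_T ..

lemma nrm_sq: "(nrm g)\<^sup>2 = (LINT x|M. (cmod (g x))\<^sup>2)"
  by (simp add: nrm_def)

lemma nrm_nonneg [simp]: "0 \<le> nrm g"
  by (simp add: nrm_def)

lemma nrm_cong: "(\<And>x. x \<in> T \<Longrightarrow> cmod (g x) = cmod (h x)) \<Longrightarrow> nrm g = nrm h"
  unfolding nrm_def by (intro arg_cong[of _ _ sqrt] Bochner_Integration.integral_cong) auto

lemma L2_dominated:
  assumes "periodic L g" "g \<in> borel_measurable lebesgue" "integrable M w"
    "\<And>x. x \<in> T \<Longrightarrow> (cmod (g x))\<^sup>2 \<le> w x"
  shows "g \<in> L2per L"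
proof -
  have [measurable]: "g \<in> borel_measurable M" by (rule meas_M) fact
  have "integrable M (\<lambda>x. (cmod (g x))\<^sup>2)"
    by (rule Bochner_Integration.integrable_bound[OF assms(3)]) (use assms(4) in \<open>auto intro!: AE_I2 simp: order.trans\<close>, force)
  then show ?thesis using assms by (simp add: L2per_iff)
qed

lemma L2_add:
  assumes "g \<in> L2per L" "h \<in> L2per L"
  shows "(\<lambda>x. g x + h x) \<in> L2per L"
proof (rule L2_dominated[where w = "\<lambda>x. 2 * (cmod (g x))\<^sup>2 + 2 * (cmod (h x))\<^sup>2"])
  fix x
  have "(cmod (g x + h x))\<^sup>2 \<le> (cmod (g x) + cmod (h x))\<^sup>2"
    by (intro power_mono norm_triangle_ineq) auto
  also have "\<dots> \<le> 2 * (cmod (g x))\<^sup>2 + 2 * (cmod (h x))\<^sup>2"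
    using sum_squares_bound[of "cmod (g x)" "cmod (h x)"] by (simp add: power2_sum)
  finally show "(cmod (g x + h x))\<^sup>2 \<le> 2 * (cmod (g x))\<^sup>2 + 2 * (cmod (h x))\<^sup>2" .
qed (use assms in \<open>auto simp: periodic_def L2per_iff\<close>)

lemma L2_bmult:
  assumes "g \<in> L2per L" "periodic L b" "b \<in> borel_measurable lebesgue" "\<And>x. x \<in> T \<Longrightarrow> cmod (b x) \<le> B"
  shows "(\<lambda>x. b x * g x) \<in> L2per L"
proof (rule L2_dominated[where w = "\<lambda>x. B\<^sup>2 * (cmod (g x))\<^sup>2"])
  fix x assume "x \<in> T"
  then show "(cmod (b x * g x))\<^sup>2 \<le> B\<^sup>2 * (cmod (g x))\<^sup>2"
    by (simp add: norm_mult power_mult_distrib assms(4) mult_right_mono power_mono)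
qed (use assms in \<open>auto simp: periodic_def L2per_iff\<close>)

lemma L2_cmult: "g \<in> L2per L \<Longrightarrow> (\<lambda>x. c * g x) \<in> L2per L"
  by (rule L2_bmult[of _ _ "cmod c"]) (auto simp: periodic_def)

lemma L2_diff: "g \<in> L2per L \<Longrightarrow> h \<in> L2per L \<Longrightarrow> (\<lambda>x. g x - h x) \<in> L2per L"
  using L2_add[OF _ L2_cmult[of h "-1"]] by simp

lemma L2_uminus: "g \<in> L2per L \<Longrightarrow> (\<lambda>x. - g x) \<in> L2per L"
  using L2_cmult[of g "-1"] by simp

lemma L2_cnj: "g \<in> L2per L \<Longrightarrow> (\<lambda>x. cnj (g x)) \<in> L2per L"
  by (rule L2_dominated[where w = "\<lambda>x. (cmod (g x))\<^sup>2"]) (auto simp: periodic_def L2per_iff intro!: borel_measurable_continuous_on[OF continuous_on_cnj[OF continuous_on_id]])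

lemma cont_per_bounded:
  fixes g :: "real \<Rightarrow> complex"
  assumes "continuous_on UNIV g" "periodic L g"
  obtains B where "0 < B" "\<And>x. cmod (g x) \<le> B"
proof -
  have "compact (g ` T)"
    by (intro compact_continuous_image continuous_on_subset[OF assms(1)]) (auto simp: T_def)
  then obtain B where "0 < B" "\<And>z. z \<in> g ` T \<Longrightarrow> cmod z \<le> B"
    using compact_imp_bounded bounded_pos by metis
  then show ?thesis
    using periodic_all_T[OF assms(2), of "\<lambda>z. cmod z \<le> B"] by (intro that[of B]) auto
qed

lemma L2_cont:
  assumes "continuous_on UNIV g" "periodic L g"
  shows "g \<in> L2per L"
proof -
  obtain B where B: "0 < B" "\<And>x. cmod (g x) \<le> B" using cont_per_bounded[OF assms] by blast
  show ?thesis
    by (rule L2_dominated[where w = "\<lambda>x. B\<^sup>2"]) (use assms B in \<open>auto intro: power_mono continuous_lebesgue_measurable\<close>)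
qed

lemma L2_cont_mult:
  assumes "g \<in> L2per L" "continuous_on UNIV b" "periodic L b"
  shows "(\<lambda>x. b x * g x) \<in> L2per L"
proof -
  obtain B where B: "0 < B" "\<And>x. cmod (b x) \<le> B" using cont_per_bounded[OF assms(2,3)] by blast
  then show ?thesis using assms by (intro L2_bmult[of _ _ B] continuous_lebesgue_measurable) auto
qed

lemma int_mult:
  assumes "g \<in> L2per L" "h \<in> L2per L"
  shows "integrable M (\<lambda>x. g x * h x)" "integrable M (\<lambda>x. cmod (g x) * cmod (h x))"
proof -
  note [measurable] = L2D(3)[OF assms(1)] L2D(3)[OF assms(2)]
  have i: "integrable M (\<lambda>x. (cmod (g x))\<^sup>2 + (cmod (h x))\<^sup>2)"
    using L2D(4) assms by (intro Bochner_Integration.integrable_add) auto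
  have b: "cmod (g x) * cmod (h x) \<le> (cmod (g x))\<^sup>2 + (cmod (h x))\<^sup>2" for x
  proof -
    have "0 \<le> cmod (g x) * cmod (h x)" by simp
    then show ?thesis using sum_squares_bound[of "cmod (g x)" "cmod (h x)"] by linarith
  qed
  show "integrable M (\<lambda>x. g x * h x)" "integrable M (\<lambda>x. cmod (g x) * cmod (h x))"
    by (rule Bochner_Integration.integrable_bound[OF i]; use b in \<open>auto simp: norm_mult\<close>)+
qed

lemma L2_one: "(\<lambda>x. c) \<in> L2per L"
  by (rule L2_cont) (auto simp: periodic_def)

lemma int_L2: assumes "g \<in> L2per L" shows "integrable M g" "integrable M (\<lambda>x. cmod (g x))"
  using int_mult[OF assms L2_one[of 1]] by auto

lemma CS_abs:
  assumes "g \<in> L2per L" "h \<in> L2per L"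
  shows "(LINT x|M. cmod (g x) * cmod (h x)) \<le> nrm g * nrm h"
proof (rule le_mult_of_AMGM)
  fix t :: real assume t: "0 < t"
  note i = L2D(4)[OF assms(1)] L2D(4)[OF assms(2)] int_mult(2)[OF assms]
  have "(LINT x|M. 2 * (cmod (g x) * cmod (h x))) \<le> (LINT x|M. t * (cmod (g x))\<^sup>2 + (1/t) * (cmod (h x))\<^sup>2)"
  proof (intro integral_mono)
    fix x
    have "0 \<le> (sqrt t * cmod (g x) - sqrt (1/t) * cmod (h x))\<^sup>2" by simp
    then show "2 * (cmod (g x) * cmod (h x)) \<le> t * (cmod (g x))\<^sup>2 + (1/t) * (cmod (h x))\<^sup>2"
      using t by (simp add: power2_diff power_mult_distrib real_sqrt_mult[symmetric] mult.commute mult.left_commute)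
         (simp add: algebra_simps real_sqrt_divide)
  qed (use i in auto)
  then show "2 * (LINT x|M. cmod (g x) * cmod (h x)) \<le> t * (nrm g)\<^sup>2 + (nrm h)\<^sup>2 / t"
    using i by (simp add: nrm_sq)
qed auto

lemma CS:
  assumes "g \<in> L2per L" "h \<in> L2per L"
  shows "cmod (LINT x|M. g x * h x) \<le> nrm g * nrm h"
proof -
  have "cmod (LINT x|M. g x * h x) \<le> (LINT x|M. cmod (g x * h x))"
    by (rule integral_norm_bound)
  also have "\<dots> \<le> nrm g * nrm h"
    using CS_abs[OF assms] by (simp add: norm_mult)
  finally show ?thesis .
qed

lemma nrm_one: "nrm (\<lambda>x. 1) = sqrt L"
  by (simp add: nrm_def)

lemma int_abs_le:
  assumes "g \<in> L2per L"
  shows "(LINT x|M. cmod (g x)) \<le> sqrt L * nrm g"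
  using CS_abs[OF L2_one[of 1] assms] nrm_one by simp

lemma nrm_mono:
  assumes "g \<in> L2per L" "h \<in> L2per L" "\<And>x. x \<in> T \<Longrightarrow> cmod (g x) \<le> cmod (h x)"
  shows "nrm g \<le> nrm h"
proof (rule power2_le_imp_le)
  show "(nrm g)\<^sup>2 \<le> (nrm h)\<^sup>2"
    unfolding nrm_sq using assms L2D(4) by (intro integral_mono) (auto intro: power_mono)
qed simp

lemma nrm_cmult: "nrm (\<lambda>x. c * g x) = cmod c * nrm g"
  by (simp add: nrm_def norm_mult power_mult_distrib real_sqrt_mult)

lemma nrm_uminus [simp]: "nrm (\<lambda>x. - g x) = nrm g"
  by (intro nrm_cong) simp

lemma nrm_cnj [simp]: "nrm (\<lambda>x. cnj (g x)) = nrm g"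
  by (intro nrm_cong) simp

lemma nrm_triangle:
  assumes "g \<in> L2per L" "h \<in> L2per L"
  shows "nrm (\<lambda>x. g x + h x) \<le> nrm g + nrm h"
proof (rule power2_le_imp_le)
  note i = L2D(4)[OF assms(1)] L2D(4)[OF assms(2)] int_mult(2)[OF assms]
  have "(nrm (\<lambda>x. g x + h x))\<^sup>2 \<le> (LINT x|M. (cmod (g x))\<^sup>2 + (cmod (h x))\<^sup>2 + 2 * (cmod (g x) * cmod (h x)))"
    unfolding nrm_sq
  proof (intro integral_mono)
    show "integrable M (\<lambda>x. (cmod (g x + h x))\<^sup>2)" using L2_add[OF assms] L2D(4) by blast
    fix x
    have "(cmod (g x + h x))\<^sup>2 \<le> (cmod (g x) + cmod (h x))\<^sup>2"
      by (intro power_mono norm_triangle_ineq) auto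
    then show "(cmod (g x + h x))\<^sup>2 \<le> (cmod (g x))\<^sup>2 + (cmod (h x))\<^sup>2 + 2 * (cmod (g x) * cmod (h x))"
      by (simp add: power2_sum)
  qed (use i in auto)
  also have "\<dots> = (nrm g)\<^sup>2 + (nrm h)\<^sup>2 + 2 * (LINT x|M. cmod (g x) * cmod (h x))"
    using i by (simp add: nrm_sq)
  also have "\<dots> \<le> (nrm g + nrm h)\<^sup>2"
    using CS_abs[OF assms] by (simp add: power2_sum)
  finally show "(nrm (\<lambda>x. g x + h x))\<^sup>2 \<le> (nrm g + nrm h)\<^sup>2" .
qed simp

lemma nrm_triangle_diff:
  assumes "g \<in> L2per L" "h \<in> L2per L"
  shows "nrm (\<lambda>x. g x - h x) \<le> nrm g + nrm h"
  using nrm_triangle[OF assms(1) L2_uminus[OF assms(2)]] by simp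

lemma nrm_diff_commute: "nrm (\<lambda>x. g x - h x) = nrm (\<lambda>x. h x - g x)"
  by (intro nrm_cong) (simp add: norm_minus_commute)

lemma nrm_bmult:
  assumes "g \<in> L2per L" "(\<lambda>x. b x * g x) \<in> L2per L" "\<And>x. x \<in> T \<Longrightarrow> cmod (b x) \<le> B"
  shows "nrm (\<lambda>x. b x * g x) \<le> B * nrm g"
proof -
  have "cmod (b 0) \<le> B" using L_pos by (intro assms(3)) (simp add: mem_T)
  then have "0 \<le> B" by (rule order_trans[OF norm_ge_zero])
  have "nrm (\<lambda>x. b x * g x) \<le> nrm (\<lambda>x. of_real B * g x)"
    using assms \<open>0 \<le> B\<close> by (intro nrm_mono L2_cmult) (auto simp: norm_mult intro: mult_right_mono)
  then show ?thesis using \<open>0 \<le> B\<close> unfolding nrm_cmult by simp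
qed

lemma tendsto_nrm:
  assumes "\<And>n. (\<lambda>x. g x - s n x) \<in> L2per L"
    "(\<lambda>n. LINT x|M. (cmod (g x - s n x))\<^sup>2) \<longlonglongrightarrow> 0" "0 < e"
  obtains n :: nat where "nrm (\<lambda>x. g x - s n x) < e"
proof -
  have "eventually (\<lambda>n. (LINT x|M. (cmod (g x - s n x))\<^sup>2) < e\<^sup>2) sequentially"
    using assms(2,3) by (intro order_tendstoD(2)) auto
  then obtain n where "(nrm (\<lambda>x. g x - s n x))\<^sup>2 < e\<^sup>2"
    unfolding nrm_sq by (auto simp: eventually_sequentially)
  then show ?thesis using that assms(3) power2_less_imp_less by fastforce
qed

section \<open>Density of test functions in the periodic L2 space\<close>

lemma L2_approx_bounded:
  assumes g: "g \<in> L2per L" and e: "0 < e"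
  obtains b B where "b \<in> L2per L" "0 < B" "\<And>x. cmod (b x) \<le> B" "nrm (\<lambda>x. g x - b x) < e"
proof -
  define s where "s n x = (if cmod (g x) \<le> real n then g x else 0)" for n x
  note [measurable] = L2D(2)[OF g] L2D(3)[OF g]
  have s_le: "cmod (s n x) \<le> cmod (g x)" for n x by (simp add: s_def)
  have [measurable]: "s n \<in> borel_measurable lebesgue" "s n \<in> borel_measurable M" for n
    unfolding s_def by measurable
  have s: "s n \<in> L2per L" for n
    by (rule L2_dominated[OF _ _ L2D(4)[OF g]])
      (use L2D(1)[OF g] in \<open>auto simp: s_def periodic_def power_mono\<close>)
  have "(\<lambda>n. LINT x|M. (cmod (g x - s n x))\<^sup>2) \<longlonglongrightarrow> (LINT x|M. (0::real))"
  proof (rule integral_dominated_convergence[OF _ _ L2D(4)[OF g]])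
    show "AE x in M. (\<lambda>n. (cmod (g x - s n x))\<^sup>2) \<longlonglongrightarrow> 0"
    proof (intro AE_I2 tendsto_eventually)
      fix x
      obtain N where "cmod (g x) \<le> real N" using real_arch_simple by blast
      then show "eventually (\<lambda>n. (cmod (g x - s n x))\<^sup>2 = 0) sequentially"
        unfolding eventually_sequentially s_def by (intro exI[of _ N]) auto
    qed
    show "AE x in M. norm ((cmod (g x - s n x))\<^sup>2) \<le> (cmod (g x))\<^sup>2" for n
      by (intro AE_I2) (simp add: s_def)
  qed measurable
  then have "(\<lambda>n. LINT x|M. (cmod (g x - s n x))\<^sup>2) \<longlonglongrightarrow> 0" by simp
  then obtain n where n: "nrm (\<lambda>x. g x - s n x) < e"
    using tendsto_nrm[of g s, OF L2_diff[OF g s] _ e] by blast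
  show ?thesis
    by (rule that[OF s _ _ n, of "real n + 1"]) (auto simp: s_def)
qed

text \<open>A chain of approximations: truncate \<open>g\<close>, write the truncation as an almost
  everywhere limit of continuous functions, clip these to a fixed height so that dominated
  convergence applies, taper them at the ends of the period, and approximate uniformly by
  trigonometric polynomials.\<close>

lemma L2_approx_test:
  assumes g: "g \<in> L2per L" and e: "0 < e"
  obtains p q where "test_fun L p" "test_fun L q" "nrm (\<lambda>x. g x - Complex (p x) (q x)) < e"
proof -
  obtain b B where b: "b \<in> L2per L" "0 < B" "\<And>x. cmod (b x) \<le> B" and gb: "nrm (\<lambda>x. g x - b x) < e / 3"
    using L2_approx_bounded[OF g, of "e / 3"] e by auto
  have "b measurable_on UNIV"
    using lebesgue_measurable_imp_measurable_on[OF L2D(2)[OF b(1)]] by simp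
  then obtain N f where N: "negligible N" and f: "\<And>n. continuous_on UNIV (f n)"
    "\<And>x. x \<notin> N \<Longrightarrow> (\<lambda>n. f n x) \<longlonglongrightarrow> b x"
    unfolding measurable_on_def by auto
  \<comment> \<open>\<open>th n\<close> is a cut-off vanishing at both ends of the period and
    tending to 1 inside, which makes the end values of \<open>F n\<close> agree. The scalar in
    \<open>F\<close> retracts \<open>f n x\<close> onto the ball of radius \<open>B\<close>, where
    \<open>b x\<close> already lies.\<close>
  define th where "th n x = min 1 (max 0 (real n * (L/2 - \<bar>x\<bar>)))" for n :: nat and x :: real
  define F where "F n x = th n x *\<^sub>R ((B / max B (cmod (f n x))) *\<^sub>R f n x)" for n x
  have contF: "continuous_on UNIV (F n)" for n
    unfolding F_def th_def using b(2) by (intro continuous_intros f(1)) auto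
  have F_le: "cmod (F n x) \<le> B" for n x
  proof -
    have th: "0 \<le> th n x" "th n x \<le> 1" by (auto simp: th_def)
    have "cmod ((B / max B (cmod (f n x))) *\<^sub>R f n x) \<le> B"
      using b(2) by (simp add: abs_mult field_simps max_def)
    then show ?thesis
      unfolding F_def norm_scaleR[of "th n x"] using th b(2) mult_mono[of "\<bar>th n x\<bar>" 1 _ B] by (simp del: norm_scaleR)
  qed
  have F_ends: "F n (- L/2) = F n (L/2)" for n
    using L_pos by (simp add: F_def th_def)
  note [measurable] = L2D(3)[OF b(1)] meas_M[OF continuous_lebesgue_measurable[OF contF]]
  have F_lim: "(\<lambda>n. F n x) \<longlonglongrightarrow> b x" if "x \<notin> N" "\<bar>x\<bar> < L/2" for x
  proof -
    have "eventually (\<lambda>n. 1 \<le> real n * (L/2 - \<bar>x\<bar>)) sequentially"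
    proof -
      obtain K where K: "1 / (L/2 - \<bar>x\<bar>) \<le> real K" using real_arch_simple by blast
      show ?thesis
      proof (intro eventually_sequentiallyI[of K])
        fix n assume "K \<le> n"
        have "1 \<le> real K * (L/2 - \<bar>x\<bar>)" using K that(2) by (simp add: divide_le_eq)
        also have "\<dots> \<le> real n * (L/2 - \<bar>x\<bar>)" using \<open>K \<le> n\<close> that(2) by (intro mult_right_mono) auto
        finally show "1 \<le> real n * (L/2 - \<bar>x\<bar>)" .
      qed
    qed
    then have "eventually (\<lambda>n. th n x = 1) sequentially"
      by eventually_elim (simp add: th_def)
    then have th: "(\<lambda>n. th n x) \<longlonglongrightarrow> 1" by (rule tendsto_eventually)
    have "(\<lambda>n. F n x) \<longlonglongrightarrow> 1 *\<^sub>R ((B / max B (cmod (b x))) *\<^sub>R b x)"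
      unfolding F_def using b(2) by (intro tendsto_intros th f(2) that) auto
    then show ?thesis using b(2) b(3)[of x] by (simp add: max_def split: if_splits)
  qed
  have "AE x in lebesgue. x \<notin> N \<union> {- L/2, L/2}"
    using N by (intro AE_not_in) (simp add: negligible_iff_null_sets[symmetric])
  then have "AE x in lebesgue. x \<in> T \<longrightarrow> (\<lambda>n. F n x) \<longlonglongrightarrow> b x"
    by (rule AE_mp) (intro AE_I2 impI F_lim, auto simp: mem_T abs_less_iff)
  then have ae: "AE x in M. (\<lambda>n. F n x) \<longlonglongrightarrow> b x"
    unfolding M_def by (subst AE_restrict_space_iff) auto
  have F2B: "(cmod (b x - F n x))\<^sup>2 \<le> (2 * B)\<^sup>2" for n x
    using norm_triangle_ineq4[of "b x" "F n x"] b(3)[of x] F_le[of n x] by (intro power_mono) auto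
  have lim: "(\<lambda>n. LINT x|M. (cmod (b x - F n x))\<^sup>2) \<longlonglongrightarrow> (LINT x|M. (0::real))"
  proof (rule integral_dominated_convergence[where w = "\<lambda>x. (2 * B)\<^sup>2"])
    show "AE x in M. (\<lambda>n. (cmod (b x - F n x))\<^sup>2) \<longlonglongrightarrow> 0"
      using ae
    proof eventually_elim
      case (elim x)
      have "(\<lambda>n. (cmod (b x - F n x))\<^sup>2) \<longlonglongrightarrow> (cmod (b x - b x))\<^sup>2"
        by (intro tendsto_intros elim)
      then show ?case by simp
    qed
    show "AE x in M. norm ((cmod (b x - F n x))\<^sup>2) \<le> (2 * B)\<^sup>2" for n
      using F2B by (intro AE_I2) simp
  qed auto
  have "eventually (\<lambda>n. (LINT x|M. (cmod (b x - F n x))\<^sup>2) < (e/3)\<^sup>2) sequentially"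
    using lim e by (intro order_tendstoD(2)) auto
  then obtain n where n: "(LINT x|M. (cmod (b x - F n x))\<^sup>2) < (e/3)\<^sup>2"
    by (auto simp: eventually_sequentially)
  \<comment> \<open>Chosen so that \<open>2 * (e/3)\<^sup>2 + 2 * (L * d\<^sup>2)\<close> is exactly
    \<open>(2 * e / 3)\<^sup>2\<close>; together with \<open>e / 3\<close> from the truncation the
    total is \<open>e\<close>.\<close>
  define d where "d = e / (3 * sqrt L)"
  have d: "0 < d" using e L_pos by (simp add: d_def)
  obtain p q where pq: "test_fun L p" "test_fun L q"
    "\<And>x. x \<in> T \<Longrightarrow> cmod (F n x - Complex (p x) (q x)) < d"
    using trig_approximation[OF L_pos continuous_on_subset[OF contF[of n] subset_UNIV] F_ends d]
    unfolding T_def by metis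
  have P: "(\<lambda>x. Complex (p x) (q x)) \<in> L2per L"
  proof (rule L2_cont)
    show "continuous_on UNIV (\<lambda>x. Complex (p x) (q x))"
      unfolding Complex_eq using pq test_fun_cont by (intro continuous_intros) auto
    show "periodic L (\<lambda>x. Complex (p x) (q x))"
      using pq by (simp add: periodic_def test_fun_def)
  qed
  have [measurable]: "(\<lambda>x. Complex (p x) (q x)) \<in> borel_measurable M"
    using L2D(3)[OF P] .
  have bp: "nrm (\<lambda>x. b x - Complex (p x) (q x)) < 2 * e / 3"
  proof -
    let ?P = "\<lambda>x. Complex (p x) (q x)"
    have pq2: "x \<in> T \<Longrightarrow> (cmod (F n x - ?P x))\<^sup>2 \<le> d\<^sup>2" for x
      using pq(3)[of x] by (intro power_mono) auto
    have FM: "(LINT x|M. (cmod (F n x - ?P x))\<^sup>2) \<le> (LINT x|M. d\<^sup>2)"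
    proof (intro integral_mono)
      show "integrable M (\<lambda>x. (cmod (F n x - Complex (p x) (q x)))\<^sup>2)"
        by (rule M.integrable_const_bound[where B = "d\<^sup>2"])
          (use pq2 in auto)
      show "x \<in> space M \<Longrightarrow> (cmod (F n x - Complex (p x) (q x)))\<^sup>2 \<le> d\<^sup>2" for x
        using pq2 by simp
    qed simp
    have bound: "(cmod (b x - ?P x))\<^sup>2 \<le> 2 * (cmod (b x - F n x))\<^sup>2 + 2 * (cmod (F n x - ?P x))\<^sup>2" for x
    proof -
      have "(cmod (b x - ?P x))\<^sup>2 \<le> (cmod (b x - F n x) + cmod (F n x - ?P x))\<^sup>2"
        using norm_triangle_ineq[of "b x - F n x" "F n x - ?P x"] by (intro power_mono) auto
      also have "\<dots> \<le> 2 * (cmod (b x - F n x))\<^sup>2 + 2 * (cmod (F n x - ?P x))\<^sup>2"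
        using sum_squares_bound[of "cmod (b x - F n x)" "cmod (F n x - ?P x)"] by (simp add: power2_sum)
      finally show ?thesis .
    qed
    have i1: "integrable M (\<lambda>x. (cmod (b x - F n x))\<^sup>2)"
      by (rule M.integrable_const_bound[where B = "(2 * B)\<^sup>2"]) (use F2B in auto)
    have i2: "integrable M (\<lambda>x. (cmod (F n x - ?P x))\<^sup>2)"
      by (rule M.integrable_const_bound[where B = "d\<^sup>2"])
        (use pq2 in auto)
    have "(nrm (\<lambda>x. b x - ?P x))\<^sup>2 \<le> (LINT x|M. 2 * (cmod (b x - F n x))\<^sup>2 + 2 * (cmod (F n x - ?P x))\<^sup>2)"
      unfolding nrm_sq using L2D(4)[OF L2_diff[OF b(1) P]] i1 i2 bound by (intro integral_mono) auto
    also have "\<dots> = 2 * (LINT x|M. (cmod (b x - F n x))\<^sup>2) + 2 * (LINT x|M. (cmod (F n x - ?P x))\<^sup>2)"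
      using i1 i2 by simp
    also have "\<dots> < 2 * (e/3)\<^sup>2 + 2 * (L * d\<^sup>2)"
      using n FM by simp
    also have "\<dots> = (2 * e / 3)\<^sup>2"
      using L_pos by (simp add: d_def power2_eq_square field_simps)
    finally show ?thesis using e by (intro power2_less_imp_less[of _ "2 * e / 3"]) auto
  qed
  have "nrm (\<lambda>x. (g x - b x) + (b x - Complex (p x) (q x))) < e"
    using nrm_triangle[OF L2_diff[OF g b(1)] L2_diff[OF b(1) P]] gb bp by simp
  then show ?thesis using that pq by simp
qed

end

subsection \<open>Absolutely continuous periodic functions\<close>

lemma continuous_antiderivative:
  fixes g :: "real \<Rightarrow> 'a::euclidean_space"
  assumes "continuous_on UNIV g"
  obtains G where "\<And>x. (G has_vector_derivative g x) (at x)" "G c = d"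
proof -
  have "\<forall>x::real. -\<infinity> < ereal x \<longrightarrow> ereal x < \<infinity> \<longrightarrow> isCont g x"
    using assms by (simp add: continuous_on_eq_continuous_at)
  then obtain F where F: "\<And>x. (F has_vector_derivative g x) (at x)"
    using einterval_antiderivative[of "-\<infinity>" "\<infinity>" g] by auto
  show ?thesis
  proof
    show "((\<lambda>x. F x - F c + d) has_vector_derivative g x) (at x)" for x
      by (auto intro!: derivative_eq_intros F)
  qed simp
qed

lemma has_vector_derivative_shift:
  fixes v :: "real \<Rightarrow> 'a::real_normed_vector"
  assumes "(v has_vector_derivative d) (at (x + c))"
  shows "((\<lambda>x. v (x + c)) has_vector_derivative d) (at x)"
proof -
  have "((\<lambda>x. x + c) has_vector_derivative 1) (at x)"
    by (auto intro!: derivative_eq_intros)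
  from vector_diff_chain_at[OF this assms] show ?thesis by (simp add: o_def)
qed

context torus
begin

lemma T_ends [simp]: "- L / 2 \<in> T" "L / 2 \<in> T" "- (L / 2) \<in> T"
  using L_pos by (auto simp: mem_T)

lemma cut_int:
  fixes g :: "real \<Rightarrow> 'a::euclidean_space"
  assumes "integrable M g"
  shows "integrable M (\<lambda>y. if y \<le> x then g y else 0)"
proof -
  note [measurable] = borel_measurable_integrable[OF assms]
  show ?thesis by (rule Bochner_Integration.integrable_bound[OF assms]) auto
qed

lemma cut_bound:
  assumes "g \<in> L2per L"
  shows "cmod (LINT y|M. (if y \<le> x then g y else 0)) \<le> sqrt L * nrm g"
proof -
  note i = int_L2[OF assms]
  have "cmod (LINT y|M. (if y \<le> x then g y else 0)) \<le> (LINT y|M. cmod (if y \<le> x then g y else 0))"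
    by (rule integral_norm_bound)
  also have "\<dots> \<le> (LINT y|M. cmod (g y))"
    using integrable_norm[OF cut_int[OF i(1)]] i(2) by (intro integral_mono) auto
  also have "\<dots> \<le> sqrt L * nrm g" by (rule int_abs_le[OF assms])
  finally show ?thesis .
qed

text \<open>
  \<open>ac v g\<close>: \<open>v\<close> is the absolutely continuous representative of an element of
  \<open>H1per L\<close> and \<open>g\<close> is one of its weak derivatives.
\<close>
definition ac :: "(real \<Rightarrow> complex) \<Rightarrow> (real \<Rightarrow> complex) \<Rightarrow> bool" where
  "ac v g \<longleftrightarrow> periodic L v \<and> continuous_on UNIV v \<and> g \<in> L2per L \<and>
     (\<forall>x\<in>T. v x = v (- L/2) + (LINT y|M. (if y \<le> x then g y else 0)))"

lemma acD:
  assumes "ac v g"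
  shows "periodic L v" "continuous_on UNIV v" "g \<in> L2per L" "v \<in> L2per L"
    "x \<in> T \<Longrightarrow> v x = v (- L/2) + (LINT y|M. (if y \<le> x then g y else 0))"
  using assms unfolding ac_def by (blast intro: L2_cont)+

lemma ac_add:
  assumes "ac v g" "ac w h"
  shows "ac (\<lambda>x. v x + w x) (\<lambda>x. g x + h x)"
  unfolding ac_def
proof (intro conjI ballI)
  fix x assume x: "x \<in> T"
  have "(LINT y|M. (if y \<le> x then g y + h y else 0))
      = (LINT y|M. (if y \<le> x then g y else 0) + (if y \<le> x then h y else 0))"
    by (intro Bochner_Integration.integral_cong) auto
  also have "\<dots> = (LINT y|M. (if y \<le> x then g y else 0)) + (LINT y|M. (if y \<le> x then h y else 0))"
    using assms by (intro Bochner_Integration.integral_add cut_int int_L2 acD(3))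
  finally show "v x + w x = v (- L/2) + w (- L/2) + (LINT y|M. (if y \<le> x then g y + h y else 0))"
    using acD(5)[OF assms(1) x] acD(5)[OF assms(2) x] by simp
qed (use assms in \<open>auto simp: ac_def periodic_def intro!: L2_add continuous_intros\<close>)

lemma ac_cmult:
  assumes "ac v g"
  shows "ac (\<lambda>x. c * v x) (\<lambda>x. c * g x)"
  unfolding ac_def
proof (intro conjI ballI)
  fix x assume x: "x \<in> T"
  have "(LINT y|M. (if y \<le> x then c * g y else 0)) = (LINT y|M. c * (if y \<le> x then g y else 0))"
    by (intro Bochner_Integration.integral_cong) auto
  also have "\<dots> = c * (LINT y|M. (if y \<le> x then g y else 0))"
    using assms by (intro integral_bounded_linear[OF bounded_linear_mult_right] cut_int int_L2 acD(3))
  finally show "c * v x = c * v (- L/2) + (LINT y|M. (if y \<le> x then c * g y else 0))"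
    using acD(5)[OF assms(1) x] by (simp add: distrib_left)
qed (use assms in \<open>auto simp: ac_def periodic_def intro!: L2_cmult continuous_intros\<close>)

lemma ac_uminus: "ac v g \<Longrightarrow> ac (\<lambda>x. - v x) (\<lambda>x. - g x)"
  using ac_cmult[of v g "-1"] by simp

lemma ac_diff: "ac v g \<Longrightarrow> ac w h \<Longrightarrow> ac (\<lambda>x. v x - w x) (\<lambda>x. g x - h x)"
  using ac_add[OF _ ac_uminus[of w h]] by simp

lemma ac_cnj:
  assumes "ac v g"
  shows "ac (\<lambda>x. cnj (v x)) (\<lambda>x. cnj (g x))"
  unfolding ac_def
proof (intro conjI ballI)
  fix x assume x: "x \<in> T"
  have "(LINT y|M. (if y \<le> x then cnj (g y) else 0)) = (LINT y|M. cnj (if y \<le> x then g y else 0))"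
    by (intro Bochner_Integration.integral_cong) auto
  also have "\<dots> = cnj (LINT y|M. (if y \<le> x then g y else 0))"
    using assms by (intro integral_bounded_linear[OF bounded_linear_cnj] cut_int int_L2 acD(3))
  finally show "cnj (v x) = cnj (v (- L/2)) + (LINT y|M. (if y \<le> x then cnj (g y) else 0))"
    using acD(5)[OF assms(1) x] by simp
qed (use assms in \<open>auto simp: ac_def periodic_def intro!: L2_cnj continuous_intros\<close>)

lemma ac_const: "ac (\<lambda>x. c) (\<lambda>x. 0)"
  by (simp add: ac_def periodic_def L2_one)

lemma ac_C1:
  assumes v: "\<And>x. (v has_vector_derivative g x) (at x)" and g: "continuous_on UNIV g" and per: "periodic L v"
  shows "ac v g"
proof -
  have cv: "continuous_on UNIV v"
    using v continuous_on_vector_derivative[of UNIV v g] by auto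
  have gper: "g (x + L) = g x" for x
  proof -
    have "((\<lambda>x. v (x + L)) has_vector_derivative g (x + L)) (at x)"
      by (intro has_vector_derivative_shift v)
    moreover have "(\<lambda>x. v (x + L)) = v" using per by (auto simp: periodic_def)
    ultimately show ?thesis using v[of x] vector_derivative_unique_at[of v "g (x + L)" x "g x"] by simp
  qed
  then have gL2: "g \<in> L2per L" using g by (intro L2_cont) (auto simp: periodic_def)
  have "v x = v (- L/2) + (LINT y|M. (if y \<le> x then g y else 0))" if x: "x \<in> T" for x
  proof -
    have "(g has_integral (v x - v (- L/2))) {- L/2..x}"
    proof (rule fundamental_theorem_of_calculus)
      show "(v has_vector_derivative g y) (at y within {- L/2..x})" for y
        by (rule has_vector_derivative_at_within[OF v])
    qed (use x in \<open>simp add: mem_T\<close>)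
    moreover have "{..x} \<inter> T = {- L/2..x}" using x by (auto simp: mem_T)
    ultimately have "((\<lambda>y. if y \<in> {..x} then g y else 0) has_integral (v x - v (- L/2))) T"
      by (simp only: has_integral_restrict_Int)
    moreover have "(LINT y|M. (if y \<le> x then g y else 0)) = integral T (\<lambda>y. if y \<le> x then g y else 0)"
      unfolding M_def
      by (rule lebesgue_integral_eq_integral[OF cut_int[OF int_L2(1)[OF gL2], unfolded M_def] T_lebesgue])
    ultimately show ?thesis by (simp add: integral_unique)
  qed
  then show ?thesis using per cv gL2 unfolding ac_def by blast
qed

lemma ac_mean:
  assumes "ac v g"
  shows "(LINT y|M. g y) = 0"
proof -
  have "(LINT y|M. (if y \<le> L/2 then g y else 0)) = (LINT y|M. g y)"
    by (intro Bochner_Integration.integral_cong) (auto simp: mem_T)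
  then show ?thesis
    using acD(5)[OF assms, of "L/2"] periodic_ends[OF acD(1)[OF assms]] by simp
qed

lemma ac_sup:
  assumes "ac v g" "v (- L/2) = 0"
  shows "cmod (v x) \<le> sqrt L * nrm g"
proof (rule periodic_all_T[OF acD(1)[OF assms(1)], where P = "\<lambda>z. cmod z \<le> sqrt L * nrm g"])
  fix x assume "x \<in> T"
  from acD(5)[OF assms(1) this] cut_bound[OF acD(3)[OF assms(1)], of x] assms(2)
  show "cmod (v x) \<le> sqrt L * nrm g" by simp
qed

text \<open>The cut-off integral is bounded on L2, so the integral formula survives uniform
  convergence of the functions together with L2 convergence of the derivatives. Facts about
  \<open>ac\<close> are transferred from smooth functions by this closedness.\<close>

lemma ac_limit:
  assumes ac: "\<And>n. ac (v n) (g n)" and u: "uniform_limit UNIV v w sequentially"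
    and g: "h \<in> L2per L" "(\<lambda>n. nrm (\<lambda>x. g n x - h x)) \<longlonglongrightarrow> 0"
  shows "ac w h"
proof -
  have p: "(\<lambda>n. v n x) \<longlonglongrightarrow> w x" for x
    using tendsto_uniform_limitI[OF u] by simp
  have "continuous_on UNIV w"
    using uniform_limit_theorem[OF _ u] acD(2)[OF ac] by simp
  moreover have "w (x + L) = w x" for x
  proof -
    have "(\<lambda>n. v n (x + L)) = (\<lambda>n. v n x)" using acD(1)[OF ac] by (simp add: periodic_def)
    then show ?thesis using p[of "x + L"] p[of x] by (auto intro: LIMSEQ_unique)
  qed
  moreover have "w x = w (- L/2) + (LINT y|M. (if y \<le> x then h y else 0))" if x: "x \<in> T" for x
  proof -
    let ?c = "\<lambda>f. LINT y|M. (if y \<le> x then f y else 0)"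
    have "cmod (?c (g n) - ?c h) \<le> sqrt L * nrm (\<lambda>x. g n x - h x)" for n
    proof -
      have "?c (g n) - ?c h = (LINT y|M. (if y \<le> x then g n y else 0) - (if y \<le> x then h y else 0))"
        by (intro Bochner_Integration.integral_diff[symmetric] cut_int int_L2 g acD(3)[OF ac])
      also have "\<dots> = ?c (\<lambda>x. g n x - h x)"
        by (intro Bochner_Integration.integral_cong) auto
      finally show ?thesis using cut_bound[OF L2_diff[OF acD(3)[OF ac] g(1)]] by simp
    qed
    then have "(\<lambda>n. ?c (g n) - ?c h) \<longlonglongrightarrow> 0"
      by (intro Lim_null_comparison[OF always_eventually tendsto_mult_right_zero[OF g(2)]]) auto
    then have "(\<lambda>n. ?c (g n)) \<longlonglongrightarrow> ?c h" by (simp add: LIM_zero_iff)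
    then have lim: "(\<lambda>n. v n (- L/2) + ?c (g n)) \<longlonglongrightarrow> w (- L/2) + ?c h"
      by (intro tendsto_add p)
    have eq: "(\<lambda>n. v n (- L/2) + ?c (g n)) = (\<lambda>n. v n x)"
      by (rule ext) (rule acD(5)[OF ac x, symmetric])
    show ?thesis by (rule LIMSEQ_unique[OF p lim[unfolded eq]])
  qed
  ultimately show ?thesis using g(1) unfolding ac_def periodic_def by blast
qed

lemma uniform_Cauchy_limit:
  fixes v :: "nat \<Rightarrow> real \<Rightarrow> complex"
  assumes c: "\<And>m n x. cmod (v m x - v n x) \<le> e m + e n" and e: "e \<longlonglongrightarrow> (0::real)"
  obtains w where "uniform_limit UNIV v w sequentially"
proof -
  have "uniformly_Cauchy_on UNIV v"
  proof (rule uniformly_Cauchy_onI)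
    fix d :: real assume d: "0 < d"
    have "eventually (\<lambda>n. e n < d / 2) sequentially"
      using e d by (intro order_tendstoD(2)) auto
    then obtain N where N: "\<And>n. n \<ge> N \<Longrightarrow> e n < d / 2" by (auto simp: eventually_sequentially)
    show "\<exists>N. \<forall>x\<in>UNIV. \<forall>m\<ge>N. \<forall>n\<ge>N. dist (v m x) (v n x) < d"
    proof (intro exI[of _ N] ballI allI impI)
      fix x m n assume "N \<le> m" "N \<le> n"
      then show "dist (v m x) (v n x) < d"
        using c[of m x n] N[of m] N[of n] unfolding dist_norm by linarith
    qed
  qed
  then show ?thesis
    using Cauchy_uniformly_convergent uniformly_convergent_on_def that by metis
qed

section \<open>Smooth approximation of absolutely continuous functions\<close>

lemma ctest_cont:
  assumes "test_fun L p" "test_fun L q"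
  shows "continuous_on UNIV (\<lambda>x. Complex (p x) (q x))" "periodic L (\<lambda>x. Complex (p x) (q x))"
    "(\<lambda>x. Complex (p x) (q x)) \<in> L2per L"
proof -
  show "continuous_on UNIV (\<lambda>x. Complex (p x) (q x))"
    unfolding Complex_eq using assms test_fun_cont by (intro continuous_intros) auto
  moreover show "periodic L (\<lambda>x. Complex (p x) (q x))"
    using assms by (simp add: periodic_def test_fun_def)
  ultimately show "(\<lambda>x. Complex (p x) (q x)) \<in> L2per L" by (rule L2_cont)
qed

lemma ctest_deriv:
  assumes "test_fun L p" "test_fun L q"
  shows "((\<lambda>x. Complex (p x) (q x)) has_vector_derivative Complex (deriv p x) (deriv q x)) (at x)"
proof -
  have "((\<lambda>x. complex_of_real (p x) + \<i> * complex_of_real (q x)) has_vector_derivative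
      complex_of_real (deriv p x) + \<i> * complex_of_real (deriv q x)) (at x)"
    using assms by (auto intro!: derivative_eq_intros test_fun_DERIV simp: has_real_derivative_iff_has_vector_derivative[symmetric])
  then show ?thesis by (simp add: Complex_eq)
qed

lemma ctest_ac:
  assumes "test_fun L p" "test_fun L q"
  shows "ac (\<lambda>x. Complex (p x) (q x)) (\<lambda>x. Complex (deriv p x) (deriv q x))"
  using assms ctest_deriv[OF assms] by (intro ac_C1 ctest_cont test_fun_deriv) auto

lemma test_ac:
  assumes "test_fun L p"
  shows "ac (\<lambda>x. complex_of_real (p x)) (\<lambda>x. complex_of_real (deriv p x))"
proof -
  have "deriv (\<lambda>x. 0::real) = (\<lambda>x. 0)" by (rule ext) simp
  then show ?thesis using ctest_ac[OF assms test_fun_const[of L 0]] by (simp add: complex_of_real_def)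
qed

text \<open>The increment of an antiderivative over one period has derivative zero because the
  integrand is periodic; the vanishing mean makes this constant increment zero.\<close>

lemma antideriv_periodic:
  fixes g :: "real \<Rightarrow> complex"
  assumes g: "continuous_on UNIV g" "periodic L g" "(LINT y|M. g y) = 0"
  obtains G where "\<And>x. (G has_vector_derivative g x) (at x)" "periodic L G" "G (- L/2) = c"
proof -
  obtain G where G: "\<And>x. (G has_vector_derivative g x) (at x)" "G (- L/2) = c"
    using continuous_antiderivative[OF g(1)] by blast
  have i: "(g has_integral (G (L/2) - G (- L/2))) T"
    unfolding T_def
  proof (rule fundamental_theorem_of_calculus)
    show "(G has_vector_derivative g x) (at x within {- L/2..L/2})" for x
      by (rule has_vector_derivative_at_within[OF G(1)])
  qed (use L_pos in simp)
  have "(LINT y|M. g y) = integral T g"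
    unfolding M_def using int_L2(1)[OF L2_cont[OF g(1,2)]] by (intro lebesgue_integral_eq_integral) (auto simp: M_def)
  then have e: "G (L/2) = G (- L/2)" using i g(3) by (simp add: integral_unique)
  have "\<exists>k. \<forall>x\<in>UNIV. G (x + L) - G x = k"
  proof (rule has_vector_derivative_zero_constant)
    fix x
    have "((\<lambda>x. G (x + L)) has_vector_derivative g (x + L)) (at x)"
      by (intro has_vector_derivative_shift G(1))
    then show "((\<lambda>x. G (x + L) - G x) has_vector_derivative 0) (at x within UNIV)"
      using g(2) by (auto intro!: derivative_eq_intros G(1) simp: periodic_def)
  qed auto
  then obtain k where k: "\<And>x. G (x + L) - G x = k" by auto
  from k[of "- L/2"] e have "k = 0" by (simp add: field_simps)
  then have "periodic L G" using k by (simp add: periodic_def)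
  then show ?thesis using that G by blast
qed

lemma L2_mean_le:
  assumes "g \<in> L2per L"
  shows "cmod ((LINT y|M. g y) / of_real L) * sqrt L \<le> nrm g"
proof -
  have "cmod (LINT y|M. g y) \<le> sqrt L * nrm g"
    using integral_norm_bound[of M g] int_abs_le[OF assms] by linarith
  then have "cmod (LINT y|M. g y) * sqrt L \<le> sqrt L * nrm g * sqrt L"
    using L_pos by (intro mult_right_mono) auto
  also have "\<dots> = L * nrm g" using L_pos by simp
  finally have "cmod (LINT y|M. g y) * sqrt L \<le> L * nrm g" .
  then show ?thesis using L_pos by (simp add: norm_divide field_simps)
qed

text \<open>As \<open>g\<close> has mean 0, the mean of an approximant is the mean of the error,
  whose norm is at most that of the error. Subtracting it at most doubles the error, hence the start
  with \<open>e/2\<close>.\<close>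

lemma L2_approx_test0:
  assumes g: "g \<in> L2per L" "(LINT y|M. g y) = 0" and e: "0 < e"
  obtains p q where "test_fun L p" "test_fun L q" "nrm (\<lambda>x. Complex (p x) (q x) - g x) < e"
    "(LINT y|M. Complex (p y) (q y)) = 0"
proof -
  obtain p q where pq: "test_fun L p" "test_fun L q" "nrm (\<lambda>x. g x - Complex (p x) (q x)) < e / 2"
    using L2_approx_test[OF g(1), of "e/2"] e by auto
  define P where "P = (\<lambda>x. Complex (p x) (q x))"
  have P: "P \<in> L2per L" unfolding P_def using ctest_cont pq by blast
  define m where "m = (LINT y|M. P y) / of_real L"
  have "m = (LINT y|M. P y - g y) / of_real L"
    unfolding m_def using g int_L2(1)[OF P] int_L2(1)[OF g(1)] by simp
  then have m: "cmod m * sqrt L \<le> nrm (\<lambda>x. P x - g x)"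
    using L2_mean_le[OF L2_diff[OF P g(1)]] by simp
  have eq: "(\<lambda>x. Complex (p x - Re m) (q x - Im m)) = (\<lambda>x. P x - m)"
    by (auto simp: P_def complex_eq_iff)
  show ?thesis
  proof (rule that[of "\<lambda>x. p x - Re m" "\<lambda>x. q x - Im m"])
    show "test_fun L (\<lambda>x. p x - Re m)" "test_fun L (\<lambda>x. q x - Im m)"
      by (intro test_fun_diff test_fun_const pq)+
    show "(LINT y|M. Complex (p y - Re m) (q y - Im m)) = 0"
      unfolding eq using int_L2(1)[OF P] L_pos by (simp add: m_def scaleR_conv_of_real)
    have "nrm (\<lambda>x. (P x - g x) - m) \<le> nrm (\<lambda>x. P x - g x) + nrm (\<lambda>x. m * 1)"
      using nrm_triangle_diff[OF L2_diff[OF P g(1)] L2_one[of m]] by simp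
    also have "\<dots> \<le> 2 * nrm (\<lambda>x. P x - g x)"
      unfolding nrm_cmult nrm_one using m by simp
    also have "\<dots> < e" using pq(3) nrm_diff_commute[of g P] by (simp add: P_def)
    finally show "nrm (\<lambda>x. Complex (p x - Re m) (q x - Im m) - g x) < e"
      unfolding eq[THEN fun_cong] by (simp add: algebra_simps)
  qed
qed

lemma ex_smooth_primitive:
  assumes g: "g \<in> L2per L" "(LINT y|M. g y) = 0" and e: "0 < e"
  obtains p q where "test_fun L p" "test_fun L q" "nrm (\<lambda>x. Complex (deriv p x) (deriv q x) - g x) < e"
    "Complex (p (- L/2)) (q (- L/2)) = c"
proof -
  obtain a b where ab: "test_fun L a" "test_fun L b" "nrm (\<lambda>x. Complex (a x) (b x) - g x) < e"
    "(LINT y|M. Complex (a y) (b y)) = 0"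
    using L2_approx_test0[OF assms] .
  obtain G where G: "\<And>x. (G has_vector_derivative Complex (a x) (b x)) (at x)" "periodic L G" "G (- L/2) = c"
    using antideriv_periodic[OF ctest_cont(1,2)[OF ab(1,2)] ab(4), where c=c] by blast
  have "((\<lambda>x. Re (G x)) has_real_derivative a x) (at x)" "((\<lambda>x. Im (G x)) has_real_derivative b x) (at x)" for x
    using bounded_linear.has_vector_derivative[OF bounded_linear_Re G(1)]
      bounded_linear.has_vector_derivative[OF bounded_linear_Im G(1)]
    by (simp_all add: has_real_derivative_iff_has_vector_derivative)
  moreover have "periodic L (\<lambda>x. Re (G x))" "periodic L (\<lambda>x. Im (G x))"
    using G(2) by (auto simp: periodic_def)
  ultimately have t: "test_fun L (\<lambda>x. Re (G x))" "deriv (\<lambda>x. Re (G x)) = a"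
     "test_fun L (\<lambda>x. Im (G x))" "deriv (\<lambda>x. Im (G x)) = b"
    using test_fun_antideriv[OF ab(1)] test_fun_antideriv[OF ab(2)] by blast+
  then show ?thesis
    using that[of "\<lambda>x. Re (G x)" "\<lambda>x. Im (G x)"] ab(3) G(3) by simp
qed

lemma smooth_seq:
  assumes g: "g \<in> L2per L" "(LINT y|M. g y) = 0"
  obtains p q where "\<And>n. test_fun L (p n)" "\<And>n. test_fun L (q n)"
    "\<And>n::nat. nrm (\<lambda>x. Complex (deriv (p n) x) (deriv (q n) x) - g x) < inverse (real (Suc n))"
    "\<And>n. Complex (p n (- L/2)) (q n (- L/2)) = c"
proof -
  have "\<exists>p q. test_fun L p \<and> test_fun L q \<and> nrm (\<lambda>x. Complex (deriv p x) (deriv q x) - g x) < inverse (real (Suc n))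
     \<and> Complex (p (- L/2)) (q (- L/2)) = c" for n
    using ex_smooth_primitive[OF g, of "inverse (real (Suc n))" c] by (metis inverse_positive_iff_positive of_nat_0_less_iff zero_less_Suc)
  then show ?thesis using that by metis
qed

text \<open>The primitive is a uniform limit of smooth periodic primitives that all vanish at
  \<open>- L/2\<close>. Pinning them there turns L2 convergence of the derivatives into a uniform
  Cauchy property, so continuity and periodicity come with the limit.\<close>

lemma ex_primitive:
  assumes g: "g \<in> L2per L" "(LINT y|M. g y) = 0"
  obtains G where "ac G g"
proof -
  obtain p q where pq: "\<And>n. test_fun L (p n)" "\<And>n. test_fun L (q n)"
    "\<And>n::nat. nrm (\<lambda>x. Complex (deriv (p n) x) (deriv (q n) x) - g x) < inverse (real (Suc n))"
    "\<And>n. Complex (p n (- L/2)) (q n (- L/2)) = 0"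
    using smooth_seq[OF g, of 0] by blast
  define P P' where "P n x = Complex (p n x) (q n x)" and "P' n x = Complex (deriv (p n) x) (deriv (q n) x)" for n x
  have ac: "ac (P n) (P' n)" for n
    unfolding P_def P'_def using ctest_ac pq by blast
  have P'_g: "nrm (\<lambda>x. P' n x - g x) \<le> inverse (real (Suc n))" for n
    using pq(3)[of n] by (simp add: P'_def)
  have sup: "cmod (P m x - P n x) \<le> sqrt L * inverse (real (Suc m)) + sqrt L * inverse (real (Suc n))" for m n x
  proof -
    have "P m (- L/2) - P n (- L/2) = 0"
      using pq(4) by (simp add: P_def)
    then have "cmod (P m x - P n x) \<le> sqrt L * nrm (\<lambda>x. P' m x - P' n x)"
      by (rule ac_sup[OF ac_diff[OF ac ac]])
    also have "nrm (\<lambda>x. P' m x - P' n x) = nrm (\<lambda>x. (P' m x - g x) - (P' n x - g x))" by simp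
    also have "\<dots> \<le> nrm (\<lambda>x. P' m x - g x) + nrm (\<lambda>x. P' n x - g x)"
      by (intro nrm_triangle_diff L2_diff g acD(3)[OF ac])
    also have "\<dots> \<le> inverse (real (Suc m)) + inverse (real (Suc n))"
      by (intro add_mono P'_g)
    finally show ?thesis using L_pos by (simp add: distrib_left)
  qed
  have z: "(\<lambda>n. inverse (real (Suc n))) \<longlonglongrightarrow> 0" by (rule LIMSEQ_inverse_real_of_nat)
  have lim: "(\<lambda>n. nrm (\<lambda>x. P' n x - g x)) \<longlonglongrightarrow> 0"
    by (rule Lim_null_comparison[OF always_eventually z]) (use P'_g in auto)
  obtain w where w: "uniform_limit UNIV P w sequentially"
    by (rule uniform_Cauchy_limit[OF sup tendsto_mult_right_zero[OF z]])
  show ?thesis by (rule that[OF ac_limit[OF ac w g(1) lim]])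
qed

text \<open>The approximants agree with \<open>v\<close> at \<open>- L/2\<close>, so convergence of
  the derivatives in L2 already forces uniform convergence of the functions. This is how the product
  rule and the tested equation reach all of \<open>ac\<close>.\<close>

lemma ac_approx:
  assumes "ac v g"
  obtains p q where "\<And>n. test_fun L (p n)" "\<And>n. test_fun L (q n)"
    "(\<lambda>n. nrm (\<lambda>x. Complex (deriv (p n) x) (deriv (q n) x) - g x)) \<longlonglongrightarrow> 0"
    "uniform_limit UNIV (\<lambda>n x. Complex (p n x) (q n x)) v sequentially"
proof -
  obtain p q where pq: "\<And>n. test_fun L (p n)" "\<And>n. test_fun L (q n)"
    "\<And>n::nat. nrm (\<lambda>x. Complex (deriv (p n) x) (deriv (q n) x) - g x) < inverse (real (Suc n))"
    "\<And>n. Complex (p n (- L/2)) (q n (- L/2)) = v (- L/2)"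
    using smooth_seq[OF acD(3)[OF assms] ac_mean[OF assms], of "v (- L/2)"] by blast
  have z: "(\<lambda>n. inverse (real (Suc n))) \<longlonglongrightarrow> 0" by (rule LIMSEQ_inverse_real_of_nat)
  have lim: "(\<lambda>n. nrm (\<lambda>x. Complex (deriv (p n) x) (deriv (q n) x) - g x)) \<longlonglongrightarrow> 0"
    by (rule Lim_null_comparison[OF always_eventually z]) (use pq(3) in \<open>auto simp: less_imp_le\<close>)
  have b: "cmod (Complex (p n x) (q n x) - v x) \<le> sqrt L * inverse (real (Suc n))" for n x
  proof -
    have "cmod (Complex (p n x) (q n x) - v x) \<le> sqrt L * nrm (\<lambda>x. Complex (deriv (p n) x) (deriv (q n) x) - g x)"
      by (rule ac_sup[OF ac_diff[OF ctest_ac[OF pq(1) pq(2)] assms]]) (use pq(4) in simp)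
    also have "\<dots> \<le> sqrt L * inverse (real (Suc n))"
      using pq(3)[of n] L_pos by (intro mult_left_mono) auto
    finally show ?thesis .
  qed
  have "uniform_limit UNIV (\<lambda>n x. Complex (p n x) (q n x)) v sequentially"
    unfolding uniform_limit_iff
  proof (intro allI impI)
    fix e :: real assume "0 < e"
    then have "eventually (\<lambda>n. sqrt L * inverse (real (Suc n)) < e) sequentially"
      using tendsto_mult_right_zero[OF z] by (intro order_tendstoD(2)) auto
    then show "eventually (\<lambda>n. \<forall>x\<in>UNIV. dist (Complex (p n x) (q n x)) (v x) < e) sequentially"
    proof eventually_elim
      case (elim n)
      show ?case
        unfolding dist_norm using order_le_less_trans[OF b elim] by blast
    qed
  qed
  then show ?thesis using that pq lim by blast
qed

section \<open>The product rule and its consequences\<close>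

lemma nrm_tendsto_bmult:
  assumes b: "\<And>n. periodic L (b n)" "\<And>n. continuous_on UNIV (b n)" "\<And>n x. cmod (b n x) \<le> B"
    and g: "\<And>n. g n \<in> L2per L" "(\<lambda>n. nrm (g n)) \<longlonglongrightarrow> 0"
  shows "(\<lambda>n. nrm (\<lambda>x. b n x * g n x)) \<longlonglongrightarrow> 0"
proof (rule Lim_null_comparison[OF always_eventually tendsto_mult_right_zero[OF g(2)]])
  show "\<forall>n. norm (nrm (\<lambda>x. b n x * g n x)) \<le> B * nrm (g n)"
    using nrm_bmult[OF g(1) L2_cont_mult[OF g(1) b(2) b(1)]] b(3) by simp
qed

lemma nrm_tendsto_unif:
  assumes d: "uniform_limit UNIV d (\<lambda>x. 0) sequentially" "\<And>n. periodic L (d n)" "\<And>n. continuous_on UNIV (d n)"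
    and g: "g \<in> L2per L"
  shows "(\<lambda>n. nrm (\<lambda>x. d n x * g x)) \<longlonglongrightarrow> 0"
proof (rule LIMSEQ_I)
  fix e :: real assume e: "0 < e"
  define e' where "e' = e / (nrm g + 1)"
  have e': "0 < e'" using e by (simp add: e'_def add_nonneg_pos)
  from d(1) e' have "eventually (\<lambda>n. \<forall>x\<in>UNIV. dist (d n x) 0 < e') sequentially"
    unfolding uniform_limit_iff by blast
  then obtain N where N: "\<And>n x. n \<ge> N \<Longrightarrow> cmod (d n x) < e'"
    unfolding eventually_sequentially dist_0_norm by auto
  show "\<exists>no. \<forall>n\<ge>no. norm (nrm (\<lambda>x. d n x * g x) - 0) < e"
  proof (intro exI[of _ N] allI impI)
    fix n assume "N \<le> n"
    then have "nrm (\<lambda>x. d n x * g x) \<le> e' * nrm g"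
      using N by (intro nrm_bmult L2_cont_mult g d less_imp_le)
    also have "\<dots> < e"
    proof -
      have "0 < nrm g + 1" using nrm_nonneg[of g] by linarith
      then show ?thesis using e by (simp add: e'_def divide_less_eq distrib_left)
    qed
    finally show "norm (nrm (\<lambda>x. d n x * g x) - 0) < e" by simp
  qed
qed

lemma tendsto_nrm_add:
  assumes "\<And>n::nat. g n \<in> L2per L" "\<And>n. h n \<in> L2per L" "(\<lambda>n. nrm (g n)) \<longlonglongrightarrow> 0" "(\<lambda>n. nrm (h n)) \<longlonglongrightarrow> 0"
  shows "(\<lambda>n. nrm (\<lambda>x. g n x + h n x)) \<longlonglongrightarrow> 0"
  by (rule Lim_null_comparison[OF always_eventually tendsto_add_zero[OF assms(3,4)]])
    (use nrm_triangle[OF assms(1,2)] in simp)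

lemma uniform_limit_minus:
  "uniform_limit UNIV (v :: nat \<Rightarrow> real \<Rightarrow> complex) w sequentially \<Longrightarrow> uniform_limit UNIV (\<lambda>n x. v n x - w x) (\<lambda>x. 0) sequentially"
  by (simp add: uniform_limit_iff dist_norm)

lemma uniform_limit_bounded:
  assumes u: "uniform_limit UNIV (v :: nat \<Rightarrow> real \<Rightarrow> complex) w sequentially"
    and v: "\<And>n. periodic L (v n)" "\<And>n. continuous_on UNIV (v n)" and w: "\<And>x. cmod (w x) \<le> B"
  obtains N where "\<And>n x. cmod (v (n + N) x) \<le> B + 1"
proof -
  have "eventually (\<lambda>n. \<forall>x\<in>UNIV. dist (v n x) (w x) < 1) sequentially"
    using u unfolding uniform_limit_iff by (rule allE[of _ 1]) simp
  then obtain N where N: "\<And>n x. n \<ge> N \<Longrightarrow> cmod (v n x - w x) < 1"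
    unfolding eventually_sequentially dist_norm by blast
  have "cmod (v (n + N) x) \<le> B + 1" for n x
    using N[of "n + N" x] w[of x] norm_triangle_sub[of "v (n + N) x" "w x"] by simp
  then show ?thesis using that by blast
qed

lemma uniform_limit_shift:
  assumes "uniform_limit UNIV (v :: nat \<Rightarrow> real \<Rightarrow> complex) w sequentially"
  shows "uniform_limit UNIV (\<lambda>n. v (n + N)) w sequentially"
  using assms unfolding uniform_limit_iff
  by (auto intro: eventually_sequentially_seg[THEN iffD2])

text \<open>By density from the smooth product rule. The error is telescoped so that each L2-small
  factor meets a uniformly bounded one and each uniformly small factor meets an L2 function; the
  shift by \<open>N\<close> makes the bound on \<open>P n\<close> hold for every index.\<close>

lemma ac_mult:
  assumes "ac v g" "ac w h"
  shows "ac (\<lambda>x. v x * w x) (\<lambda>x. v x * h x + g x * w x)"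
proof -
  obtain p q where pq: "\<And>n. test_fun L (p n)" "\<And>n. test_fun L (q n)"
    "(\<lambda>n. nrm (\<lambda>x. Complex (deriv (p n) x) (deriv (q n) x) - g x)) \<longlonglongrightarrow> 0"
    "uniform_limit UNIV (\<lambda>n x. Complex (p n x) (q n x)) v sequentially"
    using ac_approx[OF assms(1)] by blast
  obtain r s where rs: "\<And>n. test_fun L (r n)" "\<And>n. test_fun L (s n)"
    "(\<lambda>n. nrm (\<lambda>x. Complex (deriv (r n) x) (deriv (s n) x) - h x)) \<longlonglongrightarrow> 0"
    "uniform_limit UNIV (\<lambda>n x. Complex (r n x) (s n x)) w sequentially"
    using ac_approx[OF assms(2)] by blast
  obtain B where B: "0 < B" "\<And>x. cmod (v x) \<le> B"
    using cont_per_bounded[OF acD(2,1)[OF assms(1)]] by blast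
  obtain C where C: "0 < C" "\<And>x. cmod (w x) \<le> C"
    using cont_per_bounded[OF acD(2,1)[OF assms(2)]] by blast
  obtain N where N: "\<And>n x. cmod (Complex (p (n + N) x) (q (n + N) x)) \<le> B + 1"
    using uniform_limit_bounded[OF pq(4) ctest_cont(2)[OF pq(1,2)] ctest_cont(1)[OF pq(1,2)] B(2)] by blast
  define P P' R R' where "P n x = Complex (p (n + N) x) (q (n + N) x)"
    and "P' n x = Complex (deriv (p (n + N)) x) (deriv (q (n + N)) x)"
    and "R n x = Complex (r (n + N) x) (s (n + N) x)"
    and "R' n x = Complex (deriv (r (n + N)) x) (deriv (s (n + N)) x)" for n x
  have acP: "ac (P n) (P' n)" and acR: "ac (R n) (R' n)" for n
    unfolding P_def P'_def R_def R'_def using pq rs by (blast intro: ctest_ac)+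
  have contP': "continuous_on UNIV (P' n)" and contR': "continuous_on UNIV (R' n)" for n
    unfolding P'_def R'_def using pq rs by (blast intro: ctest_cont test_fun_deriv)+
  have dP: "(P n has_vector_derivative P' n x) (at x)" and dR: "(R n has_vector_derivative R' n x) (at x)" for n x
    unfolding P_def P'_def R_def R'_def using pq rs by (blast intro: ctest_deriv)+
  have lP: "(\<lambda>n. nrm (\<lambda>x. P' n x - g x)) \<longlonglongrightarrow> 0" and lR: "(\<lambda>n. nrm (\<lambda>x. R' n x - h x)) \<longlonglongrightarrow> 0"
    using LIMSEQ_ignore_initial_segment[OF pq(3), of N] LIMSEQ_ignore_initial_segment[OF rs(3), of N]
    by (simp_all add: P'_def R'_def)
  have uP: "uniform_limit UNIV P v sequentially" and uR: "uniform_limit UNIV R w sequentially"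
    using uniform_limit_shift[OF pq(4), of N] uniform_limit_shift[OF rs(4), of N]
    by (simp_all add: P_def[abs_def] R_def[abs_def])
  have acPR: "ac (\<lambda>x. P n x * R n x) (\<lambda>x. P n x * R' n x + P' n x * R n x)" for n
  proof (rule ac_C1)
    show "((\<lambda>x. P n x * R n x) has_vector_derivative P n x * R' n x + P' n x * R n x) (at x)" for x
      by (rule has_vector_derivative_mult[OF dP dR])
    show "continuous_on UNIV (\<lambda>x. P n x * R' n x + P' n x * R n x)"
      by (intro continuous_intros contP' contR' acD(2)[OF acP] acD(2)[OF acR])
    show "periodic L (\<lambda>x. P n x * R n x)"
      using acD(1)[OF acP] acD(1)[OF acR] by (simp add: periodic_def)
  qed
  have L2t: "(\<lambda>x. v x * h x + g x * w x) \<in> L2per L"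
    using L2_add[OF L2_cont_mult[OF acD(3)[OF assms(2)] acD(2,1)[OF assms(1)]]
      L2_cont_mult[OF acD(3)[OF assms(1)] acD(2,1)[OF assms(2)]]] by (simp add: mult.commute)
  have a: "periodic L (\<lambda>x. P n x - v x)" "continuous_on UNIV (\<lambda>x. P n x - v x)"
    "periodic L (\<lambda>x. R n x - w x)" "continuous_on UNIV (\<lambda>x. R n x - w x)" for n
    using acD(1,2)[OF acP] acD(1,2)[OF acR] acD(1,2)[OF assms(1)] acD(1,2)[OF assms(2)]
    by (auto simp: periodic_def intro!: continuous_intros)
  show ?thesis
  proof (rule ac_limit[OF acPR _ L2t])
    have "bounded (v ` UNIV)" "bounded (w ` UNIV)"
      using B C by (auto simp: bounded_iff)
    then show "uniform_limit UNIV (\<lambda>n x. P n x * R n x) (\<lambda>x. v x * w x) sequentially"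
      using uP uR by (intro uniform_lim_mult)
    have "(\<lambda>n. nrm (\<lambda>x. (P n x * (R' n x - h x) + (P n x - v x) * h x) + (w x * (P' n x - g x) + (R n x - w x) * P' n x))) \<longlonglongrightarrow> 0"
    proof (intro tendsto_nrm_add L2_add)
      show "(\<lambda>n. nrm (\<lambda>x. P n x * (R' n x - h x))) \<longlonglongrightarrow> 0"
        by (rule nrm_tendsto_bmult[OF acD(1)[OF acP] acD(2)[OF acP] _ L2_diff[OF acD(3)[OF acR] acD(3)[OF assms(2)]] lR])
          (use N P_def in auto)
      show "(\<lambda>n. nrm (\<lambda>x. (P n x - v x) * h x)) \<longlonglongrightarrow> 0"
        by (rule nrm_tendsto_unif[OF uniform_limit_minus[OF uP] a(1,2) acD(3)[OF assms(2)]])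
      show "(\<lambda>n. nrm (\<lambda>x. w x * (P' n x - g x))) \<longlonglongrightarrow> 0"
        by (rule nrm_tendsto_bmult[OF acD(1)[OF assms(2)] acD(2)[OF assms(2)] C(2) L2_diff[OF acD(3)[OF acP] acD(3)[OF assms(1)]] lP])
      have "(\<lambda>n. nrm (\<lambda>x. (R n x - w x) * g x)) \<longlonglongrightarrow> 0"
        by (rule nrm_tendsto_unif[OF uniform_limit_minus[OF uR] a(3,4) acD(3)[OF assms(1)]])
      \<comment> \<open>Here both factors move. Uniform convergence bounds \<open>R n - w\<close>
        once the index is shifted by \<open>K\<close>, and the L2 convergence of \<open>P' n\<close>
        does the rest; \<open>LIMSEQ_offset\<close> undoes the shift.\<close>
      moreover have "(\<lambda>n. nrm (\<lambda>x. (R n x - w x) * (P' n x - g x))) \<longlonglongrightarrow> 0"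
      proof -
        obtain K where K: "\<And>n x. cmod (R (n + K) x) \<le> C + 1"
          using uniform_limit_bounded[OF uR acD(1)[OF acR] acD(2)[OF acR] C(2)] by blast
        have "(\<lambda>n. nrm (\<lambda>x. (R (n + K) x - w x) * (P' (n + K) x - g x))) \<longlonglongrightarrow> 0"
        proof (rule nrm_tendsto_bmult[OF a(3,4) _ L2_diff[OF acD(3)[OF acP] acD(3)[OF assms(1)]]])
          show "cmod (R (n + K) x - w x) \<le> 2 * C + 1" for n x
            using norm_triangle_ineq4[of "R (n + K) x" "w x"] K[of n x] C(2)[of x] by simp
          show "(\<lambda>n. nrm (\<lambda>x. P' (n + K) x - g x)) \<longlonglongrightarrow> 0"
            using LIMSEQ_ignore_initial_segment[OF lP] by simp
        qed
        then show ?thesis by (rule LIMSEQ_offset)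
      qed
      ultimately have "(\<lambda>n. nrm (\<lambda>x. (R n x - w x) * g x + (R n x - w x) * (P' n x - g x))) \<longlonglongrightarrow> 0"
        by (intro tendsto_nrm_add L2_cont_mult L2_diff acD(3)[OF acP] acD(3)[OF assms(1)] a)
      then show "(\<lambda>n. nrm (\<lambda>x. (R n x - w x) * P' n x)) \<longlonglongrightarrow> 0"
        by (simp add: algebra_simps)
    qed (intro L2_cont_mult L2_diff a acD(1-3)[OF acP] acD(1-3)[OF acR] acD(1-3)[OF assms(1)] acD(1-3)[OF assms(2)])+
    then show "(\<lambda>n. nrm (\<lambda>x. P n x * R' n x + P' n x * R n x - (v x * h x + g x * w x))) \<longlonglongrightarrow> 0"
      by (simp add: algebra_simps)
  qed
qed

lemma ac_parts:
  assumes "ac v g" "ac w h"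
  shows "(LINT x|M. v x * h x) = - (LINT x|M. g x * w x)"
proof -
  have "(LINT x|M. v x * h x + g x * w x) = 0"
    by (rule ac_mean[OF ac_mult[OF assms]])
  moreover have "(LINT x|M. v x * h x + g x * w x) = (LINT x|M. v x * h x) + (LINT x|M. g x * w x)"
    by (intro Bochner_Integration.integral_add int_mult acD[OF assms(1)] acD[OF assms(2)])
  ultimately show ?thesis by (simp add: add_eq_0_iff2)
qed

lemma continuous_T: "continuous_on UNIV v \<Longrightarrow> continuous_on {a..b} v"
  by (rule continuous_on_subset) auto

lemma norm_if_diff_le: "cmod ((if P then a else 0) - (if Q then a else 0)) \<le> cmod a"
  by simp

text \<open>Agmon's inequality on a circle. At its minimum point \<open>y\<close>, the squared
  modulus is at most its mean \<open>(nrm v)\<^sup>2 / L\<close>; integrating its derivative,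
  bounded by twice the product of the moduli of \<open>v\<close> and \<open>g\<close>, from
  \<open>y\<close> to \<open>x\<close> gives the second term.\<close>

lemma ac_sobolev:
  assumes "ac v g"
  shows "(cmod (v x))\<^sup>2 \<le> (nrm v)\<^sup>2 / L + 2 * nrm v * nrm g"
proof (rule periodic_all_T[OF acD(1)[OF assms], where P = "\<lambda>z. (cmod z)\<^sup>2 \<le> (nrm v)\<^sup>2 / L + 2 * nrm v * nrm g"])
  fix x assume x: "x \<in> T"
  have "continuous_on T (\<lambda>y. (cmod (v y))\<^sup>2)"
    by (intro continuous_intros continuous_on_subset[OF acD(2)[OF assms]]) auto
  moreover have "compact T" "T \<noteq> {}" using T_ends(1) by (auto simp: T_def)
  ultimately obtain y where y: "y \<in> T" "\<And>z. z \<in> T \<Longrightarrow> (cmod (v y))\<^sup>2 \<le> (cmod (v z))\<^sup>2"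
    using continuous_attains_inf[of T "\<lambda>y. (cmod (v y))\<^sup>2"] by blast
  have "(LINT z|M. (cmod (v y))\<^sup>2) \<le> (LINT z|M. (cmod (v z))\<^sup>2)"
    using y L2D(4)[OF acD(4)[OF assms]] by (intro integral_mono) auto
  then have vy: "(cmod (v y))\<^sup>2 \<le> (nrm v)\<^sup>2 / L"
    using L_pos by (simp add: nrm_sq field_simps)
  let ?n = "\<lambda>x. v x * cnj (v x)" and ?g = "\<lambda>x. v x * cnj (g x) + g x * cnj (v x)"
  have n: "ac ?n ?g" by (rule ac_mult[OF assms ac_cnj[OF assms]])
  note gi = int_L2[OF acD(3)[OF n]]
  let ?c = "\<lambda>x z. if z \<le> x then ?g z else 0"
  have "?n x - ?n y = (LINT z|M. ?c x z) - (LINT z|M. ?c y z)"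
    using acD(5)[OF n x] acD(5)[OF n y(1)] by simp
  also have "\<dots> = (LINT z|M. ?c x z - ?c y z)"
    by (intro Bochner_Integration.integral_diff[symmetric] cut_int gi)
  finally have "cmod (?n x - ?n y) \<le> (LINT z|M. cmod (?c x z - ?c y z))"
    by simp
  also have "\<dots> \<le> (LINT z|M. 2 * (cmod (v z) * cmod (g z)))"
  proof (rule integral_mono)
    show "integrable M (\<lambda>z. cmod (?c x z - ?c y z))"
      by (intro integrable_norm Bochner_Integration.integrable_diff cut_int gi)
    show "integrable M (\<lambda>z. 2 * (cmod (v z) * cmod (g z)))"
      by (intro integrable_mult_right int_mult acD[OF assms])
    fix z
    have "cmod (?c x z - ?c y z) \<le> cmod (?g z)" by (rule norm_if_diff_le)
    also have "\<dots> \<le> 2 * (cmod (v z) * cmod (g z))"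
      using norm_triangle_ineq[of "v z * cnj (g z)" "g z * cnj (v z)"] by (simp add: norm_mult mult.commute[of "cmod (g z)"])
    finally show "cmod (?c x z - ?c y z) \<le> 2 * (cmod (v z) * cmod (g z))" .
  qed
  also have "\<dots> \<le> 2 * (nrm v * nrm g)"
    using CS_abs[OF acD(4)[OF assms] acD(3)[OF assms]] by simp
  finally have "cmod (?n x - ?n y) \<le> 2 * (nrm v * nrm g)" .
  moreover have "cmod (?n x) \<le> cmod (?n y) + cmod (?n x - ?n y)"
    by (metis norm_triangle_sub)
  ultimately show "(cmod (v x))\<^sup>2 \<le> (nrm v)\<^sup>2 / L + 2 * nrm v * nrm g"
    using vy by (simp add: norm_mult power2_eq_square)
qed

section \<open>Weak derivatives and the metric of the Sobolev space\<close>

lemma cont_nrm_0: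
  assumes "continuous_on UNIV v" "periodic L v" "nrm v = 0"
  shows "v x = 0"
proof (rule periodic_all_T[OF assms(2), where P = "\<lambda>z. z = 0"])
  fix x assume x: "x \<in> T"
  have "(LINT y|M. (cmod (v y))\<^sup>2) = 0"
    using assms(3) nrm_sq[of v] by simp
  moreover have "(LINT y|M. (cmod (v y))\<^sup>2) = 0 \<longleftrightarrow> (\<forall>y\<in>{- L/2..L/2}. (cmod (v y))\<^sup>2 = 0)"
    unfolding M_def T_def
  proof (rule integralL_eq_0_iff)
    show "continuous_on {- L/2..L/2} (\<lambda>y. (cmod (v y))\<^sup>2)"
      by (intro continuous_intros continuous_T assms(1))
  qed (use L_pos in auto)
  ultimately have "\<forall>y\<in>{- L/2..L/2}. (cmod (v y))\<^sup>2 = 0" by blast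
  then show "v x = 0" using x by (simp add: T_def)
qed

text \<open>Were the norm positive, density would give a test function \<open>P\<close> with
  \<open>D - P\<close> smaller than \<open>D\<close>. Orthogonality to the real and imaginary parts
  of \<open>P\<close> then bounds \<open>(nrm D)\<^sup>2\<close> by the product of the norms of
  \<open>D\<close> and \<open>D - P\<close>, which is smaller than
  \<open>(nrm D)\<^sup>2\<close>.\<close>

lemma ortho_tests:
  assumes D: "D \<in> L2per L" and o: "\<And>\<phi>. test_fun L \<phi> \<Longrightarrow> (LINT x|M. D x * complex_of_real (\<phi> x)) = 0"
  shows "nrm D = 0"
proof (rule ccontr)
  assume "nrm D \<noteq> 0"
  then have pos: "0 < nrm D" using nrm_nonneg[of D] by linarith
  then obtain p q where pq: "test_fun L p" "test_fun L q" "nrm (\<lambda>x. D x - Complex (p x) (q x)) < nrm D"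
    using L2_approx_test[OF D] by blast
  let ?P = "\<lambda>x. Complex (p x) (q x)"
  have P: "?P \<in> L2per L" using ctest_cont(3) pq by blast
  have t: "(\<lambda>x. complex_of_real (p x)) \<in> L2per L" "(\<lambda>x. complex_of_real (q x)) \<in> L2per L"
    using test_ac[OF pq(1)] test_ac[OF pq(2)] acD(4) by blast+
  have "(LINT x|M. D x * cnj (?P x)) = (LINT x|M. D x * complex_of_real (p x) - \<i> * (D x * complex_of_real (q x)))"
    by (intro Bochner_Integration.integral_cong) (auto simp: complex_eq_iff algebra_simps)
  also have "\<dots> = (LINT x|M. D x * complex_of_real (p x)) - \<i> * (LINT x|M. D x * complex_of_real (q x))"
    using int_mult(1)[OF D t(1)] int_mult(1)[OF D t(2)] by simp
  finally have z: "(LINT x|M. D x * cnj (?P x)) = 0" using o pq by simp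
  have "complex_of_real ((nrm D)\<^sup>2) = (LINT x|M. complex_of_real ((cmod (D x))\<^sup>2))"
    unfolding nrm_sq by (rule integral_complex_of_real[symmetric])
  also have "\<dots> = (LINT x|M. D x * cnj (D x - ?P x) + D x * cnj (?P x))"
    by (intro Bochner_Integration.integral_cong) (auto simp: complex_norm_square algebra_simps simp del: of_real_power)
  also have "\<dots> = (LINT x|M. D x * cnj (D x - ?P x))"
    using int_mult(1)[OF D L2_cnj[OF L2_diff[OF D P]]] int_mult(1)[OF D L2_cnj[OF P]] z by simp
  finally have "(nrm D)\<^sup>2 = cmod (LINT x|M. D x * cnj (D x - ?P x))"
    by (metis abs_of_nonneg norm_of_real zero_le_power2)
  also have "\<dots> \<le> nrm D * nrm (\<lambda>x. cnj (D x - ?P x))"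
    by (rule CS[OF D L2_cnj[OF L2_diff[OF D P]]])
  also have "\<dots> < nrm D * nrm D"
    using pos pq(3) by (intro mult_strict_left_mono) (simp_all only: nrm_cnj)
  finally show False by (simp add: power2_eq_square)
qed

lemma pairing_LINT: "pairing L v \<phi> = (LINT x|M. v x * complex_of_real (\<phi> x))"
  unfolding pairing_def LINT_T ..

lemma test_L2: "test_fun L \<phi> \<Longrightarrow> (\<lambda>x. complex_of_real (\<phi> x)) \<in> L2per L"
  using test_ac acD(4) by blast

lemma ac_weak_deriv:
  assumes "ac v g"
  shows "weak_deriv L v g"
  unfolding weak_deriv_def pairing_LINT using ac_parts[OF assms test_ac] acD(3)[OF assms] by blast

lemma test_mean0_primitive:
  assumes "test_fun L \<phi>" "(LINT x|M. complex_of_real (\<phi> x)) = 0"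
  obtains \<psi> where "test_fun L \<psi>" "deriv \<psi> = \<phi>"
proof -
  have c: "continuous_on UNIV (\<lambda>x. complex_of_real (\<phi> x))" "periodic L (\<lambda>x. complex_of_real (\<phi> x))"
    using acD(1,2)[OF test_ac[OF assms(1)]] by auto
  obtain G where G: "\<And>x. (G has_vector_derivative complex_of_real (\<phi> x)) (at x)" "periodic L G"
    using antideriv_periodic[OF c assms(2), where c = 0] by blast
  have "((\<lambda>x. Re (G x)) has_real_derivative \<phi> x) (at x)" for x
    using bounded_linear.has_vector_derivative[OF bounded_linear_Re G(1)]
    by (simp add: has_real_derivative_iff_has_vector_derivative)
  moreover have "periodic L (\<lambda>x. Re (G x))" using G(2) by (auto simp: periodic_def)
  ultimately show ?thesis
    using test_fun_antideriv[OF assms(1)] that by blast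
qed

text \<open>The du Bois-Reymond lemma. Testing with a constant shows that \<open>g\<close> has mean
  0, hence a primitive \<open>G\<close>. Then \<open>v - G\<close> is orthogonal to the derivatives
  of all test functions, which are all test functions of mean zero, so it is constant.\<close>

lemma weak_deriv_ac:
  assumes v: "periodic L v" "continuous_on UNIV v" and g: "weak_deriv L v g"
  shows "ac v g"
proof -
  have gL: "g \<in> L2per L" using g by (simp add: weak_deriv_def)
  have vL: "v \<in> L2per L" using L2_cont v by blast
  have wk: "(LINT x|M. v x * complex_of_real (deriv \<phi> x)) = - (LINT x|M. g x * complex_of_real (\<phi> x))" if "test_fun L \<phi>" for \<phi>
    using g that by (simp add: weak_deriv_def pairing_LINT)
  have "deriv (\<lambda>x. 1::real) = (\<lambda>x. 0)" by (rule ext) simp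
  then have "(LINT x|M. g x) = 0"
    using wk[OF test_fun_const[of L 1]] by simp
  then obtain G where G: "ac G g" using ex_primitive[OF gL] by blast
  define w where "w x = v x - G x" for x
  have "periodic L w" "continuous_on UNIV w"
    using v acD(1,2)[OF G] by (auto simp: w_def periodic_def intro!: continuous_intros)
  then have w: "periodic L w" "continuous_on UNIV w" "w \<in> L2per L"
    using L2_cont by auto
  have wort: "(LINT x|M. w x * complex_of_real (deriv \<phi> x)) = 0" if t: "test_fun L \<phi>" for \<phi>
  proof -
    have "(LINT x|M. w x * complex_of_real (deriv \<phi> x)) = (LINT x|M. v x * complex_of_real (deriv \<phi> x) - G x * complex_of_real (deriv \<phi> x))"
      by (simp add: w_def left_diff_distrib)
    also have "\<dots> = (LINT x|M. v x * complex_of_real (deriv \<phi> x)) - (LINT x|M. G x * complex_of_real (deriv \<phi> x))"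
      by (intro Bochner_Integration.integral_diff int_mult vL acD(4)[OF G] test_L2 test_fun_deriv t)
    finally show ?thesis using wk[OF t] ac_parts[OF G test_ac[OF t]] by simp
  qed
  define c where "c = (LINT x|M. w x) / of_real L"
  have w0: "(\<lambda>x. w x - c) \<in> L2per L" by (intro L2_diff L2_one w)
  have mean0: "(LINT x|M. w x - c) = 0"
    using int_L2(1)[OF w(3)] L_pos by (simp add: c_def scaleR_conv_of_real)
  have "nrm (\<lambda>x. w x - c) = 0"
  proof (rule ortho_tests[OF w0])
    fix \<phi> assume t: "test_fun L \<phi>"
    \<comment> \<open>The test function is split into its mean and a mean-zero part. The latter is
      the derivative of a test function, to which \<open>wort\<close> applies; the former only sees
      the mean of \<open>w - c\<close>, which is 0.\<close>
    define m where "m = (LINT x|M. \<phi> x) / L"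
    have \<phi>i: "integrable M \<phi>"
      using int_L2(1)[OF test_L2[OF t]] by (simp add: complex_of_real_integrable_eq)
    have t0: "test_fun L (\<lambda>x. \<phi> x - m)" by (intro test_fun_diff test_fun_const t)
    have "(LINT x|M. \<phi> x - m) = 0" using \<phi>i L_pos by (simp add: m_def)
    then have m0: "(LINT x|M. complex_of_real (\<phi> x - m)) = 0"
      by (simp only: integral_complex_of_real of_real_0)
    then obtain \<psi> where "test_fun L \<psi>" "deriv \<psi> = (\<lambda>x. \<phi> x - m)"
      using test_mean0_primitive[OF t0] by blast
    then have z: "(LINT x|M. w x * complex_of_real (\<phi> x - m)) = 0" using wort by metis
    have "(LINT x|M. (w x - c) * complex_of_real (\<phi> x))
        = (LINT x|M. (w x * complex_of_real (\<phi> x - m) - c * complex_of_real (\<phi> x - m)) + of_real m * (w x - c))"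
      by (intro Bochner_Integration.integral_cong) (auto simp: algebra_simps)
    also have "\<dots> = ((LINT x|M. w x * complex_of_real (\<phi> x - m)) - (LINT x|M. c * complex_of_real (\<phi> x - m))) + (LINT x|M. of_real m * (w x - c))"
    proof -
      have i: "integrable M (\<lambda>x. w x * complex_of_real (\<phi> x - m))" "integrable M (\<lambda>x. c * complex_of_real (\<phi> x - m))"
        "integrable M (\<lambda>x. of_real m * (w x - c))"
        by (intro int_mult(1) w(3) w0 L2_one test_L2 t0)+
      show ?thesis
        by (simp only: Bochner_Integration.integral_add[OF Bochner_Integration.integrable_diff[OF i(1,2)] i(3)] Bochner_Integration.integral_diff[OF i(1,2)])
    qed
    also have "\<dots> = 0"
      using z m0 mean0 by (simp only: integral_mult_right_zero) simp
    finally show "(LINT x|M. (w x - c) * complex_of_real (\<phi> x)) = 0" .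
  qed
  then have "w x - c = 0" for x
    using w by (intro cont_nrm_0[of "\<lambda>x. w x - c"]) (auto simp: periodic_def intro!: continuous_intros)
  then have "v = (\<lambda>x. G x + c)"
    by (intro ext) (metis w_def add.commute diff_add_cancel eq_iff_diff_eq_0)
  moreover have "ac (\<lambda>x. G x + c) (\<lambda>x. g x + 0)"
    by (rule ac_add[OF G ac_const])
  ultimately show ?thesis by simp
qed

lemma weak_deriv_unique:
  assumes "weak_deriv L v g" "weak_deriv L v h"
  shows "nrm (\<lambda>x. g x - h x) = 0"
proof (rule ortho_tests)
  have L: "g \<in> L2per L" "h \<in> L2per L" using assms by (auto simp: weak_deriv_def)
  then show "(\<lambda>x. g x - h x) \<in> L2per L" by (rule L2_diff)
  fix \<phi> assume t: "test_fun L \<phi>"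
  have "(LINT x|M. g x * complex_of_real (\<phi> x)) = (LINT x|M. h x * complex_of_real (\<phi> x))"
  proof -
    have "- (LINT x|M. g x * complex_of_real (\<phi> x)) = - (LINT x|M. h x * complex_of_real (\<phi> x))"
      using assms[unfolded weak_deriv_def pairing_LINT] t by (metis (no_types, lifting))
    then show ?thesis by (simp only: neg_equal_iff_equal)
  qed
  then show "(LINT x|M. (g x - h x) * complex_of_real (\<phi> x)) = 0"
    using int_mult(1)[OF L(1) test_L2[OF t]] int_mult(1)[OF L(2) test_L2[OF t]] by (simp add: left_diff_distrib)
qed

lemma nrm_eq_of_diff_0:
  assumes "g \<in> L2per L" "h \<in> L2per L" "nrm (\<lambda>x. g x - h x) = 0"
  shows "nrm g = nrm h"
  using nrm_triangle[OF L2_diff[OF assms(1,2)] assms(2)]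
    nrm_triangle_diff[OF assms(1) L2_diff[OF assms(1,2)]] assms(3) by simp

lemma weak_deriv_wderiv: "weak_deriv L v g \<Longrightarrow> weak_deriv L v (wderiv L v)"
  unfolding wderiv_def by (rule someI[where P = "weak_deriv L v"])

lemma H1_ac: "v \<in> H1per L \<Longrightarrow> ac v (wderiv L v)"
  unfolding H1per_def by (auto intro: weak_deriv_ac weak_deriv_wderiv)

lemma ac_H1: "ac v g \<Longrightarrow> v \<in> H1per L"
  unfolding H1per_def using ac_weak_deriv acD(1,2) by blast

text \<open>\<open>wderiv\<close> chooses among weak derivatives that differ by an L2-null function,
  so its norm can be computed from any explicit derivative \<open>g\<close>.\<close>

lemma ac_nrm_wderiv:
  assumes "ac v g"
  shows "nrm (wderiv L v) = nrm g"
  using weak_deriv_unique[OF ac_weak_deriv[OF H1_ac[OF ac_H1[OF assms]]] ac_weak_deriv[OF assms]]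
    acD(3)[OF assms] acD(3)[OF H1_ac[OF ac_H1[OF assms]]] by (intro nrm_eq_of_diff_0)

lemma H1norm_ac: "ac v g \<Longrightarrow> H1norm L v = sqrt ((nrm g)\<^sup>2 + (nrm v)\<^sup>2)"
  by (simp add: H1norm_def ac_nrm_wderiv)

lemma H1dist_eq:
  assumes "v \<in> H1per L" "w \<in> H1per L"
  shows "H1dist L v w = sqrt ((nrm (\<lambda>x. wderiv L v x - wderiv L w x))\<^sup>2 + (nrm (\<lambda>x. v x - w x))\<^sup>2)"
  unfolding H1dist_def by (rule H1norm_ac[OF ac_diff[OF H1_ac[OF assms(1)] H1_ac[OF assms(2)]]])

lemma weak_deriv_uminus:
  assumes "weak_deriv L z g"
  shows "weak_deriv L (\<lambda>x. - z x) (\<lambda>x. - g x)"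
  using assms L2_uminus[of g] unfolding weak_deriv_def by (simp add: pairing_LINT)

text \<open>\<open>Metric_space\<close> demands symmetry for all functions, also those without a
  weak derivative. For these the predicates defining the choice for \<open>z\<close> and for
  \<open>- z\<close> are both empty, hence equal, and so are the chosen functions.\<close>

lemma nrm_wderiv_uminus: "nrm (wderiv L (\<lambda>x. - z x)) = nrm (wderiv L z)"
proof (cases "\<exists>g. weak_deriv L z g")
  case True
  then have w: "weak_deriv L z (wderiv L z)" using weak_deriv_wderiv by blast
  then have w': "weak_deriv L (\<lambda>x. - z x) (\<lambda>x. - wderiv L z x)" by (rule weak_deriv_uminus)
  then have w'': "weak_deriv L (\<lambda>x. - z x) (wderiv L (\<lambda>x. - z x))" by (rule weak_deriv_wderiv)
  have "nrm (wderiv L (\<lambda>x. - z x)) = nrm (\<lambda>x. - wderiv L z x)"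
    using w' w'' by (intro nrm_eq_of_diff_0 weak_deriv_unique[OF w'' w']) (auto simp: weak_deriv_def)
  then show ?thesis by simp
next
  case False
  then have "\<not> weak_deriv L (\<lambda>x. - z x) g" for g
    using weak_deriv_uminus[of "\<lambda>x. - z x" g] by auto
  then have "weak_deriv L (\<lambda>x. - z x) = weak_deriv L z" using False by auto
  then show ?thesis unfolding wderiv_def by simp
qed

lemma H1_metric: "Metric_space (H1per L) (H1dist L)"
proof
  show "0 \<le> H1dist L v w" for v w by (simp add: H1dist_def H1norm_def)
next
  show "H1dist L v w = H1dist L w v" for v w
    using nrm_wderiv_uminus[of "\<lambda>x. v x - w x"] nrm_diff_commute[of v w] by (simp add: H1dist_def H1norm_def)
next
  fix v w assume vw: "v \<in> H1per L" "w \<in> H1per L"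
  show "H1dist L v w = 0 \<longleftrightarrow> v = w"
  proof
    assume "H1dist L v w = 0"
    then have "nrm (\<lambda>x. v x - w x) = 0"
      unfolding H1dist_eq[OF vw] by (simp add: sum_power2_eq_zero_iff)
    then have "v x - w x = 0" for x
      using cont_nrm_0[of "\<lambda>x. v x - w x"] acD(1,2)[OF ac_diff[OF H1_ac[OF vw(1)] H1_ac[OF vw(2)]]] by blast
    then show "v = w" by auto
  next
    assume "v = w"
    then show "H1dist L v w = 0"
      unfolding H1dist_eq[OF vw] by (simp add: nrm_def)
  qed
next
  fix v w z assume h: "v \<in> H1per L" "w \<in> H1per L" "z \<in> H1per L"
  note a = H1_ac[OF h(1)] H1_ac[OF h(2)] H1_ac[OF h(3)]
  have t: "nrm (\<lambda>x. p x - r x) \<le> nrm (\<lambda>x. p x - q x) + nrm (\<lambda>x. q x - r x)"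
    if "p \<in> L2per L" "q \<in> L2per L" "r \<in> L2per L" for p q r
    using nrm_triangle[OF L2_diff[OF that(1,2)] L2_diff[OF that(2,3)]] by simp
  have "H1dist L v z \<le> sqrt ((nrm (\<lambda>x. wderiv L v x - wderiv L w x) + nrm (\<lambda>x. wderiv L w x - wderiv L z x))\<^sup>2
      + (nrm (\<lambda>x. v x - w x) + nrm (\<lambda>x. w x - z x))\<^sup>2)"
    unfolding H1dist_eq[OF h(1,3)]
    by (intro real_sqrt_le_mono add_mono power_mono t acD[OF a(1)] acD[OF a(2)] acD[OF a(3)] nrm_nonneg)
  also have "\<dots> \<le> H1dist L v w + H1dist L w z"
    unfolding H1dist_eq[OF h(1,2)] H1dist_eq[OF h(2,3)] by (rule real_sqrt_sum_squares_triangle_ineq)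
  finally show "H1dist L v z \<le> H1dist L v w + H1dist L w z" .
qed

subsection \<open>The periodic resolvent of the derivative\<close>

abbreviation Cper :: "(real \<Rightarrow> complex) \<Rightarrow> bool" where
  "Cper h \<equiv> continuous_on UNIV h \<and> periodic L h"

text \<open>
  \<open>sol \<mu> h g\<close> means \<open>g' + \<mu> g = h\<close>, solvable in periodic functions for every
  real \<open>\<mu>\<close> other than 0, of either sign.
\<close>
definition sol :: "real \<Rightarrow> (real \<Rightarrow> complex) \<Rightarrow> (real \<Rightarrow> complex) \<Rightarrow> bool" where
  "sol \<mu> h g \<longleftrightarrow> periodic L g \<and> (\<forall>x. (g has_vector_derivative h x - of_real \<mu> * g x) (at x))"

lemma solD:
  assumes "sol \<mu> h g"
  shows "periodic L g" "continuous_on UNIV g" "(g has_vector_derivative h x - of_real \<mu> * g x) (at x)"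
  using assms continuous_on_vector_derivative[of UNIV g "\<lambda>x. h x - of_real \<mu> * g x"] by (auto simp: sol_def)

lemma sol_ac:
  assumes "sol \<mu> h g" "Cper h"
  shows "ac g (\<lambda>x. h x - of_real \<mu> * g x)"
proof (rule ac_C1)
  show "continuous_on UNIV (\<lambda>x. h x - of_real \<mu> * g x)"
    using assms(2) solD(2)[OF assms(1)] by (intro continuous_intros) auto
qed (use solD[OF assms(1)] in auto)

text \<open>Variation of constants: \<open>exp (\<mu> * x) * g x\<close> is an antiderivative
  \<open>A x + c\<close>. Over one period \<open>A\<close> is multiplied by
  \<open>exp (\<mu> * L)\<close> up to the constant \<open>k\<close>, and \<open>c\<close> is the
  value that absorbs \<open>k\<close>; it exists because \<open>exp (\<mu> * L)\<close> is not
  1.\<close>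

lemma sol_ex:
  assumes h: "Cper h" and \<mu>: "\<mu> \<noteq> 0"
  obtains g where "sol \<mu> h g"
proof -
  have "continuous_on UNIV (\<lambda>x. of_real (exp (\<mu> * x)) * h x)"
    using h by (intro continuous_intros) auto
  then obtain A where A: "\<And>x. (A has_vector_derivative of_real (exp (\<mu> * x)) * h x) (at x)" "A 0 = 0"
    using continuous_antiderivative by blast
  have "\<exists>k. \<forall>x\<in>UNIV. A (x + L) - of_real (exp (\<mu> * L)) * A x = k"
  proof (rule has_vector_derivative_zero_constant)
    fix x
    have "((\<lambda>x. A (x + L) - of_real (exp (\<mu> * L)) * A x) has_vector_derivative
      (of_real (exp (\<mu> * (x + L))) * h (x + L) - of_real (exp (\<mu> * L)) * (of_real (exp (\<mu> * x)) * h x))) (at x)"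
      by (intro has_vector_derivative_diff has_vector_derivative_mult_right has_vector_derivative_shift A)
    moreover have "of_real (exp (\<mu> * (x + L))) * h (x + L) - of_real (exp (\<mu> * L)) * (of_real (exp (\<mu> * x)) * h x) = 0"
      using h by (simp add: periodic_def distrib_left exp_add mult.commute mult.left_commute)
    ultimately show "((\<lambda>x. A (x + L) - of_real (exp (\<mu> * L)) * A x) has_vector_derivative 0) (at x within UNIV)"
      by simp
  qed auto
  then obtain k where k: "\<And>x. A (x + L) - of_real (exp (\<mu> * L)) * A x = k" by auto
  have ne: "exp (\<mu> * L) - 1 \<noteq> 0" using \<mu> L_pos by simp
  then have ne': "complex_of_real (exp (\<mu> * L) - 1) \<noteq> 0" by (simp only: of_real_eq_0_iff not_False_eq_True)
  define c where "c = k / of_real (exp (\<mu> * L) - 1)"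
  have c: "c * of_real (exp (\<mu> * L)) = k + c"
    using ne' unfolding c_def by (simp add: field_simps)
  define g where "g x = of_real (exp (- \<mu> * x)) * (A x + c)" for x
  have "sol \<mu> h g"
    unfolding sol_def
  proof (intro conjI allI)
    have "g (x + L) = g x" for x
    proof -
      have "A (x + L) + c = of_real (exp (\<mu> * L)) * (A x + c)"
        using k[of x] c by (simp add: algebra_simps)
      moreover have "complex_of_real (exp (- \<mu> * (x + L))) * of_real (exp (\<mu> * L)) = of_real (exp (- \<mu> * x))"
        by (simp add: of_real_mult[symmetric] exp_add[symmetric] algebra_simps del: of_real_mult)
      ultimately show ?thesis by (simp add: g_def mult.assoc[symmetric])
    qed
    then show "periodic L g" by (simp add: periodic_def)
    fix x
    have "((\<lambda>x. exp (- \<mu> * x)) has_real_derivative - \<mu> * exp (- \<mu> * x)) (at x)"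
      by (auto intro!: derivative_eq_intros)
    then have e: "((\<lambda>x. complex_of_real (exp (- \<mu> * x))) has_vector_derivative of_real (- \<mu> * exp (- \<mu> * x))) (at x)"
      by (intro has_vector_derivative_of_real) (simp add: has_real_derivative_iff_has_vector_derivative)
    have "((\<lambda>x. A x + c) has_vector_derivative of_real (exp (\<mu> * x)) * h x) (at x)"
      using has_vector_derivative_add[OF A(1) has_vector_derivative_const] by simp
    from has_vector_derivative_mult[OF e this]
    have "(g has_vector_derivative of_real (exp (- \<mu> * x)) * (of_real (exp (\<mu> * x)) * h x) +
       of_real (- \<mu> * exp (- \<mu> * x)) * (A x + c)) (at x)"
      unfolding g_def[abs_def] .
    moreover have "complex_of_real (exp (- \<mu> * x)) * (of_real (exp (\<mu> * x)) * h x) = h x"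
      by (simp add: mult.assoc[symmetric] of_real_mult[symmetric] exp_add[symmetric] del: of_real_mult)
    moreover have "of_real (- \<mu> * exp (- \<mu> * x)) * (A x + c) = - (of_real \<mu> * g x)"
      by (simp add: g_def)
    ultimately show "(g has_vector_derivative h x - of_real \<mu> * g x) (at x)"
      by (simp only: diff_conv_add_uminus)
  qed
  then show ?thesis by (rule that)
qed

lemma sol_lincomb:
  assumes "sol \<mu> h g" "sol \<mu> h' g'"
  shows "sol \<mu> (\<lambda>x. h x - h' x) (\<lambda>x. g x - g' x)"
  unfolding sol_def
proof (intro conjI allI)
  show "periodic L (\<lambda>x. g x - g' x)"
    using solD(1)[OF assms(1)] solD(1)[OF assms(2)] by (simp add: periodic_def)
  fix x
  show "((\<lambda>x. g x - g' x) has_vector_derivative h x - h' x - of_real \<mu> * (g x - g' x)) (at x)"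
    using has_vector_derivative_diff[OF solD(3)[OF assms(1)] solD(3)[OF assms(2)], of x]
    by (simp add: algebra_simps)
qed

text \<open>The derivative of the squared modulus of \<open>g\<close> has mean 0, so
  \<open>\<mu> * (nrm g)\<^sup>2\<close> is the real part of the pairing of \<open>g\<close> and
  \<open>h\<close>, whatever the sign of \<open>\<mu>\<close>. Using \<open>ac\<close> instead of
  \<open>sol\<close> admits a source that is only in L2, such as the forcing.\<close>

lemma res_nrm:
  assumes g: "ac g (\<lambda>x. h x - of_real \<mu> * g x)" and h: "h \<in> L2per L"
  shows "\<bar>\<mu>\<bar> * nrm g \<le> nrm h"
proof -
  note gL = acD(4)[OF g]
  let ?d = "\<lambda>x. h x - of_real \<mu> * g x"
  have "(LINT x|M. g x * cnj (?d x) + ?d x * cnj (g x)) = 0"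
    by (rule ac_mean[OF ac_mult[OF g ac_cnj[OF g]]])
  also have "(\<lambda>x. g x * cnj (?d x) + ?d x * cnj (g x))
     = (\<lambda>x. (g x * cnj (h x) + h x * cnj (g x)) - of_real (2 * \<mu>) * (g x * cnj (g x)))"
    by (auto simp: algebra_simps)
  also have "(LINT x|M. (g x * cnj (h x) + h x * cnj (g x)) - of_real (2 * \<mu>) * (g x * cnj (g x)))
     = ((LINT x|M. g x * cnj (h x)) + (LINT x|M. h x * cnj (g x))) - of_real (2 * \<mu>) * (LINT x|M. g x * cnj (g x))"
    using int_mult(1)[OF gL L2_cnj[OF h]] int_mult(1)[OF h L2_cnj[OF gL]] int_mult(1)[OF gL L2_cnj[OF gL]]
    by (simp only: Bochner_Integration.integral_diff Bochner_Integration.integral_add Bochner_Integration.integrable_add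
      integrable_mult_right integral_mult_right_zero)
  finally have "of_real (2 * \<mu>) * (LINT x|M. g x * cnj (g x)) = (LINT x|M. g x * cnj (h x)) + (LINT x|M. h x * cnj (g x))"
    by (simp add: algebra_simps)
  moreover have "(LINT x|M. g x * cnj (g x)) = of_real ((nrm g)\<^sup>2)"
    unfolding nrm_sq by (subst integral_complex_of_real[symmetric]) (simp add: complex_norm_square del: of_real_power)
  ultimately have "cmod (of_real (2 * \<mu>) * of_real ((nrm g)\<^sup>2)) \<le> cmod (LINT x|M. g x * cnj (h x)) + cmod (LINT x|M. h x * cnj (g x))"
    using norm_triangle_ineq by metis
  also have "\<dots> \<le> nrm g * nrm h + nrm h * nrm g"
    using CS[OF gL L2_cnj[OF h]] CS[OF h L2_cnj[OF gL]] by (intro add_mono) simp_all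
  finally have "nrm g * (\<bar>\<mu>\<bar> * nrm g) \<le> nrm g * nrm h"
    by (simp add: norm_mult abs_mult power2_eq_square mult.left_commute[of "nrm g"])
  then show ?thesis
    using nrm_nonneg[of g] nrm_nonneg[of h] by (cases "nrm g = 0") auto
qed

lemma res_sup_gen:
  assumes g: "ac g (\<lambda>x. h x - of_real \<mu> * g x)" and h: "h \<in> L2per L" and \<mu>: "\<mu> \<noteq> 0"
  shows "(cmod (g x))\<^sup>2 \<le> (1 / (\<mu>\<^sup>2 * L) + 4 / \<bar>\<mu>\<bar>) * (nrm h)\<^sup>2"
proof -
  have n1: "nrm g \<le> nrm h / \<bar>\<mu>\<bar>"
    using res_nrm[OF g h] \<mu> by (simp add: field_simps)
  have "nrm (\<lambda>x. h x - of_real \<mu> * g x) \<le> nrm h + \<bar>\<mu>\<bar> * nrm g"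
    using nrm_triangle_diff[OF h L2_cmult[OF acD(4)[OF g], of "of_real \<mu>"]] nrm_cmult[of "of_real \<mu>" g] by simp
  then have n2: "nrm (\<lambda>x. h x - of_real \<mu> * g x) \<le> 2 * nrm h"
    using res_nrm[OF g h] by simp
  have "(cmod (g x))\<^sup>2 \<le> (nrm g)\<^sup>2 / L + 2 * (nrm g * nrm (\<lambda>x. h x - of_real \<mu> * g x))"
    using ac_sobolev[OF g, of x] by (simp add: mult.assoc)
  also have "\<dots> \<le> (nrm h / \<bar>\<mu>\<bar>)\<^sup>2 / L + 2 * (nrm h / \<bar>\<mu>\<bar> * (2 * nrm h))"
    using n1 n2 L_pos by (intro add_mono divide_right_mono power_mono mult_left_mono mult_mono) auto
  also have "\<dots> = (1 / (\<mu>\<^sup>2 * L) + 4 / \<bar>\<mu>\<bar>) * (nrm h)\<^sup>2"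
    using \<mu> L_pos by (simp add: power_divide power2_eq_square field_simps)
  finally show ?thesis .
qed

text \<open>The gain of \<open>\<mu>\<close> to the power -1/2 from L2 to the uniform norm. It makes
  the Riccati map a contraction for large \<open>\<mu>\<close> when only the L2 norm of
  \<open>u\<close> is controlled. The condition on \<open>\<bar>\<mu>\<bar> * L\<close> lets the two
  terms of \<open>res_sup_gen\<close> merge into \<open>1 + 4 = 5\<close>.\<close>

lemma res_sup:
  assumes g: "ac g (\<lambda>x. h x - of_real \<mu> * g x)" and h: "h \<in> L2per L" and \<mu>: "1 \<le> \<bar>\<mu>\<bar> * L"
  shows "cmod (g x) \<le> sqrt (5 / \<bar>\<mu>\<bar>) * nrm h"
proof -
  have \<mu>0: "0 < \<bar>\<mu>\<bar>" using \<mu> by (cases "\<mu> = 0") auto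
  have "1 / (\<mu>\<^sup>2 * L) \<le> 1 / \<bar>\<mu>\<bar>"
  proof -
    have "\<bar>\<mu>\<bar> * 1 \<le> \<bar>\<mu>\<bar> * (\<bar>\<mu>\<bar> * L)" using \<mu> \<mu>0 by (intro mult_left_mono) auto
    also have "\<dots> = \<mu>\<^sup>2 * L" by (simp add: power2_eq_square mult.assoc[symmetric])
    finally have "\<bar>\<mu>\<bar> \<le> \<mu>\<^sup>2 * L" by simp
    then show ?thesis using \<mu>0 by (intro divide_left_mono) auto
  qed
  then have "(1 / (\<mu>\<^sup>2 * L) + 4 / \<bar>\<mu>\<bar>) * (nrm h)\<^sup>2 \<le> (5 / \<bar>\<mu>\<bar>) * (nrm h)\<^sup>2"
    by (intro mult_right_mono) (auto simp: field_simps)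
  with res_sup_gen[OF g h, of x] \<mu>0 have "(cmod (g x))\<^sup>2 \<le> (sqrt (5 / \<bar>\<mu>\<bar>) * nrm h)\<^sup>2"
    by (simp add: power_mult_distrib)
  then show ?thesis by (rule power2_le_imp_le) simp
qed

text \<open>A maximum principle: at a maximum point of \<open>cmod (g x)\<close> the derivative of
  the squared modulus vanishes, so there \<open>\<mu> * (cmod g)\<^sup>2\<close> equals the real
  part of \<open>h * cnj g\<close>.\<close>

lemma sol_sup:
  assumes g: "sol \<mu> h g" and B: "\<And>x. cmod (h x) \<le> B"
  shows "\<bar>\<mu>\<bar> * cmod (g x) \<le> B"
proof -
  have "continuous_on T (\<lambda>y. cmod (g y))"
    by (intro continuous_intros continuous_on_subset[OF solD(2)[OF g]]) auto
  moreover have "compact T" "T \<noteq> {}" using T_ends(1) by (auto simp: T_def)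
  ultimately obtain z where z: "z \<in> T" "\<And>y. y \<in> T \<Longrightarrow> cmod (g y) \<le> cmod (g z)"
    using continuous_attains_sup[of T "\<lambda>y. cmod (g y)"] by blast
  then have zmax: "cmod (g y) \<le> cmod (g z)" for y
    using periodic_all_T[OF solD(1)[OF g], where P = "\<lambda>w. cmod w \<le> cmod (g z)"] by blast
  let ?d = "h z - of_real \<mu> * g z"
  have "((\<lambda>x. g x * cnj (g x)) has_vector_derivative g z * cnj ?d + ?d * cnj (g z)) (at z)"
    by (intro has_vector_derivative_mult solD(3)[OF g] bounded_linear.has_vector_derivative[OF bounded_linear_cnj])
  from bounded_linear.has_vector_derivative[OF bounded_linear_Re this]
  have "((\<lambda>x. (cmod (g x))\<^sup>2) has_real_derivative Re (g z * cnj ?d + ?d * cnj (g z))) (at z)"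
    by (simp add: has_real_derivative_iff_has_vector_derivative complex_mult_cnj cmod_power2)
  then have "Re (g z * cnj ?d + ?d * cnj (g z)) = 0"
    by (rule DERIV_local_max[where d = 1]) (auto intro!: power_mono zmax)
  then have "\<mu> * (cmod (g z))\<^sup>2 = Re (h z * cnj (g z))"
    unfolding cmod_power2 by (simp add: algebra_simps power2_eq_square)
  then have "\<bar>\<mu>\<bar> * (cmod (g z))\<^sup>2 = \<bar>Re (h z * cnj (g z))\<bar>"
    by (metis abs_mult abs_power2)
  also have "\<dots> \<le> cmod (h z) * cmod (g z)"
    using abs_Re_le_cmod[of "h z * cnj (g z)"] by (simp add: norm_mult)
  finally have "cmod (g z) * (\<bar>\<mu>\<bar> * cmod (g z)) \<le> cmod (g z) * cmod (h z)"
    by (simp add: power2_eq_square mult.commute mult.left_commute)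
  then have "\<bar>\<mu>\<bar> * cmod (g z) \<le> cmod (h z) \<or> cmod (g z) = 0"
    by (simp add: mult_le_cancel_left_pos)  (metis norm_eq_zero mult_le_cancel_left_pos norm_ge_zero order_le_less)
  then have "\<bar>\<mu>\<bar> * cmod (g z) \<le> B"
    using B[of z] order_trans[OF norm_ge_zero B[of z]] by auto
  moreover have "\<bar>\<mu>\<bar> * cmod (g x) \<le> \<bar>\<mu>\<bar> * cmod (g z)"
    by (intro mult_left_mono zmax) auto
  ultimately show ?thesis by linarith
qed

text \<open>The difference \<open>\<mu> g - w\<close> solves the same equation with source
  \<open>\<mu> (h - w) - w'\<close>, so \<open>res_nrm\<close> applies to it. Thus
  \<open>\<mu>\<close> times the resolvent is close to the identity, at rate \<open>1/\<mu>\<close>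
  on functions with a derivative in L2.\<close>

lemma res_approx:
  assumes g: "ac g (\<lambda>x. h x - of_real \<mu> * g x)" and h: "h \<in> L2per L" and w: "ac w w'" and \<mu>: "\<mu> \<noteq> 0"
  shows "nrm (\<lambda>x. of_real \<mu> * g x - w x) \<le> nrm (\<lambda>x. h x - w x) + nrm w' / \<bar>\<mu>\<bar>"
proof -
  let ?k = "\<lambda>x. of_real \<mu> * g x - w x"
  let ?r = "\<lambda>x. of_real \<mu> * (h x - w x) - w' x"
  have eq: "(\<lambda>x. of_real \<mu> * (h x - of_real \<mu> * g x) - w' x) = (\<lambda>x. ?r x - of_real \<mu> * ?k x)"
    by (auto simp: algebra_simps)
  have k: "ac ?k (\<lambda>x. ?r x - of_real \<mu> * ?k x)"
    using ac_diff[OF ac_cmult[OF g, of "of_real \<mu>"] w] unfolding eq .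
  have hw: "(\<lambda>x. h x - w x) \<in> L2per L" by (intro L2_diff h acD[OF w])
  have r: "?r \<in> L2per L" by (intro L2_diff L2_cmult h acD[OF w])
  have "\<bar>\<mu>\<bar> * nrm ?k \<le> nrm ?r" by (rule res_nrm[OF k r])
  also have "\<dots> \<le> \<bar>\<mu>\<bar> * nrm (\<lambda>x. h x - w x) + nrm w'"
    using nrm_triangle_diff[OF L2_cmult[OF hw, of "of_real \<mu>"] acD(3)[OF w]] nrm_cmult[of "of_real \<mu>" "\<lambda>x. h x - w x"] by simp
  finally have "nrm ?k \<le> (\<bar>\<mu>\<bar> * nrm (\<lambda>x. h x - w x) + nrm w') / \<bar>\<mu>\<bar>"
    using \<mu> by (simp add: pos_le_divide_eq mult.commute)
  then show ?thesis using \<mu> by (simp add: add_divide_distrib)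
qed

text \<open>Integration by parts: for the bilinear pairing, the transpose of the resolvent at
  \<open>\<mu>\<close> is minus the resolvent at \<open>- \<mu>\<close>.\<close>

lemma res_adj:
  assumes g: "ac g (\<lambda>x. h x - of_real \<mu> * g x)" and l: "ac l (\<lambda>x. k x - of_real (- \<mu>) * l x)"
    and hk: "h \<in> L2per L" "k \<in> L2per L"
  shows "(LINT x|M. g x * k x) = - (LINT x|M. h x * l x)"
proof -
  note gL = acD(4)[OF g] and lL = acD(4)[OF l]
  have i: "integrable M (\<lambda>x. g x * k x)" "integrable M (\<lambda>x. of_real \<mu> * (g x * l x))" "integrable M (\<lambda>x. h x * l x)"
    by (intro integrable_mult_right int_mult gL lL hk)+
  have "(LINT x|M. g x * (k x - of_real (- \<mu>) * l x)) = (LINT x|M. g x * k x + of_real \<mu> * (g x * l x))"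
    by (simp add: algebra_simps)
  also have "\<dots> = (LINT x|M. g x * k x) + (LINT x|M. of_real \<mu> * (g x * l x))"
    by (intro Bochner_Integration.integral_add i)
  moreover have "(LINT x|M. (h x - of_real \<mu> * g x) * l x) = (LINT x|M. h x * l x - of_real \<mu> * (g x * l x))"
    by (simp add: algebra_simps)
  moreover have "\<dots> = (LINT x|M. h x * l x) - (LINT x|M. of_real \<mu> * (g x * l x))"
    by (intro Bochner_Integration.integral_diff i)
  ultimately show ?thesis using ac_parts[OF g l] by simp
qed

text \<open>Classical solutions for smooth sources are uniformly Cauchy by
  \<open>res_sup_gen\<close>, so solvability extends by density to L2 sources. It is needed for the
  forcing.\<close>

lemma res_ex:
  assumes h: "h \<in> L2per L" and \<mu>: "\<mu> \<noteq> 0"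
  obtains g where "ac g (\<lambda>x. h x - of_real \<mu> * g x)"
proof -
  have "\<exists>p q. test_fun L p \<and> test_fun L q \<and> nrm (\<lambda>x. h x - Complex (p x) (q x)) < inverse (real (Suc n))" for n
    using L2_approx_test[OF h, of "inverse (real (Suc n))"] by (fastforce simp del: of_nat_Suc)
  then obtain p q where pq: "\<And>n. test_fun L (p n)" "\<And>n. test_fun L (q n)"
    "\<And>n. nrm (\<lambda>x. h x - Complex (p n x) (q n x)) < inverse (real (Suc n))"
    by metis
  define P where "P n x = Complex (p n x) (q n x)" for n x
  have P: "Cper (P n)" "P n \<in> L2per L" for n
    unfolding P_def using ctest_cont pq by blast+
  have Ph: "nrm (\<lambda>x. P n x - h x) \<le> inverse (real (Suc n))" for n
    using pq(3)[of n] nrm_diff_commute[of h "P n"] by (simp add: P_def)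
  have "\<exists>g. sol \<mu> (P n) g" for n using sol_ex[OF P(1) \<mu>] by metis
  then obtain g where g: "\<And>n. sol \<mu> (P n) (g n)" by metis
  have acg: "ac (g n) (\<lambda>x. P n x - of_real \<mu> * g n x)" for n
    by (rule sol_ac[OF g P(1)])
  define C where "C = sqrt (1 / (\<mu>\<^sup>2 * L) + 4 / \<bar>\<mu>\<bar>)"
  have C0: "0 \<le> 1 / (\<mu>\<^sup>2 * L) + 4 / \<bar>\<mu>\<bar>" using L_pos by simp
  have C: "0 \<le> C" unfolding C_def using C0 by simp
  have c: "cmod (g m x - g n x) \<le> C * inverse (real (Suc m)) + C * inverse (real (Suc n))" for m n x
  proof -
    have PP: "Cper (\<lambda>x. P m x - P n x)"
      using P(1)[of m] P(1)[of n] by (auto simp: periodic_def intro!: continuous_intros)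
    have "(cmod (g m x - g n x))\<^sup>2 \<le> (1 / (\<mu>\<^sup>2 * L) + 4 / \<bar>\<mu>\<bar>) * (nrm (\<lambda>x. P m x - P n x))\<^sup>2"
      using res_sup_gen[OF sol_ac[OF sol_lincomb[OF g g] PP] L2_diff[OF P(2) P(2)] \<mu>] .
    also have "\<dots> = (C * nrm (\<lambda>x. P m x - P n x))\<^sup>2"
      using C0 by (simp add: C_def power_mult_distrib)
    finally have "cmod (g m x - g n x) \<le> C * nrm (\<lambda>x. P m x - P n x)"
      by (rule power2_le_imp_le) (use C in simp)
    also have "nrm (\<lambda>x. P m x - P n x) = nrm (\<lambda>x. (P m x - h x) - (P n x - h x))" by simp
    also have "\<dots> \<le> nrm (\<lambda>x. P m x - h x) + nrm (\<lambda>x. P n x - h x)"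
      by (intro nrm_triangle_diff L2_diff P h)
    also have "\<dots> \<le> inverse (real (Suc m)) + inverse (real (Suc n))"
      by (intro add_mono Ph)
    finally show ?thesis using C by (simp add: distrib_left mult_left_mono)
  qed
  have z: "(\<lambda>n. inverse (real (Suc n))) \<longlonglongrightarrow> 0" by (rule LIMSEQ_inverse_real_of_nat)
  obtain w where w: "uniform_limit UNIV g w sequentially"
    by (rule uniform_Cauchy_limit[OF c tendsto_mult_right_zero[OF z]])
  have p: "(\<lambda>n. g n x) \<longlonglongrightarrow> w x" for x
    using tendsto_uniform_limitI[OF w] by simp
  have wC: "continuous_on UNIV w"
    using uniform_limit_theorem[OF _ w] acD(2)[OF acg] by simp
  have wP: "periodic L w"
    unfolding periodic_def
  proof
    fix x
    have "(\<lambda>n. g n (x + L)) = (\<lambda>n. g n x)" using acD(1)[OF acg] by (simp add: periodic_def)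
    then show "w (x + L) = w x" using p[of "x + L"] p[of x] by (auto intro: LIMSEQ_unique)
  qed
  have wL: "w \<in> L2per L" by (rule L2_cont[OF wC wP])
  have t: "(\<lambda>x. h x - of_real \<mu> * w x) \<in> L2per L" by (intro L2_diff L2_cmult h wL)
  have "(\<lambda>n. nrm (\<lambda>x. (P n x - h x) + of_real (- \<mu>) * (g n x - w x))) \<longlonglongrightarrow> 0"
  proof (intro tendsto_nrm_add L2_diff L2_cmult P h wL acD(4)[OF acg])
    show "(\<lambda>n. nrm (\<lambda>x. P n x - h x)) \<longlonglongrightarrow> 0"
      by (rule Lim_null_comparison[OF always_eventually z]) (use Ph in auto)
    have "(\<lambda>n. nrm (\<lambda>x. (g n x - w x) * of_real (- \<mu>))) \<longlonglongrightarrow> 0"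
      by (rule nrm_tendsto_unif[OF uniform_limit_minus[OF w] _ _ L2_one])
        (use wC wP acD(1,2)[OF acg] in \<open>auto simp: periodic_def intro!: continuous_intros\<close>)
    then show "(\<lambda>n. nrm (\<lambda>x. of_real (- \<mu>) * (g n x - w x))) \<longlonglongrightarrow> 0"
      by (simp only: mult.commute)
  qed
  then have "(\<lambda>n. nrm (\<lambda>x. P n x - of_real \<mu> * g n x - (h x - of_real \<mu> * w x))) \<longlonglongrightarrow> 0"
    by (simp add: algebra_simps)
  from ac_limit[OF acg w t this] show ?thesis by (rule that)
qed

text \<open>Strong convergence without a rate: \<open>h\<close> is replaced by a smooth
  \<open>P\<close>, for which \<open>res_approx\<close> does have a rate. The threshold
  \<open>m\<close> depends on \<open>h\<close> and \<open>e\<close> only and serves both signs of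
  \<open>\<mu>\<close>.\<close>

lemma res_strong:
  assumes h: "h \<in> L2per L" and e: "0 < e"
  obtains m where "0 < m" "\<And>\<mu> g. m \<le> \<bar>\<mu>\<bar> \<Longrightarrow> ac g (\<lambda>x. h x - of_real \<mu> * g x) \<Longrightarrow> nrm (\<lambda>x. of_real \<mu> * g x - h x) \<le> e"
proof -
  obtain p q where pq: "test_fun L p" "test_fun L q" "nrm (\<lambda>x. h x - Complex (p x) (q x)) < e / 3"
    using L2_approx_test[OF h, of "e / 3"] e by auto
  define P P' where "P x = Complex (p x) (q x)" and "P' x = Complex (deriv p x) (deriv q x)" for x
  have acP: "ac P P'" unfolding P_def P'_def by (rule ctest_ac[OF pq(1,2)])
  have hP: "nrm (\<lambda>x. h x - P x) \<le> e / 3" using pq(3) by (simp add: P_def)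
  define m where "m = 3 * (nrm P' + 1) / e"
  have m: "0 < m" using e nrm_nonneg[of P'] by (simp add: m_def add_nonneg_pos)
  show ?thesis
  proof (rule that[OF m])
    fix \<mu> g assume \<mu>: "m \<le> \<bar>\<mu>\<bar>" and g: "ac g (\<lambda>x. h x - of_real \<mu> * g x)"
    have \<mu>0: "\<mu> \<noteq> 0" using \<mu> m by auto
    have "nrm P' / \<bar>\<mu>\<bar> \<le> nrm P' / m"
      using \<mu> m by (intro divide_left_mono) auto
    also have "\<dots> \<le> e / 3"
    proof -
      have "0 < nrm P' + 1" using nrm_nonneg[of P'] by linarith
      then have "nrm P' / m = e / 3 * (nrm P' / (nrm P' + 1))" using e by (simp add: m_def)
      also have "\<dots> \<le> e / 3 * 1"
        using e \<open>0 < nrm P' + 1\<close> by (intro mult_left_mono) auto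
      finally show ?thesis by simp
    qed
    finally have "nrm P' / \<bar>\<mu>\<bar> \<le> e / 3" .
    then have 1: "nrm (\<lambda>x. of_real \<mu> * g x - P x) \<le> 2 * e / 3"
      using res_approx[OF g h acP \<mu>0] hP by linarith
    have "nrm (\<lambda>x. (of_real \<mu> * g x - P x) - (h x - P x)) \<le> nrm (\<lambda>x. of_real \<mu> * g x - P x) + nrm (\<lambda>x. h x - P x)"
      by (intro nrm_triangle_diff L2_diff L2_cmult h acD[OF g] acD[OF acP])
    then show "nrm (\<lambda>x. of_real \<mu> * g x - h x) \<le> e" using 1 hP by simp
  qed
qed

text \<open>Banach's iteration on the unit ball of \<open>Cper\<close> in the uniform norm. The
  Lipschitz condition is phrased with pointwise bounds \<open>K\<close>, so the supremum norm itself
  never has to be formed.\<close>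

lemma fixed_point:
  fixes F :: "(real \<Rightarrow> complex) \<Rightarrow> real \<Rightarrow> complex"
  assumes c: "0 \<le> c" "c < 1"
    and F: "\<And>\<phi>. Cper \<phi> \<Longrightarrow> (\<And>x. cmod (\<phi> x) \<le> 1) \<Longrightarrow> Cper (F \<phi>) \<and> (\<forall>x. cmod (F \<phi> x) \<le> 1)"
    and Lip: "\<And>\<phi> \<psi> K x. Cper \<phi> \<Longrightarrow> Cper \<psi> \<Longrightarrow> (\<And>x. cmod (\<phi> x) \<le> 1) \<Longrightarrow> (\<And>x. cmod (\<psi> x) \<le> 1)
      \<Longrightarrow> (\<And>x. cmod (\<phi> x - \<psi> x) \<le> K) \<Longrightarrow> cmod (F \<phi> x - F \<psi> x) \<le> c * K"
  obtains \<phi> where "Cper \<phi>" "\<And>x. cmod (\<phi> x) \<le> 1" "F \<phi> = \<phi>"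
proof -
  define s where "s n = (F ^^ n) (\<lambda>x. 0)" for n
  have s: "Cper (s n) \<and> (\<forall>x. cmod (s n x) \<le> 1)" for n
  proof (induction n)
    case 0
    then show ?case by (simp add: s_def periodic_def)
  next
    case (Suc n)
    then show ?case using F[of "s n"] by (simp add: s_def)
  qed
  have step: "cmod (s (n + k) x - s n x) \<le> 2 * c ^ n" for n k x
  proof (induction n arbitrary: x)
    case 0
    have "cmod (s k x - s 0 x) \<le> 2"
    proof -
      have "cmod (s k x) \<le> 1" "cmod (s 0 x) \<le> 1" using s by auto
      then show ?thesis using norm_triangle_ineq4[of "s k x" "s 0 x"] by linarith
    qed
    then show ?case by simp
  next
    case (Suc n)
    have "cmod (F (s (n + k)) x - F (s n) x) \<le> c * (2 * c ^ n)"
      using s[of n] s[of "n + k"] Suc by (intro Lip) auto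
    then show ?case by (simp add: s_def)
  qed
  have ca: "cmod (s m x - s n x) \<le> 2 * c ^ m + 2 * c ^ n" for m n x
  proof (cases "m \<le> n")
    case True
    have "cmod (s m x - s n x) \<le> 2 * c ^ m"
      using step[of m "n - m" x] True by (simp add: norm_minus_commute)
    moreover have "0 \<le> 2 * c ^ n" using c by simp
    ultimately show ?thesis by linarith
  next
    case False
    have "cmod (s m x - s n x) \<le> 2 * c ^ n"
      using step[of n "m - n" x] False by simp
    moreover have "0 \<le> 2 * c ^ m" using c by simp
    ultimately show ?thesis by linarith
  qed
  have z: "(\<lambda>n. 2 * c ^ n) \<longlonglongrightarrow> 0"
    using c by (intro tendsto_mult_right_zero LIMSEQ_realpow_zero) auto
  obtain w where w: "uniform_limit UNIV s w sequentially"
    by (rule uniform_Cauchy_limit[OF ca z])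
  have p: "(\<lambda>n. s n x) \<longlonglongrightarrow> w x" for x
    using tendsto_uniform_limitI[OF w] by simp
  have wC: "continuous_on UNIV w"
    using uniform_limit_theorem[OF _ w] s by simp
  have wP: "periodic L w"
    unfolding periodic_def
  proof
    fix x
    have "(\<lambda>n. s n (x + L)) = (\<lambda>n. s n x)" using s by (simp add: periodic_def)
    then show "w (x + L) = w x" using p[of "x + L"] p[of x] by (auto intro: LIMSEQ_unique)
  qed
  have w1: "cmod (w x) \<le> 1" for x
    using s by (intro Lim_bounded[OF tendsto_norm[OF p]]) auto
  have sw: "cmod (s n x - w x) \<le> 2 * c ^ n" for n x
  proof -
    have "(\<lambda>k. cmod (s n x - s (n + k) x)) \<longlonglongrightarrow> cmod (s n x - w x)"
      using LIMSEQ_ignore_initial_segment[OF p[of x], of n]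
      by (intro tendsto_norm tendsto_diff tendsto_const) (simp add: add.commute)
    then show ?thesis
      by (rule Lim_bounded) (use step in \<open>auto simp: norm_minus_commute\<close>)
  qed
  have "F w x = w x" for x
  proof -
    have "cmod (F w x - s (Suc n) x) \<le> c * (2 * c ^ n)" for n
      using s[of n] wC wP w1 sw[of n] Lip[of w "s n" "2 * c ^ n" x] by (simp add: s_def norm_minus_commute)
    then have "(\<lambda>n. F w x - s (Suc n) x) \<longlonglongrightarrow> 0"
      by (intro Lim_null_comparison[OF always_eventually tendsto_mult_right_zero[OF z]]) blast
    moreover have "(\<lambda>n. F w x - s (Suc n) x) \<longlonglongrightarrow> F w x - w x"
      by (intro tendsto_diff tendsto_const LIMSEQ_Suc p)
    ultimately show ?thesis using LIMSEQ_unique by fastforce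
  qed
  then show ?thesis using that wC wP w1 by blast
qed

subsection \<open>The Riccati equation of the Zakharov-Shabat system\<close>

text \<open>The left side of the last inequality is the bound of \<open>res_sup\<close> for the
  resolvent applied to \<open>u\<close>; with 1/4, both fixed-point maps below contract by that
  factor. Only the L2 norm of \<open>u\<close> enters, so one \<open>\<mu>\<close> serves wherever
  the mass is bounded along a trajectory.\<close>

definition small :: "real \<Rightarrow> (real \<Rightarrow> complex) \<Rightarrow> bool" where
  "small \<mu> u \<longleftrightarrow> 0 < \<mu> \<and> 1 \<le> \<mu> * L \<and> sqrt (5 / \<mu>) * nrm u \<le> 1/4"

text \<open>
  \<open>\<Gamma>\<close> is, up to scaling, the ratio of the two components of a solution of the
  Zakharov-Shabat (AKNS) system; the bound 1 selects the solution that decays as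
  \<open>\<mu>\<close> grows. \<open>dual\<close> is the adjoint linearised equation; it expresses the
  first variation of the integral of \<open>u \<Gamma>\<close> with respect to \<open>u\<close>.
\<close>
definition riccati :: "real \<Rightarrow> (real \<Rightarrow> complex) \<Rightarrow> (real \<Rightarrow> complex) \<Rightarrow> bool" where
  "riccati \<mu> u \<Gamma> \<longleftrightarrow> sol \<mu> (\<lambda>x. - (cnj (u x) + 1/2 * u x * (\<Gamma> x)\<^sup>2)) \<Gamma> \<and> (\<forall>x. cmod (\<Gamma> x) \<le> 1)"

definition dual :: "real \<Rightarrow> (real \<Rightarrow> complex) \<Rightarrow> (real \<Rightarrow> complex) \<Rightarrow> (real \<Rightarrow> complex) \<Rightarrow> bool" where
  "dual \<mu> u \<Gamma> \<xi> \<longleftrightarrow> sol (- \<mu>) (\<lambda>x. u x * \<Gamma> x * \<xi> x - u x) \<xi> \<and> (\<forall>x. cmod (\<xi> x) \<le> 1)"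

lemma Cper_intros:
  "Cper (\<lambda>x. c)" "Cper h \<Longrightarrow> Cper (\<lambda>x. cnj (h x))" "Cper h \<Longrightarrow> Cper (\<lambda>x. - h x)"
  "Cper g \<Longrightarrow> Cper h \<Longrightarrow> Cper (\<lambda>x. g x * h x)" "Cper g \<Longrightarrow> Cper h \<Longrightarrow> Cper (\<lambda>x. g x + h x)"
  "Cper g \<Longrightarrow> Cper h \<Longrightarrow> Cper (\<lambda>x. g x - h x)" "Cper h \<Longrightarrow> Cper (\<lambda>x. (h x) ^ n)"
  by (auto simp: periodic_def intro!: continuous_intros)

lemma Cper_L2: "Cper h \<Longrightarrow> h \<in> L2per L"
  by (auto intro: L2_cont)

lemma Cper_ric: "Cper u \<Longrightarrow> Cper \<Gamma> \<Longrightarrow> Cper (\<lambda>x. - (cnj (u x) + 1/2 * u x * (\<Gamma> x)\<^sup>2))"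
  by (intro Cper_intros)

lemma Cper_dual: "Cper u \<Longrightarrow> Cper \<Gamma> \<Longrightarrow> Cper \<xi> \<Longrightarrow> Cper (\<lambda>x. u x * \<Gamma> x * \<xi> x - u x)"
  by (intro Cper_intros)

lemma nrm_bounded_mult:
  assumes "Cper u" "Cper h" "\<And>x. cmod (h x) \<le> K * cmod (u x)" "0 \<le> K"
  shows "nrm h \<le> K * nrm u"
proof -
  have "nrm h \<le> nrm (\<lambda>x. of_real K * u x)"
    using assms by (intro nrm_mono Cper_L2 Cper_intros) (auto simp: norm_mult)
  then show ?thesis using assms(4) unfolding nrm_cmult by simp
qed

lemma sol_small:
  assumes "small \<mu> u" "\<bar>\<nu>\<bar> = \<mu>" "Cper u" "Cper h" "sol \<nu> h g" "\<And>x. cmod (h x) \<le> K * cmod (u x)" "0 \<le> K"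
  shows "cmod (g x) \<le> K / 4"
proof -
  have "cmod (g x) \<le> sqrt (5 / \<bar>\<nu>\<bar>) * nrm h"
    using assms by (intro res_sup sol_ac Cper_L2) (auto simp: small_def)
  also have "\<dots> \<le> sqrt (5 / \<mu>) * (K * nrm u)"
    using nrm_bounded_mult[OF assms(3,4,6,7)] assms(1,2) by (simp add: small_def mult_left_mono)
  also have "\<dots> = K * (sqrt (5 / \<mu>) * nrm u)" by simp
  also have "\<dots> \<le> K * (1/4)"
    using assms(1,7) by (intro mult_left_mono) (auto simp: small_def)
  finally show ?thesis by simp
qed

lemma ric_bound:
  assumes "cmod G \<le> 1"
  shows "cmod (- (cnj z + 1/2 * z * G\<^sup>2)) \<le> 3/2 * cmod z"
proof -
  have "cmod (G\<^sup>2) \<le> 1" using assms by (simp add: norm_power power_le_one)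
  then have "cmod z * cmod (G\<^sup>2) \<le> cmod z * 1" by (intro mult_left_mono) auto
  then show ?thesis
    using norm_triangle_ineq[of "cnj z" "1/2 * z * G\<^sup>2"] unfolding norm_minus_cancel by (simp add: norm_mult norm_power)
qed

lemma dual_bound:
  assumes "cmod G \<le> 1" "cmod X \<le> 1"
  shows "cmod (z * G * X - z) \<le> 2 * cmod z"
proof -
  have "cmod (z * G * X) \<le> cmod z * 1 * 1"
    unfolding norm_mult using assms by (intro mult_mono) auto
  then show ?thesis using norm_triangle_ineq4[of "z * G * X" z] by simp
qed

lemma sqdiff_bound:
  assumes "cmod a \<le> 1" "cmod b \<le> 1" "cmod (a - b) \<le> K"
  shows "cmod (1/2 * z * (a\<^sup>2 - b\<^sup>2)) \<le> K * cmod z"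
proof -
  have "cmod (a\<^sup>2 - b\<^sup>2) = cmod (a - b) * cmod (a + b)"
    by (simp add: norm_mult[symmetric] power2_eq_square algebra_simps)
  also have "\<dots> \<le> K * 2"
    using assms norm_triangle_ineq[of a b] order_trans[OF norm_ge_zero assms(3)] by (intro mult_mono) auto
  finally have "cmod z * cmod (a\<^sup>2 - b\<^sup>2) \<le> cmod z * (K * 2)" by (intro mult_left_mono) auto
  then show ?thesis by (simp add: norm_mult mult.commute mult.left_commute)
qed

text \<open>The quadratic term is frozen and the linear periodic problem solved. On the unit ball
  the source is at most \<open>3/2\<close> times the modulus of \<open>u\<close>, so the image is
  bounded by \<open>3/8\<close>; two sources differ by at most \<open>K\<close> times that modulus,
  which gives the factor \<open>1/4\<close>.\<close>

lemma riccati_ex: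
  assumes s: "small \<mu> u" and u: "Cper u"
  obtains \<Gamma> where "riccati \<mu> u \<Gamma>"
proof -
  define F where "F \<phi> = (SOME g. sol \<mu> (\<lambda>x. - (cnj (u x) + 1/2 * u x * (\<phi> x)\<^sup>2)) g)" for \<phi>
  have \<mu>: "0 < \<mu>" "\<bar>\<mu>\<bar> = \<mu>" using s by (auto simp: small_def)
  have F: "sol \<mu> (\<lambda>x. - (cnj (u x) + 1/2 * u x * (\<phi> x)\<^sup>2)) (F \<phi>)" if p: "Cper \<phi>" for \<phi>
  proof -
    obtain g where "sol \<mu> (\<lambda>x. - (cnj (u x) + 1/2 * u x * (\<phi> x)\<^sup>2)) g"
      by (rule sol_ex[OF Cper_ric[OF u p], of \<mu>]) (use \<mu> in auto)
    then show ?thesis unfolding F_def by (rule someI[of "sol \<mu> (\<lambda>x. - (cnj (u x) + 1/2 * u x * (\<phi> x)\<^sup>2))"])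
  qed
  obtain \<Gamma> where G: "Cper \<Gamma>" "\<And>x. cmod (\<Gamma> x) \<le> 1" "F \<Gamma> = \<Gamma>"
  proof (rule fixed_point[of "1/4" F])
    fix \<phi> assume p: "Cper \<phi>" "\<And>x. cmod (\<phi> x) \<le> 1"
    have "cmod (F \<phi> x) \<le> (3/2) / 4" for x
      using ric_bound[OF p(2)] by (intro sol_small[OF s \<mu>(2) u Cper_ric[OF u p(1)] F[OF p(1)]]) auto
    then have "cmod (F \<phi> x) \<le> 1" for x by (rule order_trans) simp
    then show "Cper (F \<phi>) \<and> (\<forall>x. cmod (F \<phi> x) \<le> 1)"
      using solD(1,2)[OF F[OF p(1)]] by blast
  next
    fix \<phi> \<psi> :: "real \<Rightarrow> complex" and K x
    assume p: "Cper \<phi>" "Cper \<psi>" "\<And>x. cmod (\<phi> x) \<le> 1" "\<And>x. cmod (\<psi> x) \<le> 1" "\<And>x. cmod (\<phi> x - \<psi> x) \<le> K"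
    have K: "0 \<le> K" using p(5) norm_ge_zero order_trans by blast
    have "cmod (F \<phi> x - F \<psi> x) \<le> K / 4"
    proof (rule sol_small[OF s \<mu>(2) u _ sol_lincomb[OF F[OF p(1)] F[OF p(2)]] _ K])
      show "Cper (\<lambda>x. - (cnj (u x) + 1 / 2 * u x * (\<phi> x)\<^sup>2) - - (cnj (u x) + 1 / 2 * u x * (\<psi> x)\<^sup>2))"
        using u p by (intro Cper_intros)
      fix x
      have "- (cnj (u x) + 1 / 2 * u x * (\<phi> x)\<^sup>2) - - (cnj (u x) + 1 / 2 * u x * (\<psi> x)\<^sup>2)
          = 1/2 * u x * ((\<psi> x)\<^sup>2 - (\<phi> x)\<^sup>2)" by (simp add: algebra_simps)
      then show "cmod (- (cnj (u x) + 1 / 2 * u x * (\<phi> x)\<^sup>2) - - (cnj (u x) + 1 / 2 * u x * (\<psi> x)\<^sup>2)) \<le> K * cmod (u x)"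
        using sqdiff_bound[OF p(4) p(3)] p(5) by (simp only: norm_minus_commute)
    qed
    then show "cmod (F \<phi> x - F \<psi> x) \<le> 1/4 * K" by simp
  qed auto
  have "riccati \<mu> u \<Gamma>"
    unfolding riccati_def using F[OF G(1)] G by simp
  then show ?thesis by (rule that)
qed

lemma dual_ex:
  assumes s: "small \<mu> u" and u: "Cper u" and G: "Cper \<Gamma>" "\<And>x. cmod (\<Gamma> x) \<le> 1"
  obtains \<xi> where "dual \<mu> u \<Gamma> \<xi>"
proof -
  define F where "F \<phi> = (SOME g. sol (- \<mu>) (\<lambda>x. u x * \<Gamma> x * \<phi> x - u x) g)" for \<phi>
  have \<mu>: "0 < \<mu>" "\<bar>- \<mu>\<bar> = \<mu>" using s by (auto simp: small_def)
  have F: "sol (- \<mu>) (\<lambda>x. u x * \<Gamma> x * \<phi> x - u x) (F \<phi>)" if p: "Cper \<phi>" for \<phi>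
  proof -
    obtain g where "sol (- \<mu>) (\<lambda>x. u x * \<Gamma> x * \<phi> x - u x) g"
      by (rule sol_ex[OF Cper_dual[OF u G(1) p], of "- \<mu>"]) (use \<mu> in auto)
    then show ?thesis unfolding F_def by (rule someI[of "sol (- \<mu>) (\<lambda>x. u x * \<Gamma> x * \<phi> x - u x)"])
  qed
  obtain \<xi> where X: "Cper \<xi>" "\<And>x. cmod (\<xi> x) \<le> 1" "F \<xi> = \<xi>"
  proof (rule fixed_point[of "1/4" F])
    fix \<phi> assume p: "Cper \<phi>" "\<And>x. cmod (\<phi> x) \<le> 1"
    have "cmod (F \<phi> x) \<le> 2 / 4" for x
      using dual_bound[OF G(2) p(2)] by (intro sol_small[OF s \<mu>(2) u Cper_dual[OF u G(1) p(1)] F[OF p(1)]]) auto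
    then have "cmod (F \<phi> x) \<le> 1" for x by (rule order_trans) simp
    then show "Cper (F \<phi>) \<and> (\<forall>x. cmod (F \<phi> x) \<le> 1)"
      using solD(1,2)[OF F[OF p(1)]] by blast
  next
    fix \<phi> \<psi> :: "real \<Rightarrow> complex" and K x
    assume p: "Cper \<phi>" "Cper \<psi>" "\<And>x. cmod (\<phi> x) \<le> 1" "\<And>x. cmod (\<psi> x) \<le> 1" "\<And>x. cmod (\<phi> x - \<psi> x) \<le> K"
    have K: "0 \<le> K" using p(5) norm_ge_zero order_trans by blast
    have "cmod (F \<phi> x - F \<psi> x) \<le> K / 4"
    proof (rule sol_small[OF s \<mu>(2) u _ sol_lincomb[OF F[OF p(1)] F[OF p(2)]] _ K])
      show "Cper (\<lambda>x. u x * \<Gamma> x * \<phi> x - u x - (u x * \<Gamma> x * \<psi> x - u x))"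
        using u p G by (intro Cper_intros)
      fix x
      have "cmod (u x * \<Gamma> x * \<phi> x - u x - (u x * \<Gamma> x * \<psi> x - u x)) = cmod (u x) * (cmod (\<Gamma> x) * cmod (\<phi> x - \<psi> x))"
        by (simp add: norm_mult[symmetric] algebra_simps)
      also have "\<dots> \<le> cmod (u x) * (1 * K)"
        using p(5) G(2) K by (intro mult_left_mono mult_mono) auto
      finally show "cmod (u x * \<Gamma> x * \<phi> x - u x - (u x * \<Gamma> x * \<psi> x - u x)) \<le> K * cmod (u x)"
        by (simp add: mult.commute)
    qed
    then show "cmod (F \<phi> x - F \<psi> x) \<le> 1/4 * K" by simp
  qed auto
  have "dual \<mu> u \<Gamma> \<xi>"
    unfolding dual_def using F[OF X(1)] X by simp
  then show ?thesis by (rule that)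
qed

lemma riccatiD:
  assumes "riccati \<mu> u \<Gamma>"
  shows "Cper \<Gamma>" "cmod (\<Gamma> x) \<le> 1" "sol \<mu> (\<lambda>x. - (cnj (u x) + 1/2 * u x * (\<Gamma> x)\<^sup>2)) \<Gamma>"
  using assms solD(1,2) unfolding riccati_def by blast+

lemma dualD:
  assumes "dual \<mu> u \<Gamma> \<xi>"
  shows "Cper \<xi>" "cmod (\<xi> x) \<le> 1" "sol (- \<mu>) (\<lambda>x. u x * \<Gamma> x * \<xi> x - u x) \<xi>"
  using assms solD(1,2) unfolding dual_def by blast+

text \<open>A full power of \<open>1/\<mu>\<close>, better than the smallness used for existence:
  once the solution is known to have modulus at most 1, its source is controlled by \<open>u\<close>
  alone and the linear estimates apply again.\<close>

lemma riccati_bounds: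
  assumes s: "small \<mu> u" and u: "Cper u" and r: "riccati \<mu> u \<Gamma>"
  shows "\<mu> * nrm \<Gamma> \<le> 3/2 * nrm u" "(\<And>x. cmod (u x) \<le> A) \<Longrightarrow> \<mu> * cmod (\<Gamma> x) \<le> 3/2 * A"
proof -
  have \<mu>: "0 < \<mu>" using s by (simp add: small_def)
  note G = riccatiD[OF r] and C = Cper_ric[OF u riccatiD(1)[OF r]]
  have "\<bar>\<mu>\<bar> * nrm \<Gamma> \<le> nrm (\<lambda>x. - (cnj (u x) + 1/2 * u x * (\<Gamma> x)\<^sup>2))"
    by (rule res_nrm[OF sol_ac[OF G(3) C] Cper_L2[OF C]])
  also have "\<dots> \<le> 3/2 * nrm u"
    by (rule nrm_bounded_mult[OF u C]) (use ric_bound G(2) in auto)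
  finally show "\<mu> * nrm \<Gamma> \<le> 3/2 * nrm u" using \<mu> by simp
  assume A: "\<And>x. cmod (u x) \<le> A"
  have "\<bar>\<mu>\<bar> * cmod (\<Gamma> x) \<le> 3/2 * A"
  proof (rule sol_sup[OF G(3)])
    fix x
    show "cmod (- (cnj (u x) + 1/2 * u x * (\<Gamma> x)\<^sup>2)) \<le> 3/2 * A"
      by (rule order_trans[OF ric_bound[OF G(2)]]) (use A[of x] in simp)
  qed
  then show "\<mu> * cmod (\<Gamma> x) \<le> 3/2 * A" using \<mu> by simp
qed

lemma dual_bounds:
  assumes s: "small \<mu> u" and u: "Cper u" and G: "Cper \<Gamma>" "\<And>x. cmod (\<Gamma> x) \<le> 1" and r: "dual \<mu> u \<Gamma> \<xi>"
  shows "\<mu> * nrm \<xi> \<le> 2 * nrm u" "(\<And>x. cmod (u x) \<le> A) \<Longrightarrow> \<mu> * cmod (\<xi> x) \<le> 2 * A"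
proof -
  have \<mu>: "0 < \<mu>" using s by (simp add: small_def)
  note X = dualD[OF r] and C = Cper_dual[OF u G(1) dualD(1)[OF r]]
  have "\<bar>- \<mu>\<bar> * nrm \<xi> \<le> nrm (\<lambda>x. u x * \<Gamma> x * \<xi> x - u x)"
    by (rule res_nrm[OF sol_ac[OF X(3) C] Cper_L2[OF C]])
  also have "\<dots> \<le> 2 * nrm u"
    by (rule nrm_bounded_mult[OF u C]) (use dual_bound G(2) X(2) in auto)
  finally show "\<mu> * nrm \<xi> \<le> 2 * nrm u" using \<mu> by simp
  assume A: "\<And>x. cmod (u x) \<le> A"
  have "\<bar>- \<mu>\<bar> * cmod (\<xi> x) \<le> 2 * A"
  proof (rule sol_sup[OF X(3)])
    fix x
    show "cmod (u x * \<Gamma> x * \<xi> x - u x) \<le> 2 * A"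
      by (rule order_trans[OF dual_bound[OF G(2) X(2)]]) (use A[of x] in simp)
  qed
  then show "\<mu> * cmod (\<xi> x) \<le> 2 * A" using \<mu> by simp
qed

lemma Cper_int: "Cper h \<Longrightarrow> integrable M h"
  by (rule int_L2(1)[OF Cper_L2])

lemma ac_Cper: "ac v g \<Longrightarrow> Cper v"
  using acD(1,2) by blast

lemma L2_Cper_mult: "g \<in> L2per L \<Longrightarrow> Cper b \<Longrightarrow> (\<lambda>x. b x * g x) \<in> L2per L"
  by (rule L2_cont_mult) auto

lemma CS3:
  assumes "h \<in> L2per L" "k \<in> L2per L" "Cper b" "\<And>x. cmod (b x) \<le> B"
  shows "cmod (LINT x|M. b x * (h x * k x)) \<le> B * (nrm h * nrm k)"
proof -
  have B: "0 \<le> B" using assms(4) norm_ge_zero order_trans by blast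
  have "cmod (LINT x|M. (b x * h x) * k x) \<le> nrm (\<lambda>x. b x * h x) * nrm k"
    by (intro CS L2_Cper_mult assms)
  also have "\<dots> \<le> (B * nrm h) * nrm k"
    by (intro mult_right_mono nrm_bmult L2_Cper_mult assms) auto
  finally show ?thesis by (simp add: mult.assoc)
qed

definition cub :: "(real \<Rightarrow> complex) \<Rightarrow> real \<Rightarrow> complex" where
  "cub u x = complex_of_real ((cmod (u x))\<^sup>2) * u x"

lemma cub_eq: "cub u x = u x * cnj (u x) * u x"
  by (simp add: cub_def complex_norm_square del: of_real_power)

lemma Cper_cub: "Cper u \<Longrightarrow> Cper (cub u)"
  unfolding cub_eq[abs_def] by (intro Cper_intros)

text \<open>
  The weak form of \<open>u\<^sub>t\<close> tested against \<open>\<phi>\<close>, with derivative \<open>\<phi>'\<close>.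
\<close>
definition flow :: "real \<Rightarrow> (real \<Rightarrow> complex) \<Rightarrow> (real \<Rightarrow> complex) \<Rightarrow> (real \<Rightarrow> complex) \<Rightarrow> (real \<Rightarrow> complex) \<Rightarrow> (real \<Rightarrow> complex) \<Rightarrow> complex" where
  "flow lam f u ux \<phi> \<phi>' = \<i> * (- (LINT x|M. ux x * \<phi>' x) + (LINT x|M. cub u x * \<phi> x) - (LINT x|M. f x * \<phi> x))
     - of_real lam * (LINT x|M. u x * \<phi> x)"

end

subsection \<open>Identities at a fixed time\<close>

locale lax_pair = torus +
  fixes mu A :: real and u ux f G X g l k1 k2 :: "real \<Rightarrow> complex"
  assumes ac_u: "ac u ux" and fL: "f \<in> L2per L" and small: "small mu u"
    and ric: "riccati mu u G" and dua: "dual mu u G X"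
    and gs: "sol mu (\<lambda>x. cnj (u x)) g" and ls: "sol (- mu) u l"
    and k1: "ac k1 (\<lambda>x. f x - of_real mu * k1 x)" and k2: "ac k2 (\<lambda>x. f x - of_real (- mu) * k2 x)"
    and A: "\<And>x. cmod (u x) \<le> A"
begin

abbreviation "\<mu> \<equiv> complex_of_real mu"

lemma mu_pos: "0 < mu" using small by (simp add: small_def)

lemma A_nonneg: "0 \<le> A" using A norm_ge_zero order_trans by blast

lemma Cu: "Cper u" and CG: "Cper G" and CX: "Cper X"
  using ac_Cper[OF ac_u] riccatiD(1)[OF ric] dualD(1)[OF dua] by auto

lemma Cg: "Cper g" and Cl: "Cper l"
  using solD(1,2)[OF gs] solD(1,2)[OF ls] by auto

lemma uxL: "ux \<in> L2per L" using acD(3)[OF ac_u] .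

text \<open>
  The differential of \<open>alpha\<close> at \<open>u\<close> sends \<open>v\<close> to the integral of
  \<open>v a - cnj v X\<close>. As the parameter grows, \<open>a\<close> and \<open>X\<close> approach
  \<open>- g\<close> and \<open>- l\<close>, so \<open>a3\<close> and \<open>X3\<close> are the cubic remainders. The function
  \<open>psi\<close> is a resolvent regularisation of the forcing.
\<close>
definition "a x = G x - 1/2 * X x * (G x)\<^sup>2"
definition "c x = 1 - G x * X x"
definition "psi x = (\<mu> / 2) * (k1 x - k2 x)"
definition "dpsi x = - (\<mu>\<^sup>2 / 2) * (k1 x + k2 x)"
definition "alpha = (LINT x|M. u x * G x)"
definition "a3 x = a x + g x"
definition "X3 x = X x + l x"
definition "rho x = G x + g x"
definition "p x = cnj (u x) - \<mu> * g x"

lemma Ca: "Cper a" and Cc: "Cper c" and Crho: "Cper rho" and Ca3: "Cper a3" and CX3: "Cper X3"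
  unfolding a_def[abs_def] c_def[abs_def] rho_def[abs_def] a3_def[abs_def] X3_def[abs_def]
  by (intro Cper_intros CG CX Cg Cl)+

lemma ac_G: "ac G (\<lambda>x. - (cnj (u x) + 1/2 * u x * (G x)\<^sup>2) - \<mu> * G x)"
  by (rule sol_ac[OF riccatiD(3)[OF ric] Cper_ric[OF Cu CG]])

lemma ac_X: "ac X (\<lambda>x. \<mu> * X x - u x * c x)"
proof -
  have "(\<lambda>x. u x * G x * X x - u x - of_real (- mu) * X x) = (\<lambda>x. \<mu> * X x - u x * c x)"
    by (auto simp: c_def algebra_simps)
  then show ?thesis using sol_ac[OF dualD(3)[OF dua] Cper_dual[OF Cu CG CX]] by simp
qed

text \<open>Its mean says that \<open>u a\<close> and \<open>- cnj u X\<close> have the same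
  integral, which is the invariance of \<open>alpha\<close> under rotating the phase of
  \<open>u\<close>. That is how the damping contribution in \<open>flow_alpha\<close> is
  evaluated.\<close>

lemma ac_c: "ac c (\<lambda>x. cnj (u x) * X x + u x * a x)"
proof -
  have "ac (\<lambda>x. 1 - G x * X x) (\<lambda>x. 0 - (G x * (\<mu> * X x - u x * c x) + (- (cnj (u x) + 1/2 * u x * (G x)\<^sup>2) - \<mu> * G x) * X x))"
    by (intro ac_diff ac_const ac_mult ac_G ac_X)
  moreover have "(\<lambda>x. 0 - (G x * (\<mu> * X x - u x * c x) + (- (cnj (u x) + 1/2 * u x * (G x)\<^sup>2) - \<mu> * G x) * X x))
      = (\<lambda>x. cnj (u x) * X x + u x * a x)"
    by (auto simp: c_def a_def algebra_simps power2_eq_square)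
  ultimately show ?thesis by (simp add: c_def[abs_def])
qed

lemma ac_a: "ac a (\<lambda>x. - \<mu> * a x - cnj (u x) * c x)"
proof -
  let ?dG = "\<lambda>x. - (cnj (u x) + 1/2 * u x * (G x)\<^sup>2) - \<mu> * G x"
  have "ac (\<lambda>x. G x - 1/2 * (X x * (G x * G x))) (\<lambda>x. ?dG x - 1/2 * (X x * (G x * ?dG x + ?dG x * G x) + (\<mu> * X x - u x * c x) * (G x * G x)))"
    by (intro ac_diff ac_cmult ac_mult ac_G ac_X)
  moreover have "(\<lambda>x. ?dG x - 1/2 * (X x * (G x * ?dG x + ?dG x * G x) + (\<mu> * X x - u x * c x) * (G x * G x)))
      = (\<lambda>x. - \<mu> * a x - cnj (u x) * c x)"
    by (auto simp: c_def a_def algebra_simps power2_eq_square)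
  moreover have "(\<lambda>x. G x - 1/2 * (X x * (G x * G x))) = a"
    by (auto simp: a_def power2_eq_square)
  ultimately show ?thesis by simp
qed

text \<open>
  The undamped, unforced flow leaves the real part of \<open>alpha\<close> invariant: the integrand
  of its time derivative is the derivative of the flux appearing in the proof.
\<close>
lemma conservation:
  "- (LINT x|M. ux x * (- \<mu> * a x - cnj (u x) * c x)) - (LINT x|M. cnj (ux x) * (\<mu> * X x - u x * c x))
    + (LINT x|M. cub u x * a x) + (LINT x|M. cnj (cub u x) * X x) = 0"
proof -
  let ?da = "\<lambda>x. - \<mu> * a x - cnj (u x) * c x" and ?dX = "\<lambda>x. \<mu> * X x - u x * c x" and ?dc = "\<lambda>x. cnj (u x) * X x + u x * a x"
  note cu = ac_cnj[OF ac_u]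
  have W: "ac (\<lambda>x. \<mu> * (u x * a x - cnj (u x) * X x) + (u x * (cnj (u x) * c x) + \<mu>\<^sup>2 * c x))
     (\<lambda>x. \<mu> * ((u x * ?da x + ux x * a x) - (cnj (u x) * ?dX x + cnj (ux x) * X x))
       + ((u x * (cnj (u x) * ?dc x + cnj (ux x) * c x) + ux x * (cnj (u x) * c x)) + \<mu>\<^sup>2 * ?dc x))"
    by (intro ac_add ac_diff ac_cmult ac_mult ac_u cu ac_a ac_X ac_c)
  have eq: "(\<lambda>x. \<mu> * ((u x * ?da x + ux x * a x) - (cnj (u x) * ?dX x + cnj (ux x) * X x))
       + ((u x * (cnj (u x) * ?dc x + cnj (ux x) * c x) + ux x * (cnj (u x) * c x)) + \<mu>\<^sup>2 * ?dc x))
     = (\<lambda>x. ((- (ux x * ?da x) - cnj (ux x) * ?dX x) + cub u x * a x) + cnj (cub u x) * X x)"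
    by (auto simp: cub_eq algebra_simps power2_eq_square)
  have i: "integrable M (\<lambda>x. ux x * ?da x)" "integrable M (\<lambda>x. cnj (ux x) * ?dX x)"
    "integrable M (\<lambda>x. cub u x * a x)" "integrable M (\<lambda>x. cnj (cub u x) * X x)"
    by (intro int_mult L2_cnj uxL Cper_L2 Cper_intros Cper_cub Cu Ca Cc CX)+
  have "(LINT x|M. ((- (ux x * ?da x) - cnj (ux x) * ?dX x) + cub u x * a x) + cnj (cub u x) * X x) = 0"
    using ac_mean[OF W] unfolding eq .
  then show ?thesis
    using i by (simp only: Bochner_Integration.integral_add Bochner_Integration.integral_diff Bochner_Integration.integral_minus
      Bochner_Integration.integrable_add Bochner_Integration.integrable_diff Bochner_Integration.integrable_minus)
qed

lemma cnj_LINT: "cnj (LINT x|M. h x) = (LINT x|M. cnj (h x))" for h :: "real \<Rightarrow> complex"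
  by simp

text \<open>\<open>conservation\<close> removes the dispersive and cubic parts, leaving damping and
  forcing. If \<open>alpha\<close> were exactly quadratic in \<open>u\<close>, damping would give
  \<open>- 2 lam alpha\<close>; the integral of \<open>u X G\<^sup>2\<close> is the correction, of
  fourth order. The second flow is conjugated because the differential of \<open>alpha\<close> is
  only real-linear.\<close>

lemma flow_alpha:
  "flow lam f u ux a (\<lambda>x. - \<mu> * a x - cnj (u x) * c x)
    - cnj (flow lam f u ux (\<lambda>x. cnj (X x)) (\<lambda>x. cnj (\<mu> * X x - u x * c x)))
   = - 2 * of_real lam * alpha + of_real lam * (LINT x|M. u x * X x * (G x)\<^sup>2)
     - \<i> * ((LINT x|M. f x * a x) + (LINT x|M. cnj (f x) * X x))"
proof -
  let ?da = "\<lambda>x. - \<mu> * a x - cnj (u x) * c x" and ?dX = "\<lambda>x. \<mu> * X x - u x * c x"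
  have i: "integrable M (\<lambda>x. u x * a x)" "integrable M (\<lambda>x. cnj (u x) * X x)" "integrable M (\<lambda>x. u x * G x)"
     "integrable M (\<lambda>x. u x * X x * (G x)\<^sup>2)"
    by (intro Cper_int Cper_intros Cu Ca CX CG)+
  have h: "(LINT x|M. u x * a x) - (LINT x|M. cnj (u x) * X x) = 2 * alpha - (LINT x|M. u x * X x * (G x)\<^sup>2)"
  proof -
    have "0 = (LINT x|M. cnj (u x) * X x + u x * a x)" by (rule ac_mean[OF ac_c, symmetric])
    also have "\<dots> = (LINT x|M. cnj (u x) * X x) + (LINT x|M. u x * a x)"
      by (rule Bochner_Integration.integral_add[OF i(2,1)])
    finally have 1: "(LINT x|M. cnj (u x) * X x) = - (LINT x|M. u x * a x)" by (simp add: add_eq_0_iff)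
    have "(LINT x|M. u x * a x) = (LINT x|M. u x * G x - (1/2) * (u x * X x * (G x)\<^sup>2))"
      by (intro Bochner_Integration.integral_cong) (auto simp: a_def algebra_simps)
    also have "\<dots> = alpha - (1/2) * (LINT x|M. u x * X x * (G x)\<^sup>2)"
      using i unfolding alpha_def by (simp only: Bochner_Integration.integral_diff integrable_mult_right integral_mult_right_zero)
    finally show ?thesis using 1 by simp
  qed
  have eqs: "cnj (LINT x|M. ux x * cnj (?dX x)) = (LINT x|M. cnj (ux x) * ?dX x)"
     "cnj (LINT x|M. cub u x * cnj (X x)) = (LINT x|M. cnj (cub u x) * X x)"
     "cnj (LINT x|M. f x * cnj (X x)) = (LINT x|M. cnj (f x) * X x)"
     "cnj (LINT x|M. u x * cnj (X x)) = (LINT x|M. cnj (u x) * X x)"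
    by (simp_all only: cnj_LINT complex_cnj_mult complex_cnj_cnj)
  have cn: "cnj (flow lam f u ux (\<lambda>x. cnj (X x)) (\<lambda>x. cnj (?dX x))) =
     - \<i> * (- (LINT x|M. cnj (ux x) * ?dX x) + (LINT x|M. cnj (cub u x) * X x) - (LINT x|M. cnj (f x) * X x))
     - of_real lam * (LINT x|M. cnj (u x) * X x)"
  proof -
    define P Q R S where d: "P = (LINT x|M. ux x * cnj (?dX x))" "Q = (LINT x|M. cub u x * cnj (X x))"
      "R = (LINT x|M. f x * cnj (X x))" "S = (LINT x|M. u x * cnj (X x))"
    have "flow lam f u ux (\<lambda>x. cnj (X x)) (\<lambda>x. cnj (?dX x)) = \<i> * (- P + Q - R) - of_real lam * S"
      unfolding flow_def d ..
    then have "cnj (flow lam f u ux (\<lambda>x. cnj (X x)) (\<lambda>x. cnj (?dX x))) = - \<i> * (- cnj P + cnj Q - cnj R) - of_real lam * cnj S"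
      by simp
    then show ?thesis unfolding eqs[folded d] .
  qed
  define I1 I2 I3 I4 F1 F2 where d: "I1 = (LINT x|M. ux x * ?da x)" "I2 = (LINT x|M. cnj (ux x) * ?dX x)"
    "I3 = (LINT x|M. cub u x * a x)" "I4 = (LINT x|M. cnj (cub u x) * X x)"
    "F1 = (LINT x|M. f x * a x)" "F2 = (LINT x|M. cnj (f x) * X x)"
  have 0: "- I1 - I2 + I3 + I4 = 0" using conservation unfolding d .
  have "flow lam f u ux a ?da - cnj (flow lam f u ux (\<lambda>x. cnj (X x)) (\<lambda>x. cnj (?dX x)))
     = \<i> * (- I1 - I2 + I3 + I4) - \<i> * (F1 + F2) - of_real lam * ((LINT x|M. u x * a x) - (LINT x|M. cnj (u x) * X x))"
    unfolding cn unfolding flow_def d[symmetric] by (simp add: algebra_simps)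
  then show ?thesis unfolding 0 h d[symmetric] by (simp add: algebra_simps)
qed

lemma ac_psi: "ac psi dpsi"
proof -
  have "ac (\<lambda>x. (\<mu> / 2) * (k1 x - k2 x)) (\<lambda>x. (\<mu> / 2) * ((f x - of_real mu * k1 x) - (f x - of_real (- mu) * k2 x)))"
    by (intro ac_cmult ac_diff k1 k2)
  moreover have "(\<lambda>x. (\<mu> / 2) * ((f x - of_real mu * k1 x) - (f x - of_real (- mu) * k2 x))) = dpsi"
    by (auto simp: dpsi_def algebra_simps power2_eq_square)
  ultimately show ?thesis by (simp add: psi_def[abs_def])
qed

text \<open>The two first-order resolvents combine to a second-order one:
  \<open>psi'' = mu\<^sup>2 (psi - f)\<close>. So \<open>psi\<close> is smooth enough to be tested
  against the equation, and its dispersive term is an explicit pairing of order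
  \<open>mu\<^sup>2\<close>.\<close>

lemma ac_dpsi: "ac dpsi (\<lambda>x. \<mu>\<^sup>2 * (psi x - f x))"
proof -
  have "ac (\<lambda>x. - (\<mu>\<^sup>2 / 2) * (k1 x + k2 x)) (\<lambda>x. - (\<mu>\<^sup>2 / 2) * ((f x - of_real mu * k1 x) + (f x - of_real (- mu) * k2 x)))"
    by (intro ac_cmult ac_add k1 k2)
  moreover have "(\<lambda>x. - (\<mu>\<^sup>2 / 2) * ((f x - of_real mu * k1 x) + (f x - of_real (- mu) * k2 x))) = (\<lambda>x. \<mu>\<^sup>2 * (psi x - f x))"
    by (auto simp: psi_def algebra_simps power2_eq_square)
  ultimately show ?thesis by (simp add: dpsi_def[abs_def])
qed

lemma Cpsi: "Cper psi" by (rule ac_Cper[OF ac_psi])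

lemma nrm_psi: "nrm psi \<le> nrm f"
proof -
  have "nrm psi = mu / 2 * nrm (\<lambda>x. k1 x - k2 x)"
    unfolding psi_def[abs_def] nrm_cmult using mu_pos by (simp add: norm_divide)
  also have "\<dots> \<le> mu / 2 * (nrm k1 + nrm k2)"
    using mu_pos by (intro mult_left_mono nrm_triangle_diff acD[OF k1] acD[OF k2]) auto
  also have "\<dots> = (\<bar>mu\<bar> * nrm k1 + \<bar>- mu\<bar> * nrm k2) / 2"
    using mu_pos by (simp add: distrib_left add_divide_distrib)
  also have "\<dots> \<le> (nrm f + nrm f) / 2"
    by (intro divide_right_mono add_mono res_nrm[OF k1 fL] res_nrm[OF k2 fL]) simp
  finally show ?thesis by simp
qed

text \<open>The leading forcing term of \<open>alpha\<close> involves the resolvents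
  \<open>g\<close> and \<open>l\<close> of \<open>u\<close>. Moving them onto the forcing by
  \<open>res_adj\<close> turns them into \<open>k1\<close> and \<open>k2\<close>, whose difference
  is \<open>psi\<close>.\<close>

lemma forcing_cancel:
  "mu * Im ((LINT x|M. f x * g x) + (LINT x|M. cnj (f x) * l x)) = 2 * Im (LINT x|M. cnj (u x) * psi x)"
proof -
  have acg: "ac g (\<lambda>x. cnj (u x) - of_real mu * g x)" and acl: "ac l (\<lambda>x. u x - of_real (- mu) * l x)"
    by (intro sol_ac gs ls Cper_intros Cu)+
  have uL: "u \<in> L2per L" "(\<lambda>x. cnj (u x)) \<in> L2per L" by (intro Cper_L2 Cper_intros Cu)+
  have k1c: "ac (\<lambda>x. cnj (k1 x)) (\<lambda>x. cnj (f x) - of_real (- (- mu)) * cnj (k1 x))"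
    using ac_cnj[OF k1] by simp
  have 1: "(LINT x|M. f x * g x) = - (LINT x|M. cnj (u x) * k2 x)"
    using res_adj[OF acg k2 uL(2) fL] by (simp add: mult.commute)
  have 2: "(LINT x|M. cnj (f x) * l x) = - (LINT x|M. u x * cnj (k1 x))"
    using res_adj[OF acl k1c uL(1) L2_cnj[OF fL]] by (simp add: mult.commute)
  have 3: "Im (LINT x|M. u x * cnj (k1 x)) = - Im (LINT x|M. cnj (u x) * k1 x)"
  proof -
    have "(LINT x|M. u x * cnj (k1 x)) = cnj (LINT x|M. cnj (u x) * k1 x)"
      unfolding cnj_LINT by simp
    then show ?thesis by simp
  qed
  have i: "integrable M (\<lambda>x. cnj (u x) * k1 x)" "integrable M (\<lambda>x. cnj (u x) * k2 x)"
    by (intro int_mult uL acD[OF k1] acD[OF k2])+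
  have "(LINT x|M. cnj (u x) * psi x) = (LINT x|M. (\<mu> / 2) * (cnj (u x) * k1 x - cnj (u x) * k2 x))"
    unfolding psi_def by (simp only: right_diff_distrib mult.left_commute[of "cnj (u _)" "\<mu> / 2"])
  also have "\<dots> = of_real (mu / 2) * ((LINT x|M. cnj (u x) * k1 x) - (LINT x|M. cnj (u x) * k2 x))"
    using i by simp
  finally have "Im (LINT x|M. cnj (u x) * psi x) = mu / 2 * (Im (LINT x|M. cnj (u x) * k1 x) - Im (LINT x|M. cnj (u x) * k2 x))"
    by (simp only: Im_complex_of_real Re_complex_of_real times_complex.sel minus_complex.sel)
  then show ?thesis using 1 2 3 by (simp add: algebra_simps)
qed

text \<open>
  \<open>mu\<^sup>2 (|u|\<^sup>2 + mu Re alpha)\<close> approximates the energy. The term with \<open>psi\<close> cancels what the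
  forcing contributes at order \<open>mu\<^sup>2\<close> to the time derivative, so that the remainder
  \<open>GG\<close> stays bounded as \<open>mu\<close> grows.
\<close>
definition "GG lam = lam * mu ^ 3 * Re (LINT x|M. u x * X x * (G x)\<^sup>2) + 2 * lam * Re (LINT x|M. u x * cnj (psi x))
   - 2 * Im (LINT x|M. cub u x * cnj (psi x)) + 2 * Im (LINT x|M. f x * cnj (psi x))
   + mu ^ 3 * Im ((LINT x|M. f x * a3 x) + (LINT x|M. cnj (f x) * X3 x))"

definition "JJ = mu\<^sup>2 * ((nrm u)\<^sup>2 + mu * Re alpha) + 2 * Re (LINT x|M. u x * cnj (psi x))"

text \<open>All forcing terms of order \<open>mu\<^sup>2\<close> cancel: the mass produces the
  pairing with \<open>f\<close>, the equation of \<open>psi\<close> trades it for the pairing with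
  \<open>psi\<close>, and \<open>forcing_cancel\<close> removes that one. The pairing with
  \<open>psi\<close> is linear in \<open>u\<close> and hence damped at rate \<open>lam\<close> only,
  which leaves the second term of \<open>GG\<close>.\<close>

lemma evolution_identity:
  "mu\<^sup>2 * (2 * Re (flow lam f u ux (\<lambda>x. cnj (u x)) (\<lambda>x. cnj (ux x)))
      + mu * Re (flow lam f u ux a (\<lambda>x. - \<mu> * a x - cnj (u x) * c x)
         - cnj (flow lam f u ux (\<lambda>x. cnj (X x)) (\<lambda>x. cnj (\<mu> * X x - u x * c x)))))
    + 2 * Re (flow lam f u ux (\<lambda>x. cnj (psi x)) (\<lambda>x. cnj (dpsi x)))
   = - 2 * lam * JJ + GG lam"
proof -
  have uL: "u \<in> L2per L" "(\<lambda>x. cnj (u x)) \<in> L2per L" by (intro Cper_L2 Cper_intros Cu)+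
  have self: "(LINT x|M. v x * cnj (v x)) = of_real ((nrm v)\<^sup>2)" for v
    unfolding nrm_sq by (subst integral_complex_of_real[symmetric]) (simp add: complex_norm_square del: of_real_power)
  have quart: "Im (LINT x|M. cub u x * cnj (u x)) = 0"
  proof -
    have "(LINT x|M. cub u x * cnj (u x)) = (LINT x|M. of_real ((cmod (u x)) ^ 4))"
      by (intro Bochner_Integration.integral_cong refl)
        (simp add: cub_def complex_norm_square[symmetric] mult.assoc power_add[symmetric] flip: of_real_power of_real_mult)
    then show ?thesis by (simp only: integral_complex_of_real Im_complex_of_real)
  qed
  have m: "Re (flow lam f u ux (\<lambda>x. cnj (u x)) (\<lambda>x. cnj (ux x))) = Im (LINT x|M. f x * cnj (u x)) - lam * (nrm u)\<^sup>2"
    unfolding flow_def self using quart by simp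
  have dp: "(LINT x|M. ux x * cnj (dpsi x)) = - \<mu>\<^sup>2 * ((LINT x|M. u x * cnj (psi x)) - (LINT x|M. u x * cnj (f x)))"
  proof -
    have i: "integrable M (\<lambda>x. u x * cnj (psi x))" "integrable M (\<lambda>x. u x * cnj (f x))"
      by (intro int_mult uL L2_cnj Cper_L2 Cpsi fL)+
    have "(LINT x|M. ux x * cnj (dpsi x)) = - (LINT x|M. u x * cnj (\<mu>\<^sup>2 * (psi x - f x)))"
      using ac_parts[OF ac_u ac_cnj[OF ac_dpsi]] by simp
    also have "(LINT x|M. u x * cnj (\<mu>\<^sup>2 * (psi x - f x))) = (LINT x|M. \<mu>\<^sup>2 * (u x * cnj (psi x) - u x * cnj (f x)))"
      by (intro Bochner_Integration.integral_cong) (auto simp: algebra_simps)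
    also have "\<dots> = \<mu>\<^sup>2 * ((LINT x|M. u x * cnj (psi x)) - (LINT x|M. u x * cnj (f x)))"
      using i by simp
    finally show ?thesis by simp
  qed
  have fi: "integrable M (\<lambda>x. f x * a x)" "integrable M (\<lambda>x. f x * g x)"
     "integrable M (\<lambda>x. cnj (f x) * X x)" "integrable M (\<lambda>x. cnj (f x) * l x)"
    by (intro int_mult L2_cnj fL Cper_L2 Ca CX Cg Cl)+
  have fa: "(LINT x|M. f x * a x) = (LINT x|M. f x * a3 x) - (LINT x|M. f x * g x)"
    using Bochner_Integration.integral_add[OF fi(1,2)] by (simp add: a3_def distrib_left)
  have fX: "(LINT x|M. cnj (f x) * X x) = (LINT x|M. cnj (f x) * X3 x) - (LINT x|M. cnj (f x) * l x)"
    using Bochner_Integration.integral_add[OF fi(3,4)] by (simp add: X3_def distrib_left)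
  have s1: "Im (LINT x|M. f x * cnj (u x)) = - Im (LINT x|M. u x * cnj (f x))"
  proof -
    have "(LINT x|M. f x * cnj (u x)) = cnj (LINT x|M. u x * cnj (f x))"
      unfolding cnj_LINT by (simp add: mult.commute)
    then show ?thesis by simp
  qed
  have s2: "Im (LINT x|M. cnj (u x) * psi x) = - Im (LINT x|M. u x * cnj (psi x))"
  proof -
    have "(LINT x|M. cnj (u x) * psi x) = cnj (LINT x|M. u x * cnj (psi x))"
      unfolding cnj_LINT by simp
    then show ?thesis by simp
  qed
  have mu2: "\<mu>\<^sup>2 = of_real (mu\<^sup>2)" by simp
  have p: "Re (flow lam f u ux (\<lambda>x. cnj (psi x)) (\<lambda>x. cnj (dpsi x)))
     = - mu\<^sup>2 * (Im (LINT x|M. u x * cnj (psi x)) - Im (LINT x|M. u x * cnj (f x)))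
       - Im (LINT x|M. cub u x * cnj (psi x)) + Im (LINT x|M. f x * cnj (psi x)) - lam * Re (LINT x|M. u x * cnj (psi x))"
    unfolding flow_def dp mu2
    by (simp only: times_complex.sel minus_complex.sel plus_complex.sel uminus_complex.sel Re_complex_of_real Im_complex_of_real
        imaginary_unit.sel) (simp add: algebra_simps)
  have q: "Re (flow lam f u ux a (\<lambda>x. - \<mu> * a x - cnj (u x) * c x)
         - cnj (flow lam f u ux (\<lambda>x. cnj (X x)) (\<lambda>x. cnj (\<mu> * X x - u x * c x))))
     = - 2 * lam * Re alpha + lam * Re (LINT x|M. u x * X x * (G x)\<^sup>2)
       + Im ((LINT x|M. f x * a3 x) + (LINT x|M. cnj (f x) * X3 x)) - Im ((LINT x|M. f x * g x) + (LINT x|M. cnj (f x) * l x))"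
    unfolding flow_alpha fa fX by simp
  have fc: "mu ^ 3 * Im ((LINT x|M. f x * g x) + (LINT x|M. cnj (f x) * l x)) = - 2 * mu\<^sup>2 * Im (LINT x|M. u x * cnj (psi x))"
    using arg_cong[OF forcing_cancel, of "\<lambda>z. mu\<^sup>2 * z"] unfolding s2 by (simp add: power3_eq_cube power2_eq_square)
  define V W Q R S Y where "V = Im ((LINT x|M. f x * g x) + (LINT x|M. cnj (f x) * l x))"
    and "W = Im ((LINT x|M. f x * a3 x) + (LINT x|M. cnj (f x) * X3 x))"
    and "Q = Re (LINT x|M. u x * X x * (G x)\<^sup>2)" and "R = Re alpha"
    and "S = Im (LINT x|M. u x * cnj (psi x))" and "Y = Im (LINT x|M. u x * cnj (f x))"
  show ?thesis
    unfolding m q p JJ_def GG_def s1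
    using fc unfolding V_def[symmetric] W_def[symmetric] Q_def[symmetric] R_def[symmetric] S_def[symmetric] Y_def[symmetric]
    by (simp add: algebra_simps power2_eq_square power3_eq_cube)
qed

end

section \<open>Bounds uniform in the parameter, and limits as it grows\<close>

lemma (in torus) nrm_add_sq:
  assumes "v \<in> L2per L" "w \<in> L2per L"
  shows "(nrm (\<lambda>x. v x + w x))\<^sup>2 = (nrm v)\<^sup>2 + (nrm w)\<^sup>2 + 2 * Re (LINT x|M. v x * cnj (w x))"
proof -
  note i = L2D(4)[OF assms(1)] L2D(4)[OF assms(2)] int_mult(1)[OF assms(1) L2_cnj[OF assms(2)]]
  have ri: "integrable M (\<lambda>x. Re (v x * cnj (w x)))" by (rule integrable_Re[OF i(3)])
  have "(nrm (\<lambda>x. v x + w x))\<^sup>2 = (LINT x|M. ((cmod (v x))\<^sup>2 + (cmod (w x))\<^sup>2) + 2 * Re (v x * cnj (w x)))"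
    unfolding nrm_sq by (intro Bochner_Integration.integral_cong refl) (simp only: cmod_power2, simp add: power2_eq_square algebra_simps)
  also have "\<dots> = (nrm v)\<^sup>2 + (nrm w)\<^sup>2 + 2 * (LINT x|M. Re (v x * cnj (w x)))"
    using i ri unfolding nrm_sq
    by (simp only: Bochner_Integration.integral_add Bochner_Integration.integrable_add integral_mult_right_zero integrable_mult_right)
  also have "(LINT x|M. Re (v x * cnj (w x))) = Re (LINT x|M. v x * cnj (w x))"
    by (rule integral_Re[OF i(3)])
  finally show ?thesis .
qed

context lax_pair
begin

abbreviation "N \<equiv> nrm u"
abbreviation "F \<equiv> nrm f"
abbreviation "D \<equiv> nrm ux"

text \<open>Rescaled so as to have bounds independent of the parameter and L2 limits as it grows:
  \<open>- cnj u\<close> for \<open>hG\<close>, \<open>u\<close> for \<open>hX\<close> and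
  \<open>- u\<close> for \<open>hl\<close>.\<close>

definition "hG x = \<mu> * G x"
definition "hX x = \<mu> * X x"
definition "hl x = \<mu> * l x"

lemma cmod_mu2: "cmod (complex_of_real (mu\<^sup>2)) = mu\<^sup>2"
  unfolding norm_of_real by simp

lemma hC: "Cper hG" "Cper hX" "Cper hl"
  unfolding hG_def[abs_def] hX_def[abs_def] hl_def[abs_def] by (intro Cper_intros CG CX Cl)+

lemma uL: "u \<in> L2per L" by (rule Cper_L2[OF Cu])

lemma h_bounds: "cmod (hG x) \<le> 3/2 * A" "cmod (hX x) \<le> 2 * A" "cmod (hl x) \<le> A" "nrm hG \<le> 3/2 * N"
proof -
  show "cmod (hG x) \<le> 3/2 * A"
    using riccati_bounds(2)[OF small Cu ric A] mu_pos by (simp add: hG_def norm_mult)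
  show "cmod (hX x) \<le> 2 * A"
    using dual_bounds(2)[OF small Cu CG riccatiD(2)[OF ric] dua A] mu_pos by (simp add: hX_def norm_mult)
  show "cmod (hl x) \<le> A"
    using sol_sup[OF ls A] mu_pos by (simp add: hl_def norm_mult)
  show "nrm hG \<le> 3/2 * N"
    using riccati_bounds(1)[OF small Cu ric] mu_pos unfolding hG_def[abs_def] nrm_cmult by simp
qed

lemma scale3: "of_real (mu ^ 3) * (LINT x|M. u x * X x * (G x)\<^sup>2) = (LINT x|M. (hX x * hG x) * (u x * hG x))"
  unfolding integral_mult_right_zero[symmetric]
  by (intro Bochner_Integration.integral_cong refl) (simp add: hX_def hG_def power2_eq_square power3_eq_cube)

lemma bnd_mult: "cmod y \<le> B \<Longrightarrow> cmod z \<le> C \<Longrightarrow> cmod (y * z) \<le> B * C" for B C :: real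
  using order_trans[OF norm_ge_zero] unfolding norm_mult by (intro mult_mono) auto

lemma damping_term_bound: "\<bar>mu ^ 3 * Re (LINT x|M. u x * X x * (G x)\<^sup>2)\<bar> \<le> 9/2 * A\<^sup>2 * N\<^sup>2"
proof -
  have "mu ^ 3 * Re (LINT x|M. u x * X x * (G x)\<^sup>2) = Re (LINT x|M. (hX x * hG x) * (u x * hG x))"
    unfolding scale3[symmetric] by simp
  also have "\<bar>\<dots>\<bar> \<le> cmod (LINT x|M. (hX x * hG x) * (u x * hG x))" by (rule abs_Re_le_cmod)
  also have "\<dots> \<le> (2 * A * (3/2 * A)) * (N * nrm hG)"
    by (intro CS3 uL Cper_L2 hC Cper_intros bnd_mult h_bounds)
  also have "\<dots> \<le> (2 * A * (3/2 * A)) * (N * (3/2 * N))"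
    using A_nonneg by (intro mult_left_mono h_bounds) auto
  finally show ?thesis by (simp add: power2_eq_square)
qed

lemma ac_a3: "ac a3 (\<lambda>x. cnj (u x) * (G x * X x) - of_real mu * a3 x)"
proof -
  have "ac (\<lambda>x. a x + g x) (\<lambda>x. (- \<mu> * a x - cnj (u x) * c x) + (cnj (u x) - of_real mu * g x))"
    by (intro ac_add ac_a sol_ac gs Cper_intros Cu)
  moreover have "(\<lambda>x. (- \<mu> * a x - cnj (u x) * c x) + (cnj (u x) - of_real mu * g x)) = (\<lambda>x. cnj (u x) * (G x * X x) - of_real mu * a3 x)"
    by (auto simp: a3_def c_def algebra_simps)
  ultimately show ?thesis by (simp add: a3_def[abs_def])
qed

lemma ac_X3: "ac X3 (\<lambda>x. u x * (G x * X x) - of_real (- mu) * X3 x)"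
proof -
  have "ac (\<lambda>x. X x + l x) (\<lambda>x. (\<mu> * X x - u x * c x) + (u x - of_real (- mu) * l x))"
    by (intro ac_add ac_X sol_ac ls Cu)
  moreover have "(\<lambda>x. (\<mu> * X x - u x * c x) + (u x - of_real (- mu) * l x)) = (\<lambda>x. u x * (G x * X x) - of_real (- mu) * X3 x)"
    by (auto simp: X3_def c_def algebra_simps)
  ultimately show ?thesis by (simp add: X3_def[abs_def])
qed

text \<open>In \<open>ac_a3\<close> and \<open>ac_X3\<close> the linear sources have cancelled, so
  three powers of \<open>1/mu\<close> are available: one each from \<open>G\<close>, from
  \<open>X\<close> and from the resolvent.\<close>

lemma nrm3:
  shows "mu ^ 3 * nrm a3 \<le> 3 * A\<^sup>2 * N" "mu ^ 3 * nrm X3 \<le> 3 * A\<^sup>2 * N"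
proof -
  have GX: "mu\<^sup>2 * nrm (\<lambda>x. v x * (G x * X x)) \<le> 3 * A\<^sup>2 * N" if v: "Cper v" "nrm v = N" for v
  proof -
    have "mu\<^sup>2 * nrm (\<lambda>x. v x * (G x * X x)) = cmod (of_real (mu\<^sup>2)) * nrm (\<lambda>x. v x * (G x * X x))" by (simp only: cmod_mu2)
    also have "\<dots> = nrm (\<lambda>x. of_real (mu\<^sup>2) * (v x * (G x * X x)))" by (rule nrm_cmult[symmetric])
    also have "\<dots> = nrm (\<lambda>x. (hG x * hX x) * v x)"
      by (intro nrm_cong) (simp add: hG_def hX_def power2_eq_square norm_mult)
    also have "\<dots> \<le> (3/2 * A * (2 * A)) * nrm v"
      by (intro nrm_bmult L2_Cper_mult Cper_L2 v Cper_intros hC bnd_mult h_bounds)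
    finally show ?thesis unfolding v by (simp add: power2_eq_square)
  qed
  have "mu\<^sup>2 * (\<bar>mu\<bar> * nrm a3) \<le> mu\<^sup>2 * nrm (\<lambda>x. cnj (u x) * (G x * X x))"
    by (intro mult_left_mono res_nrm[OF ac_a3] Cper_L2 Cper_intros Cu CG CX) auto
  also have "\<dots> \<le> 3 * A\<^sup>2 * N" by (rule GX) (use Cper_intros(2)[OF Cu] in auto)
  finally show "mu ^ 3 * nrm a3 \<le> 3 * A\<^sup>2 * N" using mu_pos by (simp add: power2_eq_square power3_eq_cube mult.assoc)
  have "mu\<^sup>2 * (\<bar>- mu\<bar> * nrm X3) \<le> mu\<^sup>2 * nrm (\<lambda>x. u x * (G x * X x))"
    by (intro mult_left_mono res_nrm[OF ac_X3] Cper_L2 Cper_intros Cu CG CX) auto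
  also have "\<dots> \<le> 3 * A\<^sup>2 * N" by (rule GX) (use Cu in auto)
  finally show "mu ^ 3 * nrm X3 \<le> 3 * A\<^sup>2 * N" using mu_pos by (simp add: power2_eq_square power3_eq_cube mult.assoc)
qed

lemma psi_u: "\<bar>Re (LINT x|M. u x * cnj (psi x))\<bar> \<le> N * F"
proof -
  have "\<bar>Re (LINT x|M. u x * cnj (psi x))\<bar> \<le> cmod (LINT x|M. u x * cnj (psi x))" by (rule abs_Re_le_cmod)
  also have "\<dots> \<le> N * nrm (\<lambda>x. cnj (psi x))" by (intro CS uL Cper_L2 Cper_intros Cpsi)
  also have "\<dots> \<le> N * F" using nrm_psi by (simp add: mult_left_mono)
  finally show ?thesis .
qed

lemma cub_CS:
  assumes "k \<in> L2per L"
  shows "cmod (LINT x|M. cub u x * k x) \<le> A\<^sup>2 * (N * nrm k)"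
proof -
  have "(LINT x|M. cub u x * k x) = (LINT x|M. (u x * cnj (u x)) * (u x * k x))"
    by (simp add: cub_eq mult.assoc)
  also have "cmod \<dots> \<le> (A * A) * (N * nrm k)"
    using A by (intro CS3 uL assms Cper_intros Cu bnd_mult) auto
  finally show ?thesis by (simp add: power2_eq_square)
qed

text \<open>Uniform in \<open>mu\<close>, and quadratic in the uniform bound \<open>A\<close>, which
  by Sobolev means linear in \<open>D\<close>. This growth in \<open>D\<close>, against the
  quadratic growth of the functional, drives the bootstrap.\<close>

lemma GG_bound:
  assumes "0 \<le> lam"
  shows "\<bar>GG lam\<bar> \<le> A\<^sup>2 * (9/2 * lam * N\<^sup>2 + 8 * N * F) + 2 * lam * N * F + 2 * F\<^sup>2"
proof -
  have psiL: "(\<lambda>x. cnj (psi x)) \<in> L2per L" by (intro Cper_L2 Cper_intros Cpsi)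
  have 1: "\<bar>lam * (mu ^ 3 * Re (LINT x|M. u x * X x * (G x)\<^sup>2))\<bar> \<le> lam * (9/2 * A\<^sup>2 * N\<^sup>2)"
    unfolding abs_mult[of lam] abs_of_nonneg[OF assms] by (rule mult_left_mono[OF damping_term_bound assms])
  have 2: "\<bar>2 * lam * Re (LINT x|M. u x * cnj (psi x))\<bar> \<le> 2 * lam * (N * F)"
  proof -
    have l2: "0 \<le> 2 * lam" using assms by simp
    show ?thesis unfolding abs_mult[of "2 * lam"] abs_of_nonneg[OF l2] by (rule mult_left_mono[OF psi_u l2])
  qed
  have "\<bar>Im (LINT x|M. cub u x * cnj (psi x))\<bar> \<le> cmod (LINT x|M. cub u x * cnj (psi x))" by (rule abs_Im_le_cmod)
  also have "\<dots> \<le> A\<^sup>2 * (N * nrm (\<lambda>x. cnj (psi x)))" by (rule cub_CS[OF psiL])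
  also have "\<dots> \<le> A\<^sup>2 * (N * F)" using nrm_psi by (simp add: mult_left_mono)
  finally have 3: "\<bar>Im (LINT x|M. cub u x * cnj (psi x))\<bar> \<le> A\<^sup>2 * (N * F)" .
  have "\<bar>Im (LINT x|M. f x * cnj (psi x))\<bar> \<le> cmod (LINT x|M. f x * cnj (psi x))" by (rule abs_Im_le_cmod)
  also have "\<dots> \<le> F * nrm (\<lambda>x. cnj (psi x))" by (rule CS[OF fL psiL])
  also have "\<dots> \<le> F * F" using nrm_psi by (simp add: mult_left_mono)
  finally have 4: "\<bar>Im (LINT x|M. f x * cnj (psi x))\<bar> \<le> F * F" .
  have 5: "\<bar>mu ^ 3 * Im ((LINT x|M. f x * a3 x) + (LINT x|M. cnj (f x) * X3 x))\<bar> \<le> 6 * A\<^sup>2 * N * F"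
  proof -
    have "\<bar>Im ((LINT x|M. f x * a3 x) + (LINT x|M. cnj (f x) * X3 x))\<bar> \<le> cmod ((LINT x|M. f x * a3 x) + (LINT x|M. cnj (f x) * X3 x))"
      by (rule abs_Im_le_cmod)
    also have "\<dots> \<le> cmod (LINT x|M. f x * a3 x) + cmod (LINT x|M. cnj (f x) * X3 x)" by (rule norm_triangle_ineq)
    also have "\<dots> \<le> F * nrm a3 + nrm (\<lambda>x. cnj (f x)) * nrm X3"
      by (intro add_mono CS fL L2_cnj Cper_L2 Ca3 CX3)
    finally have "mu ^ 3 * \<bar>Im ((LINT x|M. f x * a3 x) + (LINT x|M. cnj (f x) * X3 x))\<bar> \<le> mu ^ 3 * (F * nrm a3 + F * nrm X3)"
      using mu_pos by (intro mult_left_mono) auto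
    also have "\<dots> = F * (mu ^ 3 * nrm a3) + F * (mu ^ 3 * nrm X3)" by (simp add: algebra_simps)
    also have "\<dots> \<le> F * (3 * A\<^sup>2 * N) + F * (3 * A\<^sup>2 * N)"
      by (intro add_mono mult_left_mono nrm3) auto
    finally have Q: "mu ^ 3 * \<bar>Im ((LINT x|M. f x * a3 x) + (LINT x|M. cnj (f x) * X3 x))\<bar> \<le> F * (3 * A\<^sup>2 * N) + F * (3 * A\<^sup>2 * N)" .
    have m3: "0 \<le> mu ^ 3" using mu_pos by simp
    have "F * (3 * A\<^sup>2 * N) + F * (3 * A\<^sup>2 * N) = 6 * A\<^sup>2 * N * F" by simp
    then show ?thesis unfolding abs_mult[of "mu ^ 3"] abs_of_nonneg[OF m3] using Q by linarith
  qed
  have "GG lam = lam * (mu ^ 3 * Re (LINT x|M. u x * X x * (G x)\<^sup>2)) + 2 * lam * Re (LINT x|M. u x * cnj (psi x))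
   - 2 * Im (LINT x|M. cub u x * cnj (psi x)) + 2 * Im (LINT x|M. f x * cnj (psi x))
   + mu ^ 3 * Im ((LINT x|M. f x * a3 x) + (LINT x|M. cnj (f x) * X3 x))"
    by (simp add: GG_def)
  then have "\<bar>GG lam\<bar> \<le> lam * (9/2 * A\<^sup>2 * N\<^sup>2) + 2 * lam * (N * F) + 2 * (A\<^sup>2 * (N * F)) + 2 * (F * F) + 6 * A\<^sup>2 * N * F"
    using 1 2 3 4 5 by linarith
  then show ?thesis by (simp add: algebra_simps power2_eq_square)
qed

text \<open>No derivative of \<open>u\<close> on the right: at a fixed \<open>mu\<close> the mass
  controls the functional, so with bounded mass its exponentially weighted value vanishes at
  \<open>-\<infinity>\<close>.\<close>

lemma JJ_crude: "\<bar>JJ\<bar> \<le> 5/2 * mu\<^sup>2 * N\<^sup>2 + 2 * N * F"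
proof -
  have "\<bar>Re alpha\<bar> \<le> cmod alpha" by (rule abs_Re_le_cmod)
  also have "\<dots> \<le> N * nrm G" unfolding alpha_def by (intro CS uL Cper_L2 CG)
  finally have "mu * \<bar>Re alpha\<bar> \<le> mu * (N * nrm G)" using mu_pos by (intro mult_left_mono) auto
  also have "\<dots> = N * (mu * nrm G)" by simp
  also have "\<dots> \<le> N * (3/2 * N)" by (intro mult_left_mono riccati_bounds(1)[OF small Cu ric]) auto
  finally have "\<bar>mu * Re alpha\<bar> \<le> 3/2 * N\<^sup>2" using mu_pos by (simp add: abs_mult power2_eq_square)
  then have "\<bar>N\<^sup>2 + mu * Re alpha\<bar> \<le> 5/2 * N\<^sup>2"
    using zero_le_power2[of N] by linarith
  then have "mu\<^sup>2 * \<bar>N\<^sup>2 + mu * Re alpha\<bar> \<le> mu\<^sup>2 * (5/2 * N\<^sup>2)" by (intro mult_left_mono) auto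
  then have "\<bar>mu\<^sup>2 * (N\<^sup>2 + mu * Re alpha)\<bar> \<le> mu\<^sup>2 * (5/2 * N\<^sup>2)" by (simp add: abs_mult)
  moreover have "mu\<^sup>2 * (5/2 * N\<^sup>2) = 5/2 * mu\<^sup>2 * N\<^sup>2" by simp
  ultimately show ?thesis using psi_u unfolding JJ_def by linarith
qed

lemma ac_g: "ac g p"
proof -
  have "ac g (\<lambda>x. cnj (u x) - of_real mu * g x)" by (intro sol_ac gs Cper_intros Cu)
  then show ?thesis by (simp add: p_def[abs_def])
qed

lemma ac_l: "ac l (\<lambda>x. u x - of_real (- mu) * l x)"
  by (intro sol_ac ls Cu)

text \<open>\<open>p\<close> is the derivative of \<open>g\<close> and therefore the resolvent of
  \<open>cnj ux\<close>. So \<open>mu p\<close> approximates \<open>cnj ux\<close>, and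
  \<open>(mu * nrm p)\<^sup>2\<close> is the kinetic energy as seen at a finite parameter.\<close>

lemma ac_p: "ac p (\<lambda>x. cnj (ux x) - of_real mu * p x)"
proof -
  have "ac (\<lambda>x. cnj (u x) - \<mu> * g x) (\<lambda>x. cnj (ux x) - \<mu> * p x)"
    by (intro ac_diff ac_cnj ac_cmult ac_u ac_g)
  then show ?thesis by (simp add: p_def[abs_def])
qed

lemma mu_p: "mu * nrm p \<le> D"
  using res_nrm[OF ac_p L2_cnj[OF uxL]] mu_pos by simp

lemma ac_rho: "ac rho (\<lambda>x. - (1/2 * u x * (G x)\<^sup>2) - of_real mu * rho x)"
proof -
  have "ac (\<lambda>x. G x + g x) (\<lambda>x. (- (cnj (u x) + 1/2 * u x * (G x)\<^sup>2) - \<mu> * G x) + p x)"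
    by (intro ac_add ac_G ac_g)
  moreover have "(\<lambda>x. (- (cnj (u x) + 1/2 * u x * (G x)\<^sup>2) - \<mu> * G x) + p x) = (\<lambda>x. - (1/2 * u x * (G x)\<^sup>2) - of_real mu * rho x)"
    by (auto simp: rho_def p_def algebra_simps)
  ultimately show ?thesis by (simp add: rho_def[abs_def])
qed

definition "quart = (LINT x|M. (hl x * hG x) * (u x * hG x))"

text \<open>An exact splitting into kinetic, quartic and forcing parts. In
  \<open>cnj u = p + mu g\<close> the summands are orthogonal for the real inner product because
  \<open>p\<close> is the derivative of \<open>g\<close>. The linear part \<open>- g\<close> of
  \<open>G\<close> cancels \<open>mu\<^sup>2 (nrm g)\<^sup>2\<close>, and the remainder
  \<open>rho\<close> is made explicit by moving its resolvent onto \<open>u\<close>.\<close>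

lemma JJ_expand: "JJ = mu\<^sup>2 * (nrm p)\<^sup>2 + 1/2 * Re quart + 2 * Re (LINT x|M. u x * cnj (psi x))"
proof -
  have pL: "p \<in> L2per L" and gL: "g \<in> L2per L" using acD[OF ac_p] acD[OF ac_g] by auto
  have rL: "rho \<in> L2per L" by (rule Cper_L2[OF Crho])
  have self: "(LINT x|M. v x * cnj (v x)) = of_real ((nrm v)\<^sup>2)" for v
    unfolding nrm_sq by (subst integral_complex_of_real[symmetric]) (simp add: complex_norm_square del: of_real_power)
  have i: "integrable M (\<lambda>x. g x * cnj (p x))" "integrable M (\<lambda>x. p x * cnj (g x))" "integrable M (\<lambda>x. g x * cnj (g x))"
    "integrable M (\<lambda>x. u x * rho x)" "integrable M (\<lambda>x. u x * g x)"
    by (intro int_mult L2_cnj pL gL rL uL)+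
  have "(LINT x|M. g x * cnj (p x) + p x * cnj (g x)) = 0"
    by (rule ac_mean[OF ac_mult[OF ac_g ac_cnj[OF ac_g]]])
  then have s: "(LINT x|M. g x * cnj (p x)) = - (LINT x|M. p x * cnj (g x))"
    using i by (simp add: add_eq_0_iff)
  moreover have "(LINT x|M. g x * cnj (p x)) = cnj (LINT x|M. p x * cnj (g x))"
    unfolding cnj_LINT by (simp add: mult.commute)
  ultimately have R0: "Re (LINT x|M. p x * cnj (g x)) = 0"
    by (metis complex_cnj(1) add_eq_0_iff cnj.simps(1) neg_equal_zero uminus_complex.simps(1))
  then have R1: "Re (LINT x|M. g x * cnj (p x)) = 0" using s by simp
  have "(nrm (\<lambda>x. p x + \<mu> * g x))\<^sup>2 = (nrm p)\<^sup>2 + (nrm (\<lambda>x. \<mu> * g x))\<^sup>2 + 2 * Re (LINT x|M. p x * cnj (\<mu> * g x))"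
    by (intro nrm_add_sq L2_cmult pL gL)
  also have "(LINT x|M. p x * cnj (\<mu> * g x)) = \<mu> * (LINT x|M. p x * cnj (g x))"
    unfolding integral_mult_right_zero[symmetric] by (simp add: mult.left_commute)
  also have "nrm (\<lambda>x. p x + \<mu> * g x) = N"
    unfolding p_def by simp
  finally have N2: "N\<^sup>2 = (nrm p)\<^sup>2 + mu\<^sup>2 * (nrm g)\<^sup>2"
    unfolding nrm_cmult using R0 by (simp add: power_mult_distrib)
  have "(LINT x|M. u x * g x) = (LINT x|M. g x * cnj (p x) + \<mu> * (g x * cnj (g x)))"
    unfolding p_def by (simp add: algebra_simps)
  also have "\<dots> = (LINT x|M. g x * cnj (p x)) + \<mu> * of_real ((nrm g)\<^sup>2)"
    using i self[of g] by simp
  finally have ug: "Re (LINT x|M. u x * g x) = mu * (nrm g)\<^sup>2" using R1 by simp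
  have "alpha = (LINT x|M. u x * rho x - u x * g x)"
    unfolding alpha_def rho_def by (simp add: algebra_simps)
  also have "\<dots> = (LINT x|M. u x * rho x) - (LINT x|M. u x * g x)" using i by simp
  finally have al: "Re alpha = Re (LINT x|M. u x * rho x) - mu * (nrm g)\<^sup>2" using ug by simp
  have q: "of_real (mu ^ 3) * (LINT x|M. u x * rho x) = 1/2 * quart"
  proof -
    have "(LINT x|M. u x * rho x) = (LINT x|M. rho x * u x)" by (simp add: mult.commute)
    also have "\<dots> = - (LINT x|M. - (1/2 * u x * (G x)\<^sup>2) * l x)"
      by (rule res_adj[OF ac_rho ac_l _ uL]) (intro Cper_L2 Cper_intros Cu CG)
    also have "\<dots> = (LINT x|M. 1/2 * u x * (G x)\<^sup>2 * l x)" by simp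
    finally have "of_real (mu ^ 3) * (LINT x|M. u x * rho x) = (LINT x|M. of_real (mu ^ 3) * (1/2 * u x * (G x)\<^sup>2 * l x))"
      by simp
    also have "\<dots> = (LINT x|M. 1/2 * ((hl x * hG x) * (u x * hG x)))"
      by (intro Bochner_Integration.integral_cong refl) (simp add: hl_def hG_def power2_eq_square power3_eq_cube)
    finally show ?thesis unfolding quart_def by simp
  qed
  have "mu ^ 3 * Re (LINT x|M. u x * rho x) = 1/2 * Re quart"
    using arg_cong[OF q, of Re] by simp
  then show ?thesis unfolding JJ_def N2 al by (simp add: algebra_simps power2_eq_square power3_eq_cube)
qed

lemma quart_bound: "cmod quart \<le> 9/4 * A\<^sup>2 * N\<^sup>2"
proof -
  have "cmod quart \<le> (A * (3/2 * A)) * (N * nrm hG)"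
    unfolding quart_def by (intro CS3 uL Cper_L2 hC Cper_intros bnd_mult h_bounds)
  also have "\<dots> \<le> (A * (3/2 * A)) * (N * (3/2 * N))"
    using A_nonneg by (intro mult_left_mono h_bounds) auto
  finally show ?thesis by (simp add: power2_eq_square)
qed

lemma JJ_lower: "JJ \<ge> (mu * nrm p)\<^sup>2 - 9/8 * A\<^sup>2 * N\<^sup>2 - 2 * N * F"
  using JJ_expand quart_bound psi_u abs_Re_le_cmod[of quart] by (simp add: power_mult_distrib)

lemma JJ_upper: "JJ \<le> D\<^sup>2 + 9/8 * A\<^sup>2 * N\<^sup>2 + 2 * N * F"
proof -
  have "(mu * nrm p)\<^sup>2 \<le> D\<^sup>2" using mu_p mu_pos by (intro power_mono) auto
  then show ?thesis
    using JJ_expand quart_bound psi_u abs_Re_le_cmod[of quart] by (simp add: power_mult_distrib)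
qed

text \<open>One common error for the three limits below: the first term comes from the nonlinear
  part of the Riccati and dual equations, the second from approximating \<open>u\<close> by its
  resolvent.\<close>

definition "Eb = 3 * A\<^sup>2 * N / mu\<^sup>2 + D / mu"
definition "del = nrm (\<lambda>x. psi x - f x)"

lemma Eb_nonneg: "0 \<le> Eb" using mu_pos by (simp add: Eb_def)

lemma hG_limit: "nrm (\<lambda>x. hG x + cnj (u x)) \<le> Eb"
proof -
  let ?h = "\<lambda>x. - (cnj (u x) + 1/2 * u x * (G x)\<^sup>2)"
  have h: "?h \<in> L2per L" by (intro Cper_L2 Cper_ric Cu CG)
  have "nrm (\<lambda>x. of_real mu * G x - (- cnj (u x))) \<le> nrm (\<lambda>x. ?h x - (- cnj (u x))) + nrm (\<lambda>x. - cnj (ux x)) / \<bar>mu\<bar>"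
    using mu_pos by (intro res_approx[OF _ h]) (use sol_ac[OF riccatiD(3)[OF ric] Cper_ric[OF Cu CG]] ac_uminus[OF ac_cnj[OF ac_u]] in auto)
  also have "nrm (\<lambda>x. - cnj (ux x)) = D" by simp
  also have "nrm (\<lambda>x. ?h x - (- cnj (u x))) \<le> 3 * A\<^sup>2 * N / mu\<^sup>2"
  proof -
    have "mu\<^sup>2 * nrm (\<lambda>x. ?h x - (- cnj (u x))) = cmod (of_real (mu\<^sup>2)) * nrm (\<lambda>x. ?h x - (- cnj (u x)))" by (simp only: cmod_mu2)
    also have "\<dots> = nrm (\<lambda>x. of_real (mu\<^sup>2) * (?h x - (- cnj (u x))))" by (rule nrm_cmult[symmetric])
    also have "\<dots> = nrm (\<lambda>x. (1/2 * (hG x * hG x)) * u x)"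
      by (intro nrm_cong) (simp add: hG_def power2_eq_square norm_mult)
    also have "\<dots> \<le> (1/2 * (3/2 * A * (3/2 * A))) * N"
      by (intro nrm_bmult L2_Cper_mult uL Cper_intros hC bnd_mult h_bounds) auto
    also have "\<dots> \<le> 3 * A\<^sup>2 * N" using A_nonneg by (simp add: power2_eq_square)
    finally show ?thesis using mu_pos by (simp add: pos_le_divide_eq mult.commute)
  qed
  finally show ?thesis using mu_pos by (simp add: Eb_def hG_def)
qed

lemma hX_limit: "nrm (\<lambda>x. hX x - u x) \<le> Eb"
proof -
  let ?h = "\<lambda>x. u x * G x * X x - u x"
  have h: "?h \<in> L2per L" by (intro Cper_L2 Cper_dual Cu CG CX)
  have "nrm (\<lambda>x. of_real (- mu) * X x - (- u x)) \<le> nrm (\<lambda>x. ?h x - (- u x)) + nrm (\<lambda>x. - ux x) / \<bar>- mu\<bar>"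
    using mu_pos by (intro res_approx[OF _ h]) (use sol_ac[OF dualD(3)[OF dua] Cper_dual[OF Cu CG CX]] ac_uminus[OF ac_u] in auto)
  also have "nrm (\<lambda>x. - ux x) = D" by simp
  also have "nrm (\<lambda>x. of_real (- mu) * X x - (- u x)) = nrm (\<lambda>x. hX x - u x)"
    by (intro nrm_cong) (simp add: hX_def norm_minus_commute)
  also have "nrm (\<lambda>x. ?h x - (- u x)) \<le> 3 * A\<^sup>2 * N / mu\<^sup>2"
  proof -
    have "mu\<^sup>2 * nrm (\<lambda>x. ?h x - (- u x)) = cmod (of_real (mu\<^sup>2)) * nrm (\<lambda>x. ?h x - (- u x))" by (simp only: cmod_mu2)
    also have "\<dots> = nrm (\<lambda>x. of_real (mu\<^sup>2) * (?h x - (- u x)))" by (rule nrm_cmult[symmetric])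
    also have "\<dots> = nrm (\<lambda>x. (hG x * hX x) * u x)"
      by (intro nrm_cong) (simp add: hG_def hX_def power2_eq_square norm_mult)
    also have "\<dots> \<le> (3/2 * A * (2 * A)) * N"
      by (intro nrm_bmult L2_Cper_mult uL Cper_intros hC bnd_mult h_bounds)
    also have "\<dots> \<le> 3 * A\<^sup>2 * N" using A_nonneg by (simp add: power2_eq_square)
    finally show ?thesis using mu_pos by (simp add: pos_le_divide_eq mult.commute)
  qed
  finally show ?thesis using mu_pos by (simp add: Eb_def)
qed

lemma hl_limit: "nrm (\<lambda>x. hl x + u x) \<le> Eb"
proof -
  have "nrm (\<lambda>x. of_real (- mu) * l x - u x) \<le> nrm (\<lambda>x. u x - u x) + D / \<bar>- mu\<bar>"
    using mu_pos by (intro res_approx[OF ac_l uL ac_u]) auto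
  also have "nrm (\<lambda>x. u x - u x) = 0" by (simp add: nrm_def)
  also have "nrm (\<lambda>x. of_real (- mu) * l x - u x) = nrm (\<lambda>x. hl x + u x)"
    by (intro nrm_cong) (metis (no_types, lifting) hl_def minus_add_distrib mult_minus_left norm_minus_cancel of_real_minus uminus_add_conv_diff add.commute diff_conv_add_uminus)
  finally have "nrm (\<lambda>x. hl x + u x) \<le> D / mu" using mu_pos by simp
  moreover have "0 \<le> 3 * A\<^sup>2 * N / mu\<^sup>2" by simp
  ultimately show ?thesis unfolding Eb_def by linarith
qed

definition "Q4 = (LINT x|M. (cmod (u x)) ^ 4)"

lemma Q4: "(LINT x|M. (u x * cnj (u x)) * (u x * cnj (u x))) = of_real Q4" "0 \<le> Q4"
proof -
  have eq: "of_real ((cmod z) ^ 4) = (z * cnj z) * (z * cnj z)" for z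
  proof -
    have "(cmod z) ^ 4 = (cmod z)\<^sup>2 * (cmod z)\<^sup>2" by (simp flip: power_add)
    then show ?thesis by (simp only: of_real_mult complex_norm_square)
  qed
  show "(LINT x|M. (u x * cnj (u x)) * (u x * cnj (u x))) = of_real Q4"
    unfolding Q4_def integral_complex_of_real[symmetric] eq ..
  show "0 \<le> Q4" by (simp add: Q4_def)
qed

text \<open>Covers both \<open>hX\<close>, with \<open>s = 1\<close>, and \<open>hl\<close>, with
  \<open>s = - 1\<close>. First \<open>w\<close> is replaced by \<open>s u\<close>, then the square
  of \<open>hG\<close> by that of \<open>cnj u\<close>; the costs add up to
  \<open>9/4 + 5/2\<close>, rounded up to 5.\<close>

lemma quartic_limit:
  assumes w: "Cper w" "nrm (\<lambda>x. w x - s * u x) \<le> Eb" and s: "cmod s = 1"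
  shows "cmod ((LINT x|M. (w x * hG x) * (u x * hG x)) - s * of_real Q4) \<le> 5 * A\<^sup>2 * N * Eb"
proof -
  have e: "Cper (\<lambda>x. w x - s * u x)" "Cper (\<lambda>x. hG x + cnj (u x))" by (intro Cper_intros w Cu hC)+
  have i1: "integrable M (\<lambda>x. (hG x * hG x) * (u x * (w x - s * u x)))"
    and i2: "integrable M (\<lambda>x. (s * (u x * (hG x - cnj (u x)))) * (u x * (hG x + cnj (u x))))"
    and i3: "integrable M (\<lambda>x. s * ((u x * cnj (u x)) * (u x * cnj (u x))))"
    by (intro Cper_int Cper_intros w Cu hC e)+
  have "(LINT x|M. (w x * hG x) * (u x * hG x)) = (LINT x|M. ((hG x * hG x) * (u x * (w x - s * u x))
      + (s * (u x * (hG x - cnj (u x)))) * (u x * (hG x + cnj (u x)))) + s * ((u x * cnj (u x)) * (u x * cnj (u x))))"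
    by (intro Bochner_Integration.integral_cong refl) (simp add: algebra_simps)
  also have "\<dots> = ((LINT x|M. (hG x * hG x) * (u x * (w x - s * u x))) + (LINT x|M. (s * (u x * (hG x - cnj (u x)))) * (u x * (hG x + cnj (u x)))))
      + (LINT x|M. s * ((u x * cnj (u x)) * (u x * cnj (u x))))"
    using i1 i2 i3 by (simp only: Bochner_Integration.integral_add Bochner_Integration.integrable_add)
  also have "(LINT x|M. s * ((u x * cnj (u x)) * (u x * cnj (u x)))) = s * of_real Q4"
    unfolding integral_mult_right_zero Q4 ..
  finally have "cmod ((LINT x|M. (w x * hG x) * (u x * hG x)) - s * of_real Q4)
     \<le> cmod (LINT x|M. (hG x * hG x) * (u x * (w x - s * u x))) + cmod (LINT x|M. (s * (u x * (hG x - cnj (u x)))) * (u x * (hG x + cnj (u x))))"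
    using norm_triangle_ineq by simp
  also have "\<dots> \<le> (3/2 * A * (3/2 * A)) * (N * nrm (\<lambda>x. w x - s * u x)) + (1 * (A * (3/2 * A + A))) * (N * nrm (\<lambda>x. hG x + cnj (u x)))"
  proof (intro add_mono CS3 uL Cper_L2 e Cper_intros Cu hC bnd_mult h_bounds A)
    show "cmod s \<le> 1" using s by simp
    show "cmod (hG x - cnj (u x)) \<le> 3/2 * A + A" for x
      using norm_triangle_ineq4[of "hG x" "cnj (u x)"] h_bounds(1)[of x] A[of x] by simp
  qed
  also have "\<dots> \<le> (3/2 * A * (3/2 * A)) * (N * Eb) + (1 * (A * (3/2 * A + A))) * (N * Eb)"
    using A_nonneg by (intro add_mono mult_left_mono w hG_limit) auto
  also have "\<dots> = (19/4 * A\<^sup>2) * (N * Eb)" by (simp add: power2_eq_square algebra_simps)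
  also have "\<dots> \<le> (5 * A\<^sup>2) * (N * Eb)"
    using Eb_nonneg by (intro mult_right_mono) auto
  finally show ?thesis by (simp add: mult.assoc)
qed

lemma JJ_lower_limit: "JJ \<ge> (mu * nrm p)\<^sup>2 - 1/2 * Q4 - 5 * A\<^sup>2 * N * Eb - 2 * N * F"
proof -
  have "cmod (quart - (- 1) * of_real Q4) \<le> 5 * A\<^sup>2 * N * Eb"
    unfolding quart_def using hl_limit by (intro quartic_limit hC) auto
  then have "\<bar>Re (quart - (- 1) * of_real Q4)\<bar> \<le> 5 * A\<^sup>2 * N * Eb"
    using abs_Re_le_cmod order_trans by blast
  then have "Re quart \<ge> - Q4 - 5 * A\<^sup>2 * N * Eb" by simp
  moreover have "0 \<le> 5 * A\<^sup>2 * N * Eb" using Eb_nonneg by simp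
  moreover have "mu\<^sup>2 * (nrm p)\<^sup>2 = (mu * nrm p)\<^sup>2" by (simp add: power_mult_distrib)
  ultimately show ?thesis using JJ_expand psi_u by linarith
qed

lemma cub_deriv:
  obtains d where "ac (cub u) d" "nrm d \<le> 3 * A\<^sup>2 * D"
proof -
  let ?d = "\<lambda>x. (u x * cnj (u x)) * ux x + (u x * cnj (ux x) + ux x * cnj (u x)) * u x"
  have ac: "ac (\<lambda>x. (u x * cnj (u x)) * u x) ?d"
    by (intro ac_mult ac_u ac_cnj)
  have "cmod (?d x) \<le> cmod (of_real (3 * A\<^sup>2) * ux x)" for x
  proof -
    have "cmod (?d x) \<le> cmod ((u x * cnj (u x)) * ux x) + cmod ((u x * cnj (ux x)) * u x + (ux x * cnj (u x)) * u x)"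
      by (metis norm_triangle_ineq distrib_right)
    also have "\<dots> \<le> cmod ((u x * cnj (u x)) * ux x) + (cmod ((u x * cnj (ux x)) * u x) + cmod ((ux x * cnj (u x)) * u x))"
      by (intro add_left_mono norm_triangle_ineq)
    also have "\<dots> = 3 * (cmod (u x))\<^sup>2 * cmod (ux x)" by (simp add: norm_mult power2_eq_square)
    also have "\<dots> \<le> 3 * A\<^sup>2 * cmod (ux x)"
      using A by (intro mult_right_mono mult_left_mono power_mono) auto
    also have "\<dots> = cmod (of_real (3 * A\<^sup>2) * ux x)"
      unfolding norm_mult[of "of_real (3 * A\<^sup>2)"] norm_of_real by simp
    finally show ?thesis .
  qed
  then have "nrm ?d \<le> nrm (\<lambda>x. of_real (3 * A\<^sup>2) * ux x)"
    by (intro nrm_mono acD(3)[OF ac] L2_cmult uxL)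
  then have "nrm ?d \<le> 3 * A\<^sup>2 * D" unfolding nrm_cmult norm_of_real by simp
  then show ?thesis using that ac unfolding cub_eq[abs_def] by blast
qed

lemma GXlim: "nrm (\<lambda>x. (hG x * hX x + u x * cnj (u x)) * v x) \<le> 5/2 * A\<^sup>2 * Eb"
  if v: "Cper v" "\<And>x. cmod (v x) \<le> A"
proof -
  have e: "Cper (\<lambda>x. hX x - u x)" "Cper (\<lambda>x. hG x + cnj (u x))" by (intro Cper_intros Cu hC)+
  have "nrm (\<lambda>x. (hG x * hX x + u x * cnj (u x)) * v x) = nrm (\<lambda>x. (v x * hG x) * (hX x - u x) + (v x * u x) * (hG x + cnj (u x)))"
    by (simp add: algebra_simps)
  also have "\<dots> \<le> nrm (\<lambda>x. (v x * hG x) * (hX x - u x)) + nrm (\<lambda>x. (v x * u x) * (hG x + cnj (u x)))"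
    by (intro nrm_triangle Cper_L2 Cper_intros v e hC Cu)
  also have "\<dots> \<le> (A * (3/2 * A)) * nrm (\<lambda>x. hX x - u x) + (A * A) * nrm (\<lambda>x. hG x + cnj (u x))"
    by (intro add_mono nrm_bmult Cper_L2 Cper_intros v e hC Cu bnd_mult h_bounds A)
  also have "\<dots> \<le> (A * (3/2 * A)) * Eb + (A * A) * Eb"
    using A_nonneg by (intro add_mono mult_left_mono hG_limit hX_limit) auto
  finally show ?thesis by (simp add: power2_eq_square algebra_simps)
qed

lemma Eb_ge_D: "3 * A\<^sup>2 * D / mu \<le> 3 * A\<^sup>2 * Eb"
proof -
  have "D / mu \<le> Eb" unfolding Eb_def by simp
  then have "3 * A\<^sup>2 * (D / mu) \<le> 3 * A\<^sup>2 * Eb" by (intro mult_left_mono) auto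
  then show ?thesis by simp
qed

text \<open>\<open>res_approx\<close> with the comparison function \<open>- cnj (cub u)\<close>,
  which has a derivative in L2 because \<open>u\<close> has. The source is within
  \<open>5/2 A\<^sup>2 Eb\<close> of it by \<open>GXlim\<close>, the derivative costs
  \<open>3 A\<^sup>2 Eb\<close>, and the sum is rounded up.\<close>

lemma a3_limit: "nrm (\<lambda>x. of_real (mu ^ 3) * a3 x + cnj (cub u x)) \<le> 6 * A\<^sup>2 * Eb" (is "?lhs \<le> _")
proof -
  obtain d where d: "ac (cub u) d" "nrm d \<le> 3 * A\<^sup>2 * D" by (rule cub_deriv)
  let ?h = "\<lambda>x. of_real (mu\<^sup>2) * (cnj (u x) * (G x * X x))"
  have h: "?h \<in> L2per L" by (intro Cper_L2 Cper_intros Cu CG CX)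
  have eqd: "(\<lambda>x. of_real (mu\<^sup>2) * (cnj (u x) * (G x * X x) - of_real mu * a3 x)) = (\<lambda>x. ?h x - of_real mu * (of_real (mu\<^sup>2) * a3 x))"
    by (auto simp: algebra_simps)
  have ac: "ac (\<lambda>x. of_real (mu\<^sup>2) * a3 x) (\<lambda>x. ?h x - of_real mu * (of_real (mu\<^sup>2) * a3 x))"
    using ac_cmult[OF ac_a3, of "of_real (mu\<^sup>2)"] unfolding eqd .
  have "nrm (\<lambda>x. of_real mu * (of_real (mu\<^sup>2) * a3 x) - (- cnj (cub u x))) \<le> nrm (\<lambda>x. ?h x - (- cnj (cub u x))) + nrm (\<lambda>x. - cnj (d x)) / \<bar>mu\<bar>"
    using mu_pos by (intro res_approx[OF ac h ac_uminus[OF ac_cnj[OF d(1)]]]) auto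
  also have "(\<lambda>x. of_real mu * (of_real (mu\<^sup>2) * a3 x) - (- cnj (cub u x))) = (\<lambda>x. of_real (mu ^ 3) * a3 x + cnj (cub u x))"
    by (auto simp: power2_eq_square power3_eq_cube)
  also have "(\<lambda>x. ?h x - (- cnj (cub u x))) = (\<lambda>x. (hG x * hX x + u x * cnj (u x)) * cnj (u x))"
    by (auto simp: hG_def hX_def cub_eq power2_eq_square algebra_simps)
  also have "nrm (\<lambda>x. (hG x * hX x + u x * cnj (u x)) * cnj (u x)) \<le> 5/2 * A\<^sup>2 * Eb"
    using A by (intro GXlim Cper_intros Cu) auto
  also have "nrm (\<lambda>x. - cnj (d x)) / \<bar>mu\<bar> \<le> 3 * A\<^sup>2 * Eb"
  proof -
    have "nrm (\<lambda>x. - cnj (d x)) / \<bar>mu\<bar> \<le> 3 * A\<^sup>2 * D / mu"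
      using d(2) mu_pos by (simp add: divide_right_mono)
    then show ?thesis using Eb_ge_D by linarith
  qed
  finally have Q: "?lhs \<le> 5/2 * A\<^sup>2 * Eb + 3 * A\<^sup>2 * Eb" by simp
  have "0 \<le> A\<^sup>2 * Eb" using Eb_nonneg by simp
  then show ?thesis using Q by linarith
qed

lemma X3_limit: "nrm (\<lambda>x. of_real (mu ^ 3) * X3 x - cub u x) \<le> 6 * A\<^sup>2 * Eb" (is "?lhs \<le> _")
proof -
  obtain d where d: "ac (cub u) d" "nrm d \<le> 3 * A\<^sup>2 * D" by (rule cub_deriv)
  let ?h = "\<lambda>x. of_real (mu\<^sup>2) * (u x * (G x * X x))"
  have h: "?h \<in> L2per L" by (intro Cper_L2 Cper_intros Cu CG CX)
  have eqd: "(\<lambda>x. of_real (mu\<^sup>2) * (u x * (G x * X x) - of_real (- mu) * X3 x)) = (\<lambda>x. ?h x - of_real (- mu) * (of_real (mu\<^sup>2) * X3 x))"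
    by (auto simp: algebra_simps)
  have ac: "ac (\<lambda>x. of_real (mu\<^sup>2) * X3 x) (\<lambda>x. ?h x - of_real (- mu) * (of_real (mu\<^sup>2) * X3 x))"
    using ac_cmult[OF ac_X3, of "of_real (mu\<^sup>2)"] unfolding eqd .
  have "nrm (\<lambda>x. of_real (- mu) * (of_real (mu\<^sup>2) * X3 x) - (- cub u x)) \<le> nrm (\<lambda>x. ?h x - (- cub u x)) + nrm (\<lambda>x. - d x) / \<bar>- mu\<bar>"
    using mu_pos by (intro res_approx[OF ac h ac_uminus[OF d(1)]]) auto
  also have "nrm (\<lambda>x. of_real (- mu) * (of_real (mu\<^sup>2) * X3 x) - (- cub u x)) = nrm (\<lambda>x. of_real (mu ^ 3) * X3 x - cub u x)"
    by (intro nrm_cong) (simp add: power2_eq_square power3_eq_cube norm_minus_commute mult.assoc)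
  also have "(\<lambda>x. ?h x - (- cub u x)) = (\<lambda>x. (hG x * hX x + u x * cnj (u x)) * u x)"
    by (auto simp: hG_def hX_def cub_eq power2_eq_square algebra_simps)
  also have "nrm (\<lambda>x. (hG x * hX x + u x * cnj (u x)) * u x) \<le> 5/2 * A\<^sup>2 * Eb"
    by (intro GXlim Cu A)
  also have "nrm (\<lambda>x. - d x) / \<bar>- mu\<bar> \<le> 3 * A\<^sup>2 * Eb"
  proof -
    have "nrm (\<lambda>x. - d x) / \<bar>- mu\<bar> \<le> 3 * A\<^sup>2 * D / mu"
      using d(2) mu_pos by (simp add: divide_right_mono)
    then show ?thesis using Eb_ge_D by linarith
  qed
  finally have Q: "?lhs \<le> 5/2 * A\<^sup>2 * Eb + 3 * A\<^sup>2 * Eb" by simp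
  have "0 \<le> A\<^sup>2 * Eb" using Eb_nonneg by simp
  then show ?thesis using Q by linarith
qed

text \<open>Backward in time an upper bound on the functional needs only this one side. In the limit
  the damping correction becomes \<open>lam Q4\<close>, of the good sign; the cubic pairing with
  \<open>f\<close> coming from \<open>psi\<close> is cancelled by the one coming from
  \<open>a3\<close> and \<open>X3\<close>; the real square of \<open>f\<close> has no imaginary
  part. What survives is linear in \<open>N\<close>.\<close>

lemma GG_lower_limit:
  assumes lam: "0 \<le> lam"
  shows "GG lam \<ge> - 2 * lam * N * F - (5 * lam * N + 12 * F) * A\<^sup>2 * Eb - 2 * (A\<^sup>2 * N + F) * del"
proof -
  have e: "(\<lambda>x. psi x - f x) \<in> L2per L" by (intro L2_diff Cper_L2 Cpsi fL)
  have cL: "cub u \<in> L2per L" by (intro Cper_L2 Cper_cub Cu)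
  have "cmod ((LINT x|M. (hX x * hG x) * (u x * hG x)) - 1 * of_real Q4) \<le> 5 * A\<^sup>2 * N * Eb"
    using hX_limit by (intro quartic_limit hC) auto
  then have "\<bar>Re ((LINT x|M. (hX x * hG x) * (u x * hG x)) - 1 * of_real Q4)\<bar> \<le> 5 * A\<^sup>2 * N * Eb"
    using abs_Re_le_cmod order_trans by blast
  then have "Re (of_real (mu ^ 3) * (LINT x|M. u x * X x * (G x)\<^sup>2)) \<ge> - (5 * A\<^sup>2 * N * Eb)"
    unfolding scale3 using Q4(2) by simp
  then have "mu ^ 3 * Re (LINT x|M. u x * X x * (G x)\<^sup>2) \<ge> - (5 * A\<^sup>2 * N * Eb)" by simp
  from mult_left_mono[OF this lam]
  have 1: "lam * (mu ^ 3 * Re (LINT x|M. u x * X x * (G x)\<^sup>2)) \<ge> - (5 * lam * N * A\<^sup>2 * Eb)"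
    by (simp add: algebra_simps)
  have 2: "2 * lam * Re (LINT x|M. u x * cnj (psi x)) \<ge> - 2 * lam * N * F"
    using mult_left_mono[of "- (N * F)" "Re (LINT x|M. u x * cnj (psi x))" "2 * lam"] psi_u lam by simp
  have 3: "Im (LINT x|M. cub u x * cnj (psi x)) \<le> Im (LINT x|M. cub u x * cnj (f x)) + A\<^sup>2 * N * del"
  proof -
    have "(LINT x|M. cub u x * cnj (psi x)) = (LINT x|M. cub u x * cnj (f x) + cub u x * cnj (psi x - f x))"
      by (simp add: algebra_simps)
    also have "\<dots> = (LINT x|M. cub u x * cnj (f x)) + (LINT x|M. cub u x * cnj (psi x - f x))"
      by (intro Bochner_Integration.integral_add int_mult cL L2_cnj fL e)
    finally have eq: "(LINT x|M. cub u x * cnj (psi x)) = (LINT x|M. cub u x * cnj (f x)) + (LINT x|M. cub u x * cnj (psi x - f x))" .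
    have "cmod (LINT x|M. cub u x * cnj (psi x - f x)) \<le> A\<^sup>2 * (N * nrm (\<lambda>x. cnj (psi x - f x)))"
      by (rule cub_CS[OF L2_cnj[OF e]])
    then have "Im (LINT x|M. cub u x * cnj (psi x - f x)) \<le> A\<^sup>2 * N * del"
      using abs_Im_le_cmod[of "LINT x|M. cub u x * cnj (psi x - f x)"] unfolding nrm_cnj del_def[symmetric] by (simp add: mult.assoc)
    then show ?thesis unfolding eq by simp
  qed
  have 4: "Im (LINT x|M. f x * cnj (psi x)) \<ge> - (F * del)"
  proof -
    have "(LINT x|M. f x * cnj (psi x)) = (LINT x|M. f x * cnj (f x) + f x * cnj (psi x - f x))"
      by (simp add: algebra_simps)
    also have "\<dots> = (LINT x|M. f x * cnj (f x)) + (LINT x|M. f x * cnj (psi x - f x))"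
      by (intro Bochner_Integration.integral_add int_mult L2_cnj fL e)
    also have "(LINT x|M. f x * cnj (f x)) = of_real (F\<^sup>2)"
      unfolding nrm_sq by (subst integral_complex_of_real[symmetric]) (simp add: complex_norm_square del: of_real_power)
    finally have eq: "(LINT x|M. f x * cnj (psi x)) = of_real (F\<^sup>2) + (LINT x|M. f x * cnj (psi x - f x))" .
    have "cmod (LINT x|M. f x * cnj (psi x - f x)) \<le> F * nrm (\<lambda>x. cnj (psi x - f x))"
      by (rule CS[OF fL L2_cnj[OF e]])
    then have "\<bar>Im (LINT x|M. f x * cnj (psi x - f x))\<bar> \<le> F * del"
      using abs_Im_le_cmod[of "LINT x|M. f x * cnj (psi x - f x)"] unfolding nrm_cnj del_def[symmetric] by linarith
    then show ?thesis unfolding eq by simp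
  qed
  have 5: "mu ^ 3 * Im ((LINT x|M. f x * a3 x) + (LINT x|M. cnj (f x) * X3 x)) \<ge> 2 * Im (LINT x|M. cub u x * cnj (f x)) - 12 * F * A\<^sup>2 * Eb"
  proof -
    let ?e1 = "\<lambda>x. of_real (mu ^ 3) * a3 x + cnj (cub u x)" and ?e2 = "\<lambda>x. of_real (mu ^ 3) * X3 x - cub u x"
    have eL: "?e1 \<in> L2per L" "?e2 \<in> L2per L" by (intro Cper_L2 Cper_intros Ca3 CX3 Cper_cub Cu)+
    have "of_real (mu ^ 3) * (LINT x|M. f x * a3 x) = (LINT x|M. f x * ?e1 x - f x * cnj (cub u x))"
      unfolding integral_mult_right_zero[symmetric] by (simp add: algebra_simps)
    also have "\<dots> = (LINT x|M. f x * ?e1 x) - (LINT x|M. f x * cnj (cub u x))"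
      by (intro Bochner_Integration.integral_diff int_mult fL eL L2_cnj cL)
    finally have q1: "of_real (mu ^ 3) * (LINT x|M. f x * a3 x) = (LINT x|M. f x * ?e1 x) - (LINT x|M. f x * cnj (cub u x))" .
    have "of_real (mu ^ 3) * (LINT x|M. cnj (f x) * X3 x) = (LINT x|M. cnj (f x) * ?e2 x + cub u x * cnj (f x))"
      unfolding integral_mult_right_zero[symmetric] by (simp add: algebra_simps)
    also have "\<dots> = (LINT x|M. cnj (f x) * ?e2 x) + (LINT x|M. cub u x * cnj (f x))"
      by (intro Bochner_Integration.integral_add int_mult fL eL L2_cnj cL)
    finally have q2: "of_real (mu ^ 3) * (LINT x|M. cnj (f x) * X3 x) = (LINT x|M. cnj (f x) * ?e2 x) + (LINT x|M. cub u x * cnj (f x))" .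
    have q3: "(LINT x|M. f x * cnj (cub u x)) = cnj (LINT x|M. cub u x * cnj (f x))"
      unfolding cnj_LINT by (simp add: mult.commute)
    have "cmod (LINT x|M. f x * ?e1 x) \<le> F * nrm ?e1" by (rule CS[OF fL eL(1)])
    also have "\<dots> \<le> F * (6 * A\<^sup>2 * Eb)" by (intro mult_left_mono a3_limit) auto
    finally have b1: "\<bar>Im (LINT x|M. f x * ?e1 x)\<bar> \<le> F * (6 * A\<^sup>2 * Eb)"
      using abs_Im_le_cmod order_trans by blast
    have "cmod (LINT x|M. cnj (f x) * ?e2 x) \<le> nrm (\<lambda>x. cnj (f x)) * nrm ?e2" by (rule CS[OF L2_cnj[OF fL] eL(2)])
    also have "\<dots> \<le> F * (6 * A\<^sup>2 * Eb)" unfolding nrm_cnj by (intro mult_left_mono X3_limit) auto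
    finally have b2: "\<bar>Im (LINT x|M. cnj (f x) * ?e2 x)\<bar> \<le> F * (6 * A\<^sup>2 * Eb)"
      using abs_Im_le_cmod order_trans by blast
    have "mu ^ 3 * Im ((LINT x|M. f x * a3 x) + (LINT x|M. cnj (f x) * X3 x))
       = Im (of_real (mu ^ 3) * (LINT x|M. f x * a3 x)) + Im (of_real (mu ^ 3) * (LINT x|M. cnj (f x) * X3 x))"
      by (simp only: times_complex.sel Re_complex_of_real Im_complex_of_real plus_complex.sel) (simp add: algebra_simps)
    also have "\<dots> = Im (LINT x|M. f x * ?e1 x) + Im (LINT x|M. cnj (f x) * ?e2 x) + 2 * Im (LINT x|M. cub u x * cnj (f x))"
      unfolding q1 q2 q3 by simp
    finally show ?thesis using b1 b2 by linarith
  qed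
  have "GG lam = lam * (mu ^ 3 * Re (LINT x|M. u x * X x * (G x)\<^sup>2)) + 2 * lam * Re (LINT x|M. u x * cnj (psi x))
   - 2 * Im (LINT x|M. cub u x * cnj (psi x)) + 2 * Im (LINT x|M. f x * cnj (psi x))
   + mu ^ 3 * Im ((LINT x|M. f x * a3 x) + (LINT x|M. cnj (f x) * X3 x))"
    by (simp add: GG_def)
  then have "GG lam \<ge> - (5 * lam * N * A\<^sup>2 * Eb) - 2 * lam * N * F - 2 * (A\<^sup>2 * N * del) - 2 * (F * del) - 12 * F * A\<^sup>2 * Eb"
    using 1 2 3 4 5 by linarith
  then show ?thesis by (simp add: algebra_simps)
qed

end

subsection \<open>Differentiation along a solution\<close>

lemma has_vector_derivative_eventually_I:
  fixes h :: "real \<Rightarrow> 'a::real_normed_vector"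
  assumes "\<And>e. 0 < e \<Longrightarrow> eventually (\<lambda>s. norm (h s - h t - (s - t) *\<^sub>R d) \<le> e * \<bar>s - t\<bar>) (at t)"
  shows "(h has_vector_derivative d) (at t)"
  unfolding has_vector_derivative_def has_derivative_at_alt
proof (intro conjI allI impI)
  show "bounded_linear (\<lambda>x. x *\<^sub>R d)" by (rule bounded_linear_scaleR_left)
  fix e :: real assume "0 < e"
  from assms[OF this] obtain r where r: "0 < r" "\<And>s. s \<noteq> t \<Longrightarrow> dist s t < r \<Longrightarrow> norm (h s - h t - (s - t) *\<^sub>R d) \<le> e * \<bar>s - t\<bar>"
    unfolding eventually_at by auto
  show "\<exists>r>0. \<forall>y. norm (y - t) < r \<longrightarrow> norm (h y - h t - (y - t) *\<^sub>R d) \<le> e * norm (y - t)"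
  proof (intro exI[of _ r] conjI allI impI r(1))
    fix y assume "norm (y - t) < r"
    then show "norm (h y - h t - (y - t) *\<^sub>R d) \<le> e * norm (y - t)"
      using r(2)[of y] by (cases "y = t") (auto simp: dist_norm)
  qed
qed

context torus
begin

section \<open>Continuity and linearity of the weak flow\<close>

lemma flow_diff:
  assumes u: "ac u ux" "ac v vx" and \<phi>: "ac \<phi> \<phi>'"
  shows "cmod (flow lam f u ux \<phi> \<phi>' - flow lam f v vx \<phi> \<phi>')
    \<le> (nrm (\<lambda>x. ux x - vx x) + nrm (\<lambda>x. cub u x - cub v x) + \<bar>lam\<bar> * nrm (\<lambda>x. u x - v x)) * (nrm \<phi> + nrm \<phi>')"
proof -
  note L = acD(3)[OF u(1)] acD(3)[OF u(2)] acD(4)[OF u(1)] acD(4)[OF u(2)]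
    Cper_L2[OF Cper_cub[OF ac_Cper[OF u(1)]]] Cper_L2[OF Cper_cub[OF ac_Cper[OF u(2)]]] acD(3)[OF \<phi>] acD(4)[OF \<phi>]
  have d: "(LINT x|M. p x * r x) - (LINT x|M. q x * r x) = (LINT x|M. (p x - q x) * r x)"
    if "p \<in> L2per L" "q \<in> L2per L" "r \<in> L2per L" for p q r
    using int_mult(1)[OF that(1,3)] int_mult(1)[OF that(2,3)] by (simp add: left_diff_distrib)
  have "flow lam f u ux \<phi> \<phi>' - flow lam f v vx \<phi> \<phi>'
     = \<i> * (- ((LINT x|M. ux x * \<phi>' x) - (LINT x|M. vx x * \<phi>' x)) + ((LINT x|M. cub u x * \<phi> x) - (LINT x|M. cub v x * \<phi> x)))
       - of_real lam * ((LINT x|M. u x * \<phi> x) - (LINT x|M. v x * \<phi> x))"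
    by (simp add: flow_def algebra_simps)
  also have "\<dots> = \<i> * (- (LINT x|M. (ux x - vx x) * \<phi>' x) + (LINT x|M. (cub u x - cub v x) * \<phi> x))
       - of_real lam * (LINT x|M. (u x - v x) * \<phi> x)"
    by (simp only: d[OF L(1,2,7)] d[OF L(5,6,8)] d[OF L(3,4,8)])
  finally have eq: "flow lam f u ux \<phi> \<phi>' - flow lam f v vx \<phi> \<phi>' = \<i> * (- (LINT x|M. (ux x - vx x) * \<phi>' x) + (LINT x|M. (cub u x - cub v x) * \<phi> x))
       - of_real lam * (LINT x|M. (u x - v x) * \<phi> x)" .
  define I1 I2 I3 where I: "I1 = (LINT x|M. (ux x - vx x) * \<phi>' x)" "I2 = (LINT x|M. (cub u x - cub v x) * \<phi> x)"
    "I3 = (LINT x|M. (u x - v x) * \<phi> x)"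
  have b: "cmod I1 \<le> nrm (\<lambda>x. ux x - vx x) * nrm \<phi>'" "cmod I2 \<le> nrm (\<lambda>x. cub u x - cub v x) * nrm \<phi>"
    "cmod I3 \<le> nrm (\<lambda>x. u x - v x) * nrm \<phi>"
    unfolding I by (intro CS L2_diff L)+
  have b3: "\<bar>lam\<bar> * cmod I3 \<le> \<bar>lam\<bar> * (nrm (\<lambda>x. u x - v x) * nrm \<phi>)"
    by (rule mult_left_mono[OF b(3)]) simp
  have "cmod (\<i> * (- I1 + I2) - of_real lam * I3) \<le> cmod (- I1 + I2) + \<bar>lam\<bar> * cmod I3"
    using norm_triangle_ineq4[of "\<i> * (- I1 + I2)" "of_real lam * I3"] by (simp only: norm_mult norm_ii norm_of_real mult_1)
  moreover have "cmod (- I1 + I2) \<le> cmod I1 + cmod I2"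
    using norm_triangle_ineq[of "- I1" I2] by simp
  ultimately have "cmod (flow lam f u ux \<phi> \<phi>' - flow lam f v vx \<phi> \<phi>')
     \<le> nrm (\<lambda>x. ux x - vx x) * nrm \<phi>' + nrm (\<lambda>x. cub u x - cub v x) * nrm \<phi> + \<bar>lam\<bar> * (nrm (\<lambda>x. u x - v x) * nrm \<phi>)"
    unfolding eq I[symmetric] using b b3 by linarith
  also have "\<dots> \<le> (nrm (\<lambda>x. ux x - vx x) + nrm (\<lambda>x. cub u x - cub v x) + \<bar>lam\<bar> * nrm (\<lambda>x. u x - v x)) * (nrm \<phi> + nrm \<phi>')"
    by (simp add: algebra_simps)
  finally show ?thesis .
qed

lemma flow_bound:
  assumes u: "ac u ux" and \<phi>: "ac \<phi> \<phi>'" and f: "f \<in> L2per L"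
  shows "cmod (flow lam f u ux \<phi> \<phi>') \<le> (nrm ux + nrm (cub u) + nrm f + \<bar>lam\<bar> * nrm u) * (nrm \<phi> + nrm \<phi>')"
proof -
  note L = acD(3)[OF u] acD(4)[OF u] Cper_L2[OF Cper_cub[OF ac_Cper[OF u]]] acD(3)[OF \<phi>] acD(4)[OF \<phi>]
  define I1 I2 I3 I4 where d: "I1 = (LINT x|M. ux x * \<phi>' x)" "I2 = (LINT x|M. cub u x * \<phi> x)"
    "I3 = (LINT x|M. f x * \<phi> x)" "I4 = (LINT x|M. u x * \<phi> x)"
  have b: "cmod I1 \<le> nrm ux * nrm \<phi>'" "cmod I2 \<le> nrm (cub u) * nrm \<phi>" "cmod I3 \<le> nrm f * nrm \<phi>" "cmod I4 \<le> nrm u * nrm \<phi>"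
    unfolding d by (intro CS L f)+
  have "cmod (flow lam f u ux \<phi> \<phi>') = cmod (\<i> * (- I1 + I2 - I3) - of_real lam * I4)"
    unfolding flow_def d ..
  also have "\<dots> \<le> cmod (- I1 + I2 - I3) + \<bar>lam\<bar> * cmod I4"
    using norm_triangle_ineq4[of "\<i> * (- I1 + I2 - I3)" "of_real lam * I4"] by (simp only: norm_mult norm_ii norm_of_real mult_1)
  finally have c1: "cmod (flow lam f u ux \<phi> \<phi>') \<le> cmod (- I1 + I2 - I3) + \<bar>lam\<bar> * cmod I4" .
  have c2: "cmod (- I1 + I2 - I3) \<le> cmod I1 + cmod I2 + cmod I3"
    using norm_triangle_ineq4[of "- I1 + I2" I3] norm_triangle_ineq[of "- I1" I2] by simp
  have "\<bar>lam\<bar> * cmod I4 \<le> \<bar>lam\<bar> * (nrm u * nrm \<phi>)"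
    using b by (intro mult_left_mono) auto
  with c1 c2 have "cmod (flow lam f u ux \<phi> \<phi>') \<le> nrm ux * nrm \<phi>' + nrm (cub u) * nrm \<phi> + nrm f * nrm \<phi> + \<bar>lam\<bar> * (nrm u * nrm \<phi>)"
    using b by linarith
  also have "\<dots> \<le> (nrm ux + nrm (cub u) + nrm f + \<bar>lam\<bar> * nrm u) * (nrm \<phi> + nrm \<phi>')"
    by (simp add: algebra_simps)
  finally show ?thesis .
qed

lemma flow_sub:
  assumes u: "ac u ux" and f: "f \<in> L2per L" and \<phi>: "ac \<phi> \<phi>'" "ac \<psi> \<psi>'"
  shows "flow lam f u ux (\<lambda>x. \<phi> x - \<psi> x) (\<lambda>x. \<phi>' x - \<psi>' x) = flow lam f u ux \<phi> \<phi>' - flow lam f u ux \<psi> \<psi>'"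
proof -
  note L = acD(3)[OF u] acD(4)[OF u] Cper_L2[OF Cper_cub[OF ac_Cper[OF u]]] acD(3,4)[OF \<phi>(1)] acD(3,4)[OF \<phi>(2)]
  have d: "(LINT x|M. r x * (p x - q x)) = (LINT x|M. r x * p x) - (LINT x|M. r x * q x)"
    if "p \<in> L2per L" "q \<in> L2per L" "r \<in> L2per L" for p q r
    using int_mult(1)[OF that(3,1)] int_mult(1)[OF that(3,2)] by (simp add: right_diff_distrib)
  show ?thesis unfolding flow_def
    by (simp only: d L f) (simp add: algebra_simps)
qed

lemma flow_imult:
  "flow lam f u ux (\<lambda>x. k * \<phi> x) (\<lambda>x. k * \<phi>' x) = k * flow lam f u ux \<phi> \<phi>'"
proof -
  have "(LINT x|M. r x * (k * p x)) = k * (LINT x|M. r x * p x)" for r p :: "real \<Rightarrow> complex"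
    unfolding integral_mult_right_zero[symmetric] by (simp add: mult.left_commute)
  then show ?thesis unfolding flow_def by (simp add: algebra_simps)
qed

lemma flow_sum:
  assumes u: "ac u ux" and f: "f \<in> L2per L" and \<phi>: "ac \<phi> \<phi>'" "ac \<psi> \<psi>'"
  shows "flow lam f u ux (\<lambda>x. \<phi> x + \<psi> x) (\<lambda>x. \<phi>' x + \<psi>' x) = flow lam f u ux \<phi> \<phi>' + flow lam f u ux \<psi> \<psi>'"
  using flow_sub[OF u f \<phi>(1) ac_uminus[OF \<phi>(2)], of lam] flow_imult[of lam f u ux "-1" \<psi> \<psi>'] by simp

lemma cub_lip:
  assumes u: "ac u ux" "ac v vx" and A: "\<And>x. cmod (u x) \<le> A" "\<And>x. cmod (v x) \<le> A"
  shows "nrm (\<lambda>x. cub u x - cub v x) \<le> 3 * A\<^sup>2 * nrm (\<lambda>x. u x - v x)"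
proof -
  have L: "Cper u" "Cper v" using u ac_Cper by blast+
  have "cmod (cub u x - cub v x) \<le> cmod (of_real (3 * A\<^sup>2) * (u x - v x))" for x
  proof -
    have b: "cmod (y * z) \<le> A * A" if "cmod y \<le> A" "cmod z \<le> A" for y z
      using that order_trans[OF norm_ge_zero] unfolding norm_mult by (intro mult_mono) auto
    have c: "cmod (cnj (u x)) \<le> A" "cmod (cnj (v x)) \<le> A" using A by auto
    have eq: "cub u x - cub v x = (u x * cnj (u x)) * (u x - v x) + (cnj (u x) * v x) * (u x - v x) + (v x * v x) * cnj (u x - v x)"
      by (simp add: cub_eq algebra_simps)
    have "cmod (cub u x - cub v x) \<le> cmod ((u x * cnj (u x)) * (u x - v x)) + cmod ((cnj (u x) * v x) * (u x - v x)) + cmod ((v x * v x) * cnj (u x - v x))"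
      unfolding eq by (intro order_trans[OF norm_triangle_ineq] add_right_mono norm_triangle_ineq)
    also have "\<dots> = (cmod (u x * cnj (u x)) + cmod (cnj (u x) * v x) + cmod (v x * v x)) * cmod (u x - v x)"
      unfolding norm_mult complex_mod_cnj by (simp add: algebra_simps)
    also have "\<dots> \<le> (A * A + A * A + A * A) * cmod (u x - v x)"
      by (intro mult_right_mono add_mono b A c) auto
    also have "\<dots> = cmod (of_real (3 * A\<^sup>2) * (u x - v x))"
      unfolding norm_mult[of "of_real _"] norm_of_real by (simp add: power2_eq_square)
    finally show ?thesis .
  qed
  then have "nrm (\<lambda>x. cub u x - cub v x) \<le> nrm (\<lambda>x. of_real (3 * A\<^sup>2) * (u x - v x))"
    by (intro nrm_mono Cper_L2 Cper_intros L Cper_cub) auto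
  then show ?thesis unfolding nrm_cmult norm_of_real by simp
qed

lemma nrm_diff_bounds:
  assumes "g \<in> L2per L" "h \<in> L2per L"
  shows "\<bar>nrm g - nrm h\<bar> \<le> nrm (\<lambda>x. g x - h x)"
  using nrm_triangle[OF L2_diff[OF assms] assms(2)] nrm_triangle[OF L2_diff[OF assms(2,1)] assms(1)]
    nrm_diff_commute[of g h] by simp

end

section \<open>Time regularity of a solution\<close>

locale nls = torus +
  fixes lam :: real and f :: "real \<Rightarrow> complex" and u :: "real \<Rightarrow> real \<Rightarrow> complex"
  assumes fL: "f \<in> L2per L" and sol_u: "nls_solution L lam f u"
begin

definition "ux t = wderiv L (u t)"
definition "Nt t = nrm (u t)"
definition "Dt t = nrm (ux t)"
definition "St t = sqrt ((Nt t)\<^sup>2 / L + 2 * Nt t * Dt t)"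

lemma u_H1: "u t \<in> H1per L"
proof -
  interpret H: Metric_space "H1per L" "H1dist L" by (rule H1_metric)
  have "continuous_map euclideanreal H.mtopology u"
    using sol_u by (simp add: nls_solution_def H1top_def)
  then show ?thesis using continuous_map_image_subset_topspace by fastforce
qed

lemma ac_u: "ac (u t) (ux t)"
  unfolding ux_def by (rule H1_ac[OF u_H1])

lemma u_cont: "((\<lambda>s. H1dist L (u s) (u t)) \<longlongrightarrow> 0) (at t)"
proof -
  interpret H: Metric_space "H1per L" "H1dist L" by (rule H1_metric)
  have c: "continuous_map euclideanreal H.mtopology u"
    using sol_u by (simp add: nls_solution_def H1top_def)
  show ?thesis
  proof (rule tendstoI)
    fix e :: real assume e: "0 < e"
    have "\<exists>U. openin euclideanreal U \<and> t \<in> U \<and> (\<forall>y\<in>U. u y \<in> H.mball (u t) e)"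
      using c[unfolded H.continuous_map_to_metric] e by simp
    then obtain U where U: "openin euclideanreal U" "t \<in> U" "\<forall>y\<in>U. u y \<in> H.mball (u t) e"
      by blast
    have "eventually (\<lambda>s. s \<in> U) (at t)"
      using U(1,2) by (intro eventually_at_in_open') auto
    then show "eventually (\<lambda>s. dist (H1dist L (u s) (u t)) 0 < e) (at t)"
    proof eventually_elim
      case (elim s)
      then have "H1dist L (u t) (u s) < e" using U(3) by auto
      then show ?case using H.commute[of "u s" "u t"] H.nonneg[of "u s" "u t"] by simp
    qed
  qed
qed

lemma dist_le: "nrm (\<lambda>x. u s x - u t x) \<le> H1dist L (u s) (u t)" "nrm (\<lambda>x. ux s x - ux t x) \<le> H1dist L (u s) (u t)"
  unfolding H1dist_eq[OF u_H1 u_H1] ux_def by (auto intro: real_le_rsqrt)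

lemma du_lim: "((\<lambda>s. nrm (\<lambda>x. u s x - u t x)) \<longlongrightarrow> 0) (at t)" "((\<lambda>s. nrm (\<lambda>x. ux s x - ux t x)) \<longlongrightarrow> 0) (at t)"
  by (rule Lim_null_comparison[OF always_eventually u_cont[of t]]; use dist_le in simp)+

lemma Nt_cont: "isCont Nt t" and Dt_cont: "isCont Dt t"
proof -
  have "((\<lambda>s. Nt s - Nt t) \<longlongrightarrow> 0) (at t)" "((\<lambda>s. Dt s - Dt t) \<longlongrightarrow> 0) (at t)"
    unfolding Nt_def Dt_def
    by (rule Lim_null_comparison[OF always_eventually du_lim(1)], use nrm_diff_bounds acD(4)[OF ac_u] in simp)
       (rule Lim_null_comparison[OF always_eventually du_lim(2)], use nrm_diff_bounds acD(3)[OF ac_u] in simp)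
  then show "isCont Nt t" "isCont Dt t" unfolding isCont_def by (simp_all add: LIM_zero_iff)
qed

lemma NDt_nonneg: "0 \<le> Nt t" "0 \<le> Dt t" by (simp_all add: Nt_def Dt_def)

lemma St_cont: "isCont St t"
  unfolding St_def using L_pos by (intro continuous_intros Nt_cont Dt_cont) auto

lemma u_sup: "cmod (u t x) \<le> St t"
  unfolding St_def Nt_def Dt_def using ac_sobolev[OF ac_u] by (rule real_le_rsqrt)

lemma St_nonneg: "0 \<le> St t" using u_sup norm_ge_zero order_trans by blast

abbreviation "Fl t \<equiv> flow lam f (u t) (ux t)"

definition "w s t = nrm (\<lambda>x. ux s x - ux t x) + nrm (\<lambda>x. cub (u s) x - cub (u t) x) + \<bar>lam\<bar> * nrm (\<lambda>x. u s x - u t x)"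

lemma Fl_diff: "ac \<phi> \<phi>' \<Longrightarrow> cmod (Fl s \<phi> \<phi>' - Fl t \<phi> \<phi>') \<le> w s t * (nrm \<phi> + nrm \<phi>')"
  unfolding w_def by (rule flow_diff[OF ac_u ac_u])

lemma w_lim: "((\<lambda>s. w s t) \<longlongrightarrow> 0) (at t)"
proof -
  have "((\<lambda>s. 3 * (max (St s) (St t))\<^sup>2 * nrm (\<lambda>x. u s x - u t x)) \<longlongrightarrow> 3 * (max (St t) (St t))\<^sup>2 * 0) (at t)"
    by (intro tendsto_intros du_lim isContD[OF St_cont])
  then have l: "((\<lambda>s. 3 * (max (St s) (St t))\<^sup>2 * nrm (\<lambda>x. u s x - u t x)) \<longlongrightarrow> 0) (at t)" by simp
  have b: "nrm (\<lambda>x. cub (u s) x - cub (u t) x) \<le> 3 * (max (St s) (St t))\<^sup>2 * nrm (\<lambda>x. u s x - u t x)" for s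
  proof (rule cub_lip[OF ac_u ac_u])
    show "cmod (u s x) \<le> max (St s) (St t)" for x using u_sup[of s x] by linarith
    show "cmod (u t x) \<le> max (St s) (St t)" for x using u_sup[of t x] by linarith
  qed
  have "((\<lambda>s. nrm (\<lambda>x. cub (u s) x - cub (u t) x)) \<longlongrightarrow> 0) (at t)"
    by (rule Lim_null_comparison[OF always_eventually l]) (use b in simp)
  then have "((\<lambda>s. w s t) \<longlongrightarrow> 0 + 0 + \<bar>lam\<bar> * 0) (at t)"
    unfolding w_def by (intro tendsto_intros du_lim)
  then show ?thesis by simp
qed

lemma w_nonneg: "0 \<le> w s t" by (simp add: w_def)

lemma test_derivative:
  assumes \<phi>: "test_fun L \<phi>"
  shows "((\<lambda>s. LINT x|M. u s x * complex_of_real (\<phi> x)) has_vector_derivative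
    Fl t (\<lambda>x. complex_of_real (\<phi> x)) (\<lambda>x. complex_of_real (deriv \<phi> x))) (at t)"
proof -
  obtain d where d: "((\<lambda>s. pairing L (u s) \<phi>) has_vector_derivative d) (at t)"
    "\<i> * d + pairing L (u t) (deriv (deriv \<phi>)) + pairing L (\<lambda>x. complex_of_real ((cmod (u t x))\<^sup>2) * u t x) \<phi>
               + \<i> * complex_of_real lam * pairing L (u t) \<phi> = pairing L f \<phi>"
    using sol_u \<phi> unfolding nls_solution_def by blast
  have p: "pairing L (u t) (deriv (deriv \<phi>)) = - (LINT x|M. ux t x * complex_of_real (deriv \<phi> x))"
    unfolding pairing_LINT by (rule ac_parts[OF ac_u test_ac[OF test_fun_deriv[OF \<phi>]]])
  have "\<i> * d = \<i> * Fl t (\<lambda>x. complex_of_real (\<phi> x)) (\<lambda>x. complex_of_real (deriv \<phi> x))"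
  proof -
    define P C Q R where d': "P = (LINT x|M. ux t x * complex_of_real (deriv \<phi> x))"
      "C = (LINT x|M. complex_of_real ((cmod (u t x))\<^sup>2) * u t x * complex_of_real (\<phi> x))"
      "Q = (LINT x|M. u t x * complex_of_real (\<phi> x))" "R = (LINT x|M. f x * complex_of_real (\<phi> x))"
    have "\<i> * d + - P + C + \<i> * of_real lam * Q = R"
      using d(2)[unfolded p] unfolding pairing_LINT d' .
    then have "\<i> * d = R + P - C - \<i> * of_real lam * Q" by (simp add: algebra_simps)
    also have "\<dots> = \<i> * (\<i> * (- P + C - R) - of_real lam * Q)" by (simp add: algebra_simps)
    finally show ?thesis unfolding flow_def cub_def d' .
  qed
  then have "d = Fl t (\<lambda>x. complex_of_real (\<phi> x)) (\<lambda>x. complex_of_real (deriv \<phi> x))" by simp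
  then show ?thesis using d(1) unfolding pairing_LINT by simp
qed

text \<open>
  The error of the first order expansion of \<open>u\<close> in time. The equation only says that it is
  \<open>o(s - t)\<close> for each fixed test function; taking \<open>\<phi>\<close> to be the increment of
  \<open>u\<close> itself shows that the squared \<open>L\<^sup>2\<close> norm of the increment is \<open>o(s - t)\<close>.
\<close>
definition "Err s t \<phi> \<phi>' = (LINT x|M. (u s x - u t x) * \<phi> x) - of_real (s - t) * Fl t \<phi> \<phi>'"

lemma uL: "u t \<in> L2per L" by (rule acD(4)[OF ac_u])

lemma duL: "(\<lambda>x. u s x - u t x) \<in> L2per L" by (intro L2_diff uL)

text \<open>The mean value inequality on the segment from \<open>t\<close> to \<open>s\<close>: the
  tested solution has derivative \<open>Fl\<close>, and \<open>w\<close> measures how much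
  \<open>Fl\<close> varies relative to the norms of the test function.\<close>

lemma Err_test:
  assumes \<phi>: "test_fun L \<phi>" and e: "\<And>r. \<bar>r - t\<bar> \<le> \<bar>s - t\<bar> \<Longrightarrow> w r t \<le> e"
  shows "cmod (Err s t (\<lambda>x. complex_of_real (\<phi> x)) (\<lambda>x. complex_of_real (deriv \<phi> x)))
    \<le> \<bar>s - t\<bar> * (e * (nrm (\<lambda>x. complex_of_real (\<phi> x)) + nrm (\<lambda>x. complex_of_real (deriv \<phi> x))))"
proof -
  let ?p = "\<lambda>x. complex_of_real (\<phi> x)" and ?p' = "\<lambda>x. complex_of_real (deriv \<phi> x)"
  let ?h = "\<lambda>s. LINT x|M. u s x * ?p x"
  have "cmod (?h s - ?h t - (s - t) *\<^sub>R Fl t ?p ?p') \<le> norm (s - t) * (e * (nrm ?p + nrm ?p'))"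
  proof (rule vector_differentiable_bound_linearization[where S = "cball t \<bar>s - t\<bar>" and f' = "\<lambda>r. Fl r ?p ?p'"])
    show "closed_segment t s \<subseteq> cball t \<bar>s - t\<bar>"
      by (intro closed_segment_subset) (auto simp: dist_norm)
    show "(?h has_vector_derivative Fl r ?p ?p') (at r within cball t \<bar>s - t\<bar>)" for r
      by (rule has_vector_derivative_at_within[OF test_derivative[OF \<phi>]])
    show "norm (Fl r ?p ?p' - Fl t ?p ?p') \<le> e * (nrm ?p + nrm ?p')" if "r \<in> cball t \<bar>s - t\<bar>" for r
    proof -
      have "w r t \<le> e" using that by (intro e) (simp add: dist_norm)
      then have "w r t * (nrm ?p + nrm ?p') \<le> e * (nrm ?p + nrm ?p')" by (intro mult_right_mono) auto
      then show ?thesis using Fl_diff[OF test_ac[OF \<phi>], of r t] by linarith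
    qed
  qed auto
  moreover have "?h s - ?h t = (LINT x|M. (u s x - u t x) * ?p x)"
    using int_mult(1)[OF uL test_L2[OF \<phi>]] by (simp add: left_diff_distrib)
  ultimately show ?thesis by (simp add: Err_def scaleR_conv_of_real)
qed

lemma Err_sub:
  assumes "ac \<phi> \<phi>'" "ac \<psi> \<psi>'"
  shows "Err s t (\<lambda>x. \<phi> x - \<psi> x) (\<lambda>x. \<phi>' x - \<psi>' x) = Err s t \<phi> \<phi>' - Err s t \<psi> \<psi>'"
proof -
  have "(LINT x|M. (u s x - u t x) * (\<phi> x - \<psi> x)) = (LINT x|M. (u s x - u t x) * \<phi> x - (u s x - u t x) * \<psi> x)"
    by (simp add: right_diff_distrib)
  also have "\<dots> = (LINT x|M. (u s x - u t x) * \<phi> x) - (LINT x|M. (u s x - u t x) * \<psi> x)"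
    by (intro Bochner_Integration.integral_diff int_mult duL acD(4)[OF assms(1)] acD(4)[OF assms(2)])
  finally show ?thesis unfolding Err_def flow_sub[OF ac_u fL assms] by (simp add: algebra_simps)
qed

lemma Err_add_i:
  assumes "ac \<phi> \<phi>'" "ac \<psi> \<psi>'"
  shows "Err s t (\<lambda>x. \<phi> x + \<i> * \<psi> x) (\<lambda>x. \<phi>' x + \<i> * \<psi>' x) = Err s t \<phi> \<phi>' + \<i> * Err s t \<psi> \<psi>'"
proof -
  have "(LINT x|M. (u s x - u t x) * (\<phi> x + \<i> * \<psi> x)) = (LINT x|M. (u s x - u t x) * \<phi> x + \<i> * ((u s x - u t x) * \<psi> x))"
    by (simp add: algebra_simps)
  also have "\<dots> = (LINT x|M. (u s x - u t x) * \<phi> x) + (LINT x|M. \<i> * ((u s x - u t x) * \<psi> x))"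
    by (intro Bochner_Integration.integral_add integrable_mult_right int_mult duL acD(4)[OF assms(1)] acD(4)[OF assms(2)])
  finally show ?thesis
    unfolding Err_def flow_sum[OF ac_u fL assms(1) ac_cmult[OF assms(2)]] flow_imult integral_mult_right_zero
    by (simp only: distrib_left right_diff_distrib distrib_right left_diff_distrib) (simp add: mult.left_commute)
qed

lemma nrm_Re_Im: "h \<in> L2per L \<Longrightarrow> nrm (\<lambda>x. complex_of_real (Re (h x))) \<le> nrm h" "h \<in> L2per L \<Longrightarrow> nrm (\<lambda>x. complex_of_real (Im (h x))) \<le> nrm h"
proof -
  assume h: "h \<in> L2per L"
  have [measurable]: "h \<in> borel_measurable lebesgue" by (rule L2D(2)[OF h])
  have p: "periodic L h" by (rule L2D(1)[OF h])
  have "(\<lambda>x. complex_of_real (Re (h x))) \<in> L2per L" "(\<lambda>x. complex_of_real (Im (h x))) \<in> L2per L"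
    by (rule L2_dominated[OF _ _ L2D(4)[OF h]]; use p in \<open>auto simp: periodic_def abs_Re_le_cmod abs_Im_le_cmod power2_le_iff_abs_le cmod_power2\<close>)+
  then show "nrm (\<lambda>x. complex_of_real (Re (h x))) \<le> nrm h" "nrm (\<lambda>x. complex_of_real (Im (h x))) \<le> nrm h"
    using h by (auto intro!: nrm_mono simp: abs_Re_le_cmod abs_Im_le_cmod)
qed

text \<open>The bound for test functions depends on them only through norms, so it passes to the
  limit along \<open>ac_approx\<close>. The factor 2 pays for treating real and imaginary parts
  separately. Uniformity in the test function is essential: it may then depend on
  \<open>s\<close>.\<close>

lemma Err_ac:
  assumes \<phi>: "ac \<phi> \<phi>'" and e: "\<And>r. \<bar>r - t\<bar> \<le> \<bar>s - t\<bar> \<Longrightarrow> w r t \<le> e"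
  shows "cmod (Err s t \<phi> \<phi>') \<le> 2 * e * \<bar>s - t\<bar> * (nrm \<phi> + nrm \<phi>')"
proof -
  obtain p q where pq: "\<And>n. test_fun L (p n)" "\<And>n. test_fun L (q n)"
    "(\<lambda>n. nrm (\<lambda>x. Complex (deriv (p n) x) (deriv (q n) x) - \<phi>' x)) \<longlonglongrightarrow> 0"
    "uniform_limit UNIV (\<lambda>n x. Complex (p n x) (q n x)) \<phi> sequentially"
    using ac_approx[OF \<phi>] by blast
  define P P' where "P n x = Complex (p n x) (q n x)" and "P' n x = Complex (deriv (p n) x) (deriv (q n) x)" for n x
  have acP: "ac (P n) (P' n)" for n unfolding P_def P'_def by (rule ctest_ac[OF pq(1,2)])
  have dP: "ac (\<lambda>x. P n x - \<phi> x) (\<lambda>x. P' n x - \<phi>' x)" for n by (rule ac_diff[OF acP \<phi>])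
  have e0: "0 \<le> e" using e[of t] w_nonneg[of t t] by simp
  have l1: "(\<lambda>n. nrm (\<lambda>x. P' n x - \<phi>' x)) \<longlonglongrightarrow> 0" using pq(3) by (simp add: P'_def)
  have "(\<lambda>n. nrm (\<lambda>x. (P n x - \<phi> x) * 1)) \<longlonglongrightarrow> 0"
    by (rule nrm_tendsto_unif[OF _ acD(1)[OF dP] acD(2)[OF dP] L2_one]) (use uniform_limit_minus[OF pq(4)] in \<open>simp add: P_def\<close>)
  then have l0: "(\<lambda>n. nrm (\<lambda>x. P n x - \<phi> x)) \<longlonglongrightarrow> 0" by simp
  have bP: "cmod (Err s t (P n) (P' n)) \<le> 2 * e * \<bar>s - t\<bar> * (nrm (P n) + nrm (P' n))" for n
  proof -
    let ?p = "\<lambda>x. complex_of_real (p n x)" and ?p' = "\<lambda>x. complex_of_real (deriv (p n) x)"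
    let ?q = "\<lambda>x. complex_of_real (q n x)" and ?q' = "\<lambda>x. complex_of_real (deriv (q n) x)"
    have "Err s t (P n) (P' n) = Err s t ?p ?p' + \<i> * Err s t ?q ?q'"
      using Err_add_i[OF test_ac[OF pq(1)] test_ac[OF pq(2)], of s t n n] by (simp add: P_def[abs_def] P'_def[abs_def] Complex_eq)
    then have "cmod (Err s t (P n) (P' n)) \<le> cmod (Err s t ?p ?p') + cmod (Err s t ?q ?q')"
      using norm_triangle_ineq[of "Err s t ?p ?p'" "\<i> * Err s t ?q ?q'"] by (simp add: norm_mult)
    also have "\<dots> \<le> \<bar>s - t\<bar> * (e * (nrm ?p + nrm ?p')) + \<bar>s - t\<bar> * (e * (nrm ?q + nrm ?q'))"
      by (intro add_mono Err_test pq e)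
    also have "\<dots> \<le> \<bar>s - t\<bar> * (e * (nrm (P n) + nrm (P' n))) + \<bar>s - t\<bar> * (e * (nrm (P n) + nrm (P' n)))"
      using nrm_Re_Im[OF acD(4)[OF acP], of n] nrm_Re_Im[OF acD(3)[OF acP], of n] e0
      by (intro add_mono mult_left_mono) (auto simp: P_def P'_def)
    finally show ?thesis by (simp add: algebra_simps)
  qed
  define K where "K = nrm (\<lambda>x. u s x - u t x) + \<bar>s - t\<bar> * (nrm (ux t) + nrm (cub (u t)) + nrm f + \<bar>lam\<bar> * nrm (u t))"
  have dE: "cmod (Err s t (P n) (P' n) - Err s t \<phi> \<phi>') \<le> K * (nrm (\<lambda>x. P n x - \<phi> x) + nrm (\<lambda>x. P' n x - \<phi>' x))" for n
  proof -
    let ?d = "\<lambda>x. P n x - \<phi> x" and ?d' = "\<lambda>x. P' n x - \<phi>' x"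
    have "cmod (Err s t ?d ?d') \<le> cmod (LINT x|M. (u s x - u t x) * ?d x) + \<bar>s - t\<bar> * cmod (Fl t ?d ?d')"
      unfolding Err_def using norm_triangle_ineq4[of "LINT x|M. (u s x - u t x) * ?d x" "of_real (s - t) * Fl t ?d ?d'"]
      by (simp only: norm_mult norm_of_real)
    also have "\<dots> \<le> nrm (\<lambda>x. u s x - u t x) * nrm ?d + \<bar>s - t\<bar> * ((nrm (ux t) + nrm (cub (u t)) + nrm f + \<bar>lam\<bar> * nrm (u t)) * (nrm ?d + nrm ?d'))"
      by (intro add_mono CS duL acD(4)[OF dP] mult_left_mono flow_bound ac_u dP fL) auto
    also have "\<dots> \<le> K * (nrm ?d + nrm ?d')"
      by (simp add: K_def algebra_simps)
    finally show ?thesis unfolding Err_sub[OF acP \<phi>] .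
  qed
  have "(\<lambda>n. K * (nrm (\<lambda>x. P n x - \<phi> x) + nrm (\<lambda>x. P' n x - \<phi>' x))) \<longlonglongrightarrow> K * (0 + 0)"
    by (intro tendsto_intros l0 l1)
  then have lim2: "(\<lambda>n. K * (nrm (\<lambda>x. P n x - \<phi> x) + nrm (\<lambda>x. P' n x - \<phi>' x))) \<longlonglongrightarrow> 0" by simp
  have "(\<lambda>n. Err s t (P n) (P' n) - Err s t \<phi> \<phi>') \<longlonglongrightarrow> 0"
    by (rule Lim_null_comparison[OF always_eventually lim2]) (use dE in simp)
  then have lE: "(\<lambda>n. cmod (Err s t (P n) (P' n))) \<longlonglongrightarrow> cmod (Err s t \<phi> \<phi>')"
    by (intro tendsto_norm) (simp add: LIM_zero_iff)
  have n0: "(\<lambda>n. nrm (P n) - nrm \<phi>) \<longlonglongrightarrow> 0"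
    by (rule Lim_null_comparison[OF always_eventually l0]) (use nrm_diff_bounds[OF acD(4)[OF acP] acD(4)[OF \<phi>]] in simp)
  have n1: "(\<lambda>n. nrm (P' n) - nrm \<phi>') \<longlonglongrightarrow> 0"
    by (rule Lim_null_comparison[OF always_eventually l1]) (use nrm_diff_bounds[OF acD(3)[OF acP] acD(3)[OF \<phi>]] in simp)
  have "(\<lambda>n. 2 * e * \<bar>s - t\<bar> * (nrm (P n) + nrm (P' n))) \<longlonglongrightarrow> 2 * e * \<bar>s - t\<bar> * (nrm \<phi> + nrm \<phi>')"
    using n0 n1 by (intro tendsto_intros) (simp_all add: LIM_zero_iff)
  from LIMSEQ_le[OF lE this] bP show ?thesis by blast
qed

lemma w_small:
  assumes "0 < e"
  shows "eventually (\<lambda>s. \<forall>r. \<bar>r - t\<bar> \<le> \<bar>s - t\<bar> \<longrightarrow> w r t \<le> e) (at t)"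
proof -
  have "eventually (\<lambda>s. w s t < e) (at t)"
    using w_lim assms by (rule order_tendstoD(2))
  then obtain d where d: "0 < d" "\<And>r. r \<noteq> t \<Longrightarrow> dist r t < d \<Longrightarrow> w r t < e"
    unfolding eventually_at by auto
  have tt: "w t t = 0" by (simp add: w_def nrm_def)
  show ?thesis
    unfolding eventually_at
  proof (intro exI[of _ d] conjI d(1) ballI impI allI)
    fix s r assume s: "s \<noteq> t \<and> dist s t < d" and r: "\<bar>r - t\<bar> \<le> \<bar>s - t\<bar>"
    show "w r t \<le> e"
    proof (cases "r = t")
      case True then show ?thesis using tt assms by simp
    next
      case False
      have "dist r t < d" using s r by (simp add: dist_real_def)
      then show ?thesis using d(2)[OF False] by simp
    qed
  qed
qed

lemma Err_small:
  assumes "0 < e"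
  shows "eventually (\<lambda>s. \<forall>\<phi> \<phi>'. ac \<phi> \<phi>' \<longrightarrow> cmod (Err s t \<phi> \<phi>') \<le> e * \<bar>s - t\<bar> * (nrm \<phi> + nrm \<phi>')) (at t)"
proof -
  have "0 < e / 2" using assms by simp
  from w_small[OF this, of t] show ?thesis
  proof eventually_elim
    case (elim s)
    show ?case
    proof (intro allI impI)
      fix \<phi> \<phi>' assume a: "ac \<phi> \<phi>'"
      show "cmod (Err s t \<phi> \<phi>') \<le> e * \<bar>s - t\<bar> * (nrm \<phi> + nrm \<phi>')"
        using Err_ac[OF a, of t s "e / 2"] elim by simp
    qed
  qed
qed

lemma L2_little_o:
  assumes e: "0 < e"
  shows "eventually (\<lambda>s. (nrm (\<lambda>x. u s x - u t x))\<^sup>2 \<le> e * \<bar>s - t\<bar>) (at t)"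
proof -
  define K where "K = nrm (ux t) + nrm (cub (u t)) + nrm f + \<bar>lam\<bar> * nrm (u t) + 1"
  have K: "0 < K" unfolding K_def by (intro add_nonneg_pos add_nonneg_nonneg) auto
  have l: "((\<lambda>s. K * (nrm (\<lambda>x. u s x - u t x) + nrm (\<lambda>x. ux s x - ux t x))) \<longlongrightarrow> K * (0 + 0)) (at t)"
    by (intro tendsto_intros du_lim)
  have "eventually (\<lambda>s. K * (nrm (\<lambda>x. u s x - u t x) + nrm (\<lambda>x. ux s x - ux t x)) < e) (at t)"
    using order_tendstoD(2)[OF l, of e] e by simp
  with Err_small[OF zero_less_one, of t] show ?thesis
  proof eventually_elim
    case (elim s)
    let ?d = "\<lambda>x. u s x - u t x" and ?d' = "\<lambda>x. ux s x - ux t x"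
    have ac: "ac (\<lambda>x. cnj (?d x)) (\<lambda>x. cnj (?d' x))" by (intro ac_cnj ac_diff ac_u)
    have n: "nrm (\<lambda>x. cnj (?d x)) = nrm ?d" "nrm (\<lambda>x. cnj (?d' x)) = nrm ?d'" by (rule nrm_cnj)+
    have "(LINT x|M. ?d x * cnj (?d x)) = of_real ((nrm ?d)\<^sup>2)"
      unfolding nrm_sq by (subst integral_complex_of_real[symmetric]) (simp add: complex_norm_square del: of_real_power)
    then have "of_real ((nrm ?d)\<^sup>2) = Err s t (\<lambda>x. cnj (?d x)) (\<lambda>x. cnj (?d' x)) + of_real (s - t) * Fl t (\<lambda>x. cnj (?d x)) (\<lambda>x. cnj (?d' x))"
      unfolding Err_def by simp
    then have q1: "cmod (of_real ((nrm ?d)\<^sup>2)) \<le> cmod (Err s t (\<lambda>x. cnj (?d x)) (\<lambda>x. cnj (?d' x))) + \<bar>s - t\<bar> * cmod (Fl t (\<lambda>x. cnj (?d x)) (\<lambda>x. cnj (?d' x)))"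
      using norm_triangle_ineq[of "Err s t (\<lambda>x. cnj (?d x)) (\<lambda>x. cnj (?d' x))" "of_real (s - t) * Fl t (\<lambda>x. cnj (?d x)) (\<lambda>x. cnj (?d' x))"]
      by (simp only: norm_mult norm_of_real)
    have q2: "cmod (of_real ((nrm ?d)\<^sup>2)) = (nrm ?d)\<^sup>2" unfolding norm_of_real by simp
    have q3: "cmod (Err s t (\<lambda>x. cnj (?d x)) (\<lambda>x. cnj (?d' x))) \<le> 1 * \<bar>s - t\<bar> * (nrm ?d + nrm ?d')"
      using elim(1)[rule_format, OF ac] unfolding n .
    have q4: "\<bar>s - t\<bar> * cmod (Fl t (\<lambda>x. cnj (?d x)) (\<lambda>x. cnj (?d' x))) \<le> \<bar>s - t\<bar> * ((K - 1) * (nrm ?d + nrm ?d'))"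
      using flow_bound[OF ac_u ac fL, of lam t] unfolding n by (intro mult_left_mono) (auto simp: K_def)
    have "(nrm ?d)\<^sup>2 \<le> 1 * \<bar>s - t\<bar> * (nrm ?d + nrm ?d') + \<bar>s - t\<bar> * ((K - 1) * (nrm ?d + nrm ?d'))"
      using q1 q2 q3 q4 by linarith
    also have "\<dots> = \<bar>s - t\<bar> * (K * (nrm ?d + nrm ?d'))" by (simp add: algebra_simps)
    also have "\<dots> \<le> \<bar>s - t\<bar> * e" using elim(2) by (intro mult_left_mono) auto
    finally show ?case by (simp add: mult.commute)
  qed
qed

lemma pairing_derivative:
  assumes \<phi>: "ac \<phi> \<phi>'"
  shows "((\<lambda>s. LINT x|M. u s x * \<phi> x) has_vector_derivative Fl t \<phi> \<phi>') (at t)"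
proof (rule has_vector_derivative_eventually_I)
  fix e :: real assume e: "0 < e"
  define e' where "e' = e / (nrm \<phi> + nrm \<phi>' + 1)"
  have p: "0 < nrm \<phi> + nrm \<phi>' + 1" by (intro add_nonneg_pos add_nonneg_nonneg) auto
  have e': "0 < e'" using e p by (simp add: e'_def)
  from Err_small[OF e', of t] show "eventually (\<lambda>s. cmod ((LINT x|M. u s x * \<phi> x) - (LINT x|M. u t x * \<phi> x) - (s - t) *\<^sub>R Fl t \<phi> \<phi>') \<le> e * \<bar>s - t\<bar>) (at t)"
  proof eventually_elim
    case (elim s)
    have "(LINT x|M. u s x * \<phi> x) - (LINT x|M. u t x * \<phi> x) = (LINT x|M. (u s x - u t x) * \<phi> x)"
      using int_mult(1)[OF uL acD(4)[OF \<phi>]] by (simp add: left_diff_distrib)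
    then have "(LINT x|M. u s x * \<phi> x) - (LINT x|M. u t x * \<phi> x) - (s - t) *\<^sub>R Fl t \<phi> \<phi>' = Err s t \<phi> \<phi>'"
      by (simp add: Err_def scaleR_conv_of_real)
    moreover have "cmod (Err s t \<phi> \<phi>') \<le> e' * \<bar>s - t\<bar> * (nrm \<phi> + nrm \<phi>')" using elim \<phi> by blast
    moreover have "e' * (nrm \<phi> + nrm \<phi>') \<le> e" using e p by (simp add: e'_def divide_le_eq)
    then have "e' * (nrm \<phi> + nrm \<phi>') * \<bar>s - t\<bar> \<le> e * \<bar>s - t\<bar>" by (intro mult_right_mono) auto
    ultimately show ?case by (simp add: mult.commute mult.left_commute)
  qed
qed

text \<open>The chain rule for a functional with a real-linear differential, split into a linear and
  an antilinear pairing, and a remainder quadratic in the L2 increment. By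
  \<open>L2_little_o\<close> that remainder is \<open>o(s - t)\<close>, although \<open>u\<close>
  has no time derivative in L2.\<close>

lemma derivative_from_expansion:
  fixes h :: "real \<Rightarrow> complex"
  assumes \<phi>: "ac \<phi> \<phi>'" "ac \<psi> \<psi>'"
    and h: "eventually (\<lambda>s. cmod (h s - h t - ((LINT x|M. (u s x - u t x) * \<phi> x) - cnj (LINT x|M. (u s x - u t x) * \<psi> x)))
        \<le> C * (nrm (\<lambda>x. u s x - u t x))\<^sup>2) (at t)" and C: "0 \<le> C"
  shows "(h has_vector_derivative Fl t \<phi> \<phi>' - cnj (Fl t \<psi> \<psi>')) (at t)"
proof (rule has_vector_derivative_eventually_I)
  fix e :: real assume e: "0 < e"
  define Q where "Q = nrm \<phi> + nrm \<phi>' + nrm \<psi> + nrm \<psi>' + 1"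
  have Q: "0 < Q" unfolding Q_def by (intro add_nonneg_pos add_nonneg_nonneg) auto
  have e1: "0 < e / 2 / Q" using e Q by simp
  have e2: "0 < e / 2 / (C + 1)" using e C by simp
  from Err_small[OF e1, of t] L2_little_o[OF e2, of t] h
  show "eventually (\<lambda>s. cmod (h s - h t - (s - t) *\<^sub>R (Fl t \<phi> \<phi>' - cnj (Fl t \<psi> \<psi>'))) \<le> e * \<bar>s - t\<bar>) (at t)"
  proof eventually_elim
    case (elim s)
    define R where "R = h s - h t - ((LINT x|M. (u s x - u t x) * \<phi> x) - cnj (LINT x|M. (u s x - u t x) * \<psi> x))"
    have eq: "h s - h t - (s - t) *\<^sub>R (Fl t \<phi> \<phi>' - cnj (Fl t \<psi> \<psi>')) = (R + Err s t \<phi> \<phi>') - cnj (Err s t \<psi> \<psi>')"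
      unfolding R_def Err_def by (simp add: scaleR_conv_of_real algebra_simps)
    have q1: "cmod (h s - h t - (s - t) *\<^sub>R (Fl t \<phi> \<phi>' - cnj (Fl t \<psi> \<psi>'))) \<le> (cmod R + cmod (Err s t \<phi> \<phi>')) + cmod (Err s t \<psi> \<psi>')"
      unfolding eq using norm_triangle_ineq4[of "R + Err s t \<phi> \<phi>'" "cnj (Err s t \<psi> \<psi>')"] norm_triangle_ineq[of R "Err s t \<phi> \<phi>'"]
      by simp
    have q2: "cmod R \<le> e / 2 * \<bar>s - t\<bar>"
    proof -
      have "cmod R \<le> C * (nrm (\<lambda>x. u s x - u t x))\<^sup>2" using elim(3) by (simp add: R_def)
      also have "\<dots> \<le> C * (e / 2 / (C + 1) * \<bar>s - t\<bar>)" by (intro mult_left_mono elim C)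
      also have "\<dots> = (C / (C + 1)) * (e / 2 * \<bar>s - t\<bar>)" by simp
      also have "\<dots> \<le> 1 * (e / 2 * \<bar>s - t\<bar>)" using C e by (intro mult_right_mono) auto
      finally show ?thesis by simp
    qed
    have q3: "cmod (Err s t \<phi> \<phi>') \<le> e / 2 / Q * \<bar>s - t\<bar> * (nrm \<phi> + nrm \<phi>')" using elim(1) \<phi> by blast
    have q4: "cmod (Err s t \<psi> \<psi>') \<le> e / 2 / Q * \<bar>s - t\<bar> * (nrm \<psi> + nrm \<psi>')" using elim(1) \<phi> by blast
    have "cmod (h s - h t - (s - t) *\<^sub>R (Fl t \<phi> \<phi>' - cnj (Fl t \<psi> \<psi>')))
        \<le> e / 2 * \<bar>s - t\<bar> + e / 2 / Q * \<bar>s - t\<bar> * (nrm \<phi> + nrm \<phi>') + e / 2 / Q * \<bar>s - t\<bar> * (nrm \<psi> + nrm \<psi>')"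
      using q1 q2 q3 q4 by linarith
    also have "\<dots> = e / 2 * \<bar>s - t\<bar> + e / 2 / Q * \<bar>s - t\<bar> * ((nrm \<phi> + nrm \<phi>') + (nrm \<psi> + nrm \<psi>'))"
      by (simp only: distrib_left add.assoc)
    also have "\<dots> = e / 2 * \<bar>s - t\<bar> + e / 2 / Q * \<bar>s - t\<bar> * (Q - 1)"
    proof -
      have "(nrm \<phi> + nrm \<phi>') + (nrm \<psi> + nrm \<psi>') = Q - 1"
        by (simp add: Q_def)
      then show ?thesis by (simp only:)
    qed
    also have "\<dots> \<le> e / 2 * \<bar>s - t\<bar> + e / 2 / Q * \<bar>s - t\<bar> * Q"
      using e Q by (intro add_left_mono mult_left_mono) auto
    also have "\<dots> = e * \<bar>s - t\<bar>" using Q by simp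
    finally show ?case .
  qed
qed

lemma mass_derivative:
  "((\<lambda>s. (Nt s)\<^sup>2) has_real_derivative 2 * Re (Fl t (\<lambda>x. cnj (u t x)) (\<lambda>x. cnj (ux t x)))) (at t)"
proof -
  have acc: "ac (\<lambda>x. cnj (u t x)) (\<lambda>x. cnj (ux t x))" and acn: "ac (\<lambda>x. - cnj (u t x)) (\<lambda>x. - cnj (ux t x))"
    by (intro ac_cnj ac_uminus ac_u)+
  have self: "(LINT x|M. v x * cnj (v x)) = of_real ((nrm v)\<^sup>2)" for v
    unfolding nrm_sq by (subst integral_complex_of_real[symmetric]) (simp add: complex_norm_square del: of_real_power)
  have "((\<lambda>s. complex_of_real ((Nt s)\<^sup>2)) has_vector_derivative Fl t (\<lambda>x. cnj (u t x)) (\<lambda>x. cnj (ux t x)) - cnj (Fl t (\<lambda>x. - cnj (u t x)) (\<lambda>x. - cnj (ux t x)))) (at t)"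
  \<comment> \<open>With \<open>- cnj (u t)\<close> in the antilinear slot the differential is twice
    the real part of the pairing with \<open>cnj (u t)\<close>; the remainder is exactly the squared
    increment, hence \<open>C = 1\<close>.\<close>
  proof (rule derivative_from_expansion[OF acc acn, where C = 1])
    show "eventually (\<lambda>s. cmod (complex_of_real ((Nt s)\<^sup>2) - complex_of_real ((Nt t)\<^sup>2)
        - ((LINT x|M. (u s x - u t x) * cnj (u t x)) - cnj (LINT x|M. (u s x - u t x) * - cnj (u t x)))) \<le> 1 * (nrm (\<lambda>x. u s x - u t x))\<^sup>2) (at t)"
    proof (rule always_eventually, rule allI)
      fix s
      let ?d = "\<lambda>x. u s x - u t x"
      have "(Nt s)\<^sup>2 = (nrm (\<lambda>x. ?d x + u t x))\<^sup>2" by (simp add: Nt_def)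
      also have "\<dots> = (nrm ?d)\<^sup>2 + (Nt t)\<^sup>2 + 2 * Re (LINT x|M. ?d x * cnj (u t x))"
        unfolding Nt_def by (rule nrm_add_sq[OF duL uL])
      finally have n: "(Nt s)\<^sup>2 - (Nt t)\<^sup>2 - 2 * Re (LINT x|M. ?d x * cnj (u t x)) = (nrm ?d)\<^sup>2" by simp
      have m: "cnj (LINT x|M. ?d x * - cnj (u t x)) = - cnj (LINT x|M. ?d x * cnj (u t x))"
        by (simp only: mult_minus_right Bochner_Integration.integral_minus complex_cnj_minus)
      have "complex_of_real ((Nt s)\<^sup>2) - complex_of_real ((Nt t)\<^sup>2) - ((LINT x|M. ?d x * cnj (u t x)) - cnj (LINT x|M. ?d x * - cnj (u t x)))
        = of_real ((Nt s)\<^sup>2 - (Nt t)\<^sup>2 - 2 * Re (LINT x|M. ?d x * cnj (u t x)))"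
        unfolding m by (simp add: complex_eq_iff)
      then show "cmod (complex_of_real ((Nt s)\<^sup>2) - complex_of_real ((Nt t)\<^sup>2)
        - ((LINT x|M. ?d x * cnj (u t x)) - cnj (LINT x|M. ?d x * - cnj (u t x)))) \<le> 1 * (nrm ?d)\<^sup>2"
        unfolding n by (simp only: norm_of_real) simp
    qed
  qed simp
  from bounded_linear.has_vector_derivative[OF bounded_linear_Re this]
  have "((\<lambda>s. (Nt s)\<^sup>2) has_vector_derivative Re (Fl t (\<lambda>x. cnj (u t x)) (\<lambda>x. cnj (ux t x)) - cnj (Fl t (\<lambda>x. - cnj (u t x)) (\<lambda>x. - cnj (ux t x))))) (at t)"
    by simp
  moreover have "Fl t (\<lambda>x. - cnj (u t x)) (\<lambda>x. - cnj (ux t x)) = - Fl t (\<lambda>x. cnj (u t x)) (\<lambda>x. cnj (ux t x))"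
    using flow_imult[of lam f "u t" "ux t" "-1"] by simp
  ultimately show ?thesis by (simp add: has_real_derivative_iff_has_vector_derivative)
qed

lemma mass_flow: "Re (Fl t (\<lambda>x. cnj (u t x)) (\<lambda>x. cnj (ux t x))) = Im (LINT x|M. f x * cnj (u t x)) - lam * (Nt t)\<^sup>2"
proof -
  have self: "(LINT x|M. v x * cnj (v x)) = of_real ((nrm v)\<^sup>2)" for v
    unfolding nrm_sq by (subst integral_complex_of_real[symmetric]) (simp add: complex_norm_square del: of_real_power)
  have "Im (LINT x|M. cub (u t) x * cnj (u t x)) = 0"
  proof -
    have "(LINT x|M. cub (u t) x * cnj (u t x)) = (LINT x|M. of_real ((cmod (u t x)) ^ 4))"
      by (intro Bochner_Integration.integral_cong refl)
        (simp add: cub_def complex_norm_square[symmetric] mult.assoc power_add[symmetric] flip: of_real_power of_real_mult)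
    then show ?thesis by (simp only: integral_complex_of_real Im_complex_of_real)
  qed
  then show ?thesis unfolding flow_def self Nt_def by simp
qed

end

section \<open>First variation of the Riccati functional\<close>

context torus
begin

text \<open>By \<open>riccati_diff\<close> with equal potentials, a \<open>small\<close> potential
  has only one solution bounded by 1, so the choice is determined and varies with \<open>v\<close>
  in a Lipschitz way.\<close>

definition Gam :: "real \<Rightarrow> (real \<Rightarrow> complex) \<Rightarrow> real \<Rightarrow> complex" where
  "Gam mu v = (SOME G. riccati mu v G)"

lemma Gam: "small mu v \<Longrightarrow> Cper v \<Longrightarrow> riccati mu v (Gam mu v)"
  unfolding Gam_def by (rule riccati_ex) (auto intro: someI[where P = "riccati mu v"])

text \<open>Let \<open>K\<close> be the maximum of the difference. The uniform resolvent bound gives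
  \<open>K\<close> at most \<open>3/2\<close> times \<open>sqrt (5 / mu) * nrm ?d\<close>, plus
  \<open>K / 4\<close> by smallness. Absorbing the quarter leaves the factor 2.\<close>

lemma riccati_diff:
  assumes s: "small mu u" and u: "Cper u" and v: "Cper v" and G: "riccati mu u G" and H: "riccati mu v H"
  shows "cmod (H x - G x) \<le> 2 * sqrt (5 / mu) * nrm (\<lambda>x. v x - u x)"
proof -
  note g = riccatiD[OF G] and h = riccatiD[OF H]
  have mu: "0 < mu" "1 \<le> \<bar>mu\<bar> * L" "\<bar>mu\<bar> = mu" using s by (auto simp: small_def)
  let ?\<Delta> = "\<lambda>x. H x - G x"
  let ?e = "\<lambda>x. - (cnj (v x) + 1/2 * v x * (H x)\<^sup>2) - - (cnj (u x) + 1/2 * u x * (G x)\<^sup>2)"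
  have C\<Delta>: "Cper ?\<Delta>" by (intro Cper_intros g h)
  have Ce: "Cper ?e" by (intro Cper_intros g h u v)
  have "continuous_on T (\<lambda>y. cmod (?\<Delta> y))"
    by (rule continuous_on_norm, rule continuous_on_subset[OF _ subset_UNIV]) (use C\<Delta> in blast)
  moreover have "compact T" by (simp add: T_def)
  moreover have "T \<noteq> {}" using T_ends(1) by blast
  ultimately have "\<exists>z\<in>T. \<forall>y\<in>T. cmod (?\<Delta> y) \<le> cmod (?\<Delta> z)"
    by (intro continuous_attains_sup)
  then obtain z where z: "\<And>y. y \<in> T \<Longrightarrow> cmod (?\<Delta> y) \<le> cmod (?\<Delta> z)"
    by blast
  define K where "K = cmod (?\<Delta> z)"
  have K: "cmod (H y - G y) \<le> K" for y
    unfolding K_def by (rule periodic_all_T[of ?\<Delta> "\<lambda>w. cmod w \<le> cmod (?\<Delta> z)"]) (use C\<Delta> z in auto)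
  let ?d = "\<lambda>x. v x - u x"
  have dL: "?d \<in> L2per L" by (intro Cper_L2 Cper_intros u v)
  have "nrm ?e = nrm (\<lambda>x. - (cnj (?d x) + 1/2 * ?d x * (H x)\<^sup>2) + 1/2 * u x * ((G x)\<^sup>2 - (H x)\<^sup>2))"
    by (intro nrm_cong arg_cong[of _ _ cmod]) (simp add: algebra_simps add_divide_distrib diff_divide_distrib)
  also have "\<dots> \<le> nrm (\<lambda>x. - (cnj (?d x) + 1/2 * ?d x * (H x)\<^sup>2)) + nrm (\<lambda>x. 1/2 * u x * ((G x)\<^sup>2 - (H x)\<^sup>2))"
    by (intro nrm_triangle Cper_L2 Cper_intros u v g h)
  also have "\<dots> \<le> 3/2 * nrm ?d + K * nrm u"
  proof (intro add_mono nrm_bounded_mult Cper_intros u v g h)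
    show "cmod (- (cnj (?d y) + 1/2 * ?d y * (H y)\<^sup>2)) \<le> 3/2 * cmod (?d y)" for y
      by (rule ric_bound[OF h(2)])
    show "cmod (1/2 * u y * ((G y)\<^sup>2 - (H y)\<^sup>2)) \<le> K * cmod (u y)" for y
      using K[of y] by (intro sqdiff_bound g h) (simp add: norm_minus_commute)
  qed (auto simp: K_def)
  finally have ne: "nrm ?e \<le> 3/2 * nrm ?d + K * nrm u" .
  have "K \<le> sqrt (5 / mu) * nrm ?e"
    unfolding K_def using res_sup[OF sol_ac[OF sol_lincomb[OF h(3) g(3)] Ce] Cper_L2[OF Ce] mu(2), of z] mu(3) by simp
  also have "\<dots> \<le> sqrt (5 / mu) * (3/2 * nrm ?d + K * nrm u)"
    using ne mu by (intro mult_left_mono) auto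
  also have "\<dots> = 3/2 * (sqrt (5 / mu) * nrm ?d) + K * (sqrt (5 / mu) * nrm u)" by (simp add: algebra_simps)
  also have "\<dots> \<le> 3/2 * (sqrt (5 / mu) * nrm ?d) + K * (1/4)"
    using s by (intro add_left_mono mult_left_mono) (auto simp: small_def K_def)
  finally have "K \<le> 2 * sqrt (5 / mu) * nrm ?d" by simp
  then show ?thesis using K[of x] by linarith
qed

text \<open>The unknown variation of \<open>G\<close> enters through the integral of
  \<open>u (H - G)\<close>. Pairing the equation of \<open>H - G\<close> with the dual solution
  \<open>X\<close> replaces it by terms explicit in \<open>v - u\<close>; everything of second order
  is collected in \<open>?R\<close>, where \<open>riccati_diff\<close> makes each product quadratic
  in the L2 distance.\<close>

lemma alpha_expansion:
  assumes s: "small mu u" and u: "Cper u" and v: "Cper v" and G: "riccati mu u G" and H: "riccati mu v H"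
    and X: "dual mu u G X"
  shows "cmod ((LINT x|M. v x * H x) - (LINT x|M. u x * G x)
      - ((LINT x|M. (v x - u x) * (G x - 1/2 * X x * (G x)\<^sup>2)) - cnj (LINT x|M. (v x - u x) * cnj (X x))))
    \<le> sqrt L * (4 * sqrt (5 / mu) + 2 * (sqrt (5 / mu))\<^sup>2 * nrm u) * (nrm (\<lambda>x. v x - u x))\<^sup>2"
proof -
  note g = riccatiD[OF G] and h = riccatiD[OF H] and xx = dualD[OF X]
  let ?\<Delta> = "\<lambda>x. H x - G x" and ?d = "\<lambda>x. v x - u x"
  let ?e = "\<lambda>x. - (cnj (v x) + 1/2 * v x * (H x)\<^sup>2) - - (cnj (u x) + 1/2 * u x * (G x)\<^sup>2)"
  let ?R = "\<lambda>x. ?d x * ?\<Delta> x - X x * (1/2 * u x * (?\<Delta> x)\<^sup>2 + 1/2 * ?d x * ((H x)\<^sup>2 - (G x)\<^sup>2))"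
  define K where "K = 2 * sqrt (5 / mu) * nrm ?d"
  have K: "cmod (?\<Delta> x) \<le> K" for x unfolding K_def by (rule riccati_diff[OF s u v G H])
  have K0: "0 \<le> K" using K norm_ge_zero order_trans by blast
  have C: "Cper ?\<Delta>" "Cper ?e" "Cper ?d" by (intro Cper_intros g h u v)+
  have acX: "ac X (\<lambda>x. u x * G x * X x - u x - of_real (- mu) * X x)"
    by (rule sol_ac[OF xx(3) Cper_dual[OF u g(1) xx(1)]])
  have ac\<Delta>: "ac ?\<Delta> (\<lambda>x. ?e x - of_real mu * ?\<Delta> x)"
    by (rule sol_ac[OF sol_lincomb[OF h(3) g(3)] C(2)])
  have i: "integrable M (\<lambda>x. u x * ?\<Delta> x)" "integrable M (\<lambda>x. X x * ?e x)" "integrable M (\<lambda>x. u x * G x * X x * ?\<Delta> x)"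
    "integrable M (\<lambda>x. of_real mu * (X x * ?\<Delta> x))" "integrable M (\<lambda>x. ?d x * G x)" "integrable M (\<lambda>x. ?d x * ?\<Delta> x)"
    "integrable M (\<lambda>x. v x * H x)" "integrable M (\<lambda>x. u x * G x)" "integrable M ?R"
    "integrable M (\<lambda>x. ?d x * (G x - 1/2 * X x * (G x)\<^sup>2))" "integrable M (\<lambda>x. cnj (?d x) * X x)"
    by (intro Cper_int Cper_intros u v g h xx C)+
  have "(LINT x|M. X x * (?e x - of_real mu * ?\<Delta> x)) = - (LINT x|M. (u x * G x * X x - u x - of_real (- mu) * X x) * ?\<Delta> x)"
    by (rule ac_parts[OF acX ac\<Delta>])
  also have "(\<lambda>x. X x * (?e x - of_real mu * ?\<Delta> x)) = (\<lambda>x. X x * ?e x - of_real mu * (X x * ?\<Delta> x))"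
    by (rule ext) (simp only: right_diff_distrib mult.left_commute)
  also have "(\<lambda>x. (u x * G x * X x - u x - of_real (- mu) * X x) * ?\<Delta> x) = (\<lambda>x. (u x * G x * X x * ?\<Delta> x - u x * ?\<Delta> x) + of_real mu * (X x * ?\<Delta> x))"
    by (rule ext) (simp add: algebra_simps)
  finally have 1: "(LINT x|M. u x * ?\<Delta> x) = (LINT x|M. X x * ?e x) + (LINT x|M. u x * G x * X x * ?\<Delta> x)"
    unfolding Bochner_Integration.integral_diff[OF i(2,4)] Bochner_Integration.integral_add[OF Bochner_Integration.integrable_diff[OF i(3,1)] i(4)]
      Bochner_Integration.integral_diff[OF i(3,1)] by (simp add: algebra_simps)
  have "(LINT x|M. v x * H x) = (LINT x|M. (u x * G x + ?d x * G x) + (u x * ?\<Delta> x + ?d x * ?\<Delta> x))"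
    by (intro Bochner_Integration.integral_cong refl) (simp add: algebra_simps)
  also have "\<dots> = ((LINT x|M. u x * G x) + (LINT x|M. ?d x * G x)) + ((LINT x|M. u x * ?\<Delta> x) + (LINT x|M. ?d x * ?\<Delta> x))"
    using i by (simp only: Bochner_Integration.integral_add Bochner_Integration.integrable_add)
  finally have 2: "(LINT x|M. v x * H x) - (LINT x|M. u x * G x)
     = ((LINT x|M. ?d x * G x) + (LINT x|M. ?d x * ?\<Delta> x)) + ((LINT x|M. X x * ?e x) + (LINT x|M. u x * G x * X x * ?\<Delta> x))"
    unfolding 1 by simp
  also have "\<dots> = (LINT x|M. (?d x * G x + ?d x * ?\<Delta> x) + (X x * ?e x + u x * G x * X x * ?\<Delta> x))"
    using i by (simp only: Bochner_Integration.integral_add Bochner_Integration.integrable_add)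
  also have "\<dots> = (LINT x|M. (?d x * (G x - 1/2 * X x * (G x)\<^sup>2) - cnj (?d x) * X x) + ?R x)"
    by (intro Bochner_Integration.integral_cong refl) (simp add: algebra_simps power2_eq_square add_divide_distrib diff_divide_distrib)
  also have "\<dots> = ((LINT x|M. ?d x * (G x - 1/2 * X x * (G x)\<^sup>2)) - (LINT x|M. cnj (?d x) * X x)) + (LINT x|M. ?R x)"
    unfolding Bochner_Integration.integral_add[OF Bochner_Integration.integrable_diff[OF i(10,11)] i(9)]
      Bochner_Integration.integral_diff[OF i(10,11)] ..
  finally have 3: "(LINT x|M. v x * H x) - (LINT x|M. u x * G x)
     = ((LINT x|M. ?d x * (G x - 1/2 * X x * (G x)\<^sup>2)) - (LINT x|M. cnj (?d x) * X x)) + (LINT x|M. ?R x)" .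
  have 4: "cnj (LINT x|M. ?d x * cnj (X x)) = (LINT x|M. cnj (?d x) * X x)"
    by (subst Bochner_Integration.integral_cnj[symmetric]) simp
  have "cmod (LINT x|M. ?R x) \<le> (LINT x|M. cmod (?R x))" by (rule integral_norm_bound)
  also have "\<dots> \<le> (LINT x|M. 2 * K * cmod (?d x) + 1/2 * K\<^sup>2 * cmod (u x))"
  proof (rule integral_mono)
    show "integrable M (\<lambda>x. cmod (?R x))" by (rule integrable_norm[OF i(9)])
    show "integrable M (\<lambda>x. 2 * K * cmod (?d x) + 1/2 * K\<^sup>2 * cmod (u x))"
      by (intro Bochner_Integration.integrable_add integrable_mult_right int_L2 Cper_L2 C u)
    fix x
    have b1: "cmod (?d x * ?\<Delta> x) \<le> K * cmod (?d x)"
      using mult_left_mono[OF K[of x], of "cmod (?d x)"] by (simp add: norm_mult mult.commute)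
    have b2: "cmod (1/2 * u x * (?\<Delta> x)\<^sup>2) \<le> 1/2 * K\<^sup>2 * cmod (u x)"
    proof -
      have "(cmod (?\<Delta> x))\<^sup>2 \<le> K\<^sup>2" by (intro power_mono K) auto
      from mult_left_mono[OF this, of "1/2 * cmod (u x)"] show ?thesis by (simp add: norm_mult norm_power mult.commute)
    qed
    have b3: "cmod (1/2 * ?d x * ((H x)\<^sup>2 - (G x)\<^sup>2)) \<le> K * cmod (?d x)"
      by (rule sqdiff_bound[OF h(2) g(2) K])
    let ?Y = "1/2 * u x * (?\<Delta> x)\<^sup>2 + 1/2 * ?d x * ((H x)\<^sup>2 - (G x)\<^sup>2)"
    have "cmod (X x * ?Y) \<le> cmod ?Y"
      using xx(2)[of x] mult_right_mono[of "cmod (X x)" 1 "cmod ?Y"] by (simp add: norm_mult)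
    moreover have "cmod ?Y \<le> cmod (1/2 * u x * (?\<Delta> x)\<^sup>2) + cmod (1/2 * ?d x * ((H x)\<^sup>2 - (G x)\<^sup>2))"
      by (rule norm_triangle_ineq)
    moreover have "cmod (?R x) \<le> cmod (?d x * ?\<Delta> x) + cmod (X x * ?Y)"
      by (rule norm_triangle_ineq4)
    ultimately show "cmod (?R x) \<le> 2 * K * cmod (?d x) + 1/2 * K\<^sup>2 * cmod (u x)"
      using b1 b2 b3 by linarith
  qed
  also have "\<dots> = 2 * K * (LINT x|M. cmod (?d x)) + 1/2 * K\<^sup>2 * (LINT x|M. cmod (u x))"
  proof -
    have j: "integrable M (\<lambda>x. 2 * K * cmod (?d x))" "integrable M (\<lambda>x. 1/2 * K\<^sup>2 * cmod (u x))"
      by (intro integrable_mult_right int_L2 Cper_L2 C u)+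
    show ?thesis unfolding Bochner_Integration.integral_add[OF j] by simp
  qed
  also have "\<dots> \<le> 2 * K * (sqrt L * nrm ?d) + 1/2 * K\<^sup>2 * (sqrt L * nrm u)"
    using K0 by (intro add_mono mult_left_mono int_abs_le Cper_L2 C u) auto
  also have "\<dots> = sqrt L * (4 * sqrt (5 / mu) + 2 * (sqrt (5 / mu))\<^sup>2 * nrm u) * (nrm ?d)\<^sup>2"
    by (simp add: K_def power2_eq_square algebra_simps del: real_sqrt_mult_self real_sqrt_pow2_iff real_sqrt_pow2 real_sqrt_power)
  finally show ?thesis unfolding 3 4 by simp
qed

text \<open>\<open>psi\<close> and \<open>JJ\<close> freed from a fixed time. The resolvents
  \<open>k1\<close> and \<open>k2\<close> depend on the parameter and the forcing alone, so they
  stay constant when \<open>Jfun\<close> is followed along a solution.\<close>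

definition psif :: "real \<Rightarrow> (real \<Rightarrow> complex) \<Rightarrow> (real \<Rightarrow> complex) \<Rightarrow> real \<Rightarrow> complex" where
  "psif mu k1 k2 x = (of_real mu / 2) * (k1 x - k2 x)"

definition Jfun :: "real \<Rightarrow> (real \<Rightarrow> complex) \<Rightarrow> (real \<Rightarrow> complex) \<Rightarrow> (real \<Rightarrow> complex) \<Rightarrow> real" where
  "Jfun mu k1 k2 v = mu\<^sup>2 * ((nrm v)\<^sup>2 + mu * Re (LINT x|M. v x * Gam mu v x)) + 2 * Re (LINT x|M. v x * cnj (psif mu k1 k2 x))"

end

section \<open>The functional along a solution\<close>

context nls
begin

abbreviation "nf \<equiv> nrm f"

definition "Ebt mu t = 3 * (St t)\<^sup>2 * Nt t / mu\<^sup>2 + Dt t / mu"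
definition "Q4t t = (LINT x|M. (cmod (u t x)) ^ 4)"

lemma Cu: "Cper (u t)" by (rule ac_Cper[OF ac_u])

text \<open>The interface between the fixed-time identities and the arguments in time;
  \<open>d\<close> is \<open>GG lam\<close>. Smallness at nearby times is required because the
  derivative compares \<open>Gam\<close> at neighbouring states.\<close>

lemma Jfun_estimates:
  assumes lam: "0 \<le> lam" and s: "small mu (u t)" and ev: "eventually (\<lambda>s. small mu (u s)) (at t)"
    and k1: "ac k1 (\<lambda>x. f x - of_real mu * k1 x)" and k2: "ac k2 (\<lambda>x. f x - of_real (- mu) * k2 x)"
  obtains d p where
    "((\<lambda>s. Jfun mu k1 k2 (u s)) has_real_derivative - 2 * lam * Jfun mu k1 k2 (u t) + d) (at t)"
    "\<bar>d\<bar> \<le> (St t)\<^sup>2 * (9/2 * lam * (Nt t)\<^sup>2 + 8 * Nt t * nf) + 2 * lam * Nt t * nf + 2 * nf\<^sup>2"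
    "d \<ge> - 2 * lam * Nt t * nf - (5 * lam * Nt t + 12 * nf) * (St t)\<^sup>2 * Ebt mu t - 2 * ((St t)\<^sup>2 * Nt t + nf) * nrm (\<lambda>x. psif mu k1 k2 x - f x)"
    "\<bar>Jfun mu k1 k2 (u t)\<bar> \<le> 5/2 * mu\<^sup>2 * (Nt t)\<^sup>2 + 2 * Nt t * nf"
    "Jfun mu k1 k2 (u t) \<le> (Dt t)\<^sup>2 + 9/8 * (St t)\<^sup>2 * (Nt t)\<^sup>2 + 2 * Nt t * nf"
    "ac p (\<lambda>x. cnj (ux t x) - of_real mu * p x)"
    "Jfun mu k1 k2 (u t) \<ge> (mu * nrm p)\<^sup>2 - 9/8 * (St t)\<^sup>2 * (Nt t)\<^sup>2 - 2 * Nt t * nf"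
    "Jfun mu k1 k2 (u t) \<ge> (mu * nrm p)\<^sup>2 - 1/2 * Q4t t - 5 * (St t)\<^sup>2 * Nt t * Ebt mu t - 2 * Nt t * nf"
proof -
  have mu: "0 < mu" using s by (simp add: small_def)
  have Cr: "Cper (u r)" for r by (rule Cu)
  define G where "G = Gam mu (u t)"
  have G: "riccati mu (u t) G" unfolding G_def by (rule Gam[OF s Cu])
  obtain X where X: "dual mu (u t) G X"
    using dual_ex[OF s Cu riccatiD(1,2)[OF G]] by blast
  obtain g where g: "sol mu (\<lambda>x. cnj (u t x)) g"
    by (rule sol_ex[OF Cper_intros(2)[OF Cu], of mu]) (use mu in auto)
  obtain l where l: "sol (- mu) (u t) l"
    by (rule sol_ex[OF Cu, of "- mu"]) (use mu in auto)
  interpret lax_pair L mu "St t" "u t" "ux t" f G X g l k1 k2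
    by unfold_locales (fact ac_u fL s G X g l k1 k2 u_sup)+
  have psi: "psif mu k1 k2 = lax_pair.psi mu k1 k2"
    by (rule ext) (simp add: psif_def psi_def)
  have Jt: "Jfun mu k1 k2 (u t) = JJ"
    unfolding Jfun_def psi G_def[symmetric] unfolding JJ_def alpha_def ..
  let ?da = "\<lambda>x. - of_real mu * a x - cnj (u t x) * c x" and ?dX = "\<lambda>x. of_real mu * X x - u t x * c x"
  have "((\<lambda>s. LINT x|M. u s x * Gam mu (u s) x) has_vector_derivative
      Fl t a ?da - cnj (Fl t (\<lambda>x. cnj (X x)) (\<lambda>x. cnj (?dX x)))) (at t)"
  proof (rule derivative_from_expansion[OF ac_a ac_cnj[OF ac_X], where C = "sqrt L * (4 * sqrt (5 / mu) + 2 * (sqrt (5 / mu))\<^sup>2 * nrm (u t))"])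
    show "\<forall>\<^sub>F s in at t. cmod ((LINT x|M. u s x * Gam mu (u s) x) - (LINT x|M. u t x * Gam mu (u t) x) -
        ((LINT x|M. (u s x - u t x) * a x) - cnj (LINT x|M. (u s x - u t x) * cnj (X x))))
      \<le> sqrt L * (4 * sqrt (5 / mu) + 2 * (sqrt (5 / mu))\<^sup>2 * nrm (u t)) * (nrm (\<lambda>x. u s x - u t x))\<^sup>2"
      using ev
    proof eventually_elim
      case (elim s)
      show ?case
        using alpha_expansion[OF s Cr Cr G Gam[OF elim Cr] X] unfolding G_def[symmetric] a_def .
    qed
    show "0 \<le> sqrt L * (4 * sqrt (5 / mu) + 2 * (sqrt (5 / mu))\<^sup>2 * nrm (u t))"
      using L_pos mu by (intro mult_nonneg_nonneg add_nonneg_nonneg) auto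
  qed
  from bounded_linear.has_vector_derivative[OF bounded_linear_Re this]
  have dR: "((\<lambda>s. Re (LINT x|M. u s x * Gam mu (u s) x)) has_real_derivative
      Re (Fl t a ?da - cnj (Fl t (\<lambda>x. cnj (X x)) (\<lambda>x. cnj (?dX x))))) (at t)"
    by (simp add: has_real_derivative_iff_has_vector_derivative)
  have "((\<lambda>s. LINT x|M. u s x * cnj (psi x)) has_vector_derivative Fl t (\<lambda>x. cnj (psi x)) (\<lambda>x. cnj (dpsi x))) (at t)"
    by (rule pairing_derivative[OF ac_cnj[OF ac_psi]])
  from bounded_linear.has_vector_derivative[OF bounded_linear_Re this]
  have dP: "((\<lambda>s. Re (LINT x|M. u s x * cnj (psi x))) has_real_derivative Re (Fl t (\<lambda>x. cnj (psi x)) (\<lambda>x. cnj (dpsi x)))) (at t)"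
    by (simp add: has_real_derivative_iff_has_vector_derivative)
  have "((\<lambda>s. mu\<^sup>2 * ((Nt s)\<^sup>2 + mu * Re (LINT x|M. u s x * Gam mu (u s) x)) + 2 * Re (LINT x|M. u s x * cnj (psi x))) has_real_derivative
     mu\<^sup>2 * (2 * Re (Fl t (\<lambda>x. cnj (u t x)) (\<lambda>x. cnj (ux t x))) + mu * Re (Fl t a ?da - cnj (Fl t (\<lambda>x. cnj (X x)) (\<lambda>x. cnj (?dX x)))))
     + 2 * Re (Fl t (\<lambda>x. cnj (psi x)) (\<lambda>x. cnj (dpsi x)))) (at t)"
    by (intro DERIV_add DERIV_cmult mass_derivative dR dP)
  then have "((\<lambda>s. Jfun mu k1 k2 (u s)) has_real_derivative - 2 * lam * Jfun mu k1 k2 (u t) + GG lam) (at t)"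
    unfolding evolution_identity Jt unfolding Jfun_def psi Nt_def .
  then show ?thesis
  proof (rule that)
    show "\<bar>GG lam\<bar> \<le> (St t)\<^sup>2 * (9/2 * lam * (Nt t)\<^sup>2 + 8 * Nt t * nf) + 2 * lam * Nt t * nf + 2 * nf\<^sup>2"
      using GG_bound[OF lam] unfolding Nt_def .
    show "GG lam \<ge> - 2 * lam * Nt t * nf - (5 * lam * Nt t + 12 * nf) * (St t)\<^sup>2 * Ebt mu t - 2 * ((St t)\<^sup>2 * Nt t + nf) * nrm (\<lambda>x. psif mu k1 k2 x - f x)"
      using GG_lower_limit[OF lam] unfolding Nt_def psi del_def Ebt_def Eb_def Dt_def .
    show "\<bar>Jfun mu k1 k2 (u t)\<bar> \<le> 5/2 * mu\<^sup>2 * (Nt t)\<^sup>2 + 2 * Nt t * nf"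
      using JJ_crude unfolding Jt Nt_def .
    show "Jfun mu k1 k2 (u t) \<le> (Dt t)\<^sup>2 + 9/8 * (St t)\<^sup>2 * (Nt t)\<^sup>2 + 2 * Nt t * nf"
      using JJ_upper unfolding Jt Nt_def Dt_def .
    show "ac p (\<lambda>x. cnj (ux t x) - of_real mu * p x)" by (rule ac_p)
    show "Jfun mu k1 k2 (u t) \<ge> (mu * nrm p)\<^sup>2 - 9/8 * (St t)\<^sup>2 * (Nt t)\<^sup>2 - 2 * Nt t * nf"
      using JJ_lower unfolding Jt Nt_def .
    show "Jfun mu k1 k2 (u t) \<ge> (mu * nrm p)\<^sup>2 - 1/2 * Q4t t - 5 * (St t)\<^sup>2 * Nt t * Ebt mu t - 2 * Nt t * nf"
      using JJ_lower_limit unfolding Jt Nt_def Dt_def Eb_def Ebt_def Q4_def Q4t_def .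
  qed
qed

end

subsection \<open>Growth and boundedness backward in time\<close>

lemma exp_weighted_derivative:
  fixes y :: "real \<Rightarrow> real"
  assumes "(y has_real_derivative y') (at t)"
  shows "((\<lambda>s. exp (c * s) * y s) has_real_derivative exp (c * t) * (y' + c * y t)) (at t)"
  by (auto intro!: derivative_eq_intros assms simp: algebra_simps)

lemma le_of_le_add_eps:
  fixes x y K :: real
  assumes "\<And>e. 0 < e \<Longrightarrow> e \<le> 1 \<Longrightarrow> x \<le> y + e * K"
  shows "x \<le> y"
proof (rule ccontr)
  assume "\<not> x \<le> y"
  then have d: "0 < x - y" by simp
  define e where "e = min 1 ((x - y) / (2 * (\<bar>K\<bar> + 1)))"
  have e: "0 < e" "e \<le> 1" using d by (auto simp: e_def)
  have "e * K \<le> e * (\<bar>K\<bar> + 1)" using e by (intro mult_left_mono) auto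
  also have "e * (\<bar>K\<bar> + 1) \<le> (x - y) / (2 * (\<bar>K\<bar> + 1)) * (\<bar>K\<bar> + 1)"
    by (intro mult_right_mono) (auto simp: e_def)
  also have "\<dots> = (x - y) / 2"
    by (simp add: field_simps)
  finally show False using assms[OF e] d by simp
qed

lemma eventually_exp_ge:
  fixes c K :: real
  assumes "0 < c"
  shows "eventually (\<lambda>t. K \<le> exp (- c * t)) at_bot"
proof -
  have "eventually (\<lambda>t. t \<le> - ln (\<bar>K\<bar> + 1) / c) at_bot"
    by (rule eventually_le_at_bot)
  then show ?thesis
  proof eventually_elim
    case (elim t)
    have "c * t \<le> - ln (\<bar>K\<bar> + 1)"
      using mult_left_mono[OF elim, of c] assms by simp
    then have "ln (\<bar>K\<bar> + 1) \<le> - c * t" by simp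
    then have "exp (ln (\<bar>K\<bar> + 1)) \<le> exp (- c * t)" by (simp only: exp_le_cancel_iff)
    moreover have "exp (ln (\<bar>K\<bar> + 1)) = \<bar>K\<bar> + 1" by (intro exp_ln) auto
    ultimately show ?case by linarith
  qed
qed

lemma tendsto_const_over:
  fixes K :: real
  shows "((\<lambda>x. K / x) \<longlongrightarrow> 0) at_top"
  by (intro tendsto_divide_0[OF tendsto_const] filterlim_at_top_imp_at_infinity filterlim_ident)

context torus
begin

lemma psif_limit:
  assumes f: "f \<in> L2per L" and e: "0 < e"
  shows "eventually (\<lambda>mu. \<forall>k1 k2. ac k1 (\<lambda>x. f x - of_real mu * k1 x) \<longrightarrow> ac k2 (\<lambda>x. f x - of_real (- mu) * k2 x)
     \<longrightarrow> nrm (\<lambda>x. psif mu k1 k2 x - f x) \<le> e) at_top"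
proof -
  obtain m where m: "0 < m" "\<And>\<mu> g. m \<le> \<bar>\<mu>\<bar> \<Longrightarrow> ac g (\<lambda>x. f x - of_real \<mu> * g x) \<Longrightarrow> nrm (\<lambda>x. of_real \<mu> * g x - f x) \<le> e"
    using res_strong[OF f e] by metis
  have "eventually (\<lambda>mu. m \<le> mu) at_top" by (rule eventually_ge_at_top)
  then show ?thesis
  proof eventually_elim
    case (elim mu)
    show ?case
    proof (intro allI impI)
      fix k1 k2 assume k: "ac k1 (\<lambda>x. f x - of_real mu * k1 x)" "ac k2 (\<lambda>x. f x - of_real (- mu) * k2 x)"
      have b: "nrm (\<lambda>x. of_real mu * k1 x - f x) \<le> e" "nrm (\<lambda>x. of_real (- mu) * k2 x - f x) \<le> e"
        using m(2)[OF _ k(1)] m(2)[OF _ k(2)] elim m(1) by auto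
      have L: "(\<lambda>x. of_real mu * k1 x - f x) \<in> L2per L" "(\<lambda>x. of_real (- mu) * k2 x - f x) \<in> L2per L"
        by (intro L2_diff L2_cmult f acD(4)[OF k(1)] acD(4)[OF k(2)])+
      have "nrm (\<lambda>x. psif mu k1 k2 x - f x) = nrm (\<lambda>x. (1/2) * ((of_real mu * k1 x - f x) + (of_real (- mu) * k2 x - f x)))"
        by (intro nrm_cong arg_cong[of _ _ cmod]) (simp add: psif_def field_simps)
      also have "\<dots> = 1/2 * nrm (\<lambda>x. (of_real mu * k1 x - f x) + (of_real (- mu) * k2 x - f x))"
        unfolding nrm_cmult by simp
      also have "\<dots> \<le> 1/2 * (e + e)"
        using nrm_triangle[OF L] b by simp
      finally show "nrm (\<lambda>x. psif mu k1 k2 x - f x) \<le> e" by simp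
    qed
  qed
qed

lemma res_limit:
  assumes h: "h \<in> L2per L" and e: "0 < e"
  shows "eventually (\<lambda>mu. \<forall>p. ac p (\<lambda>x. h x - of_real mu * p x) \<longrightarrow> nrm h \<le> mu * nrm p + e) at_top"
proof -
  obtain m where m: "0 < m" "\<And>\<mu> g. m \<le> \<bar>\<mu>\<bar> \<Longrightarrow> ac g (\<lambda>x. h x - of_real \<mu> * g x) \<Longrightarrow> nrm (\<lambda>x. of_real \<mu> * g x - h x) \<le> e"
    using res_strong[OF h e] by metis
  have "eventually (\<lambda>mu. m \<le> mu) at_top" by (rule eventually_ge_at_top)
  then show ?thesis
  proof eventually_elim
    case (elim mu)
    show ?case
    proof (intro allI impI)
      fix p assume p: "ac p (\<lambda>x. h x - of_real mu * p x)"
      have "nrm (\<lambda>x. of_real mu * p x - h x) \<le> e"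
        using m(2)[OF _ p] elim m(1) by auto
      moreover have "\<bar>nrm (\<lambda>x. of_real mu * p x) - nrm h\<bar> \<le> nrm (\<lambda>x. of_real mu * p x - h x)"
        by (intro nrm_diff_bounds L2_cmult acD(4)[OF p] h)
      moreover have "nrm (\<lambda>x. of_real mu * p x) = mu * nrm p"
        unfolding nrm_cmult using elim m(1) by simp
      ultimately show "nrm h \<le> mu * nrm p + e" by linarith
    qed
  qed
qed

lemma eventually_small: "eventually (\<lambda>mu. \<forall>v. nrm v \<le> B \<longrightarrow> small mu v) at_top"
proof -
  have "((\<lambda>mu::real. 5 / mu) \<longlongrightarrow> 0) at_top" using tendsto_const_over[of 5] by simp
  then have "((\<lambda>mu. sqrt (5 / mu) * \<bar>B\<bar>) \<longlongrightarrow> sqrt 0 * \<bar>B\<bar>) at_top" by (intro tendsto_intros)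
  then have "eventually (\<lambda>mu. sqrt (5 / mu) * \<bar>B\<bar> < 1/4) at_top"
    by (intro order_tendstoD(2)) auto
  moreover have "eventually (\<lambda>mu. 0 < mu \<and> 1 / L \<le> mu) at_top"
    by (intro eventually_conj eventually_gt_at_top eventually_ge_at_top)
  ultimately show ?thesis
  proof eventually_elim
    case (elim mu)
    have "1 \<le> mu * L" using elim(2) L_pos by (simp add: divide_le_eq)
    moreover have "sqrt (5 / mu) * nrm v \<le> 1/4" if "nrm v \<le> B" for v
    proof -
      have "sqrt (5 / mu) * nrm v \<le> sqrt (5 / mu) * \<bar>B\<bar>" using that elim by (intro mult_left_mono) auto
      then show ?thesis using elim by linarith
    qed
    ultimately show ?case using elim by (simp add: small_def)
  qed
qed

end

context nls
begin

lemma St_sq: "(St t)\<^sup>2 = (Nt t)\<^sup>2 / L + 2 * Nt t * Dt t"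
  unfolding St_def using L_pos NDt_nonneg[of t] by (intro real_sqrt_pow2 add_nonneg_nonneg) auto

lemma Q4t_le: "Q4t t \<le> (St t)\<^sup>2 * (Nt t)\<^sup>2" "0 \<le> Q4t t"
proof -
  have L: "integrable M (\<lambda>x. (cmod (u t x))\<^sup>2)" by (rule L2D(4)[OF uL])
  have le: "(cmod (u t x)) ^ 4 \<le> (St t)\<^sup>2 * (cmod (u t x))\<^sup>2" for x
  proof -
    have "(cmod (u t x)) ^ 4 = (cmod (u t x))\<^sup>2 * (cmod (u t x))\<^sup>2" by (simp flip: power_add)
    also have "\<dots> \<le> (St t)\<^sup>2 * (cmod (u t x))\<^sup>2"
      using u_sup by (intro mult_right_mono power_mono) auto
    finally show ?thesis .
  qed
  have i: "integrable M (\<lambda>x. (St t)\<^sup>2 * (cmod (u t x))\<^sup>2)" by (rule integrable_mult_right[OF L])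
  have [measurable]: "u t \<in> borel_measurable M" by (rule L2D(3)[OF uL])
  have "integrable M (\<lambda>x. (cmod (u t x)) ^ 4)"
    by (rule Bochner_Integration.integrable_bound[OF i]) (use le in auto)
  then have "Q4t t \<le> (LINT x|M. (St t)\<^sup>2 * (cmod (u t x))\<^sup>2)"
    unfolding Q4t_def using i le by (intro integral_mono) auto
  then show "Q4t t \<le> (St t)\<^sup>2 * (Nt t)\<^sup>2" by (simp add: Nt_def nrm_sq)
  show "0 \<le> Q4t t" by (simp add: Q4t_def)
qed

lemma H1norm_u: "H1norm L (u t) = sqrt ((Dt t)\<^sup>2 + (Nt t)\<^sup>2)"
  using H1norm_ac[OF ac_u] by (simp add: Dt_def Nt_def)

lemma energy_u: "energy L (u t) = (Dt t)\<^sup>2 - 1/2 * Q4t t"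
proof -
  have "(L4norm L (u t)) ^ 4 = Q4t t"
    unfolding L4norm_def LINT_T Q4t_def by (rule real_root_pow_pos2) auto
  then show ?thesis by (simp add: energy_def Dt_def ux_def)
qed

lemma mass_forcing: "\<bar>Im (LINT x|M. f x * cnj (u t x))\<bar> \<le> nf * Nt t"
proof -
  have "\<bar>Im (LINT x|M. f x * cnj (u t x))\<bar> \<le> cmod (LINT x|M. f x * cnj (u t x))" by (rule abs_Im_le_cmod)
  also have "\<dots> \<le> nf * nrm (\<lambda>x. cnj (u t x))" by (intro CS fL L2_cnj uL)
  finally show ?thesis by (simp add: Nt_def)
qed

text \<open>Young's inequality charges the forcing to half a unit of damping,
  \<open>lam / 2\<close>, and a constant; this is where the exact rate \<open>2 lam\<close> splits
  into \<open>5/2 lam\<close> and \<open>3/2 lam\<close>.\<close>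

lemma mass_rate:
  assumes lam: "0 < lam"
  obtains y' where "((\<lambda>s. (Nt s)\<^sup>2) has_real_derivative y') (at t)"
    "y' \<ge> - (5/2 * lam) * (Nt t)\<^sup>2 - 2 * nf\<^sup>2 / lam" "y' \<le> - (3/2 * lam) * (Nt t)\<^sup>2 + 2 * nf\<^sup>2 / lam"
proof -
  have am: "2 * (nf * Nt t) \<le> lam / 2 * (Nt t)\<^sup>2 + 2 * nf\<^sup>2 / lam"
  proof -
    have "0 \<le> (lam * Nt t - 2 * nf)\<^sup>2 / (2 * lam)" using lam by simp
    also have "\<dots> = lam / 2 * (Nt t)\<^sup>2 + 2 * nf\<^sup>2 / lam - 2 * (nf * Nt t)"
      using lam by (simp add: power2_eq_square field_simps)
    finally show ?thesis by simp
  qed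
  show ?thesis
    using that[OF mass_derivative] mass_forcing[of t] am unfolding mass_flow by (simp add: algebra_simps)
qed

lemma mass_upper:
  assumes lam: "0 < lam"
  obtains B where "0 < B" "\<And>t. t \<le> 0 \<Longrightarrow> Nt t \<le> B * exp (- (5/4 * lam) * t)"
proof -
  \<comment> \<open>The shift with \<open>5/2 * lam * b = 2 * nf\<^sup>2 / lam\<close>: it absorbs
    the constant, so that the weighted shifted square is monotone.\<close>
  define b where "b = (2 * nf\<^sup>2 / lam) / (5/2 * lam)"
  have b: "0 \<le> b" using lam by (simp add: b_def)
  define B where "B = sqrt ((Nt 0)\<^sup>2 + b + 1)"
  have B2: "B\<^sup>2 = (Nt 0)\<^sup>2 + b + 1" unfolding B_def using b by simp
  have B: "0 < B" unfolding B_def using b by (simp add: add_nonneg_pos)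
  show ?thesis
  proof (rule that[OF B])
    fix t :: real assume t: "t \<le> 0"
    have "exp (5/2 * lam * t) * ((Nt t)\<^sup>2 + b) \<le> exp (5/2 * lam * 0) * ((Nt 0)\<^sup>2 + b)"
    proof (rule DERIV_nonneg_imp_nondecreasing[OF t])
      fix s :: real
      obtain y' where y': "((\<lambda>s. (Nt s)\<^sup>2) has_real_derivative y') (at s)" "y' \<ge> - (5/2 * lam) * (Nt s)\<^sup>2 - 2 * nf\<^sup>2 / lam"
        using mass_rate[OF lam] by blast
      have d: "((\<lambda>s. (Nt s)\<^sup>2 + b) has_real_derivative y' + 0) (at s)"
        by (intro DERIV_add y' DERIV_const)
      have "5/2 * lam * b = 2 * nf\<^sup>2 / lam" using lam by (simp add: b_def)
      then have "0 \<le> y' + 0 + 5/2 * lam * ((Nt s)\<^sup>2 + b)" using y'(2) by (simp add: distrib_left)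
      then show "\<exists>y. ((\<lambda>s. exp (5/2 * lam * s) * ((Nt s)\<^sup>2 + b)) has_real_derivative y) (at s) \<and> 0 \<le> y"
        by (intro exI[of _ "exp (5/2 * lam * s) * (y' + 0 + 5/2 * lam * ((Nt s)\<^sup>2 + b))"] conjI
            exp_weighted_derivative[OF d] mult_nonneg_nonneg) auto
    qed
    then have "exp (5/2 * lam * t) * ((Nt t)\<^sup>2 + b) \<le> B\<^sup>2" using B2 by simp
    moreover have "exp (5/2 * lam * t) * (Nt t)\<^sup>2 \<le> exp (5/2 * lam * t) * ((Nt t)\<^sup>2 + b)"
      using b by (intro mult_left_mono) auto
    ultimately have "exp (5/2 * lam * t) * (Nt t)\<^sup>2 \<le> B\<^sup>2" by linarith
    moreover have "(exp (5/4 * lam * t))\<^sup>2 = exp (5/2 * lam * t)" by (simp add: exp_double[symmetric])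
    ultimately have "(exp (5/4 * lam * t) * Nt t)\<^sup>2 \<le> B\<^sup>2" by (simp add: power_mult_distrib)
    then have "exp (5/4 * lam * t) * Nt t \<le> B" by (rule power2_le_imp_le) (use B in simp)
    then have "exp (- (5/4 * lam) * t) * (exp (5/4 * lam * t) * Nt t) \<le> exp (- (5/4 * lam) * t) * B"
      by (intro mult_left_mono) auto
    moreover have "exp (- (5/4 * lam) * t) * (exp (5/4 * lam * t) * Nt t) = Nt t"
      by (simp add: mult.assoc[symmetric] exp_add[symmetric])
    ultimately show "Nt t \<le> B * exp (- (5/4 * lam) * t)"
      by (simp only: mult.commute[of B])
  qed
qed

lemma mass_lower:
  assumes lam: "0 < lam" and t0: "(Nt t0)\<^sup>2 > 4/3 * nf\<^sup>2 / lam\<^sup>2"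
  shows "eventually (\<lambda>t. exp (- (1/2) * lam * t) \<le> Nt t) at_bot"
proof -
  \<comment> \<open>The equilibrium of the upper differential inequality. Once the square of the
    norm is above it, the excess grows backward at least like
    \<open>exp (- 3/2 lam t)\<close>.\<close>
  define b where "b = 4/3 * nf\<^sup>2 / lam\<^sup>2"
  have b: "0 \<le> b" "3/2 * lam * b = 2 * nf\<^sup>2 / lam" using lam by (auto simp: b_def power2_eq_square)
  define c where "c = exp (3/2 * lam * t0) * ((Nt t0)\<^sup>2 - b)"
  have c: "0 < c" using t0 by (simp add: c_def b_def)
  \<comment> \<open>The square grows at rate \<open>3/2 lam\<close> while only \<open>lam\<close> is
    claimed; the spare factor swallows \<open>c\<close>, so the final bound has constant 1.\<close>
  have "eventually (\<lambda>t. 1 / c \<le> exp (- (1/2 * lam) * t)) at_bot"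
    by (rule eventually_exp_ge) (use lam in simp)
  moreover have "eventually (\<lambda>t. t \<le> t0) at_bot" by (rule eventually_le_at_bot)
  ultimately show ?thesis
  proof eventually_elim
    case (elim t)
    have "exp (3/2 * lam * t) * ((Nt t)\<^sup>2 - b) \<ge> exp (3/2 * lam * t0) * ((Nt t0)\<^sup>2 - b)"
    proof (rule DERIV_nonpos_imp_nonincreasing[OF elim(2)])
      fix s :: real
      obtain y' where y': "((\<lambda>s. (Nt s)\<^sup>2) has_real_derivative y') (at s)" "y' \<le> - (3/2 * lam) * (Nt s)\<^sup>2 + 2 * nf\<^sup>2 / lam"
        using mass_rate[OF lam] by blast
      have d: "((\<lambda>s. (Nt s)\<^sup>2 - b) has_real_derivative y' - 0) (at s)"
        by (intro DERIV_diff y' DERIV_const)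
      have "0 \<ge> y' - 0 + 3/2 * lam * ((Nt s)\<^sup>2 - b)" using y'(2) b(2) by (simp add: right_diff_distrib)
      then show "\<exists>y. ((\<lambda>s. exp (3/2 * lam * s) * ((Nt s)\<^sup>2 - b)) has_real_derivative y) (at s) \<and> y \<le> 0"
        by (intro exI[of _ "exp (3/2 * lam * s) * (y' - 0 + 3/2 * lam * ((Nt s)\<^sup>2 - b))"] conjI
            exp_weighted_derivative[OF d] mult_nonneg_nonpos) auto
    qed
    then have "c \<le> exp (3/2 * lam * t) * ((Nt t)\<^sup>2 - b)" by (simp add: c_def)
    also have "\<dots> \<le> exp (3/2 * lam * t) * (Nt t)\<^sup>2" using b by (intro mult_left_mono) auto
    finally have "c \<le> exp (3/2 * lam * t) * (Nt t)\<^sup>2" .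
    then have "exp (- (3/2 * lam) * t) * c \<le> exp (- (3/2 * lam) * t) * (exp (3/2 * lam * t) * (Nt t)\<^sup>2)"
      by (intro mult_left_mono) auto
    then have "exp (- (3/2 * lam) * t) * c \<le> (Nt t)\<^sup>2"
      by (simp add: mult.assoc[symmetric] exp_add[symmetric])
    moreover have "(exp (- (1/2) * lam * t))\<^sup>2 \<le> exp (- (3/2 * lam) * t) * c"
    proof -
      have "1 \<le> exp (- (1/2 * lam) * t) * c" using elim(1) c by (simp add: divide_le_eq)
      then have "exp (- lam * t) * 1 \<le> exp (- lam * t) * (exp (- (1/2 * lam) * t) * c)" by (intro mult_left_mono) auto
      also have "\<dots> = exp (- (3/2 * lam) * t) * c" by (simp add: mult.assoc[symmetric] exp_add[symmetric])
      also have "exp (- lam * t) * 1 = (exp (- (1/2) * lam * t))\<^sup>2" by (simp add: exp_double[symmetric])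
      finally show ?thesis .
    qed
    ultimately have "(exp (- (1/2) * lam * t))\<^sup>2 \<le> (Nt t)\<^sup>2" by linarith
    then show ?case by (rule power2_le_imp_le) (rule NDt_nonneg)
  qed
qed

lemma forcing_resolvents_ex:
  assumes "mu \<noteq> 0"
  obtains k1 k2 where "ac k1 (\<lambda>x. f x - of_real mu * k1 x)" "ac k2 (\<lambda>x. f x - of_real (- mu) * k2 x)"
proof -
  obtain k1 where "ac k1 (\<lambda>x. f x - of_real mu * k1 x)" by (rule res_ex[OF fL assms])
  moreover obtain k2 where "ac k2 (\<lambda>x. f x - of_real (- mu) * k2 x)" by (rule res_ex[OF fL, of "- mu"]) (use assms in simp)
  ultimately show ?thesis by (rule that)
qed

lemma cont_bound:
  fixes h :: "real \<Rightarrow> real"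
  assumes "\<And>t. isCont h t"
  obtains B where "0 \<le> B" "\<And>t. a \<le> t \<Longrightarrow> t \<le> b \<Longrightarrow> h t \<le> B"
proof -
  have "compact (h ` {a..b})"
    using assms by (intro compact_continuous_image continuous_at_imp_continuous_on) auto
  then obtain B where "0 < B" "\<forall>z\<in>h ` {a..b}. norm z \<le> B"
    using compact_imp_bounded bounded_pos by metis
  then show ?thesis using that[of B] by force
qed

text \<open>For each \<open>t\<close> the parameter is chosen afterwards. The compactness constants
  \<open>Nm\<close>, \<open>Dm\<close>, \<open>Sm\<close> depend on \<open>t\<close>, but they
  multiply only errors that vanish as \<open>mu\<close> grows, so they leave no trace in
  \<open>C\<close>; the surviving data are \<open>J0\<close> at time 0 and the growth constant
  \<open>B\<close>.\<close>

lemma energy_upper: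
  assumes lam: "0 < lam"
  obtains C where "0 \<le> C" "\<And>t. t \<le> 0 \<Longrightarrow> (Dt t)\<^sup>2 - 1/2 * Q4t t \<le> C * exp (- 2 * lam * t)"
proof -
  obtain B where B: "0 < B" "\<And>t. t \<le> 0 \<Longrightarrow> Nt t \<le> B * exp (- (5/4 * lam) * t)"
    using mass_upper[OF lam] by blast
  define J0 where "J0 = (Dt 0)\<^sup>2 + 9/8 * (St 0)\<^sup>2 * (Nt 0)\<^sup>2 + 2 * Nt 0 * nf"
  have J0: "0 \<le> J0" unfolding J0_def using NDt_nonneg[of 0] by (intro add_nonneg_nonneg mult_nonneg_nonneg) auto
  define C where "C = J0 + 8/3 * nf * B + 2 * nf * B"
  have C: "0 \<le> C" unfolding C_def using J0 B by simp
  show ?thesis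
  proof (rule that[OF C])
    fix t :: real assume t: "t \<le> 0"
    \<comment> \<open>The interval is one unit longer than \<open>[t, 0]\<close> at each end, so
      that smallness also holds near the end points, as differentiability there requires.\<close>
    obtain Nm where Nm: "0 \<le> Nm" "\<And>s. t - 1 \<le> s \<Longrightarrow> s \<le> 1 \<Longrightarrow> Nt s \<le> Nm" using cont_bound[OF Nt_cont] by blast
    obtain Dm where Dm: "0 \<le> Dm" "\<And>s. t - 1 \<le> s \<Longrightarrow> s \<le> 1 \<Longrightarrow> Dt s \<le> Dm" using cont_bound[OF Dt_cont] by blast
    obtain Sm where Sm: "0 \<le> Sm" "\<And>s. t - 1 \<le> s \<Longrightarrow> s \<le> 1 \<Longrightarrow> St s \<le> Sm" using cont_bound[OF St_cont] by blast
    define Em where "Em mu = 3 * Sm\<^sup>2 * Nm / mu\<^sup>2 + Dm / mu" for mu :: real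
    have "((\<lambda>mu. (3 * Sm\<^sup>2 * Nm / mu) * (1 / mu) + Dm / mu) \<longlongrightarrow> 0 * 0 + 0) at_top"
      by (intro tendsto_intros tendsto_const_over)
    then have Em_lim: "(Em \<longlongrightarrow> 0) at_top" by (simp add: Em_def[abs_def] power2_eq_square)
    have main: "(Dt t)\<^sup>2 - 1/2 * Q4t t \<le> exp (- 2 * lam * t) * (J0 + 8/3 * nf * B) + 2 * Nt t * nf
        + e * (exp (- 2 * lam * t) / (2 * lam) + 1 + 2 * Dt t)" if e: "0 < e" "e \<le> 1" for e
    proof -
      define K1 where "K1 = (5 * lam * Nm + 12 * nf) * Sm\<^sup>2 + 5 * Sm\<^sup>2 * Nm + 1"
      have K1: "0 < K1" unfolding K1_def using Nm(1) lam by (intro add_nonneg_pos add_nonneg_nonneg mult_nonneg_nonneg) auto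
      define K2 where "K2 = 2 * (Sm\<^sup>2 * Nm + nf) + 1"
      have K2: "0 < K2" unfolding K2_def using Nm(1) by (intro add_nonneg_pos add_nonneg_nonneg mult_nonneg_nonneg) auto
      have "eventually (\<lambda>mu. Em mu < e / 2 / K1) at_top"
        using Em_lim e K1 by (intro order_tendstoD(2)) auto
      moreover have "eventually (\<lambda>mu. \<forall>k1 k2. ac k1 (\<lambda>x. f x - of_real mu * k1 x) \<longrightarrow> ac k2 (\<lambda>x. f x - of_real (- mu) * k2 x)
         \<longrightarrow> nrm (\<lambda>x. psif mu k1 k2 x - f x) \<le> e / 2 / K2) at_top"
        using e K2 by (intro psif_limit fL) auto
      moreover have "eventually (\<lambda>mu. \<forall>p. ac p (\<lambda>x. cnj (ux t x) - of_real mu * p x) \<longrightarrow> nrm (\<lambda>x. cnj (ux t x)) \<le> mu * nrm p + e) at_top"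
        using e by (intro res_limit L2_cnj acD(3)[OF ac_u])
      moreover have "eventually (\<lambda>mu. \<forall>v. nrm v \<le> Nm \<longrightarrow> small mu v) at_top" by (rule eventually_small)
      moreover have "eventually (\<lambda>mu::real. 0 < mu) at_top" by (rule eventually_gt_at_top)
      ultimately have "eventually (\<lambda>mu. Em mu < e / 2 / K1 \<and> (\<forall>k1 k2. ac k1 (\<lambda>x. f x - of_real mu * k1 x) \<longrightarrow> ac k2 (\<lambda>x. f x - of_real (- mu) * k2 x)
         \<longrightarrow> nrm (\<lambda>x. psif mu k1 k2 x - f x) \<le> e / 2 / K2) \<and> (\<forall>p. ac p (\<lambda>x. cnj (ux t x) - of_real mu * p x) \<longrightarrow> nrm (\<lambda>x. cnj (ux t x)) \<le> mu * nrm p + e)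
         \<and> (\<forall>v. nrm v \<le> Nm \<longrightarrow> small mu v) \<and> 0 < mu) at_top"
        by eventually_elim simp
      then obtain mu where mu: "Em mu < e / 2 / K1"
        "\<And>k1 k2. ac k1 (\<lambda>x. f x - of_real mu * k1 x) \<Longrightarrow> ac k2 (\<lambda>x. f x - of_real (- mu) * k2 x) \<Longrightarrow> nrm (\<lambda>x. psif mu k1 k2 x - f x) \<le> e / 2 / K2"
        "\<And>p. ac p (\<lambda>x. cnj (ux t x) - of_real mu * p x) \<Longrightarrow> nrm (\<lambda>x. cnj (ux t x)) \<le> mu * nrm p + e"
        "\<And>v. nrm v \<le> Nm \<Longrightarrow> small mu v" "0 < mu"
        using eventually_happens'[OF trivial_limit_at_top_linorder] by blast
      obtain k1 k2 where k: "ac k1 (\<lambda>x. f x - of_real mu * k1 x)" "ac k2 (\<lambda>x. f x - of_real (- mu) * k2 x)"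
        using forcing_resolvents_ex[of mu] mu(5) by auto
      have sm: "small mu (u s)" if "t - 1 \<le> s" "s \<le> 1" for s
        using mu(4)[of "u s"] Nm(2)[OF that] by (simp add: Nt_def)
      have ev: "eventually (\<lambda>r. small mu (u r)) (at s)" if "t \<le> s" "s \<le> 0" for s
      proof -
        have "eventually (\<lambda>r. r \<in> {t - 1<..<1}) (at s)"
          using that by (intro eventually_at_in_open') auto
        then show ?thesis by eventually_elim (auto intro: sm)
      qed
      have Eb: "0 \<le> Ebt mu s" "Ebt mu s \<le> Em mu" if "t - 1 \<le> s" "s \<le> 1" for s
      proof -
        have "(St s)\<^sup>2 \<le> Sm\<^sup>2" using Sm(2)[OF that] St_nonneg by (intro power_mono) auto
        then have "3 * (St s)\<^sup>2 * Nt s \<le> 3 * Sm\<^sup>2 * Nm"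
          using Nm(2)[OF that] NDt_nonneg by (intro mult_mono) auto
        then show "Ebt mu s \<le> Em mu"
          unfolding Ebt_def Em_def using Dm(2)[OF that] mu(5) by (intro add_mono divide_right_mono) auto
        show "0 \<le> Ebt mu s" unfolding Ebt_def using NDt_nonneg[of s] mu(5) by simp
      qed
      let ?J = "\<lambda>s. Jfun mu k1 k2 (u s)"
      \<comment> \<open>The added terms are antiderivatives that compensate the two parts of the
        lower bound on \<open>d\<close> after weighting: \<open>3/4\<close> is
        \<open>2 - 5/4\<close>, and \<open>8/3\<close> is 2 divided by \<open>3/4\<close>.\<close>
      let ?W = "\<lambda>s. exp (2 * lam * s) * ?J s + (8/3 * nf * B * exp (3/4 * lam * s) + e / (2 * lam) * exp (2 * lam * s))"
      have "?W t \<le> ?W 0"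
      proof (rule DERIV_nonneg_imp_nondecreasing[OF t])
        fix s :: real assume s: "t \<le> s" "s \<le> 0"
        then have s': "t - 1 \<le> s" "s \<le> 1" by auto
        obtain d where d: "(?J has_real_derivative - 2 * lam * ?J s + d) (at s)"
          "d \<ge> - 2 * lam * Nt s * nf - (5 * lam * Nt s + 12 * nf) * (St s)\<^sup>2 * Ebt mu s - 2 * ((St s)\<^sup>2 * Nt s + nf) * nrm (\<lambda>x. psif mu k1 k2 x - f x)"
          using Jfun_estimates[OF less_imp_le[OF lam] sm[OF s'] ev[OF s] k] by blast
        have S2: "(St s)\<^sup>2 \<le> Sm\<^sup>2" using Sm(2)[OF s'] St_nonneg by (intro power_mono) auto
        have Ns: "Nt s \<le> Nm" by (rule Nm(2)[OF s'])
        have b1: "(5 * lam * Nt s + 12 * nf) * (St s)\<^sup>2 * Ebt mu s \<le> e / 2"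
        proof -
          have "(5 * lam * Nt s + 12 * nf) * (St s)\<^sup>2 \<le> (5 * lam * Nm + 12 * nf) * Sm\<^sup>2"
            using S2 Ns lam Nm(1) by (intro mult_mono add_mono mult_left_mono) auto
          also have "\<dots> \<le> K1" unfolding K1_def using Nm(1) by simp
          finally have "(5 * lam * Nt s + 12 * nf) * (St s)\<^sup>2 * Ebt mu s \<le> K1 * (e / 2 / K1)"
            using Eb[OF s'] mu(1) K1 by (intro mult_mono) auto
          then show ?thesis using K1 by simp
        qed
        have b2: "2 * ((St s)\<^sup>2 * Nt s + nf) * nrm (\<lambda>x. psif mu k1 k2 x - f x) \<le> e / 2"
        proof -
          have "2 * ((St s)\<^sup>2 * Nt s + nf) \<le> 2 * (Sm\<^sup>2 * Nm + nf)"
            using S2 Ns NDt_nonneg[of s] by (intro mult_left_mono add_mono mult_mono) auto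
          also have "\<dots> \<le> K2" by (simp add: K2_def)
          finally have "2 * ((St s)\<^sup>2 * Nt s + nf) * nrm (\<lambda>x. psif mu k1 k2 x - f x) \<le> K2 * (e / 2 / K2)"
            using mu(2)[OF k] K2 by (intro mult_mono) auto
          then show ?thesis using K2 by simp
        qed
        have "Nt s * nf \<le> (B * exp (- (5/4 * lam) * s)) * nf" by (rule mult_right_mono[OF B(2)[OF s(2)]]) simp
        from mult_left_mono[OF this, of "2 * lam"] have b3: "2 * lam * Nt s * nf \<le> 2 * lam * nf * B * exp (- (5/4 * lam) * s)"
          using lam by (simp add: algebra_simps)
        have db: "d \<ge> - (2 * lam * nf * B * exp (- (5/4 * lam) * s)) - e" using d(2) b1 b2 b3 by linarith
        have "((\<lambda>s. 8/3 * nf * B * exp (3/4 * lam * s) + e / (2 * lam) * exp (2 * lam * s)) has_real_derivative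
           2 * lam * nf * B * exp (3/4 * lam * s) + e * exp (2 * lam * s)) (at s)"
          using lam by (auto intro!: derivative_eq_intros)
        from DERIV_add[OF exp_weighted_derivative[OF d(1), of "2 * lam"] this]
        have "(?W has_real_derivative exp (2 * lam * s) * (- 2 * lam * ?J s + d + 2 * lam * ?J s)
            + (2 * lam * nf * B * exp (3/4 * lam * s) + e * exp (2 * lam * s))) (at s)" .
        moreover have "0 \<le> exp (2 * lam * s) * (- 2 * lam * ?J s + d + 2 * lam * ?J s)
            + (2 * lam * nf * B * exp (3/4 * lam * s) + e * exp (2 * lam * s))"
        proof -
          have "exp (2 * lam * s) * d \<ge> exp (2 * lam * s) * (- (2 * lam * nf * B * exp (- (5/4 * lam) * s)) - e)"
            by (rule mult_left_mono[OF db]) simp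
          also have "exp (2 * lam * s) * (- (2 * lam * nf * B * exp (- (5/4 * lam) * s)) - e)
             = - (2 * lam * nf * B * (exp (2 * lam * s) * exp (- (5/4 * lam) * s))) - e * exp (2 * lam * s)"
            by (simp add: algebra_simps)
          also have "exp (2 * lam * s) * exp (- (5/4 * lam) * s) = exp (3/4 * lam * s)"
            by (simp add: exp_add[symmetric])
          finally show ?thesis by simp
        qed
        ultimately show "\<exists>y. (?W has_real_derivative y) (at s) \<and> 0 \<le> y" by blast
      qed
      then have W: "exp (2 * lam * t) * ?J t \<le> ?J 0 + 8/3 * nf * B + e / (2 * lam)"
      proof -
        assume a: "?W t \<le> ?W 0"
        have "0 \<le> 8/3 * nf * B * exp (3/4 * lam * t) + e / (2 * lam) * exp (2 * lam * t)"
          using B(1) e lam by (intro add_nonneg_nonneg mult_nonneg_nonneg) auto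
        with a show ?thesis by simp
      qed
      have t': "t - 1 \<le> t" "t \<le> 1" "t - 1 \<le> 0" "(0::real) \<le> 1" using t by auto
      have "?J 0 \<le> J0"
        using Jfun_estimates[OF less_imp_le[OF lam] sm[OF t'(3,4)] ev[OF t order_refl] k] unfolding J0_def by blast
      with W have W': "exp (2 * lam * t) * ?J t \<le> J0 + 8/3 * nf * B + e / (2 * lam)" by simp
      have Jt: "?J t \<le> exp (- 2 * lam * t) * (J0 + 8/3 * nf * B + e / (2 * lam))"
      proof -
        have "exp (- 2 * lam * t) * (exp (2 * lam * t) * ?J t) \<le> exp (- 2 * lam * t) * (J0 + 8/3 * nf * B + e / (2 * lam))"
          by (intro mult_left_mono W') auto
        then show ?thesis by (simp add: mult.assoc[symmetric] exp_add[symmetric])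
      qed
      obtain p where p: "ac p (\<lambda>x. cnj (ux t x) - of_real mu * p x)"
        "?J t \<ge> (mu * nrm p)\<^sup>2 - 1/2 * Q4t t - 5 * (St t)\<^sup>2 * Nt t * Ebt mu t - 2 * Nt t * nf"
        using Jfun_estimates[OF less_imp_le[OF lam] sm[OF t'(1,2)] ev[OF order_refl t] k] by blast
      have b4: "5 * (St t)\<^sup>2 * Nt t * Ebt mu t \<le> e"
      proof -
        have S2: "(St t)\<^sup>2 \<le> Sm\<^sup>2" using Sm(2)[OF t'(1,2)] St_nonneg by (intro power_mono) auto
        have "5 * (St t)\<^sup>2 * Nt t \<le> 5 * Sm\<^sup>2 * Nm"
          using S2 Nm(2)[OF t'(1,2)] NDt_nonneg[of t] by (intro mult_mono) auto
        also have "\<dots> \<le> K1" unfolding K1_def using Nm(1) lam by simp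
        finally have "5 * (St t)\<^sup>2 * Nt t * Ebt mu t \<le> K1 * (e / 2 / K1)"
          using Eb[OF t'(1,2)] mu(1) K1 by (intro mult_mono) auto
        then show ?thesis using K1 e by simp
      qed
      have "Dt t \<le> mu * nrm p + e" using mu(3)[OF p(1)] by (simp add: Dt_def)
      then have "(Dt t)\<^sup>2 - 2 * e * Dt t \<le> (mu * nrm p)\<^sup>2"
      proof (cases "e \<le> Dt t")
        case True
        then have "(Dt t - e)\<^sup>2 \<le> (mu * nrm p)\<^sup>2" using \<open>Dt t \<le> mu * nrm p + e\<close> by (intro power_mono) auto
        moreover have "(Dt t - e)\<^sup>2 = (Dt t)\<^sup>2 - 2 * e * Dt t + e\<^sup>2" by (simp add: power2_diff)
        ultimately show ?thesis using zero_le_power2[of e] by linarith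
      next
        case False
        have "(Dt t)\<^sup>2 - 2 * e * Dt t = Dt t * (Dt t - 2 * e)" by (simp add: power2_eq_square algebra_simps)
        also have "\<dots> \<le> 0" using False NDt_nonneg[of t] by (intro mult_nonneg_nonpos) auto
        also have "0 \<le> (mu * nrm p)\<^sup>2" by simp
        finally show ?thesis .
      qed
      then have "(Dt t)\<^sup>2 - 1/2 * Q4t t \<le> exp (- 2 * lam * t) * (J0 + 8/3 * nf * B + e / (2 * lam)) + e + 2 * Nt t * nf + 2 * e * Dt t"
        using p(2) Jt b4 by linarith
      then show ?thesis by (simp add: algebra_simps)
    qed
    have "(Dt t)\<^sup>2 - 1/2 * Q4t t \<le> exp (- 2 * lam * t) * (J0 + 8/3 * nf * B) + 2 * Nt t * nf"
      by (rule le_of_le_add_eps[OF main])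
    also have "2 * Nt t * nf \<le> exp (- 2 * lam * t) * (2 * nf * B)"
    proof -
      have "exp (- (5/4 * lam) * t) \<le> exp (- 2 * lam * t)" using lam t by (simp add: mult_right_mono_neg)
      then have "B * exp (- (5/4 * lam) * t) \<le> B * exp (- 2 * lam * t)" using B by (intro mult_left_mono) auto
      then have "Nt t \<le> B * exp (- 2 * lam * t)" using B(2)[OF t] by linarith
      from mult_right_mono[OF this, of "2 * nf"] show ?thesis by (simp add: algebra_simps)
    qed
    finally show "(Dt t)\<^sup>2 - 1/2 * Q4t t \<le> C * exp (- 2 * lam * t)"
      by (simp add: C_def algebra_simps)
  qed
qed

text \<open>A Gagliardo-Nirenberg argument: \<open>Q4t\<close> is at most the squared uniform norm
  times the squared L2 norm, and in the resulting \<open>2 N^3 D\<close> the square of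
  \<open>D\<close> is split off. The factor 1/2 in the energy leaves half of it to be absorbed,
  hence \<open>2 * E\<close>.\<close>

lemma Dt_le_of_energy:
  assumes "(Dt t)\<^sup>2 - 1/2 * Q4t t \<le> E"
  shows "(Dt t)\<^sup>2 \<le> 2 * E + (Nt t) ^ 4 / L + (Nt t) ^ 6"
proof -
  have "(St t)\<^sup>2 * (Nt t)\<^sup>2 = (Nt t) ^ 4 / L + 2 * (Nt t) ^ 3 * Dt t"
    unfolding St_sq by (simp add: algebra_simps power2_eq_square power3_eq_cube power4_eq_xxxx)
  moreover have "2 * (Nt t) ^ 3 * Dt t \<le> (Nt t) ^ 6 + (Dt t)\<^sup>2"
    using sum_squares_bound[of "(Nt t) ^ 3" "Dt t"] by (simp flip: power_mult)
  ultimately show ?thesis using assms Q4t_le(1)[of t] by linarith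
qed

text \<open>
  At a fixed parameter the functional is bounded by the mass alone, so its weighted equation can be
  integrated from \<open>-\<infinity>\<close>. The remainder is linear and the functional quadratic in
  \<open>Dt\<close>, which halves the exponent.
\<close>
lemma Dt_improve_rate:
  assumes lam: "0 < lam" and Mb: "\<And>t. Nt t \<le> Mb"
  shows "\<exists>C. \<forall>K \<theta> t. C \<le> K \<longrightarrow> 0 < \<theta> \<longrightarrow> \<theta> \<le> 1 \<longrightarrow> (\<forall>t\<le>0. Dt t \<le> K * exp (- (\<theta> * lam) * t)) \<longrightarrow> t \<le> 0
      \<longrightarrow> Dt t \<le> K * exp (- (\<theta> / 2 * lam) * t)"
proof -
  have Mb0: "0 \<le> Mb" using Mb[of 0] NDt_nonneg[of 0] by linarith
  define s0 where "s0 = Mb\<^sup>2 / L + 2 * Mb"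
  have s0: "0 \<le> s0" unfolding s0_def using Mb0 L_pos by simp
  have S2: "(St t)\<^sup>2 \<le> s0 * (1 + Dt t)" for t
  proof -
    have "(Nt t)\<^sup>2 / L \<le> Mb\<^sup>2 / L" using Mb NDt_nonneg[of t] L_pos by (intro divide_right_mono power_mono) auto
    moreover have "2 * Nt t * Dt t \<le> 2 * Mb * Dt t" using Mb[of t] NDt_nonneg[of t] by (intro mult_right_mono) auto
    moreover have "0 \<le> Mb\<^sup>2 / L * Dt t" using NDt_nonneg[of t] L_pos by simp
    moreover have "s0 * (1 + Dt t) = Mb\<^sup>2 / L + 2 * Mb + Mb\<^sup>2 / L * Dt t + 2 * Mb * Dt t"
      by (simp add: s0_def distrib_left distrib_right)
    ultimately show ?thesis unfolding St_sq using Mb0 by linarith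
  qed
  define c0 where "c0 = 9/2 * lam * Mb\<^sup>2 + 8 * Mb * nf"
  define c1 where "c1 = 2 * lam * Mb * nf + 2 * nf\<^sup>2"
  define c3 where "c3 = s0 * c0 + c1"
  define c4 where "c4 = 9/8 * s0 * Mb\<^sup>2 + 2 * Mb * nf"
  have c01: "0 \<le> c0" "0 \<le> c1" unfolding c0_def c1_def using Mb0 lam by auto
  have c34: "0 \<le> c3" "0 \<le> c4" unfolding c3_def c4_def using c01 Mb0 s0 by auto
  have N2: "(Nt t)\<^sup>2 \<le> Mb\<^sup>2" for t using Mb NDt_nonneg[of t] by (intro power_mono) auto
  have Nf: "Nt t * nf \<le> Mb * nf" for t using Mb by (intro mult_right_mono) auto
  have dbound: "(St t)\<^sup>2 * (9/2 * lam * (Nt t)\<^sup>2 + 8 * Nt t * nf) + 2 * lam * Nt t * nf + 2 * nf\<^sup>2 \<le> c3 * (1 + Dt t)" for t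
  proof -
    have "(St t)\<^sup>2 * (9/2 * lam * (Nt t)\<^sup>2 + 8 * Nt t * nf) \<le> (s0 * (1 + Dt t)) * c0"
    proof (intro mult_mono S2)
      have "9/2 * lam * (Nt t)\<^sup>2 \<le> 9/2 * lam * Mb\<^sup>2" using N2 lam by (intro mult_left_mono) auto
      then show "9/2 * lam * (Nt t)\<^sup>2 + 8 * Nt t * nf \<le> c0" unfolding c0_def using Nf[of t] by linarith
    qed (use s0 NDt_nonneg[of t] lam in auto)
    moreover have "2 * lam * Nt t * nf \<le> 2 * lam * Mb * nf"
      using mult_left_mono[OF Nf[of t], of "2 * lam"] lam by (simp add: mult.assoc)
    moreover have "0 \<le> c1 * Dt t" using c01 NDt_nonneg[of t] by simp
    moreover have "c3 * (1 + Dt t) = (s0 * (1 + Dt t)) * c0 + c1 + c1 * Dt t"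
      by (simp add: c3_def algebra_simps)
    ultimately show ?thesis unfolding c1_def by linarith
  qed
  have rbound: "9/8 * (St t)\<^sup>2 * (Nt t)\<^sup>2 + 2 * Nt t * nf \<le> c4 * (1 + Dt t)" for t
  proof -
    have "9/8 * ((St t)\<^sup>2 * (Nt t)\<^sup>2) \<le> 9/8 * ((s0 * (1 + Dt t)) * Mb\<^sup>2)"
      using S2[of t] N2[of t] s0 NDt_nonneg[of t] by (intro mult_left_mono mult_mono) auto
    moreover have "0 \<le> 2 * Mb * nf * Dt t" using Mb0 NDt_nonneg[of t] by simp
    moreover have "c4 * (1 + Dt t) = 9/8 * ((s0 * (1 + Dt t)) * Mb\<^sup>2) + 2 * (Mb * nf) + 2 * Mb * nf * Dt t"
      by (simp add: c4_def algebra_simps)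
    ultimately have "9/8 * ((St t)\<^sup>2 * (Nt t)\<^sup>2) + 2 * (Nt t * nf) \<le> c4 * (1 + Dt t)" using Nf[of t] by linarith
    then show ?thesis by (simp only: mult.assoc)
  qed
  \<comment> \<open>The second entry gives
    \<open>(2 * c3 / lam + 2 * c4) * K \<le> K\<^sup>2\<close>, so the same \<open>K\<close> is
    reproduced with half the exponent. The first lets \<open>1 + Dt\<close> be bounded by twice the
    assumed exponential.\<close>
  define C where "C = max 1 (2 * c3 / lam + 2 * c4)"
  show ?thesis
  proof (intro exI[of _ C] allI impI)
    fix K \<theta> t :: real
    assume K: "C \<le> K" and th: "0 < \<theta>" "\<theta> \<le> 1" and hyp: "\<forall>t\<le>0. Dt t \<le> K * exp (- (\<theta> * lam) * t)" and t: "t \<le> 0"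
    have K1: "1 \<le> K" "2 * c3 / lam + 2 * c4 \<le> K" using K by (auto simp: C_def)
    have oneD: "1 + Dt r \<le> 2 * K * exp (- (\<theta> * lam) * r)" if "r \<le> 0" for r
    proof -
      have "1 \<le> exp (- (\<theta> * lam) * r)" using that th lam by (simp add: mult_nonneg_nonpos)
      then have "1 * 1 \<le> K * exp (- (\<theta> * lam) * r)" using K1 by (intro mult_mono) auto
      then show ?thesis using hyp that by force
    qed
    define P where "P = 2 * c3 * K"
    have P: "0 \<le> P" unfolding P_def using c34 K1 by simp
    let ?E = "exp (- (\<theta> * lam) * t)"
    define Y where "Y = P / lam * ?E + c4 * (1 + Dt t)"
    have Y0: "0 \<le> Y" unfolding Y_def using P lam c34 NDt_nonneg[of t] by simp
    have Dt_le: "Dt t \<le> sqrt Y + e" if e: "0 < e" for e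
    proof -
      have "eventually (\<lambda>mu. \<forall>p. ac p (\<lambda>x. cnj (ux t x) - of_real mu * p x) \<longrightarrow> nrm (\<lambda>x. cnj (ux t x)) \<le> mu * nrm p + e) at_top"
        using e by (intro res_limit L2_cnj acD(3)[OF ac_u])
      moreover have "eventually (\<lambda>mu. \<forall>v. nrm v \<le> Mb \<longrightarrow> small mu v) at_top" by (rule eventually_small)
      moreover have "eventually (\<lambda>mu::real. 0 < mu) at_top" by (rule eventually_gt_at_top)
      ultimately have "eventually (\<lambda>mu. (\<forall>p. ac p (\<lambda>x. cnj (ux t x) - of_real mu * p x) \<longrightarrow> nrm (\<lambda>x. cnj (ux t x)) \<le> mu * nrm p + e)
         \<and> (\<forall>v. nrm v \<le> Mb \<longrightarrow> small mu v) \<and> 0 < mu) at_top"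
        by eventually_elim simp
      then obtain mu where mu:
        "\<And>p. ac p (\<lambda>x. cnj (ux t x) - of_real mu * p x) \<Longrightarrow> nrm (\<lambda>x. cnj (ux t x)) \<le> mu * nrm p + e"
        "\<And>v. nrm v \<le> Mb \<Longrightarrow> small mu v" "0 < mu"
        using eventually_happens'[OF trivial_limit_at_top_linorder] by blast
      obtain k1 k2 where k: "ac k1 (\<lambda>x. f x - of_real mu * k1 x)" "ac k2 (\<lambda>x. f x - of_real (- mu) * k2 x)"
        using forcing_resolvents_ex[of mu] mu(3) by auto
      have sm: "small mu (u s)" for s
        using mu(2)[of "u s"] Mb[of s] by (simp add: Nt_def)
      have ev: "eventually (\<lambda>r. small mu (u r)) (at s)" for s by (simp add: sm)
      let ?J = "\<lambda>s. Jfun mu k1 k2 (u s)"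
      \<comment> \<open>The exponent left when the remainder, growing at rate
        \<open>\<theta> lam\<close>, is weighted by \<open>exp (2 lam s)\<close>. It is positive, so
        the integral from \<open>-\<infinity>\<close> converges, and at least \<open>lam\<close>, so
        the constant is uniform in \<open>\<theta>\<close>.\<close>
      define w where "w = (2 - \<theta>) * lam"
      have w: "0 < w" "lam \<le> w" unfolding w_def using th lam by auto
      let ?W = "\<lambda>s. exp (2 * lam * s) * ?J s - P / w * exp (w * s)"
      define JB where "JB = 5/2 * mu\<^sup>2 * Mb\<^sup>2 + 2 * Mb * nf"
      have mono: "?W t \<le> ?W s" if st: "s \<le> t" for s
      proof (rule DERIV_nonpos_imp_nonincreasing[OF st])
        fix r assume r: "s \<le> r" "r \<le> t"
        obtain d where d: "(?J has_real_derivative - 2 * lam * ?J r + d) (at r)"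
          "\<bar>d\<bar> \<le> (St r)\<^sup>2 * (9/2 * lam * (Nt r)\<^sup>2 + 8 * Nt r * nf) + 2 * lam * Nt r * nf + 2 * nf\<^sup>2"
          using Jfun_estimates[OF less_imp_le[OF lam] sm ev k] by blast
        have "c3 * (1 + Dt r) \<le> c3 * (2 * K * exp (- (\<theta> * lam) * r))"
          using oneD r t c34 by (intro mult_left_mono) auto
        then have db: "d \<le> P * exp (- (\<theta> * lam) * r)"
          using d(2) dbound[of r] unfolding P_def by (simp add: mult_ac)
        have "((\<lambda>s. P / w * exp (w * s)) has_real_derivative P * exp (w * r)) (at r)"
          using w by (auto intro!: derivative_eq_intros)
        from DERIV_diff[OF exp_weighted_derivative[OF d(1), of "2 * lam"] this]
        have "(?W has_real_derivative exp (2 * lam * r) * (- 2 * lam * ?J r + d + 2 * lam * ?J r) - P * exp (w * r)) (at r)" .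
        moreover have "exp (2 * lam * r) * (- 2 * lam * ?J r + d + 2 * lam * ?J r) - P * exp (w * r) \<le> 0"
        proof -
          have "exp (2 * lam * r) * d \<le> exp (2 * lam * r) * (P * exp (- (\<theta> * lam) * r))"
            by (rule mult_left_mono[OF db]) simp
          also have "\<dots> = P * (exp (2 * lam * r) * exp (- (\<theta> * lam) * r))" by (simp only: mult.left_commute)
          also have "exp (2 * lam * r) * exp (- (\<theta> * lam) * r) = exp (w * r)"
            by (simp add: exp_add[symmetric] w_def algebra_simps)
          finally show ?thesis by simp
        qed
        ultimately show "\<exists>y. (?W has_real_derivative y) (at r) \<and> y \<le> 0" by blast
      qed
      have "?W t \<le> 0"
      proof (rule tendsto_lowerbound)
        have "filterlim (\<lambda>s. 2 * lam * s) at_bot at_bot"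
          by (rule filterlim_tendsto_pos_mult_at_bot[OF tendsto_const _ filterlim_ident]) (use lam in simp)
        then have "((\<lambda>s. exp (2 * lam * s)) \<longlongrightarrow> 0) at_bot" by (rule filterlim_compose[OF exp_at_bot])
        then show "((\<lambda>s. exp (2 * lam * s) * JB) \<longlongrightarrow> 0) at_bot" by (rule tendsto_mult_left_zero)
        have "eventually (\<lambda>s. s \<le> t) at_bot" by (rule eventually_le_at_bot)
        then show "eventually (\<lambda>s. ?W t \<le> exp (2 * lam * s) * JB) at_bot"
        proof eventually_elim
          case (elim s)
          have "\<bar>?J s\<bar> \<le> 5/2 * mu\<^sup>2 * (Nt s)\<^sup>2 + 2 * Nt s * nf"
            using Jfun_estimates[OF less_imp_le[OF lam] sm ev k, of s] by blast
          moreover have "5/2 * mu\<^sup>2 * (Nt s)\<^sup>2 \<le> 5/2 * mu\<^sup>2 * Mb\<^sup>2" using N2 by (intro mult_left_mono) auto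
          ultimately have "?J s \<le> JB" unfolding JB_def using Nf[of s] by linarith
          then have "exp (2 * lam * s) * ?J s \<le> exp (2 * lam * s) * JB" by (intro mult_left_mono) auto
          moreover have "0 \<le> P / w * exp (w * s)" using P w by simp
          ultimately show ?case using mono[OF elim] by linarith
        qed
      qed simp
      then have W: "exp (2 * lam * t) * ?J t \<le> P / w * exp (w * t)" by simp
      have "exp (- 2 * lam * t) * (exp (2 * lam * t) * ?J t) \<le> exp (- 2 * lam * t) * (P / w * exp (w * t))"
        by (intro mult_left_mono W) auto
      moreover have "exp (- 2 * lam * t) * (exp (2 * lam * t) * ?J t) = ?J t"
        by (simp add: mult.assoc[symmetric] exp_add[symmetric])
      moreover have "exp (- 2 * lam * t) * (P / w * exp (w * t)) = P / w * (exp (- 2 * lam * t) * exp (w * t))"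
        by (simp only: mult.left_commute)
      moreover have "exp (- 2 * lam * t) * exp (w * t) = ?E"
        by (simp add: exp_add[symmetric] w_def algebra_simps)
      ultimately have "?J t \<le> P / w * ?E" by metis
      also have "\<dots> \<le> P / lam * ?E" using P w lam by (intro mult_right_mono divide_left_mono) auto
      finally have Jt: "?J t \<le> P / lam * ?E" .
      obtain p where p: "ac p (\<lambda>x. cnj (ux t x) - of_real mu * p x)"
        "?J t \<ge> (mu * nrm p)\<^sup>2 - 9/8 * (St t)\<^sup>2 * (Nt t)\<^sup>2 - 2 * Nt t * nf"
        using Jfun_estimates[OF less_imp_le[OF lam] sm ev k, of t] by blast
      have "(mu * nrm p)\<^sup>2 \<le> Y" unfolding Y_def using p(2) Jt rbound[of t] by linarith
      then have "mu * nrm p \<le> sqrt Y" by (rule real_le_rsqrt)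
      then show ?thesis using mu(1)[OF p(1)] by (simp add: Dt_def)
    qed
    have "Dt t \<le> sqrt Y" by (rule field_le_epsilon) (rule Dt_le)
    also have "sqrt Y \<le> K * exp (- (\<theta> / 2 * lam) * t)"
    proof (rule real_le_lsqrt)
      have "Y \<le> P / lam * ?E + c4 * (2 * K * ?E)"
        unfolding Y_def using oneD[OF t] c34 by (intro add_left_mono mult_left_mono) auto
      also have "\<dots> = (2 * c3 / lam + 2 * c4) * (K * ?E)" by (simp add: P_def algebra_simps)
      also have "\<dots> \<le> K * (K * ?E)" using K1 by (intro mult_right_mono) auto
      also have "?E = (exp (- (\<theta> / 2 * lam) * t))\<^sup>2" by (simp add: exp_double[symmetric])
      finally show "Y \<le> (K * exp (- (\<theta> / 2 * lam) * t))\<^sup>2" by (simp add: power2_eq_square mult_ac)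
    qed (use K1 in simp)
    finally show "Dt t \<le> K * exp (- (\<theta> / 2 * lam) * t)" .
  qed
qed

text \<open>The energy bound gives the first rate, \<open>\<theta> = 1\<close>. Halving repeats
  forever with one and the same \<open>K\<close>, so at each fixed time the exponential factor tends
  to 1 and only \<open>K\<close> remains.\<close>

lemma Dt_bounded:
  assumes lam: "0 < lam" and Mb: "\<And>t. Nt t \<le> Mb"
  shows "\<exists>K. \<forall>t\<le>0. Dt t \<le> K"
proof -
  obtain C0 where C0: "0 \<le> C0" "\<And>t. t \<le> 0 \<Longrightarrow> (Dt t)\<^sup>2 - 1/2 * Q4t t \<le> C0 * exp (- 2 * lam * t)"
    using energy_upper[OF lam] by blast
  obtain C where C: "\<forall>K \<theta> t. C \<le> K \<longrightarrow> 0 < \<theta> \<longrightarrow> \<theta> \<le> 1 \<longrightarrow> (\<forall>t\<le>0. Dt t \<le> K * exp (- (\<theta> * lam) * t)) \<longrightarrow> t \<le> 0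
      \<longrightarrow> Dt t \<le> K * exp (- (\<theta> / 2 * lam) * t)"
    using Dt_improve_rate[OF lam Mb] ..
  define Q where "Q = Mb ^ 4 / L + Mb ^ 6"
  have Mb0: "0 \<le> Mb" using Mb[of 0] NDt_nonneg[of 0] by linarith
  have Q: "0 \<le> Q" unfolding Q_def using L_pos Mb0 by simp
  define K where "K = max C (sqrt (2 * C0 + Q))"
  have it: "Dt t \<le> K * exp (- ((1/2) ^ n * lam) * t)" if "t \<le> 0" for n t
    using that
  proof (induction n arbitrary: t)
    case (0 t)
    have "(Nt t) ^ 4 / L \<le> Mb ^ 4 / L" "(Nt t) ^ 6 \<le> Mb ^ 6"
      using Mb[of t] NDt_nonneg[of t] L_pos by (auto intro!: divide_right_mono power_mono)
    then have "(Dt t)\<^sup>2 \<le> 2 * (C0 * exp (- 2 * lam * t)) + Q"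
      using Dt_le_of_energy[OF C0(2)[OF 0]] unfolding Q_def by linarith
    also have "Q \<le> Q * exp (- 2 * lam * t)"
    proof -
      have "1 \<le> exp (- 2 * lam * t)" using 0 lam by (simp add: mult_nonneg_nonpos)
      from mult_left_mono[OF this Q] show ?thesis by simp
    qed
    finally have "(Dt t)\<^sup>2 \<le> (2 * C0 + Q) * exp (- 2 * lam * t)" by (simp add: distrib_right)
    also have "exp (- 2 * lam * t) = (exp (- lam * t))\<^sup>2" by (simp add: exp_double[symmetric])
    finally have "Dt t \<le> sqrt ((2 * C0 + Q) * (exp (- lam * t))\<^sup>2)" by (rule real_le_rsqrt)
    also have "\<dots> = sqrt (2 * C0 + Q) * exp (- lam * t)" by (simp add: real_sqrt_mult)
    also have "\<dots> \<le> K * exp (- lam * t)" unfolding K_def by (intro mult_right_mono) auto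
    finally show ?case by simp
  next
    case (Suc n t)
    have "Dt t \<le> K * exp (- ((1/2) ^ n / 2 * lam) * t)"
    proof (rule C[rule_format])
      show "C \<le> K" by (simp add: K_def)
      show "0 < (1/2 :: real) ^ n" by simp
      show "(1/2 :: real) ^ n \<le> 1" by (rule power_le_one) auto
    qed (use Suc in auto)
    then show ?case by simp
  qed
  show ?thesis
  proof (intro exI[of _ K] allI impI)
    fix t :: real assume t: "t \<le> 0"
    have "(\<lambda>n. (1/2 :: real) ^ n) \<longlonglongrightarrow> 0" by (rule LIMSEQ_realpow_zero) auto
    then have "(\<lambda>n. K * exp (- ((1/2) ^ n * lam) * t)) \<longlonglongrightarrow> K * exp (- (0 * lam) * t)"
      by (intro tendsto_intros) auto
    then have "(\<lambda>n. K * exp (- ((1/2) ^ n * lam) * t)) \<longlonglongrightarrow> K" by simp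
    then show "Dt t \<le> K" by (rule LIMSEQ_le_const) (use it[OF t] in auto)
  qed
qed

section \<open>The dichotomy: bounded mass forces the trajectory into the attractor\<close>

lemma shift_solution: "nls_solution L lam f (\<lambda>t. u (t + r))"
  unfolding nls_solution_def
proof (intro conjI allI impI)
  have "continuous_map euclideanreal euclideanreal (\<lambda>t. t + r)"
    unfolding continuous_map_iff_continuous2 by (intro continuous_intros)
  moreover have "continuous_map euclideanreal (H1top L) u" using sol_u by (simp add: nls_solution_def)
  ultimately show "continuous_map euclideanreal (H1top L) (\<lambda>t. u (t + r))"
    by (rule continuous_map_compose[unfolded o_def])
  fix \<phi> t assume "test_fun L \<phi>"
  then obtain D where D: "((\<lambda>s. pairing L (u s) \<phi>) has_vector_derivative D) (at (t + r))"
    "\<i> * D + pairing L (u (t + r)) (deriv (deriv \<phi>)) + pairing L (\<lambda>x. complex_of_real ((cmod (u (t + r) x))\<^sup>2) * u (t + r) x) \<phi>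
      + \<i> * complex_of_real lam * pairing L (u (t + r)) \<phi> = pairing L f \<phi>"
    using sol_u unfolding nls_solution_def by blast
  have "((\<lambda>s. s + r) has_vector_derivative 1) (at t)"
    by (auto intro!: derivative_eq_intros)
  from vector_diff_chain_at[OF this D(1)]
  have "((\<lambda>s. pairing L (u (s + r)) \<phi>) has_vector_derivative D) (at t)" by (simp add: o_def)
  with D(2) show "\<exists>D. ((\<lambda>s. pairing L (u (s + r)) \<phi>) has_vector_derivative D) (at t) \<and>
      \<i> * D + pairing L (u (t + r)) (deriv (deriv \<phi>)) + pairing L (\<lambda>x. complex_of_real ((cmod (u (t + r) x))\<^sup>2) * u (t + r) x) \<phi>
      + \<i> * complex_of_real lam * pairing L (u (t + r)) \<phi> = pairing L f \<phi>" by blast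
qed

lemma in_attractor:
  assumes lam: "0 < lam" and Mb: "\<And>t. Nt t \<le> Mb" and A: "is_global_attractor L lam f A"
  shows "u s \<in> A"
proof -
  obtain K where K: "\<And>t. t \<le> 0 \<Longrightarrow> Dt t \<le> K" using Dt_bounded[OF lam Mb] by blast
  \<comment> \<open>The bootstrap bounds the derivative for \<open>t \<le> 0\<close> only; if
    \<open>s\<close> is positive, continuity covers the remaining compact interval.\<close>
  obtain K' where K': "\<And>t. 0 \<le> t \<Longrightarrow> t \<le> s \<Longrightarrow> Dt t \<le> K'" using cont_bound[OF Dt_cont] by blast
  have "H1norm L (u t) \<le> max K K' + Mb" if "t \<le> s" for t
  proof -
    have "Dt t \<le> max K K'" using K[of t] K'[of t] that by (cases "t \<le> 0") auto
    moreover have "H1norm L (u t) \<le> Dt t + Nt t"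
      unfolding H1norm_u using NDt_nonneg[of t] by (intro sqrt_sum_squares_le_sum) auto
    ultimately show ?thesis using Mb[of t] by linarith
  qed
  then have B: "H1bounded L (u ` {..s})"
    unfolding H1bounded_def using u_H1 by (intro conjI exI[of _ "max K K' + Mb"]) auto
  have ev: "u s \<in> evolve L lam f t (u ` {..s})" if "0 \<le> t" for t
  proof -
    have "u s = (\<lambda>\<tau>. u (\<tau> + (s - t))) t" "(\<lambda>\<tau>. u (\<tau> + (s - t))) 0 \<in> u ` {..s}" using that by auto
    then show ?thesis unfolding evolve_def
      by (intro CollectI exI[of _ "\<lambda>\<tau>. u (\<tau> + (s - t))"] conjI shift_solution)
  qed
  have near: "\<exists>a\<in>A. H1dist L (u s) a < \<epsilon>" if "0 < \<epsilon>" for \<epsilon>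
  proof -
    have "eventually (\<lambda>t. \<forall>w\<in>evolve L lam f t (u ` {..s}). \<exists>a\<in>A. H1dist L w a < \<epsilon>) at_top"
      using A B that unfolding is_global_attractor_def by blast
    then have "eventually (\<lambda>t. (\<forall>w\<in>evolve L lam f t (u ` {..s}). \<exists>a\<in>A. H1dist L w a < \<epsilon>) \<and> 0 \<le> t) at_top"
      by (intro eventually_conj eventually_ge_at_top)
    then obtain t where "\<forall>w\<in>evolve L lam f t (u ` {..s}). \<exists>a\<in>A. H1dist L w a < \<epsilon>" "0 \<le> t"
      using eventually_happens'[OF trivial_limit_at_top_linorder] by blast
    then show ?thesis using ev by blast
  qed
  have "compactin (Metric_space.mtopology (H1per L) (H1dist L)) A"
    using A by (simp add: is_global_attractor_def H1top_def)
  then have "closedin (Metric_space.mtopology (H1per L) (H1dist L)) A"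
    by (intro compactin_imp_closedin Metric_space.Hausdorff_space_mtopology[OF H1_metric])
  then have cl: "A \<subseteq> H1per L" "\<And>x. x \<in> H1per L - A \<Longrightarrow> \<exists>r>0. disjnt A (Metric_space.mball (H1per L) (H1dist L) x r)"
    unfolding Metric_space.closedin_metric[OF H1_metric] by auto
  show ?thesis
  proof (rule ccontr)
    assume "u s \<notin> A"
    then obtain r where r: "0 < r" "disjnt A (Metric_space.mball (H1per L) (H1dist L) (u s) r)"
      using cl(2)[of "u s"] u_H1 by auto
    obtain a where "a \<in> A" "H1dist L (u s) a < r" using near[OF r(1)] by blast
    then have "a \<in> Metric_space.mball (H1per L) (H1dist L) (u s) r"
      using cl(1) u_H1 by (auto simp: Metric_space.in_mball[OF H1_metric])
    then show False using r(2) \<open>a \<in> A\<close> by (auto simp: disjnt_def)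
  qed
qed

lemma backward_growth:
  assumes lam: "0 < lam" and A: "is_global_attractor L lam f A" and out: "\<not> range u \<subseteq> A"
  shows "eventually (\<lambda>t. exp (- (1/2) * lam * t) \<le> L2norm L (u t) \<and> L2norm L (u t) \<le> exp (- (3/2) * lam * t) \<and>
     energy L (u t) \<le> exp (- 3 * lam * t) \<and> H1norm L (u t) \<le> exp (- (9/2) * lam * t)) at_bot"
proof -
  have "\<exists>t0. (Nt t0)\<^sup>2 > 4/3 * nf\<^sup>2 / lam\<^sup>2"
  proof (rule ccontr)
    assume "\<not> ?thesis"
    then have "Nt t \<le> sqrt (4/3 * nf\<^sup>2 / lam\<^sup>2)" for t by (intro real_le_rsqrt) (auto simp: not_less)
    from in_attractor[OF lam this A] out show False by auto
  qed
  then obtain t0 where "(Nt t0)\<^sup>2 > 4/3 * nf\<^sup>2 / lam\<^sup>2" by blast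
  note lower = mass_lower[OF lam this]
  obtain B where B: "0 < B" "\<And>t. t \<le> 0 \<Longrightarrow> Nt t \<le> B * exp (- (5/4 * lam) * t)"
    using mass_upper[OF lam] by blast
  obtain C where C: "0 \<le> C" "\<And>t. t \<le> 0 \<Longrightarrow> (Dt t)\<^sup>2 - 1/2 * Q4t t \<le> C * exp (- 2 * lam * t)"
    using energy_upper[OF lam] by blast
  define Q where "Q = 2 * C + B ^ 4 / L + B ^ 6 + B\<^sup>2"
  \<comment> \<open>The slack in the three upper bounds: \<open>1/4 = 3/2 - 5/4\<close> for the L2
    norm, \<open>1 = 3 - 2\<close> for the energy, and \<open>3/2 = 9 - 15/2\<close> for the squared
    Sobolev norm. Each eventually exceeds the corresponding constant.\<close>
  have "eventually (\<lambda>t. B \<le> exp (- (1/4 * lam) * t)) at_bot" by (rule eventually_exp_ge) (use lam in simp)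
  moreover have "eventually (\<lambda>t. C \<le> exp (- lam * t)) at_bot" by (rule eventually_exp_ge) (use lam in simp)
  moreover have "eventually (\<lambda>t. Q \<le> exp (- (3/2 * lam) * t)) at_bot" by (rule eventually_exp_ge) (use lam in simp)
  moreover have "eventually (\<lambda>t::real. t \<le> 0) at_bot" by (rule eventually_le_at_bot)
  ultimately show ?thesis using lower
  proof eventually_elim
    case (elim t)
    \<comment> \<open>All terms of the squared Sobolev norm are compared with \<open>x ^ 6\<close>,
      its fastest growing one: \<open>x\<close> is at least 1, and the energy rate 2 is below
      \<open>6 * 5/4\<close>.\<close>
    define x where "x = exp (- (5/4 * lam) * t)"
    have x: "1 \<le> x" unfolding x_def using elim(4) lam by (simp add: mult_nonneg_nonpos)
    have xk: "x ^ k \<le> x ^ 6" if "k \<le> 6" for k using x that by (rule power_increasing[rotated])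
    have N: "Nt t \<le> B * x" unfolding x_def by (rule B(2)[OF elim(4)])
    have E: "(Dt t)\<^sup>2 - 1/2 * Q4t t \<le> C * exp (- 2 * lam * t)" by (rule C(2)[OF elim(4)])
    have Nk: "(Nt t) ^ k \<le> B ^ k * x ^ 6" if "k \<le> 6" for k
    proof -
      have "(Nt t) ^ k \<le> (B * x) ^ k" using N NDt_nonneg[of t] by (intro power_mono) auto
      also have "\<dots> \<le> B ^ k * x ^ 6" unfolding power_mult_distrib using xk[OF that] B(1) by (intro mult_left_mono) auto
      finally show ?thesis .
    qed
    have e2: "exp (- 2 * lam * t) \<le> x ^ 6"
    proof -
      have "- 2 * lam * t \<le> 6 * (- (5/4 * lam) * t)" using elim(4) lam by (simp add: mult_nonneg_nonpos)
      then show ?thesis unfolding x_def by (simp add: exp_of_nat_mult[symmetric])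
    qed
    have "B * x \<le> exp (- (1/4 * lam) * t) * x" using elim(1) x by (intro mult_right_mono) auto
    also have "\<dots> = exp (- (3/2) * lam * t)" unfolding x_def by (simp add: exp_add[symmetric])
    finally have 1: "Nt t \<le> exp (- (3/2) * lam * t)" using N by linarith
    have "C * exp (- 2 * lam * t) \<le> exp (- lam * t) * exp (- 2 * lam * t)" using elim(2) by (intro mult_right_mono) auto
    also have "\<dots> = exp (- 3 * lam * t)" by (simp add: exp_add[symmetric])
    finally have 2: "energy L (u t) \<le> exp (- 3 * lam * t)" unfolding energy_u using E by linarith
    have "(Dt t)\<^sup>2 + (Nt t)\<^sup>2 \<le> Q * x ^ 6"
    proof -
      have "(Nt t) ^ 4 / L \<le> B ^ 4 * x ^ 6 / L" using Nk[of 4] L_pos by (intro divide_right_mono) auto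
      moreover have "2 * (C * exp (- 2 * lam * t)) \<le> 2 * (C * x ^ 6)" using e2 C(1) by (intro mult_left_mono) auto
      moreover have "Q * x ^ 6 = 2 * (C * x ^ 6) + B ^ 4 * x ^ 6 / L + B ^ 6 * x ^ 6 + B\<^sup>2 * x ^ 6"
        by (simp add: Q_def algebra_simps)
      ultimately show ?thesis using Dt_le_of_energy[OF E] Nk[of 2] Nk[of 6] by linarith
    qed
    also have "\<dots> \<le> exp (- (3/2 * lam) * t) * x ^ 6" using elim(3) x by (intro mult_right_mono) auto
    also have "x ^ 6 = exp (6 * (- (5/4 * lam) * t))" unfolding x_def by (simp add: exp_of_nat_mult[symmetric])
    also have "exp (- (3/2 * lam) * t) * exp (6 * (- (5/4 * lam) * t)) = (exp (- (9/2) * lam * t))\<^sup>2"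
      by (simp add: exp_add[symmetric] exp_double[symmetric])
    finally have "H1norm L (u t) \<le> exp (- (9/2) * lam * t)"
      unfolding H1norm_u by (intro real_le_lsqrt) auto
    with elim(5) 1 2 show ?case by (simp add: Nt_def)
  qed
qed

end

theorem theorem3p1:
  "\<exists>c1 C1 C2 C3 :: real \<Rightarrow> real \<Rightarrow> real \<Rightarrow> real.
     (\<forall>a b c. 0 < c1 a b c \<and> 0 < C1 a b c \<and> 0 < C2 a b c \<and> 0 < C3 a b c) \<and>
     (\<forall>(L::real) (lam::real) (f :: real \<Rightarrow> complex) (u0 :: real \<Rightarrow> complex)
        (u :: real \<Rightarrow> real \<Rightarrow> complex) (A :: (real \<Rightarrow> complex) set).
        0 < L \<longrightarrow> 0 < lam \<longrightarrow> f \<in> L2per L \<longrightarrow> u0 \<in> H1per L \<longrightarrow>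
        nls_solution L lam f u \<longrightarrow> u 0 = u0 \<longrightarrow>
        is_global_attractor L lam f A \<longrightarrow> \<not> range u \<subseteq> A \<longrightarrow>
        (\<forall>\<^sub>F t in at_bot.
           c1 (L2norm L u0) (L2norm L f) lam * exp (- (1/2) * lam * t) \<le> L2norm L (u t) \<and>
           L2norm L (u t) \<le> C1 (L2norm L u0) (L2norm L f) lam * exp (- (3/2) * lam * t) \<and>
           energy L (u t) \<le> C2 (H1norm L u0) (L2norm L f) L * exp (- 3 * lam * t) \<and>
           H1norm L (u t) \<le> C3 (L2norm L u0) (L2norm L f) lam * exp (- (9/2) * lam * t)))"
proof (intro exI[of _ "\<lambda>_ _ _. 1"] conjI allI impI)
  fix L lam :: real and f u0 u A
  assume a: "0 < L" "0 < lam" "f \<in> L2per L" "nls_solution L lam f u" "is_global_attractor L lam f A" "\<not> range u \<subseteq> A"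
  interpret nls L lam f u by unfold_locales (use a in auto)
  show "\<forall>\<^sub>F t in at_bot. 1 * exp (- (1/2) * lam * t) \<le> L2norm L (u t) \<and> L2norm L (u t) \<le> 1 * exp (- (3/2) * lam * t) \<and>
           energy L (u t) \<le> 1 * exp (- 3 * lam * t) \<and> H1norm L (u t) \<le> 1 * exp (- (9/2) * lam * t)"
    using backward_growth[OF a(2,5,6)] by simp
qed simp_all

end
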